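(* Let $n,p$ be positive integers and let $\alpha,\beta\in\mathbb{R}$ with $n+\alpha>0$ and $\beta>-1$. For $x,y\in\widehat{B}_p$ the polyharmonic weighted Bergman kernel is given by $$R_{p,\alpha,\beta}(x,y)=\sum_{k=0}^{p-1}|x|^{2k}|\overline{y}|^{2k}R_{1,\alpha+4k,\beta}(x,y);$$ in particular $$R_{p}(x,y)=\sum_{k=0}^{p-1}|x|^{2k}|\overline{y}|^{2k}R_{1,4k,0}(x,y),$$ where $R_p$ is the (unweighted) polyharmonic Bergman kernel for $\widehat{B}_p$, and the harmonic weighted kernels $R_{1,\cdot,\cdot}$ are extended from $B\times B$ to $\widehat{B}_p\times\widehat{B}_p$.
   Context: Notation: for $z\in\mathbb{C}^n$, $|z|=(\sum_j z_j^2)^{1/2}$ is the complex extension of the Euclidean norm (principal square root) and $\overline{y}$ is the componentwise conjugate, so $|x|^{2k}=(\sum_jx_j^2)^k$ and $|\overline{y}|^{2k}=(\sum_j\overline{y_j}^2)^k$. Sets: $B$ is the open unit ball of $\mathbb{R}^n$ centred at $0$ and $\widehat{B}_p=\bigcup_{k=0}^{p-1}e^{k\pi i/p}B\subset\mathbb{C}^n$. Polyharmonic functions: a complex-valued analytic function $u$ on $B$ is polyharmonic of order $p$ if $\Delta^p u=0$ on $B$; the space of these is $\mathcal{A}_{\Delta^p}(B)$. Each such $u$ has an expansion $u=\sum_{m\ge 0} q_m$ into homogeneous polynomials $q_m$ of degree $m$, converging on $B$, and is extended holomorphically to rotated balls by $u(e^{i\psi}x)=\sum_m e^{im\psi}q_m(x)$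 ($\psi\in\mathbb{R}$, $x\in B$). In this way $u$ is regarded as a function on $\widehat{B}_p$. Weighted Bergman space: for $n+\alpha>0$, $\beta>-1$, $b_{p,\alpha,\beta}^2(\widehat{B}_p)$ is the space of $u\in\mathcal{A}_{\Delta^p}(B)$ (extended to $\widehat{B}_p$) with $\langle u,u\rangle_{b_{p,\alpha,\beta}^2}<\infty$, where $\langle u,v\rangle_{b_{p,\alpha,\beta}^2}=\frac1p\sum_{k=0}^{p-1}\int_B u(e^{k\pi i/p}y)\overline{v(e^{k\pi i/p}y)}\,|y|^\alpha(1-|y|^2)^\beta dy$. It is a Hilbert space on which point evaluations at points of $\widehat{B}_p$ are bounded. Kernels: $R_{p,\alpha,\beta}:\widehat{B}_p\times\widehat{B}_p\to\mathbb{C}$ is the unique function such that for every $x\in\widehat{B}_p$ one has $R_{p,\alpha,\beta}(\cdot,x)\in b_{p,\alpha,\beta}^2(\widehat{B}_p)$ and $u(x)=\langle u,R_{p,\alpha,\beta}(\cdot,x)\rangle_{b_{p,\alpha,\beta}^2}$ for all $u\in b_{p,\alpha,\beta}^2(\widehat{B}_p)$. The unweighted kernel $R_p$ is defined in the same way using the unweighted inner product (weight identically $1$). For $p=1$ one has $\widehat{B}_1=B$ and $R_{1,\alpha,\beta}$ (the harmonic weighted Bergman kernel) is defined on $B\times B$, where it is real and symmetric. It is extended to $\widehat{B}_p\times\widehat{B}_p$ by applying in the first variable the holomorphic extension $u(e^{i\psi}x)=\sum_m e^{im\psi}q_m(x)$ (for a function $u=\sum_m q_m$ on $B$ with $q_m$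 homogeneous polynomials of degree $m$), and in the second variable its complex conjugate (antiholomorphic) version $u(e^{i\psi}y)=\sum_m e^{-im\psi}q_m(y)$: if $R_{1,\alpha,\beta}(x,y)=\sum_{m\ge 0} r_m(x,y)$ on $B\times B$ with $r_m$ a polynomial homogeneous of degree $m$ in $x$ and homogeneous of degree $m$ in $y$, then $R_{1,\alpha,\beta}(e^{j\pi i/p}x,e^{l\pi i/p}y)=\sum_m e^{m(j-l)\pi i/p}r_m(x,y)$ for $x,y\in B$, $0\le j,l\le p-1$. *)

theory Defs
  imports "HOL-Analysis.Analysis"
begin

section \<open>Vectors in complex n-space and rotated balls\<close>

definition cplx_vec :: "real ^ 'n \<Rightarrow> complex ^ 'n" where
  "cplx_vec x = (\<chi> i. complex_of_real (x $ i))"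

definition cnj_vec :: "complex ^ 'n \<Rightarrow> complex ^ 'n" where
  "cnj_vec z = (\<chi> i. cnj (z $ i))"

text \<open>The complex extension of the Euclidean norm; it is complex-valued and differs from
  \<^const>\<open>norm\<close> on \<^typ>\<open>complex ^ 'n\<close>.\<close>

definition cnorm :: "complex ^ 'n \<Rightarrow> complex" where
  "cnorm z = csqrt (\<Sum>j\<in>UNIV. (z $ j)\<^sup>2)"

definition rot :: "real \<Rightarrow> real ^ 'n \<Rightarrow> complex ^ 'n" where
  "rot \<psi> x = cis \<psi> *s cplx_vec x"

definition hat_ball :: "nat \<Rightarrow> (complex ^ 'n) set" where
  "hat_ball p = (\<Union>k<p. rot (real k * pi / real p) ` ball 0 1)"


section \<open>Polyharmonic functions\<close>

text \<open>Multi-indices are functions \<^typ>\<open>'n \<Rightarrow> nat\<close>.\<close>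

definition mpow :: "real ^ 'n \<Rightarrow> ('n \<Rightarrow> nat) \<Rightarrow> real" where
  "mpow x a = (\<Prod>i\<in>UNIV. (x $ i) ^ a i)"

definition multi_indices :: "nat \<Rightarrow> ('n::finite \<Rightarrow> nat) set" where
  "multi_indices m = {a. (\<Sum>i\<in>UNIV. a i) = m}"

definition real_analytic_on :: "(real ^ 'n \<Rightarrow> complex) \<Rightarrow> (real ^ 'n) set \<Rightarrow> bool" where
  "real_analytic_on f S \<longleftrightarrow>
     (\<forall>x\<in>S. \<exists>r>0. \<exists>c. \<forall>h\<in>ball 0 r.
        ((\<lambda>a. c a * complex_of_real (mpow h a)) has_sum f (x + h)) UNIV)"

definition partial_deriv :: "'n \<Rightarrow> (real ^ 'n \<Rightarrow> complex) \<Rightarrow> real ^ 'n \<Rightarrow> complex" where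
  "partial_deriv i f x = vector_derivative (\<lambda>t. f (x + t *\<^sub>R axis i 1)) (at 0)"

definition laplacian :: "(real ^ 'n \<Rightarrow> complex) \<Rightarrow> real ^ 'n \<Rightarrow> complex" where
  "laplacian f x = (\<Sum>i\<in>UNIV. partial_deriv i (partial_deriv i f) x)"

definition polyharmonic :: "nat \<Rightarrow> (real ^ 'n \<Rightarrow> complex) set" where
  "polyharmonic p = {u. real_analytic_on u (ball 0 1) \<and> (\<forall>x\<in>ball 0 1. (laplacian ^^ p) u x = 0)}"


section \<open>Extension to rotated balls\<close>

definition homog_poly :: "nat \<Rightarrow> (real ^ 'n \<Rightarrow> complex) \<Rightarrow> bool" where
  "homog_poly m q \<longleftrightarrow> (\<exists>c. \<forall>x. q x = (\<Sum>a\<in>multi_indices m. c a * complex_of_real (mpow x a)))"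

definition homog_expansion :: "(real ^ 'n \<Rightarrow> complex) \<Rightarrow> (nat \<Rightarrow> real ^ 'n \<Rightarrow> complex) \<Rightarrow> bool" where
  "homog_expansion u q \<longleftrightarrow>
     (\<forall>m. homog_poly m (q m)) \<and> (\<forall>x\<in>ball 0 1. (\<lambda>m. q m x) sums u x)"

text \<open>The value below does not depend on the representation of the argument: the expansion is
  unique, and \<open>rot \<psi> x = rot \<phi> y\<close> with \<open>x \<noteq> 0\<close> forces \<open>y = x\<close> or \<open>y = - x\<close>, with a
  corresponding change of the angle by a multiple of \<open>\<pi>\<close>.\<close>

definition hol_ext :: "(real ^ 'n \<Rightarrow> complex) \<Rightarrow> complex ^ 'n \<Rightarrow> complex" where
  "hol_ext u z = (THE s. \<exists>q \<psi> x. homog_expansion u q \<and> x \<in> ball 0 1 \<and> z = rot \<psi> x \<and>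
     (\<lambda>m. cis (real m * \<psi>) * q m x) sums s)"

definition bihomog_poly :: "nat \<Rightarrow> (real ^ 'n \<Rightarrow> real ^ 'n \<Rightarrow> complex) \<Rightarrow> bool" where
  "bihomog_poly m r \<longleftrightarrow> (\<exists>c. \<forall>x y. r x y =
     (\<Sum>a\<in>multi_indices m. \<Sum>b\<in>multi_indices m. c a b * complex_of_real (mpow x a * mpow y b)))"

definition bihomog_expansion ::
  "((complex ^ 'n) \<times> (complex ^ 'n) \<Rightarrow> complex) \<Rightarrow> (nat \<Rightarrow> real ^ 'n \<Rightarrow> real ^ 'n \<Rightarrow> complex) \<Rightarrow> bool" where
  "bihomog_expansion K r \<longleftrightarrow>
     (\<forall>m. bihomog_poly m (r m)) \<and>
     (\<forall>x\<in>ball 0 1. \<forall>y\<in>ball 0 1. (\<lambda>m. r m x y) sums K (cplx_vec x, cplx_vec y))"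

text \<open>Holomorphic extension in the first and antiholomorphic extension in the second variable;
  only the values of \<open>K\<close> at pairs of real vectors in the unit ball are used.\<close>

definition kernel_ext ::
  "((complex ^ 'n) \<times> (complex ^ 'n) \<Rightarrow> complex) \<Rightarrow> (complex ^ 'n) \<times> (complex ^ 'n) \<Rightarrow> complex" where
  "kernel_ext K = (\<lambda>(z, w). THE s. \<exists>r \<psi> x \<phi> y. bihomog_expansion K r \<and>
     x \<in> ball 0 1 \<and> z = rot \<psi> x \<and> y \<in> ball 0 1 \<and> w = rot \<phi> y \<and>
     (\<lambda>m. cis (real m * (\<psi> - \<phi>)) * r m x y) sums s)"


section \<open>Weighted Bergman spaces and their kernels\<close>

definition bergman_integrand ::
  "nat \<Rightarrow> (real ^ 'n \<Rightarrow> real) \<Rightarrow> (complex ^ 'n \<Rightarrow> complex) \<Rightarrow> (complex ^ 'n \<Rightarrow> complex) \<Rightarrow>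
    nat \<Rightarrow> real ^ 'n \<Rightarrow> complex" where
  "bergman_integrand p \<omega> U V k y =
     U (rot (real k * pi / real p) y) * cnj (V (rot (real k * pi / real p) y)) * complex_of_real (\<omega> y)"

definition bergman_inner ::
  "nat \<Rightarrow> (real ^ 'n \<Rightarrow> real) \<Rightarrow> (complex ^ 'n \<Rightarrow> complex) \<Rightarrow> (complex ^ 'n \<Rightarrow> complex) \<Rightarrow> complex" where
  "bergman_inner p \<omega> U V =
     1 / of_nat p * (\<Sum>k<p. set_lebesgue_integral lborel (ball 0 1) (bergman_integrand p \<omega> U V k))"

text \<open>The condition \<open>\<langle>U, U\<rangle> < \<infinity>\<close> is expressed by integrability, as the Bochner integral is
  \<open>0\<close> for non-integrable functions.\<close>

definition bergman_space :: "nat \<Rightarrow> (real ^ 'n \<Rightarrow> real) \<Rightarrow> (complex ^ 'n \<Rightarrow> complex) set" where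
  "bergman_space p \<omega> = {U.
     (\<exists>u\<in>polyharmonic p. \<forall>z\<in>hat_ball p. U z = hol_ext u z) \<and>
     (\<forall>k<p. set_integrable lborel (ball 0 1) (bergman_integrand p \<omega> U U k))}"

definition bergman_kernel ::
  "nat \<Rightarrow> (real ^ 'n \<Rightarrow> real) \<Rightarrow> (complex ^ 'n) \<times> (complex ^ 'n) \<Rightarrow> complex" where
  "bergman_kernel p \<omega> = (THE R. R \<in> extensional (hat_ball p \<times> hat_ball p) \<and>
     (\<forall>x\<in>hat_ball p. (\<lambda>z. R (z, x)) \<in> bergman_space p \<omega> \<and>
        (\<forall>U\<in>bergman_space p \<omega>. U x = bergman_inner p \<omega> U (\<lambda>z. R (z, x)))))"

definition bergman_weight :: "real \<Rightarrow> real \<Rightarrow> real ^ 'n \<Rightarrow> real" where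
  "bergman_weight \<alpha> \<beta> y = norm y powr \<alpha> * (1 - (norm y)\<^sup>2) powr \<beta>"

text \<open>\<open>weighted_kernel p \<alpha> \<beta>\<close> is \<open>R_{p,\<alpha>,\<beta>}\<close>, \<open>unweighted_kernel p\<close> is \<open>R_p\<close>, and
  \<open>harmonic_kernel_ext \<alpha> \<beta>\<close> is the extended \<open>R_{1,\<alpha>,\<beta>}\<close>.\<close>

definition weighted_kernel ::
  "nat \<Rightarrow> real \<Rightarrow> real \<Rightarrow> (complex ^ 'n) \<times> (complex ^ 'n) \<Rightarrow> complex" where
  "weighted_kernel p \<alpha> \<beta> = bergman_kernel p (bergman_weight \<alpha> \<beta>)"

definition unweighted_kernel :: "nat \<Rightarrow> (complex ^ 'n) \<times> (complex ^ 'n) \<Rightarrow> complex" where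
  "unweighted_kernel p = bergman_kernel p (\<lambda>_. 1)"

definition harmonic_kernel_ext :: "real \<Rightarrow> real \<Rightarrow> (complex ^ 'n) \<times> (complex ^ 'n) \<Rightarrow> complex" where
  "harmonic_kernel_ext \<alpha> \<beta> = kernel_ext (weighted_kernel 1 \<alpha> \<beta>)"

end

theory Submission
  imports Defs "HOL-Complex_Analysis.Conformal_Mappings"
begin

text \<open>A polyharmonic function of order \<open>p\<close> on the unit ball has an expansion
  \<open>u(x) = \<Sum>k<p. |x|^(2k) \<Sum>j. g k j (x)\<close> with harmonic homogeneous polynomials \<open>g k j\<close> of
  degree \<open>j\<close>, converging on the whole ball (Almansi), so that on the rotated balls
  \<open>u(e^(i\<psi>) x) = \<Sum>k<p. e^(2ki\<psi>) |x|^(2k) \<Sum>j. e^(ij\<psi>) g k j (x)\<close>.  In the inner product of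
  the Bergman space the averages over the \<open>p\<close> rotations of the phases \<open>e^(2(k-l)i\<psi>)\<close> vanish for
  \<open>k \<noteq> l\<close>, and harmonic homogeneous polynomials of different degrees are orthogonal for every
  radial weight.  Hence the pieces \<open>|x|^(2k) g\<close>, \<open>g\<close> harmonic of degree \<open>j\<close>, are mutually
  orthogonal, and on the piece \<open>(k, j)\<close> the norm is that of \<open>g\<close> with respect to the weight
  multiplied by \<open>|y|^(4k)\<close>, which replaces \<open>\<alpha>\<close> by \<open>\<alpha> + 4k\<close>.  The kernel of the \<open>k\<close>-th block
  is therefore \<open>|x|^(2k) |y|^(2k)\<close> times the harmonic kernel for \<open>\<alpha> + 4k\<close>, and the theorem is
  the sum over the blocks.

  The point that needs work is Almansi's expansion on the whole ball.  For a function \<open>u\<close> that is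
  only known to be real analytic, the moments of \<open>y \<mapsto> u(ty)\<close> against a harmonic polynomial of
  degree \<open>j\<close> satisfy, by Green's formula, an Euler differential equation in \<open>t\<close>, whose right-hand
  side is the corresponding moment of \<open>\<Delta> u\<close> (\<open>moment_has_derivative\<close>).  If \<open>\<Delta>^p u = 0\<close>, they are
  thus combinations of \<open>t^j, t^(j+2), \<dots>, t^(j+2p-2)\<close> for all \<open>t < 1\<close> (\<open>moment_expansion\<close>), which
  bounds the harmonic components of the Taylor polynomials at \<open>0\<close> in mean square.  Bernstein's
  inequality turns mean square bounds into pointwise ones up to a power of the degree
  (\<open>sup_le_weighted_norm\<close>), and this gives convergence on the whole ball
  (\<open>polyharmonic_expansion\<close>).

  The candidate for the kernel is the stated sum, with the reproducing kernels \<open>zonal \<omega> j\<close> of the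
  spaces of harmonic polynomials of degree \<open>j\<close> in place of the unknown harmonic kernel.  Its
  sections lie in the space because their series converge beyond the sphere, and they reproduce by
  the orthogonality above (\<open>bergman_component\<close>, \<open>polyharmonic_kernel_reproducing\<close>).  By uniqueness
  of the kernel it is the Bergman kernel; the case \<open>p = 1\<close> identifies the sum of the \<open>zonal \<omega> j\<close> as the
  harmonic kernel.  The unweighted statement is the case \<open>\<alpha> = \<beta> = 0\<close>.\<close>

section \<open>Homogeneous polynomials\<close>

text \<open>Inductive generation of the homogeneous polynomials: unlike the coefficient form
  \<^const>\<open>homog_poly\<close>, it makes closure properties, differentiability and complexification
  plain inductions.\<close>

inductive homog :: "nat \<Rightarrow> (real ^ 'n \<Rightarrow> complex) \<Rightarrow> bool" where
  const: "homog 0 (\<lambda>_. c)"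
| add: "homog m f \<Longrightarrow> homog m g \<Longrightarrow> homog m (\<lambda>x. f x + g x)"
| coord: "homog m f \<Longrightarrow> homog (Suc m) (\<lambda>x. complex_of_real (x $ i) * f x)"

lemma homog_zero: "homog m (\<lambda>_. 0)"
proof (induction m)
  case 0
  show ?case by (rule homog.const)
next
  case (Suc m)
  from homog.coord[OF this] show ?case by simp
qed

lemma homog_scale: "homog m f \<Longrightarrow> homog m (\<lambda>x. c * f x)"
proof (induction rule: homog.induct)
  case (const d)
  show ?case by (rule homog.const)
next
  case (add m f g)
  from homog.add[OF add.IH] show ?case by (simp add: algebra_simps)
next
  case (coord m f i)
  from homog.coord[OF coord.IH, of i] show ?case by (simp add: algebra_simps)
qed

lemma homog_sum: "(\<And>a. a \<in> A \<Longrightarrow> homog m (f a)) \<Longrightarrow> homog m (\<lambda>x. \<Sum>a\<in>A. f a x)"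
  by (induction A rule: infinite_finite_induct) (auto intro: homog_zero homog.add)

lemma homog_mult: "homog m f \<Longrightarrow> homog l g \<Longrightarrow> homog (m + l) (\<lambda>x. f x * g x)"
proof (induction rule: homog.induct)
  case (const d)
  then show ?case by (simp add: homog_scale)
next
  case (add m f g)
  then show ?case by (simp add: algebra_simps homog.add)
next
  case (coord m f i)
  from homog.coord[OF coord.IH[OF coord.prems], of i] show ?case by (simp add: algebra_simps)
qed

lemma homog_cnj: "homog m f \<Longrightarrow> homog m (\<lambda>x. cnj (f x))"
  by (induction rule: homog.induct) (auto intro: homog.intros)

lemma homog_x: "homog 1 (\<lambda>x. complex_of_real (x $ i))"
  using homog.coord[OF homog.const[of 1], of i] by simp

lemma of_real_norm_sq: "complex_of_real ((norm (x :: real ^ 'n))\<^sup>2) = (\<Sum>i\<in>UNIV. (complex_of_real (x $ i))\<^sup>2)"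
  by (simp add: norm_vec_def L2_set_def real_sqrt_pow2 sum_nonneg)

lemma homog_norm_sq: "homog 2 (\<lambda>x :: real ^ 'n. complex_of_real ((norm x)\<^sup>2))"
proof -
  have "homog 2 (\<lambda>x :: real ^ 'n. (complex_of_real (x $ i))\<^sup>2)" for i
    using homog_mult[OF homog_x[of i] homog_x[of i]] by (simp add: power2_eq_square numeral_2_eq_2)
  then show ?thesis unfolding of_real_norm_sq by (intro homog_sum)
qed

lemma homog_norm_power: "homog (2 * k) (\<lambda>x :: real ^ 'n. complex_of_real ((norm x) ^ (2 * k)))"
proof (induction k)
  case 0
  show ?case by (simp add: homog.const)
next
  case (Suc k)
  from homog_mult[OF homog_norm_sq this] show ?case
    by (simp add: power_mult power2_eq_square algebra_simps)
qed

lemma homog_scaleR: "homog m f \<Longrightarrow> f (t *\<^sub>R x) = complex_of_real (t ^ m) * f x"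
  by (induction rule: homog.induct) (auto simp: algebra_simps)

lemma homog_continuous: "homog m f \<Longrightarrow> continuous_on S f"
  by (induction rule: homog.induct) (auto intro!: continuous_intros)

lemma finite_multi_indices: "finite (multi_indices m :: ('n::finite \<Rightarrow> nat) set)"
proof (rule finite_subset)
  show "(multi_indices m :: ('n \<Rightarrow> nat) set) \<subseteq> (UNIV :: 'n set) \<rightarrow>\<^sub>E {..m}"
    by (auto simp: multi_indices_def PiE_def intro: member_le_sum)
qed (auto intro: finite_PiE)

lemma mpow_upd: "mpow x (a(i := Suc (a i))) = x $ i * mpow (x :: real ^ 'n) a"
proof -
  have "mpow x (a(i := Suc (a i))) = (x $ i) ^ Suc (a i) * (\<Prod>j\<in>UNIV - {i}. (x $ j) ^ a j)"
    unfolding mpow_def by (subst prod.remove[of UNIV i]) (auto intro!: prod.cong)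
  also have "\<dots> = x $ i * mpow x a"
    unfolding mpow_def using prod.remove[of UNIV i "\<lambda>j. (x $ j) ^ a j"] by simp
  finally show ?thesis .
qed

lemma sum_upd_Suc: "(\<Sum>j\<in>UNIV. (a(i := Suc (a i))) j) = Suc (\<Sum>j\<in>UNIV. a (j::'n::finite))"
proof -
  have "(\<Sum>j\<in>UNIV. (a(i := Suc (a i))) j) = Suc (a i) + (\<Sum>j\<in>UNIV - {i}. a j)"
    by (subst sum.remove[of UNIV i]) (auto intro!: sum.cong)
  also have "\<dots> = Suc (\<Sum>j\<in>UNIV. a j)"
    using sum.remove[of UNIV i a] by simp
  finally show ?thesis .
qed

lemma homog_mpow: "homog (\<Sum>i\<in>UNIV. a i) (\<lambda>x :: real ^ 'n. complex_of_real (mpow x a))"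
proof (induction "\<Sum>i\<in>UNIV. a i" arbitrary: a)
  case 0
  then have "a = (\<lambda>_. 0)" by (simp add: fun_eq_iff)
  then show ?case by (simp add: mpow_def homog.const)
next
  case (Suc m)
  then have "\<not> (\<forall>i. a i = 0)" by (metis nat.distinct(1) sum.neutral)
  then obtain i where i: "a i \<noteq> 0" by auto
  define b where "b = a(i := a i - 1)"
  have a: "a = b(i := Suc (b i))" using i by (simp add: b_def fun_eq_iff)
  have s: "(\<Sum>i\<in>UNIV. a i) = Suc (\<Sum>i\<in>UNIV. b i)"
    by (subst a) (rule sum_upd_Suc)
  with Suc.hyps(2) have "m = (\<Sum>i\<in>UNIV. b i)" by simp
  from homog.coord[OF Suc.hyps(1)[OF this], of i] show ?case
    unfolding s by (subst a) (simp add: mpow_upd del: fun_upd_apply)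
qed

lemma homog_poly_imp_homog: "homog_poly m f \<Longrightarrow> homog m (f :: real ^ 'n \<Rightarrow> complex)"
proof -
  assume "homog_poly m f"
  then obtain c where c: "f = (\<lambda>x. \<Sum>a\<in>multi_indices m. c a * complex_of_real (mpow x a))"
    unfolding homog_poly_def fun_eq_iff by blast
  have "homog m (\<lambda>x :: real ^ 'n. complex_of_real (mpow x a))" if "a \<in> multi_indices m" for a
    using homog_mpow[of a] that by (simp add: multi_indices_def)
  then show ?thesis unfolding c by (intro homog_sum homog_scale)
qed

lemma homog_imp_homog_poly: "homog m f \<Longrightarrow> homog_poly m (f :: real ^ 'n \<Rightarrow> complex)"
proof (induction rule: homog.induct)
  case (const c)
  have "(multi_indices 0 :: ('n \<Rightarrow> nat) set) = {\<lambda>_. 0}" by (auto simp: multi_indices_def fun_eq_iff)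
  then show ?case unfolding homog_poly_def
    by (intro exI[of _ "\<lambda>_. c"]) (simp add: mpow_def)
next
  case (add m f g)
  then obtain c d where "\<forall>x. f x = (\<Sum>a\<in>multi_indices m. c a * complex_of_real (mpow x a))"
     "\<forall>x. g x = (\<Sum>a\<in>multi_indices m. d a * complex_of_real (mpow x a))"
    unfolding homog_poly_def by blast
  then show ?case unfolding homog_poly_def
    by (intro exI[of _ "\<lambda>a. c a + d a"]) (simp add: algebra_simps sum.distrib)
next
  case (coord m f i)
  then obtain c where c: "\<forall>x. f x = (\<Sum>a\<in>multi_indices m. c a * complex_of_real (mpow x a))"
    unfolding homog_poly_def by blast
  define S :: "('n \<Rightarrow> nat) \<Rightarrow> ('n \<Rightarrow> nat)" where "S a = a(i := Suc (a i))" for a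
  have inj: "inj_on S A" for A
    by (rule inj_onI) (metis S_def fun_upd_apply fun_upd_triv fun_upd_upd nat.inject)
  have sub: "S ` multi_indices m \<subseteq> multi_indices (Suc m)"
    unfolding S_def multi_indices_def using sum_upd_Suc by (auto simp del: fun_upd_apply)
  define d where "d b = (if b \<in> S ` multi_indices m then c (the_inv_into (multi_indices m) S b) else 0)" for b
  have dS: "d (S a) = c a" if "a \<in> multi_indices m" for a
    using that by (simp add: d_def the_inv_into_f_f[OF inj])
  have mS: "mpow x (S a) = x $ i * mpow x a" for x a
    unfolding S_def by (rule mpow_upd)
  have "complex_of_real (x $ i) * f x = (\<Sum>b\<in>multi_indices (Suc m). d b * complex_of_real (mpow x b))" for x
  proof -
    have "complex_of_real (x $ i) * f x = (\<Sum>a\<in>multi_indices m. d (S a) * complex_of_real (mpow x (S a)))"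
      using c by (auto simp: sum_distrib_left dS mS intro!: sum.cong)
    also have "\<dots> = (\<Sum>b\<in>S ` multi_indices m. d b * complex_of_real (mpow x b))"
      by (simp add: sum.reindex[OF inj] o_def)
    also have "\<dots> = (\<Sum>b\<in>multi_indices (Suc m). d b * complex_of_real (mpow x b))"
      using sub by (intro sum.mono_neutral_left finite_multi_indices) (auto simp: d_def)
    finally show ?thesis .
  qed
  then show ?case unfolding homog_poly_def by blast
qed

lemma homog_poly_iff: "homog_poly m f \<longleftrightarrow> homog m f"
  using homog_poly_imp_homog homog_imp_homog_poly by blast

lemma has_derivative_partial:
  assumes "(f has_derivative f') (at x)"
  shows "((\<lambda>t. f (x + t *\<^sub>R axis i 1)) has_vector_derivative f' (axis i 1)) (at 0)"
    and "partial_deriv i f x = f' (axis i 1)"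
proof -
  have lin: "linear f'" using assms by (rule has_derivative_linear)
  have "((\<lambda>t. f (x + t *\<^sub>R axis i 1)) has_derivative (\<lambda>t. f' (t *\<^sub>R axis i 1))) (at 0)"
    by (rule has_derivative_compose[of "\<lambda>t. x + t *\<^sub>R axis i 1" _ 0 UNIV f f'])
       (auto intro!: derivative_eq_intros assms)
  then show *: "((\<lambda>t. f (x + t *\<^sub>R axis i 1)) has_vector_derivative f' (axis i 1)) (at 0)"
    unfolding has_vector_derivative_def linear_scale[OF lin] .
  show "partial_deriv i f x = f' (axis i 1)"
    unfolding partial_deriv_def by (rule vector_derivative_at[OF *])
qed

lemma sum_axis: "(\<Sum>j\<in>UNIV. complex_of_real (axis i 1 $ j) * D j) = D (i::'n::finite)"
proof -
  have "(\<Sum>j\<in>UNIV. complex_of_real (axis i 1 $ j) * D j) = (\<Sum>j\<in>UNIV. if j = i then D j else 0)"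
    by (intro sum.cong) (auto simp: axis_def)
  then show ?thesis by simp
qed

text \<open>Differentiability, homogeneity of the partial derivatives and Euler's identity are proved in one
  induction, since the product with a coordinate needs all of them for the factor.\<close>

lemma homog_derivative_exists:
  "homog m f \<Longrightarrow> \<exists>D. (\<forall>i. homog (m - 1) (D i)) \<and> (m = 0 \<longrightarrow> (\<forall>i x. D i x = 0)) \<and>
     (\<forall>x. (f has_derivative (\<lambda>h. \<Sum>i\<in>UNIV. complex_of_real (h $ i) * D i x)) (at x)) \<and>
     (\<forall>x. (\<Sum>i\<in>UNIV. complex_of_real (x $ i) * D i x) = of_nat m * f x)"
proof (induction rule: homog.induct)
  case (const c)
  show ?case by (intro exI[of _ "\<lambda>_ _. 0"]) (auto intro: homog_zero)
next
  case (add m f g)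
  then obtain D E where D: "\<forall>i. homog (m - 1) (D i)" "m = 0 \<longrightarrow> (\<forall>i x. D i x = 0)"
     "\<And>x. (f has_derivative (\<lambda>h. \<Sum>i\<in>UNIV. complex_of_real (h $ i) * D i x)) (at x)"
     "\<And>x. (\<Sum>i\<in>UNIV. complex_of_real (x $ i) * D i x) = of_nat m * f x"
     and E: "\<forall>i. homog (m - 1) (E i)" "m = 0 \<longrightarrow> (\<forall>i x. E i x = 0)"
     "\<And>x. (g has_derivative (\<lambda>h. \<Sum>i\<in>UNIV. complex_of_real (h $ i) * E i x)) (at x)"
     "\<And>x. (\<Sum>i\<in>UNIV. complex_of_real (x $ i) * E i x) = of_nat m * g x" by blast
  show ?case
  proof (intro exI[of _ "\<lambda>i x. D i x + E i x"] conjI allI)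
    fix x
    show "((\<lambda>x. f x + g x) has_derivative (\<lambda>h. \<Sum>i\<in>UNIV. complex_of_real (h $ i) * (D i x + E i x))) (at x)"
      using has_derivative_add[OF D(3) E(3), of x] by (simp add: distrib_left sum.distrib)
    show "(\<Sum>i\<in>UNIV. complex_of_real (x $ i) * (D i x + E i x)) = of_nat m * (f x + g x)"
      using D(4)[of x] E(4)[of x] by (simp add: distrib_left sum.distrib)
  qed (use D E in \<open>auto intro: homog.add\<close>)
next
  case (coord m f i)
  then obtain D where D: "\<forall>i. homog (m - 1) (D i)" "m = 0 \<longrightarrow> (\<forall>i x. D i x = 0)"
     "\<And>x. (f has_derivative (\<lambda>h. \<Sum>i\<in>UNIV. complex_of_real (h $ i) * D i x)) (at x)"
     "\<And>x. (\<Sum>i\<in>UNIV. complex_of_real (x $ i) * D i x) = of_nat m * f x" by blast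
  define E where "E j x = (if j = i then f x else 0) + complex_of_real (x $ i) * D j x" for j x
  have E_sum: "(\<Sum>j\<in>UNIV. complex_of_real (h $ j) * E j x) =
      complex_of_real (h $ i) * f x + complex_of_real (x $ i) * (\<Sum>j\<in>UNIV. complex_of_real (h $ j) * D j x)" for h x
  proof -
    have "(\<Sum>j\<in>UNIV. complex_of_real (h $ j) * E j x) =
       (\<Sum>j\<in>UNIV. (if j = i then complex_of_real (h $ j) * f x else 0)) +
       (\<Sum>j\<in>UNIV. complex_of_real (h $ j) * (complex_of_real (x $ i) * D j x))"
      by (subst sum.distrib[symmetric]) (auto simp: E_def algebra_simps intro!: sum.cong)
    then show ?thesis by (simp add: sum_distrib_left mult_ac)
  qed
  show ?case
  proof (intro exI[of _ E] conjI allI)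
    fix j
    show "homog (Suc m - 1) (E j)"
    proof -
      have "homog m (\<lambda>x. complex_of_real (x $ i) * D j x)"
      proof (cases "m = 0")
        case True
        with D(2) homog_zero[of m] show ?thesis by simp
      next
        case False
        with homog.coord[of "m - 1" "D j" i] D(1) show ?thesis by simp
      qed
      moreover have "homog m (\<lambda>x. if j = i then f x else 0)"
        using coord.hyps homog_zero by (cases "j = i") auto
      ultimately show ?thesis unfolding E_def by (simp add: homog.add)
    qed
  next
    fix x
    show "((\<lambda>x. complex_of_real (x $ i) * f x) has_derivative
        (\<lambda>h. \<Sum>j\<in>UNIV. complex_of_real (h $ j) * E j x)) (at x)"
      unfolding E_sum
      by (auto intro!: derivative_eq_intros D(3) bounded_linear_imp_has_derivative simp: algebra_simps
           simp flip: of_real_def)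
    show "(\<Sum>j\<in>UNIV. complex_of_real (x $ j) * E j x) = of_nat (Suc m) * (complex_of_real (x $ i) * f x)"
      unfolding E_sum D(4) by (simp add: algebra_simps)
  qed auto
qed

lemma
  assumes "homog m f"
  shows homog_partial: "homog (m - 1) (partial_deriv i f)"
    and homog_has_derivative:
      "(f has_derivative (\<lambda>h. \<Sum>i\<in>UNIV. complex_of_real (h $ i) * partial_deriv i f x)) (at x)"
    and homog_euler: "(\<Sum>i\<in>UNIV. complex_of_real (x $ i) * partial_deriv i f x) = of_nat m * f x"
    and homog_0_partial: "m = 0 \<Longrightarrow> partial_deriv i f x = 0"
proof -
  from homog_derivative_exists[OF assms]
  obtain D where D: "\<And>i. homog (m - 1) (D i)" "m = 0 \<longrightarrow> (\<forall>i x. D i x = 0)"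
     "\<And>x. (f has_derivative (\<lambda>h. \<Sum>i\<in>UNIV. complex_of_real (h $ i) * D i x)) (at x)"
     "\<And>x. (\<Sum>i\<in>UNIV. complex_of_real (x $ i) * D i x) = of_nat m * f x" by blast
  have eq: "partial_deriv i f = D i" for i
    using has_derivative_partial(2)[OF D(3)] sum_axis by (auto simp: fun_eq_iff)
  show "homog (m - 1) (partial_deriv i f)" using D(1) by (simp add: eq)
  show "(f has_derivative (\<lambda>h. \<Sum>i\<in>UNIV. complex_of_real (h $ i) * partial_deriv i f x)) (at x)"
    using D(3) by (simp add: eq)
  show "(\<Sum>i\<in>UNIV. complex_of_real (x $ i) * partial_deriv i f x) = of_nat m * f x"
    using D(4) by (simp add: eq)
  show "partial_deriv i f x = 0" if "m = 0" using D(2) that by (simp add: eq)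
qed

text \<open>The polynomial as a function on complex vectors: it restricts to holomorphic curves for
  Bernstein's inequality, and evaluates \<open>q\<close> at \<open>e^(i\<psi>) x\<close> independently of the representation of
  this point.\<close>

lemma homog_complexification:
  "homog m f \<Longrightarrow> \<exists>\<Phi>. (\<forall>x. \<Phi> (cplx_vec x) = f x) \<and> (\<forall>c z. \<Phi> (c *s z) = c ^ m * \<Phi> z) \<and>
     (\<forall>\<gamma> S. (\<forall>i. (\<lambda>t. \<gamma> t $ i) holomorphic_on S) \<longrightarrow> (\<lambda>t. \<Phi> (\<gamma> t)) holomorphic_on S)"
proof (induction rule: homog.induct)
  case (const c)
  show ?case by (intro exI[of _ "\<lambda>_. c"]) auto
next
  case (add m f g)
  then obtain \<Phi> \<Psi> where "\<forall>x. \<Phi> (cplx_vec x) = f x" "\<forall>c z. \<Phi> (c *s z) = c ^ m * \<Phi> z"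
     "\<forall>\<gamma> S. (\<forall>i. (\<lambda>t. \<gamma> t $ i) holomorphic_on S) \<longrightarrow> (\<lambda>t. \<Phi> (\<gamma> t)) holomorphic_on S"
     "\<forall>x. \<Psi> (cplx_vec x) = g x" "\<forall>c z. \<Psi> (c *s z) = c ^ m * \<Psi> z"
     "\<forall>\<gamma> S. (\<forall>i. (\<lambda>t. \<gamma> t $ i) holomorphic_on S) \<longrightarrow> (\<lambda>t. \<Psi> (\<gamma> t)) holomorphic_on S"
    by blast
  then show ?case
    by (intro exI[of _ "\<lambda>z. \<Phi> z + \<Psi> z"]) (auto simp: algebra_simps intro!: holomorphic_intros)
next
  case (coord m f i)
  then obtain \<Phi> where "\<forall>x. \<Phi> (cplx_vec x) = f x" "\<forall>c z. \<Phi> (c *s z) = c ^ m * \<Phi> z"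
     "\<forall>\<gamma> S. (\<forall>i. (\<lambda>t. \<gamma> t $ i) holomorphic_on S) \<longrightarrow> (\<lambda>t. \<Phi> (\<gamma> t)) holomorphic_on S"
    by blast
  then show ?case
    by (intro exI[of _ "\<lambda>z. z $ i * \<Phi> z"]) (auto simp: algebra_simps cplx_vec_def intro!: holomorphic_intros)
qed


section \<open>A Bernstein inequality\<close>

lemma unit_vector_multiple:
  fixes x :: "real ^ 'n"
  obtains u where "norm u = 1" "x = norm x *\<^sub>R u"
proof (cases "x = 0")
  case True
  then show ?thesis using that[of "axis undefined 1"] by simp
next
  case False
  then show ?thesis using that[of "sgn x"] by (simp add: norm_sgn sgn_div_norm)
qed

text \<open>On the great circle through \<open>x\<close> and \<open>y\<close>, \<open>f\<close> is a trigonometric polynomial; with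
  \<open>z = e^(i\<theta>)\<close> it is \<open>z^(-m) g(z)\<close> for an entire function \<open>g\<close> with \<open>|g| \<le> M\<close> on the unit
  circle.  The maximum principle, applied to \<open>g\<close> and to \<open>z^(2m) g(1/z)\<close>, gives
  \<open>|g| \<le> e\<^sup>2 M \<le> 9 M\<close> on the disc of radius \<open>1/m\<close> around \<open>1\<close>, and Cauchy's estimate there bounds
  the derivative by a multiple of \<open>m\<close>; the linear growth in \<open>m\<close> is what matters later.\<close>

lemma bernstein_tangential:
  fixes x y :: "real ^ 'n"
  assumes f: "homog m f" and M: "\<And>x. norm (f x) \<le> M * norm x ^ m"
    and xy: "norm x = 1" "norm y = 1" "x \<bullet> y = 0"
  shows "norm (\<Sum>i\<in>UNIV. complex_of_real (y $ i) * partial_deriv i f x) \<le> 10 * real m * M"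
proof (cases "m = 0")
  case True
  then show ?thesis using homog_0_partial[OF f] by simp
next
  case False
  then have m: "m > 0" by simp
  have M0: "M \<ge> 0" using order_trans[OF norm_ge_zero M[of x]] xy by simp
  from homog_complexification[OF f] obtain \<Phi> where
    \<Phi>: "\<And>x. \<Phi> (cplx_vec x) = f x" "\<And>c z. \<Phi> (c *s z) = c ^ m * \<Phi> z"
      "\<And>\<gamma> S. (\<And>i. (\<lambda>t. \<gamma> t $ i) holomorphic_on S) \<Longrightarrow> (\<lambda>t. \<Phi> (\<gamma> t)) holomorphic_on S" by blast
  \<comment> \<open>chosen so that \<open>cos \<theta> x + sin \<theta> y = \<alpha> z + cnj \<alpha> / z\<close> for \<open>z = e^(i\<theta>)\<close>\<close>
  define \<alpha> where "\<alpha> i = Complex (x $ i / 2) (- (y $ i) / 2)" for i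
  define g where "g z = \<Phi> (\<chi> i. \<alpha> i * z\<^sup>2 + cnj (\<alpha> i))" for z
  define g' where "g' z = \<Phi> (\<chi> i. \<alpha> i + cnj (\<alpha> i) * z\<^sup>2)" for z
  have hol: "g holomorphic_on S" "g' holomorphic_on S" for S
    unfolding g_def g'_def by (auto intro!: \<Phi>(3) holomorphic_intros)
  have circ: "g z = z ^ m * f (Re z *\<^sub>R x + Im z *\<^sub>R y)" if "norm z = 1" for z
  proof -
    have zz: "z * cnj z = 1" using that by (simp add: complex_norm_square[symmetric])
    have "\<alpha> i * z\<^sup>2 + cnj (\<alpha> i) = z * (\<alpha> i * z + cnj (\<alpha> i * z))" for i
      using zz by (simp add: algebra_simps power2_eq_square)
    moreover have "\<alpha> i * z + cnj (\<alpha> i * z) = complex_of_real (Re z * x $ i + Im z * y $ i)" for i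
      unfolding complex_add_cnj by (simp add: \<alpha>_def algebra_simps)
    ultimately have "(\<chi> i. \<alpha> i * z\<^sup>2 + cnj (\<alpha> i)) = z *s cplx_vec (Re z *\<^sub>R x + Im z *\<^sub>R y)"
      by (simp add: vec_eq_iff cplx_vec_def)
    then show ?thesis unfolding g_def using \<Phi> by simp
  qed
  have unit: "norm (a *\<^sub>R x + b *\<^sub>R y) = sqrt (a\<^sup>2 + b\<^sup>2)" for a b
    using xy by (simp add: norm_eq_sqrt_inner inner_add_left inner_add_right inner_commute
        power2_eq_square real_sqrt_eq_1_iff)
  have bd: "norm (g z) \<le> M" if "norm z = 1" for z
  proof -
    have "norm (Re z *\<^sub>R x + Im z *\<^sub>R y) = 1"
      using that by (simp add: unit norm_complex_def)
    then show ?thesis using circ[OF that] M[of "Re z *\<^sub>R x + Im z *\<^sub>R y"] that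
      by (simp add: norm_mult norm_power)
  qed
  have refl: "g z = z ^ (2 * m) * g' (1 / z)" if "z \<noteq> 0" for z
  proof -
    have "(\<chi> i. \<alpha> i * z\<^sup>2 + cnj (\<alpha> i)) = z\<^sup>2 *s (\<chi> i. \<alpha> i + cnj (\<alpha> i) * (1 / z)\<^sup>2)"
      using that by (simp add: vec_eq_iff field_simps)
    then show ?thesis unfolding g_def g'_def using \<Phi>(2) by (simp add: power_mult)
  qed
  have bd': "norm (g' z) \<le> M" if "norm z = 1" for z
  proof -
    have z: "z \<noteq> 0" "norm (1 / z) = 1" using that by (auto simp: norm_divide)
    have "g (1 / z) = (1 / z) ^ (2 * m) * g' z" using refl[of "1 / z"] z by simp
    then have "norm (g' z) = norm (g (1 / z))" using that by (simp add: norm_mult norm_power norm_divide)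
    then show ?thesis using bd[OF z(2)] by simp
  qed
  have disc: "norm (h z) \<le> M" if "h holomorphic_on UNIV" "\<And>z. norm z = 1 \<Longrightarrow> norm (h z) \<le> M" "norm z \<le> 1"
    for h z
  proof (rule maximum_modulus_frontier[where S = "cball 0 1" and f = h and \<xi> = z])
    show "continuous_on (closure (cball 0 1)) h"
      using that(1) holomorphic_on_imp_continuous_on holomorphic_on_subset by blast
    show "h holomorphic_on interior (cball 0 1)" using that(1) holomorphic_on_subset by blast
  qed (use that in auto)
  have big: "norm (g z) \<le> M * 9" if "norm (1 - z) \<le> 1 / real m" for z
  proof (cases "norm z \<le> 1")
    case True
    with disc[OF hol(1) bd] have "norm (g z) \<le> M" by blast
    with M0 show ?thesis by simp
  next
    case False
    then have z: "z \<noteq> 0" "norm (1 / z) \<le> 1" by (auto simp: norm_divide divide_le_eq)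
    have "norm z \<le> 1 + 1 / real m" using that norm_triangle_ineq2[of z 1] by (simp add: norm_minus_commute)
    also have "\<dots> \<le> exp (1 / real m)" by (rule exp_ge_add_one_self)
    finally have "norm z ^ (2 * m) \<le> exp (1 / real m) ^ (2 * m)" by (intro power_mono) auto
    also have "\<dots> = exp 1 ^ 2" using m by (simp add: exp_of_nat_mult[symmetric] field_simps)
    also have "\<dots> \<le> 3 ^ 2" by (intro power_mono exp_le) auto
    finally have "norm z ^ (2 * m) \<le> 9" by simp
    moreover have "norm (g' (1 / z)) \<le> M" using disc[OF hol(2) bd'] z by blast
    ultimately have "norm (g' (1 / z)) * norm z ^ (2 * m) \<le> M * 9"
      using M0 by (intro mult_mono) auto
    then show ?thesis unfolding refl[OF z(1)] by (simp add: norm_mult norm_power mult.commute)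
  qed
  have g1: "norm (deriv g 1) \<le> 9 * real m * M"
  proof -
    have "norm ((deriv ^^ 1) g 1) \<le> fact 1 * (M * 9) / (1 / real m) ^ 1"
      by (intro Cauchy_inequality hol holomorphic_on_imp_continuous_on big)
         (use m in \<open>auto simp: dist_norm\<close>)
    then show ?thesis using m by (simp add: mult_ac)
  qed
  define d where "d = (\<Sum>i\<in>UNIV. complex_of_real (y $ i) * partial_deriv i f x)"
  have "((\<lambda>t. g (cis t)) has_vector_derivative (\<i> * deriv g 1)) (at 0)"
  proof -
    have "(g has_field_derivative deriv g (cis 0)) (at (cis 0))"
      by (rule holomorphic_derivI[of _ UNIV]) (auto intro: hol)
    moreover have "(cis has_vector_derivative \<i> * cis 0) (at 0)"
      unfolding cis_conv_exp
      by (rule field_vector_diff_chain_at[of "\<lambda>t. \<i> * complex_of_real t" \<i> 0 exp, unfolded o_def, THEN has_vector_derivative_eq_rhs])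
         (auto intro!: derivative_eq_intros has_vector_derivative_mult_right)
    ultimately show ?thesis using field_vector_diff_chain_at[of cis "\<i> * cis 0" 0 g "deriv g (cis 0)"]
      by (simp add: o_def)
  qed
  moreover have "((\<lambda>t. g (cis t)) has_vector_derivative (\<i> * of_nat m * f x + d)) (at 0)"
  proof -
    have "((\<lambda>t. f (cos t *\<^sub>R x + sin t *\<^sub>R y)) has_derivative
       (\<lambda>t. \<Sum>i\<in>UNIV. complex_of_real ((t *\<^sub>R y) $ i) * partial_deriv i f x)) (at 0)"
      by (rule has_derivative_compose[of "\<lambda>t. cos t *\<^sub>R x + sin t *\<^sub>R y" "\<lambda>t. t *\<^sub>R y" 0 UNIV f])
         (auto intro!: derivative_eq_intros homog_has_derivative[OF f])
    also have "(\<lambda>t. \<Sum>i\<in>UNIV. complex_of_real ((t *\<^sub>R y) $ i) * partial_deriv i f x) = (\<lambda>t. t *\<^sub>R d)"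
      unfolding d_def by (simp add: fun_eq_iff scaleR_conv_of_real[where 'a = complex] sum_distrib_left mult_ac)
    finally have 1: "((\<lambda>t. f (cos t *\<^sub>R x + sin t *\<^sub>R y)) has_vector_derivative d) (at 0)"
      unfolding has_vector_derivative_def .
    have 2: "((\<lambda>t. cis t ^ m) has_vector_derivative (\<i> * of_nat m)) (at 0)"
      unfolding DeMoivre cis_conv_exp
      by (auto intro!: derivative_eq_intros has_vector_derivative_real_field)
    have "((\<lambda>t. cis t ^ m * f (cos t *\<^sub>R x + sin t *\<^sub>R y)) has_vector_derivative
        (cis 0 ^ m * d + \<i> * of_nat m * f (cos 0 *\<^sub>R x + sin 0 *\<^sub>R y))) (at 0)"
      by (rule has_vector_derivative_mult[OF 2 1])
    moreover have "(\<lambda>t. g (cis t)) = (\<lambda>t. cis t ^ m * f (cos t *\<^sub>R x + sin t *\<^sub>R y))"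
      by (auto simp: fun_eq_iff circ)
    ultimately show ?thesis by (simp add: add.commute)
  qed
  ultimately have "\<i> * deriv g 1 = \<i> * of_nat m * f x + d" by (rule vector_derivative_unique_at)
  then have "d = \<i> * deriv g 1 - \<i> * of_nat m * f x" by simp
  then have "norm d \<le> norm (\<i> * deriv g 1) + norm (\<i> * of_nat m * f x)" by (simp only: norm_triangle_ineq4)
  also have "\<dots> \<le> 9 * real m * M + real m * M"
    using g1 M[of x] xy by (intro add_mono) (auto simp: norm_mult mult_left_mono)
  finally show ?thesis by (simp add: d_def mult_ac)
qed

text \<open>A coordinate direction is split into a radial part, where Euler's identity applies, and a
  tangential one.\<close>

lemma bernstein:
  fixes x :: "real ^ 'n"
  assumes f: "homog m f" and M: "\<And>x. norm (f x) \<le> M * norm x ^ m"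
  shows "norm (partial_deriv i f x) \<le> 11 * real m * M * norm x ^ (m - 1)"
proof -
  obtain u where u: "norm u = 1" "x = norm x *\<^sub>R u" by (rule unit_vector_multiple)
  have M0: "M \<ge> 0" using order_trans[OF norm_ge_zero M[of u]] u by simp
  define v where "v = axis i 1 - (u $ i) *\<^sub>R u"
  have "v \<bullet> u = 0" using u(1)
    by (simp add: v_def inner_diff_left inner_axis' flip: power2_norm_eq_inner)
  have nv: "norm v \<le> 1"
  proof -
    have "(norm v)\<^sup>2 = v \<bullet> axis i 1" using \<open>v \<bullet> u = 0\<close>
      by (simp add: power2_norm_eq_inner v_def[symmetric] inner_diff_right) (simp add: v_def inner_diff_right)
    also have "\<dots> \<le> norm v" using norm_cauchy_schwarz[of v "axis i 1"] by simp
    finally have "norm v * norm v \<le> 1 * norm v" by (simp add: power2_eq_square)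
    then show ?thesis by (cases "norm v = 0") (auto simp: mult_le_cancel_right)
  qed
  obtain w where w: "norm w = 1" "v = norm v *\<^sub>R w" "norm v = 0 \<or> w \<bullet> u = 0"
  proof (cases "v = 0")
    case True
    then show ?thesis using that[of u] u by simp
  next
    case False
    then show ?thesis using that[of "sgn v"] \<open>v \<bullet> u = 0\<close> by (simp add: norm_sgn sgn_div_norm)
  qed
  define D where "D y = (\<Sum>j\<in>UNIV. complex_of_real (y $ j) * partial_deriv j f u)" for y
  have "partial_deriv i f u = D (axis i 1)" unfolding D_def by (rule sum_axis[symmetric])
  also have "axis i 1 = (u $ i) *\<^sub>R u + norm v *\<^sub>R w" using w(2) by (simp add: v_def)
  also have "D \<dots> = of_real (u $ i) * D u + of_real (norm v) * D w"
    by (simp add: D_def algebra_simps sum.distrib sum_distrib_left)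
  finally have eq: "partial_deriv i f u = of_real (u $ i) * D u + of_real (norm v) * D w" .
  have "norm (D u) \<le> real m * M"
    using M[of u] u by (simp add: D_def homog_euler[OF f] norm_mult mult_left_mono)
  moreover have "\<bar>u $ i\<bar> \<le> 1" using component_le_norm_cart[of u i] u by simp
  moreover have "norm v * norm (D w) \<le> 1 * (10 * real m * M)"
  proof (cases "norm v = 0")
    case True
    then show ?thesis using M0 by simp
  next
    case False
    then have "norm (D w) \<le> 10 * real m * M" unfolding D_def
      using w u by (intro bernstein_tangential[OF f M]) (auto simp: inner_commute)
    with nv M0 show ?thesis by (intro mult_mono) auto
  qed
  ultimately have "\<bar>u $ i\<bar> * norm (D u) + norm v * norm (D w) \<le> 1 * (real m * M) + 1 * (10 * real m * M)"
    using mult_mono[of "\<bar>u $ i\<bar>" 1 "norm (D u)" "real m * M"] by (simp add: mult_ac)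
  moreover have "norm (partial_deriv i f u) \<le> \<bar>u $ i\<bar> * norm (D u) + norm v * norm (D w)"
    unfolding eq by (rule norm_triangle_le) (simp add: norm_mult)
  ultimately have "norm (partial_deriv i f u) \<le> 1 * (real m * M) + 1 * (10 * real m * M)" by linarith
  then have b: "norm (partial_deriv i f u) \<le> 11 * real m * M" by (simp add: mult_ac)
  have "partial_deriv i f x = of_real (norm x ^ (m - 1)) * partial_deriv i f u"
    by (subst u(2)) (simp add: homog_scaleR[OF homog_partial[OF f]])
  then have "norm (partial_deriv i f x) = norm x ^ (m - 1) * norm (partial_deriv i f u)"
    by (simp add: norm_mult norm_power)
  also have "\<dots> \<le> norm x ^ (m - 1) * (11 * real m * M)" using b by (intro mult_left_mono) auto
  finally show ?thesis by (simp add: mult_ac)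
qed

section \<open>Series of homogeneous polynomials\<close>

text \<open>The hypothesis under which a series of homogeneous polynomials behaves on the ball of
  radius \<open>R\<close> like a power series in one variable.  By Bernstein's inequality it is inherited
  by the series of partial derivatives.\<close>

definition growth :: "real \<Rightarrow> (nat \<Rightarrow> real ^ 'n \<Rightarrow> complex) \<Rightarrow> bool" where
  "growth R q \<longleftrightarrow> (\<forall>m. homog m (q m)) \<and>
     (\<forall>r. 0 < r \<and> r < R \<longrightarrow> (\<exists>C. \<forall>m x. norm (q m x) * r ^ m \<le> C * norm x ^ m))"

definition hsum :: "(nat \<Rightarrow> real ^ 'n \<Rightarrow> complex) \<Rightarrow> real ^ 'n \<Rightarrow> complex" where
  "hsum q x = (\<Sum>m. q m x)"

lemma growth_homog: "growth R q \<Longrightarrow> homog m (q m)"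
  by (simp add: growth_def)

lemma growthD:
  assumes "growth R q" "0 < r" "r < R"
  shows "\<exists>C\<ge>0. \<forall>m x. norm (q m x) \<le> C * (norm x / r) ^ m"
proof -
  from assms obtain C where C: "\<And>m x. norm (q m x) * r ^ m \<le> C * norm x ^ m"
    unfolding growth_def by blast
  have "norm (q m x) \<le> \<bar>C\<bar> * (norm x / r) ^ m" for m x
  proof -
    have "C * norm x ^ m \<le> \<bar>C\<bar> * norm x ^ m" by (auto intro: mult_right_mono)
    with C[of m x] have "norm (q m x) * r ^ m \<le> \<bar>C\<bar> * norm x ^ m" by linarith
    then show ?thesis using assms by (simp add: power_divide field_simps)
  qed
  then show ?thesis by (intro exI[of _ "\<bar>C\<bar>"]) auto
qed

lemma growthI:
  assumes "\<And>m. homog m (q m)"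
    and "\<And>r. 0 < r \<Longrightarrow> r < R \<Longrightarrow> \<exists>C. \<forall>m x. norm (q m x) \<le> C * (norm x / r) ^ m"
  shows "growth R q"
  unfolding growth_def
proof (intro conjI allI impI)
  fix r assume r: "0 < r \<and> r < R"
  with assms(2) obtain C where "\<And>m x. norm (q m x) \<le> C * (norm x / r) ^ m" by blast
  with r show "\<exists>C. \<forall>m x. norm (q m x) * r ^ m \<le> C * norm x ^ m"
    by (intro exI[of _ C]) (auto simp: power_divide field_simps)
qed (fact assms)

lemma growth_mono: "growth R q \<Longrightarrow> S \<le> R \<Longrightarrow> growth S q"
  unfolding growth_def
proof (intro conjI allI impI)
  assume a: "(\<forall>m. homog m (q m)) \<and> (\<forall>r. 0 < r \<and> r < R \<longrightarrow> (\<exists>C. \<forall>m x. norm (q m x) * r ^ m \<le> C * norm x ^ m))" "S \<le> R"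
  show "homog m (q m)" for m using a by simp
  show "\<exists>C. \<forall>m x. norm (q m x) * r ^ m \<le> C * norm x ^ m" if "0 < r \<and> r < S" for r
    using a that by simp
qed

lemma growth_add:
  assumes "growth R q" "growth R q'"
  shows "growth R (\<lambda>m x. q m x + q' m x)"
proof (rule growthI)
  fix r :: real assume r: "0 < r" "r < R"
  obtain C where C: "C \<ge> 0" "\<And>m x. norm (q m x) \<le> C * (norm x / r) ^ m" using growthD[OF assms(1) r] by blast
  obtain D where D: "D \<ge> 0" "\<And>m x. norm (q' m x) \<le> D * (norm x / r) ^ m" using growthD[OF assms(2) r] by blast
  have "norm (q m x + q' m x) \<le> (C + D) * (norm x / r) ^ m" for m x
    using norm_triangle_mono[OF C(2) D(2)] by (simp add: algebra_simps)
  then show "\<exists>C. \<forall>m x. norm (q m x + q' m x) \<le> C * (norm x / r) ^ m" by blast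
qed (intro homog.add growth_homog[OF assms(1)] growth_homog[OF assms(2)])

lemma Suc_power_le:
  assumes "0 \<le> \<rho>" "\<rho> < (1 :: real)"
  shows "real (Suc m) * \<rho> ^ m \<le> 1 / (1 - \<rho>)"
proof -
  have "real (Suc m) * \<rho> ^ m = (\<Sum>k\<le>m. \<rho> ^ m)" by simp
  also have "\<dots> \<le> (\<Sum>k\<le>m. \<rho> ^ k)"
    using assms by (intro sum_mono power_decreasing) auto
  also have "\<dots> \<le> (\<Sum>k. \<rho> ^ k)"
    using assms by (intro sum_le_suminf summable_geometric) auto
  also have "\<dots> = 1 / (1 - \<rho>)" using assms by (intro suminf_geometric) auto
  finally show ?thesis .
qed

text \<open>The factor \<open>m\<close> lost in Bernstein's inequality is absorbed by passing to a slightly smaller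
  radius.\<close>

lemma growth_partial:
  assumes "growth R q"
  shows "growth R (\<lambda>m. partial_deriv i (q (Suc m)))"
proof (rule growthI)
  show "homog m (partial_deriv i (q (Suc m)))" for m
    using homog_partial[OF growth_homog[OF assms, of "Suc m"]] by simp
  fix r :: real assume r: "0 < r" "r < R"
  define r' where "r' = (r + R) / 2"
  have r': "0 < r'" "r' < R" "r < r'" using r by (auto simp: r'_def)
  obtain C where C: "C \<ge> 0" "\<And>m x. norm (q m x) \<le> C * (norm x / r') ^ m"
    using growthD[OF assms r'(1,2)] by blast
  have "norm (partial_deriv i (q (Suc m)) x) \<le> (11 * C / r' * (1 / (1 - r / r'))) * (norm x / r) ^ m" for m x
  proof -
    have "norm (partial_deriv i (q (Suc m)) x)
        \<le> 11 * real (Suc m) * (C / r' ^ Suc m) * norm x ^ (Suc m - 1)"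
      using C(2)[of "Suc m"] by (intro bernstein growth_homog[OF assms]) (simp add: power_divide)
    also have "\<dots> = 11 * C / r' * (real (Suc m) * (r / r') ^ m) * (norm x / r) ^ m"
      using r r' by (simp add: power_divide field_simps)
    also have "\<dots> \<le> 11 * C / r' * (1 / (1 - r / r')) * (norm x / r) ^ m"
      using r r' C(1) by (intro mult_right_mono mult_left_mono Suc_power_le) auto
    finally show ?thesis .
  qed
  then show "\<exists>C. \<forall>m x. norm (partial_deriv i (q (Suc m)) x) \<le> C * (norm x / r) ^ m" by blast
qed

lemma growth_uniform:
  assumes "growth R q" "s < R" "0 < R"
  shows "\<exists>B. summable B \<and> (\<forall>m x. norm x \<le> s \<longrightarrow> norm (q m x) \<le> B m) \<and> (\<forall>m. 0 \<le> B m)"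
proof -
  define t where "t = max s 0"
  define r where "r = (t + R) / 2"
  have t: "0 \<le> t" "s \<le> t" "t < R" using assms by (auto simp: t_def)
  then have r: "0 < r" "r < R" "t < r" by (auto simp: r_def)
  obtain C where C: "C \<ge> 0" "\<And>m x. norm (q m x) \<le> C * (norm x / r) ^ m"
    using growthD[OF assms(1) r(1,2)] by blast
  show ?thesis
  proof (intro exI[of _ "\<lambda>m. C * (t / r) ^ m"] conjI allI impI)
    show "summable (\<lambda>m. C * (t / r) ^ m)"
      using r t by (intro summable_mult summable_geometric) auto
    show "norm (q m x) \<le> C * (t / r) ^ m" if "norm x \<le> s" for m x
    proof -
      have "norm x / r \<le> t / r" using that t r by (intro divide_right_mono) auto
      then have "C * (norm x / r) ^ m \<le> C * (t / r) ^ m"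
        using r C(1) by (intro mult_left_mono power_mono) auto
      with C(2)[of m x] show ?thesis by linarith
    qed
  qed (use C r t in auto)
qed

lemma growth_summable:
  assumes "growth R q" "norm x < R"
  shows "summable (\<lambda>m. norm (q m x))" "summable (\<lambda>m. q m x)" "(\<lambda>m. q m x) sums hsum q x"
proof -
  have R: "0 < R" using assms(2) norm_ge_zero[of x] by linarith
  obtain B where B: "summable B" "\<And>m y. norm y \<le> norm x \<Longrightarrow> norm (q m y) \<le> B m"
    using growth_uniform[OF assms R] by blast
  show "summable (\<lambda>m. norm (q m x))"
    by (rule summable_comparison_test'[OF B(1), of 0]) (use B(2) in auto)
  then show "summable (\<lambda>m. q m x)" by (rule summable_norm_cancel)
  then show "(\<lambda>m. q m x) sums hsum q x" by (simp add: hsum_def summable_sums)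
qed

lemma hsum_has_derivative:
  assumes q: "growth R q" and x: "norm x < R"
  shows "(hsum q has_derivative
     (\<lambda>h. \<Sum>i\<in>UNIV. complex_of_real (h $ i) * hsum (\<lambda>m. partial_deriv i (q (Suc m))) x)) (at x)"
proof -
  have R: "0 < R" using x norm_ge_zero[of x] by linarith
  define s where "s = (norm x + R) / 2"
  have s: "norm x < s" "s < R" using x by (auto simp: s_def)
  let ?D = "\<lambda>i x. hsum (\<lambda>m. partial_deriv i (q (Suc m))) x"
  have "\<forall>i. \<exists>B. summable B \<and> (\<forall>m x. norm x \<le> s \<longrightarrow> norm (partial_deriv i (q (Suc m)) x) \<le> B m) \<and> (\<forall>m. 0 \<le> B m)"
    using growth_uniform[OF growth_partial[OF q] s(2) R] by blast
  from choice[OF this] obtain B where "\<forall>i. summable (B i) \<and>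
      (\<forall>m x. norm x \<le> s \<longrightarrow> norm (partial_deriv i (q (Suc m)) x) \<le> B i m) \<and> (\<forall>m. 0 \<le> B i m)" by blast
  then have B: "\<And>i. summable (B i)"
    "\<And>i m x. norm x \<le> s \<Longrightarrow> norm (partial_deriv i (q (Suc m)) x) \<le> B i m" "\<And>i m. 0 \<le> B i m"
    by blast+
  define T where "T N = (\<Sum>i\<in>UNIV. \<Sum>m. B i (m + N))" for N
  have "T \<longlonglongrightarrow> (\<Sum>i\<in>(UNIV :: 'a set). 0)"
    unfolding T_def
  proof (intro tendsto_sum)
    fix i
    have "(\<lambda>N. suminf (B i) - (\<Sum>m<N. B i m)) \<longlonglongrightarrow> suminf (B i) - suminf (B i)"
      by (intro tendsto_intros summable_LIMSEQ B)
    then show "(\<lambda>N. \<Sum>m. B i (m + N)) \<longlonglongrightarrow> 0"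
      by (simp add: suminf_minus_initial_segment[OF B(1)])
  qed
  then have T0: "T \<longlonglongrightarrow> 0" by simp
  have tail: "norm ((\<Sum>n<Suc N. partial_deriv i (q n) y) - ?D i y) \<le> (\<Sum>m. B i (m + N))"
    if y: "norm y \<le> s" for i N y
  proof -
    have y': "norm y < R" using y s by simp
    have sm: "summable (\<lambda>m. partial_deriv i (q (Suc m)) y)"
      by (rule growth_summable(2)[OF growth_partial[OF q] y'])
    have "(\<Sum>n<Suc N. partial_deriv i (q n) y) = (\<Sum>m<N. partial_deriv i (q (Suc m)) y)"
      by (subst sum.lessThan_Suc_shift) (simp add: homog_0_partial[OF growth_homog[OF q]])
    then have "(\<Sum>n<Suc N. partial_deriv i (q n) y) - ?D i y = - (\<Sum>m. partial_deriv i (q (Suc (m + N))) y)"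
      using suminf_minus_initial_segment[OF sm, of N] by (simp add: hsum_def)
    also have "norm \<dots> \<le> (\<Sum>m. B i (m + N))"
      unfolding norm_minus_cancel using B y
      by (intro norm_suminf_le) (auto simp: summable_iff_shift)
    finally show ?thesis .
  qed
  have "\<exists>g. \<forall>y\<in>ball 0 s. (\<lambda>n. q n y) sums g y \<and>
      (g has_derivative (\<lambda>h. \<Sum>i\<in>UNIV. complex_of_real (h $ i) * ?D i y)) (at y within ball 0 s)"
  proof (rule has_derivative_series)
    show "(q n has_derivative (\<lambda>h. \<Sum>i\<in>UNIV. complex_of_real (h $ i) * partial_deriv i (q n) y)) (at y within ball 0 s)"
      for n y by (rule has_derivative_at_withinI[OF homog_has_derivative[OF growth_homog[OF q]]])
    fix e :: real assume e: "e > 0"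
    with T0 have "\<forall>\<^sub>F N in sequentially. T N < e" by (simp add: order_tendstoD)
    then obtain N0 where N0: "\<And>N. N \<ge> N0 \<Longrightarrow> T N < e" by (auto simp: eventually_sequentially)
    have "\<forall>\<^sub>F N in sequentially. T (N - 1) < e \<and> N > 0"
      unfolding eventually_sequentially by (intro exI[of _ "Suc N0"]) (auto intro: N0)
    then show "\<forall>\<^sub>F n in sequentially. \<forall>y\<in>ball 0 s. \<forall>h.
        norm ((\<Sum>j<n. \<Sum>i\<in>UNIV. complex_of_real (h $ i) * partial_deriv i (q j) y) -
              (\<Sum>i\<in>UNIV. complex_of_real (h $ i) * ?D i y)) \<le> e * norm h"
    proof eventually_elim
      case (elim N)
      then obtain M where N: "N = Suc M" and TM: "T M < e" by (cases N) auto
      show ?case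
      proof (intro ballI allI)
        fix y h :: "real ^ 'a" assume "y \<in> ball 0 s"
        then have y: "norm y \<le> s" by simp
        have "(\<Sum>j<N. \<Sum>i\<in>UNIV. complex_of_real (h $ i) * partial_deriv i (q j) y) -
              (\<Sum>i\<in>UNIV. complex_of_real (h $ i) * ?D i y)
           = (\<Sum>i\<in>UNIV. complex_of_real (h $ i) * ((\<Sum>j<Suc M. partial_deriv i (q j) y) - ?D i y))"
          unfolding N by (subst sum.swap) (simp only: sum_subtractf right_diff_distrib sum_distrib_left)
        also have "norm \<dots> \<le> (\<Sum>i\<in>UNIV. norm h * (\<Sum>m. B i (m + M)))"
          by (rule sum_norm_le, unfold norm_mult norm_of_real)
             (auto intro!: mult_mono tail y component_le_norm_cart simp del: sum.lessThan_Suc)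
        also have "\<dots> = norm h * T M" by (simp add: T_def sum_distrib_left)
        also have "\<dots> \<le> e * norm h" using mult_left_mono[of "T M" e "norm h"] TM by (simp add: mult.commute)
        finally show "norm ((\<Sum>j<N. \<Sum>i\<in>UNIV. complex_of_real (h $ i) * partial_deriv i (q j) y) -
              (\<Sum>i\<in>UNIV. complex_of_real (h $ i) * ?D i y)) \<le> e * norm h" .
      qed
    qed
  qed (use s growth_summable[OF q x] in auto)
  then obtain g where g: "\<And>y. y \<in> ball 0 s \<Longrightarrow> (\<lambda>n. q n y) sums g y"
    "\<And>y. y \<in> ball 0 s \<Longrightarrow> (g has_derivative (\<lambda>h. \<Sum>i\<in>UNIV. complex_of_real (h $ i) * ?D i y)) (at y within ball 0 s)"
    by blast
  have eq: "g y = hsum q y" if "y \<in> ball 0 s" for y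
    using g(1)[OF that] by (simp add: hsum_def sums_iff)
  have xs: "x \<in> ball 0 s" using s by simp
  have "(g has_derivative (\<lambda>h. \<Sum>i\<in>UNIV. complex_of_real (h $ i) * ?D i x)) (at x)"
    using g(2)[OF xs] xs by (simp add: at_within_open[of _ "ball 0 s"])
  from has_derivative_transform_within_open[OF this open_ball xs] eq show ?thesis by blast
qed

lemma hsum_partial:
  assumes "growth R q" "norm x < R"
  shows "partial_deriv i (hsum q) x = hsum (\<lambda>m. partial_deriv i (q (Suc m))) x"
  using has_derivative_partial(2)[OF hsum_has_derivative[OF assms], of i] by (simp add: sum_axis)

section \<open>Real analyticity\<close>

text \<open>Taylor coefficients are indexed by words in the coordinates first: then Taylor's formula
  is a plain induction on the degree, and multi-indices appear only as letter counts.\<close>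

definition wpow :: "real ^ 'n \<Rightarrow> 'n list \<Rightarrow> real" where
  "wpow h l = (\<Prod>i\<leftarrow>l. h $ i)"

fun wderiv :: "'n list \<Rightarrow> (real ^ 'n \<Rightarrow> complex) \<Rightarrow> real ^ 'n \<Rightarrow> complex" where
  "wderiv [] f = f"
| "wderiv (i # l) f = wderiv l (partial_deriv i f)"

abbreviation words :: "nat \<Rightarrow> 'n list set" where
  "words k \<equiv> {l. length l = k}"

lemma finite_words: "finite (words k :: 'n::finite list set)"
  using finite_lists_length_eq[of "UNIV :: 'n set" k] by simp

lemma sum_words_Suc: "(\<Sum>l\<in>words (Suc k). F l) = (\<Sum>i\<in>UNIV. \<Sum>l\<in>words k. F (i # (l :: 'n::finite list)))"
proof -
  have "words (Suc k) = (\<lambda>(i, l). i # l) ` (UNIV \<times> (words k :: 'n list set))"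
    by (auto simp: image_iff length_Suc_conv)
  moreover have "inj_on (\<lambda>(i, l). i # l) (UNIV \<times> (words k :: 'n list set))"
    by (auto simp: inj_on_def)
  ultimately show ?thesis by (simp only: sum.reindex sum.cartesian_product o_def) (simp add: case_prod_beta)
qed

lemma wderiv_bound:
  assumes "homog m f" "\<And>x. norm (f x) \<le> M * norm x ^ m"
  shows "norm (wderiv l f x) \<le> 11 ^ length l * real (m choose length l) * fact (length l) * M * norm x ^ (m - length l)"
  using assms
proof (induction l arbitrary: m f M)
  case Nil
  then show ?case by simp
next
  case (Cons i l)
  let ?k = "length l"
  have "norm (wderiv l (partial_deriv i f) x)
      \<le> 11 ^ ?k * real ((m - 1) choose ?k) * fact ?k * (11 * real m * M) * norm x ^ (m - 1 - ?k)"
    by (rule Cons.IH[OF homog_partial[OF Cons.prems(1)] bernstein[OF Cons.prems]])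
  also have "\<dots> = 11 ^ Suc ?k * real (m * ((m - 1) choose ?k)) * fact ?k * M * norm x ^ (m - Suc ?k)"
    by simp
  also have "m * ((m - 1) choose ?k) = Suc ?k * (m choose Suc ?k)"
    by (rule binomial_absorption[symmetric])
  finally show ?case by (simp add: algebra_simps)
qed

lemma sum_words_wpow: "(\<Sum>l\<in>words k. \<bar>wpow h l\<bar>) = (\<Sum>i\<in>UNIV. \<bar>h $ i\<bar>) ^ k"
proof (induction k)
  case 0
  show ?case by (simp add: wpow_def)
next
  case (Suc k)
  have "(\<Sum>l\<in>words (Suc k). \<bar>wpow h l\<bar>) = (\<Sum>i\<in>UNIV. \<bar>h $ i\<bar> * (\<Sum>l\<in>words k. \<bar>wpow h l\<bar>))"
    unfolding sum_words_Suc by (simp add: wpow_def abs_mult sum_distrib_left)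
  then show ?case by (simp add: Suc.IH sum_distrib_right)
qed

text \<open>Both sides have the same derivative in \<open>s\<close> by the statement for the partial derivatives, and
  agree at \<open>s = 0\<close>.\<close>

lemma homog_taylor_ray:
  assumes "homog m f"
  shows "f (x + s *\<^sub>R h) = (\<Sum>k\<le>m. of_real (s ^ k / fact k) * (\<Sum>l\<in>words k. wderiv l f x * of_real (wpow h l)))"
  using assms
proof (induction m arbitrary: f s)
  case 0
  have "f (x + s *\<^sub>R h) = f (0 *\<^sub>R (x + s *\<^sub>R h))" using homog_scaleR[OF 0, of 0 "x + s *\<^sub>R h"] by simp
  also have "\<dots> = f x" using homog_scaleR[OF 0, of 0 x] by simp
  finally show ?case by (simp add: wpow_def)
next
  case (Suc m)
  define T where "T s = (\<Sum>k\<le>Suc m. of_real (s ^ k / fact k) * (\<Sum>l\<in>words k. wderiv l f x * of_real (wpow h l)))" for s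
  define D where "D s = (\<Sum>i\<in>UNIV. complex_of_real (h $ i) * partial_deriv i f (x + s *\<^sub>R h))" for s
  have f': "((\<lambda>s. f (x + s *\<^sub>R h)) has_vector_derivative D s) (at s)" for s
  proof -
    have "((\<lambda>s. f (x + s *\<^sub>R h)) has_derivative
        (\<lambda>t. \<Sum>i\<in>UNIV. complex_of_real ((t *\<^sub>R h) $ i) * partial_deriv i f (x + s *\<^sub>R h))) (at s)"
      by (rule has_derivative_compose[of "\<lambda>s. x + s *\<^sub>R h" "\<lambda>t. t *\<^sub>R h" s UNIV f])
         (auto intro!: derivative_eq_intros homog_has_derivative[OF Suc.prems])
    then show ?thesis unfolding has_vector_derivative_def D_def
      by (simp add: scaleR_conv_of_real[where 'a = complex] sum_distrib_left mult_ac)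
  qed
  have "(T has_vector_derivative (\<Sum>k\<le>Suc m. of_real (real k * s ^ (k - 1) / fact k) *
      (\<Sum>l\<in>words k. wderiv l f x * of_real (wpow h l)))) (at s)" for s
    unfolding T_def
    by (intro has_vector_derivative_sum has_vector_derivative_mult_left has_vector_derivative_of_real)
       (auto intro!: derivative_eq_intros simp: has_real_derivative_iff_has_vector_derivative[symmetric])
  also have "(\<Sum>k\<le>Suc m. of_real (real k * s ^ (k - 1) / fact k) *
      (\<Sum>l\<in>words k. wderiv l f x * of_real (wpow h l))) = D s" for s
  proof -
    have "(\<Sum>k\<le>Suc m. complex_of_real (real k * s ^ (k - 1) / fact k) * (\<Sum>l\<in>words k. wderiv l f x * of_real (wpow h l)))
      = (\<Sum>k\<le>m. complex_of_real (s ^ k / fact k) * (\<Sum>l\<in>words (Suc k). wderiv l f x * of_real (wpow h l)))"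
      by (subst sum.atMost_Suc_shift) (simp add: fact_Suc mult_divide_mult_cancel_left del: of_nat_Suc)
    also have "\<dots> = (\<Sum>k\<le>m. \<Sum>i\<in>UNIV. of_real (h $ i) * (of_real (s ^ k / fact k) *
        (\<Sum>l\<in>words k. wderiv l (partial_deriv i f) x * of_real (wpow h l))))"
      unfolding sum_words_Suc by (simp add: sum_distrib_left wpow_def mult_ac)
    also have "\<dots> = (\<Sum>i\<in>UNIV. of_real (h $ i) * partial_deriv i f (x + s *\<^sub>R h))"
      by (subst sum.swap, subst Suc.IH) (use homog_partial[OF Suc.prems] in \<open>auto simp: sum_distrib_left\<close>)
    finally show ?thesis by (simp add: D_def)
  qed
  finally have T': "(T has_vector_derivative D s) (at s)" for s .
  have "((\<lambda>s. f (x + s *\<^sub>R h) - T s) has_vector_derivative 0) (at s within UNIV)" for s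
    using has_vector_derivative_diff[OF f' T', of s] by simp
  then have "\<exists>c. \<forall>s\<in>UNIV. f (x + s *\<^sub>R h) - T s = c"
    by (intro has_derivative_zero_constant) (auto simp: has_vector_derivative_def)
  then obtain c where c: "\<And>s. f (x + s *\<^sub>R h) - T s = c" by blast
  have "T 0 = f x"
    unfolding T_def by (subst sum.atMost_Suc_shift) (simp add: wpow_def)
  with c[of 0] have "c = 0" by simp
  with c[of s] show ?case by (simp add: T_def)
qed

lemma has_sum_group:
  fixes f :: "'a \<Rightarrow> 'b :: banach"
  assumes "(\<lambda>x. norm (f x)) summable_on UNIV"
  shows "((\<lambda>a. infsum f {x. \<pi> x = a}) has_sum infsum f UNIV) UNIV"
proof -
  have bij: "bij_betw snd (SIGMA a:UNIV. {x. \<pi> x = a}) UNIV"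
    by (rule bij_betwI[of _ _ _ "\<lambda>x. (\<pi> x, x)"]) auto
  have f: "f summable_on UNIV" by (rule abs_summable_summable[OF assms])
  show ?thesis
  proof (rule has_sum_SigmaD)
    show "((\<lambda>p. f (snd p)) has_sum infsum f UNIV) (SIGMA a:UNIV. {x. \<pi> x = a})"
      unfolding has_sum_reindex_bij_betw[OF bij] using f by (rule has_sum_infsum)
    show "((\<lambda>y. f (snd (a, y))) has_sum infsum f {x. \<pi> x = a}) {x. \<pi> x = a}" for a
      using summable_on_subset_banach[OF f, of "{x. \<pi> x = a}"] by simp
  qed
qed

lemma wpow_eq_mpow: "wpow h l = mpow (h :: real ^ 'n) (count_list l)"
proof (induction l)
  case Nil
  show ?case by (simp add: wpow_def mpow_def)
next
  case (Cons i l)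
  have "count_list (i # l) = (count_list l)(i := Suc (count_list l i))" by (auto simp: fun_eq_iff)
  then have "mpow h (count_list (i # l)) = h $ i * mpow h (count_list l)"
    by (simp only: mpow_upd)
  also have "\<dots> = wpow h (i # l)" unfolding Cons.IH[symmetric] by (simp add: wpow_def)
  finally show ?case by (rule sym)
qed

lemma norm1_le: "(\<Sum>i\<in>UNIV. \<bar>(h :: real ^ 'n) $ i\<bar>) \<le> real CARD('n) * norm h"
  using sum_bounded_above[of UNIV "\<lambda>i. \<bar>h $ i\<bar>" "norm h"] component_le_norm_cart[of h] by simp

text \<open>The gradient bound is linear in the degree, so the Taylor series of a homogeneous
  polynomial of degree \<open>m\<close> at \<open>x\<close> is majorised by \<open>(|x| + 11 |h|\<^sub>1)^m\<close>, uniformly summable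
  in \<open>m\<close> as long as this base is less than \<open>R\<close>.\<close>

lemma growth_imp_real_analytic:
  fixes q :: "nat \<Rightarrow> real ^ 'n \<Rightarrow> complex"
  assumes q: "growth R q"
  shows "real_analytic_on (hsum q) (ball 0 R)"
  unfolding real_analytic_on_def
proof
  fix x :: "real ^ 'n" assume "x \<in> ball 0 R"
  then have x: "norm x < R" by simp
  define s where "s = (norm x + R) / 2"
  have s: "norm x < s" "s < R" "0 < s" using x norm_ge_zero[of x] by (auto simp: s_def simp del: norm_ge_zero)
  define \<delta> where "\<delta> = (s - norm x) / (11 * real CARD('n))"
  have \<delta>: "\<delta> > 0" using s by (simp add: \<delta>_def)
  obtain C where C: "C \<ge> 0" "\<And>m x. norm (q m x) \<le> C * (norm x / s) ^ m"
    using growthD[OF q s(3,2)] by blast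
  define A where "A = (\<lambda>(m, l). wderiv l (q m) x / of_real (fact (length l)))"
  define \<pi> :: "nat \<times> 'n list \<Rightarrow> 'n \<Rightarrow> nat" where "\<pi> = (\<lambda>(m, l). count_list l)"
  have "((\<lambda>a. infsum A {p. \<pi> p = a} * of_real (mpow h a)) has_sum hsum q (x + h)) UNIV"
    if "h \<in> ball 0 \<delta>" for h
  proof -
    define f where "f = (\<lambda>(m, l). A (m, l) * complex_of_real (wpow h l))"
    define \<rho> where "\<rho> = norm x + 11 * (\<Sum>i\<in>UNIV. \<bar>h $ i\<bar>)"
    have "11 * (\<Sum>i\<in>UNIV. \<bar>h $ i\<bar>) < s - norm x"
    proof -
      have "11 * (\<Sum>i\<in>UNIV. \<bar>h $ i\<bar>) \<le> 11 * (real CARD('n) * norm h)" using norm1_le[of h] by simp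
      also have "\<dots> < 11 * (real CARD('n) * \<delta>)" using that by simp
      also have "\<dots> = s - norm x" by (simp add: \<delta>_def)
      finally show ?thesis .
    qed
    then have \<rho>: "0 \<le> \<rho>" "\<rho> < s" by (auto simp: \<rho>_def sum_nonneg)
    have "norm h \<le> (\<Sum>i\<in>UNIV. \<bar>h $ i\<bar>)" by (rule norm_le_l1_cart)
    then have "norm x + norm h < s" using \<rho> norm_ge_zero[of h] unfolding \<rho>_def by linarith
    then have xh: "norm (x + h) < R" using norm_triangle_ineq[of x h] s by linarith
    have M: "norm (q m y) \<le> C / s ^ m * norm y ^ m" for m y
      using C(2)[of m y] by (simp add: power_divide)
    have fb: "norm (f (m, l)) \<le> 11 ^ length l * real (m choose length l) * (C / s ^ m) * norm x ^ (m - length l) * \<bar>wpow h l\<bar>" for m l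
    proof -
      have "norm (f (m, l)) = norm (wderiv l (q m) x) / fact (length l) * \<bar>wpow h l\<bar>"
        by (simp add: f_def A_def norm_mult norm_divide)
      also have "\<dots> \<le> (11 ^ length l * real (m choose length l) * fact (length l) * (C / s ^ m) * norm x ^ (m - length l)) / fact (length l) * \<bar>wpow h l\<bar>"
        by (intro mult_right_mono divide_right_mono wderiv_bound growth_homog[OF q] M) auto
      also have "\<dots> = 11 ^ length l * real (m choose length l) * (C / s ^ m) * norm x ^ (m - length l) * \<bar>wpow h l\<bar>"
        by simp
      finally show ?thesis .
    qed
    define L where "L m = (\<Union>k\<le>m. (words k :: 'n list set))" for m
    have fin: "finite (L m)" for m by (auto simp: L_def finite_words)
    have f0: "f (m, l) = 0" if "l \<notin> L m" for m l
    proof -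
      have "m < length l" using that by (auto simp: L_def)
      with fb[of m l] show ?thesis by (simp add: binomial_eq_0)
    qed
    have sumL: "(\<Sum>l\<in>L m. F l) = (\<Sum>k\<le>m. \<Sum>l\<in>words k. F l)" for F :: "_ \<Rightarrow> 'c :: comm_monoid_add" and m
      unfolding L_def by (intro sum.UNION_disjoint) (auto simp: finite_words)
    have inner: "((\<lambda>l. norm (f (m, l))) has_sum (\<Sum>l\<in>L m. norm (f (m, l)))) UNIV" for m
      by (rule has_sum_finite_neutralI[OF fin]) (auto simp: f0)
    have bound: "(\<Sum>l\<in>L m. norm (f (m, l))) \<le> C * (\<rho> / s) ^ m" for m
    proof -
      have "(\<Sum>l\<in>L m. norm (f (m, l))) \<le> (\<Sum>k\<le>m. \<Sum>l\<in>words k.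
          11 ^ k * real (m choose k) * (C / s ^ m) * norm x ^ (m - k) * \<bar>wpow h l\<bar>)"
        unfolding sumL using fb by (intro sum_mono) auto
      also have "\<dots> = (\<Sum>k\<le>m. (C / s ^ m) * (real (m choose k) * (11 * (\<Sum>i\<in>UNIV. \<bar>h $ i\<bar>)) ^ k * norm x ^ (m - k)))"
        unfolding sum_distrib_left[symmetric] sum_words_wpow[symmetric] power_mult_distrib
        by (subst sum_distrib_left, intro sum.cong refl) (simp add: mult_ac)
      also have "\<dots> = (C / s ^ m) * (11 * (\<Sum>i\<in>UNIV. \<bar>h $ i\<bar>) + norm x) ^ m"
        by (simp add: binomial_ring sum_distrib_left)
      also have "\<dots> = C * (\<rho> / s) ^ m" by (simp add: \<rho>_def power_divide add.commute)
      finally show ?thesis .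
    qed
    have sumB: "(\<lambda>m. C * (\<rho> / s) ^ m) summable_on UNIV"
    proof -
      have "summable (\<lambda>m. C * (\<rho> / s) ^ m)" using \<rho> s by (intro summable_mult summable_geometric) auto
      then show ?thesis using \<rho> s C(1) by (subst summable_on_UNIV_nonneg_real_iff) auto
    qed
    have "(\<lambda>p. norm (f p)) summable_on (UNIV \<times> UNIV)"
      unfolding Infinite_Sum.abs_summable_on_Sigma_iff
    proof (intro conjI ballI)
      show "(\<lambda>l. norm (f (m, l))) summable_on UNIV" for m using inner by (auto simp: summable_on_def)
      show "(\<lambda>m. norm (infsum (\<lambda>l. norm (f (m, l))) UNIV)) summable_on UNIV"
        using bound by (intro Infinite_Sum.abs_summable_on_comparison_test'[OF sumB])
           (simp add: infsumI[OF inner] sum_nonneg)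
    qed
    then have f: "(\<lambda>p. norm (f p)) summable_on UNIV" by simp
    have q_eq: "infsum (\<lambda>l. f (m, l)) UNIV = q m (x + h)" for m
    proof -
      have "((\<lambda>l. f (m, l)) has_sum (\<Sum>l\<in>L m. f (m, l))) UNIV"
        by (rule has_sum_finite_neutralI[OF fin]) (auto simp: f0)
      moreover have "(\<Sum>l\<in>L m. f (m, l)) = q m (x + 1 *\<^sub>R h)"
        unfolding sumL homog_taylor_ray[OF growth_homog[OF q]]
        by (auto simp: f_def A_def sum_distrib_left mult_ac intro!: sum.cong)
      ultimately show ?thesis by (simp add: infsumI)
    qed
    have f': "f summable_on (UNIV \<times> UNIV)" using abs_summable_summable[OF f] by simp
    have "infsum f UNIV = infsum (\<lambda>m. q m (x + h)) UNIV"
      using infsum_Sigma_banach[OF f'] by (simp add: q_eq)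
    also have "\<dots> = hsum q (x + h)"
      by (intro infsumI norm_summable_imp_has_sum growth_summable[OF q xh])
    finally have "((\<lambda>a. infsum f {p. \<pi> p = a}) has_sum hsum q (x + h)) UNIV"
      using has_sum_group[OF f, of \<pi>] by simp
    moreover have "infsum f {p. \<pi> p = a} = infsum A {p. \<pi> p = a} * of_real (mpow h a)" for a
    proof -
      have "infsum f {p. \<pi> p = a} = infsum (\<lambda>p. of_real (mpow h a) * A p) {p. \<pi> p = a}"
        by (intro infsum_cong) (auto simp: f_def \<pi>_def wpow_eq_mpow mult.commute)
      then show ?thesis unfolding infsum_cmult_right' by (simp add: mult.commute)
    qed
    ultimately show ?thesis by simp
  qed
  with \<delta> show "\<exists>r>0. \<exists>c. \<forall>h\<in>ball 0 r. ((\<lambda>a. c a * complex_of_real (mpow h a)) has_sum hsum q (x + h)) UNIV"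
    by (intro exI[of _ \<delta>] conjI exI[of _ "\<lambda>a. infsum A {p. \<pi> p = a}"] ballI) simp_all
qed

lemma mpow_le: "\<bar>mpow (x :: real ^ 'n) a\<bar> \<le> norm x ^ (\<Sum>i\<in>UNIV. a i)"
  unfolding mpow_def abs_prod power_abs power_sum
  by (intro prod_mono conjI power_mono component_le_norm_cart) auto

text \<open>Absolute convergence at the point with all coordinates equal to \<open>\<delta>\<close>, where the monomials of
  degree \<open>m\<close> take the value \<open>\<delta>^m\<close>, bounds the coefficients.\<close>

lemma real_analytic_imp_growth:
  fixes f :: "real ^ 'n \<Rightarrow> complex"
  assumes "real_analytic_on f S" "x \<in> S"
  shows "\<exists>\<delta>>0. \<exists>q. growth \<delta> q \<and> (\<forall>h. norm h < \<delta> \<longrightarrow> f (x + h) = hsum q h)"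
proof -
  from assms obtain r c where r: "r > 0" and
    c: "\<And>h. h \<in> ball 0 r \<Longrightarrow> ((\<lambda>a. c a * complex_of_real (mpow h a)) has_sum f (x + h)) UNIV"
    unfolding real_analytic_on_def by blast
  define \<delta> where "\<delta> = r / (2 * real CARD('n))"
  have \<delta>: "\<delta> > 0" "\<delta> \<le> r / 2" using r by (auto simp: \<delta>_def divide_le_eq)
  define v :: "real ^ 'n" where "v = (\<chi> i. \<delta>)"
  have "norm v \<le> real CARD('n) * \<delta>" using norm_le_l1_cart[of v] \<delta> by (simp add: v_def)
  also have "\<dots> < r" using r by (simp add: \<delta>_def)
  finally have "v \<in> ball 0 r" by simp
  from c[OF this] have "(\<lambda>a. c a * complex_of_real (mpow v a)) summable_on UNIV"
    by (auto simp: summable_on_def)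
  then have abs: "(\<lambda>a. norm (c a * complex_of_real (mpow v a))) summable_on UNIV"
    by (simp add: summable_on_iff_abs_summable_on_complex)
  have mv: "mpow v a = \<delta> ^ (\<Sum>i\<in>UNIV. a i)" for a by (simp add: mpow_def v_def power_sum)
  define C where "C = infsum (\<lambda>a. norm (c a * complex_of_real (mpow v a))) UNIV"
  define q where "q m h = (\<Sum>a\<in>multi_indices m. c a * complex_of_real (mpow h a))" for m h
  have hom: "homog m (q m)" for m
    by (rule homog_poly_imp_homog) (auto simp: homog_poly_def q_def)
  have qb: "norm (q m h) * \<delta> ^ m \<le> C * norm h ^ m" for m h
  proof -
    have "norm (q m h) * \<delta> ^ m \<le> (\<Sum>a\<in>multi_indices m. norm (c a * complex_of_real (mpow h a))) * \<delta> ^ m"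
      unfolding q_def using \<delta> by (intro mult_right_mono norm_sum) auto
    also have "\<dots> = (\<Sum>a\<in>multi_indices m. norm (c a) * \<bar>mpow h a\<bar> * \<delta> ^ m)"
      by (simp add: norm_mult sum_distrib_right)
    also have "\<dots> \<le> (\<Sum>a\<in>multi_indices m. norm (c a) * norm h ^ m * \<delta> ^ m)"
      using mpow_le[of h] \<delta> by (intro sum_mono mult_right_mono mult_left_mono) (auto simp: multi_indices_def)
    also have "\<dots> = (\<Sum>a\<in>multi_indices m. norm (c a * complex_of_real (mpow v a))) * norm h ^ m"
      using \<delta> unfolding sum_distrib_right
      by (intro sum.cong) (auto simp: mv multi_indices_def norm_mult norm_power)
    also have "\<dots> \<le> C * norm h ^ m"
      unfolding C_def using abs
      by (intro mult_right_mono finite_sum_le_infsum finite_multi_indices) auto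
    finally show ?thesis .
  qed
  have gr: "growth \<delta> q"
    unfolding growth_def
  proof (intro conjI allI impI)
    fix r assume r: "0 < r \<and> r < \<delta>"
    have "norm (q m h) * r ^ m \<le> C * norm h ^ m" for m h
    proof -
      have "norm (q m h) * r ^ m \<le> norm (q m h) * \<delta> ^ m"
        using r by (intro mult_left_mono power_mono) auto
      with qb[of m h] show ?thesis by linarith
    qed
    then show "\<exists>C. \<forall>m h. norm (q m h) * r ^ m \<le> C * norm h ^ m" by blast
  qed (fact hom)
  show ?thesis
  proof (intro exI[of _ \<delta>] exI[of _ q] conjI allI impI \<delta>(1) gr)
    fix h :: "real ^ 'n" assume h: "norm h < \<delta>"
    then have "h \<in> ball 0 r" using \<delta> r by simp
    note hs = c[OF this]
    then have "(\<lambda>a. norm (c a * complex_of_real (mpow h a))) summable_on UNIV"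
      by (simp add: summable_on_iff_abs_summable_on_complex[symmetric]) (auto simp: summable_on_def)
    from has_sum_group[OF this, of "\<lambda>a. \<Sum>i\<in>UNIV. a i"]
    have "((\<lambda>m. q m h) has_sum f (x + h)) UNIV"
      using infsumI[OF hs] finite_multi_indices[where 'n = 'n]
      by (simp add: q_def multi_indices_def[symmetric])
    then show "f (x + h) = hsum q h"
      unfolding hsum_def by (rule sums_unique[OF has_sum_imp_sums])
  qed
qed

lemma real_analyticI:
  assumes "\<And>x. x \<in> S \<Longrightarrow> \<exists>\<delta>>0. \<exists>q. growth \<delta> q \<and> (\<forall>h. norm h < \<delta> \<longrightarrow> f (x + h) = hsum q h)"
  shows "real_analytic_on f S"
  unfolding real_analytic_on_def
proof
  fix x assume "x \<in> S"
  from assms[OF this] obtain \<delta> q where q: "\<delta> > 0" "growth \<delta> q" "\<And>h. norm h < \<delta> \<Longrightarrow> f (x + h) = hsum q h"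
    by blast
  from growth_imp_real_analytic[OF q(2)] q(1)
  obtain r c where r: "r > 0" "\<And>h. h \<in> ball 0 r \<Longrightarrow> ((\<lambda>a. c a * complex_of_real (mpow h a)) has_sum hsum q (0 + h)) UNIV"
    unfolding real_analytic_on_def by fastforce
  show "\<exists>r>0. \<exists>c. \<forall>h\<in>ball 0 r. ((\<lambda>a. c a * complex_of_real (mpow h a)) has_sum f (x + h)) UNIV"
    using r q by (intro exI[of _ "min r \<delta>"] conjI exI[of _ c]) auto
qed

lemma real_analytic_add:
  assumes "real_analytic_on f S" "real_analytic_on g S"
  shows "real_analytic_on (\<lambda>x. f x + g x) S"
proof (rule real_analyticI)
  fix x assume x: "x \<in> S"
  obtain \<delta> q where q: "\<delta> > 0" "growth \<delta> q" "\<And>h. norm h < \<delta> \<Longrightarrow> f (x + h) = hsum q h" using real_analytic_imp_growth[OF assms(1) x] by blast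
  obtain \<epsilon> q' where q': "\<epsilon> > 0" "growth \<epsilon> q'" "\<And>h. norm h < \<epsilon> \<Longrightarrow> g (x + h) = hsum q' h" using real_analytic_imp_growth[OF assms(2) x] by blast
  have "growth (min \<delta> \<epsilon>) (\<lambda>m x. q m x + q' m x)"
    by (intro growth_add growth_mono[OF q(2)] growth_mono[OF q'(2)]) auto
  moreover have "f (x + h) + g (x + h) = hsum (\<lambda>m x. q m x + q' m x) h" if "norm h < min \<delta> \<epsilon>" for h
    using that q q' growth_summable(2)[OF q(2), of h] growth_summable(2)[OF q'(2), of h]
    by (simp add: hsum_def suminf_add)
  ultimately show "\<exists>\<delta>>0. \<exists>p. growth \<delta> p \<and> (\<forall>h. norm h < \<delta> \<longrightarrow> f (x + h) + g (x + h) = hsum p h)"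
    using q(1) q'(1) by (intro exI[of _ "min \<delta> \<epsilon>"] conjI exI[of _ "\<lambda>m x. q m x + q' m x"]) auto
qed

lemma real_analytic_zero: "real_analytic_on (\<lambda>_. 0) S"
  unfolding real_analytic_on_def by (intro ballI exI[of _ 1] conjI exI[of _ "\<lambda>_. 0"]) auto

lemma real_analytic_sum: "(\<And>a. a \<in> A \<Longrightarrow> real_analytic_on (f a) S) \<Longrightarrow> real_analytic_on (\<lambda>x. \<Sum>a\<in>A. f a x) S"
proof (induction A rule: infinite_finite_induct)
  case (insert a A)
  have "real_analytic_on (\<lambda>x. f a x + (\<Sum>a\<in>A. f a x)) S"
    using insert by (intro real_analytic_add) auto
  then show ?case using insert.hyps by simp
qed (auto intro: real_analytic_zero)

lemma
  assumes f: "real_analytic_on f S" and S: "open S" "x \<in> S"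
  shows real_analytic_has_derivative:
      "(f has_derivative (\<lambda>h. \<Sum>i\<in>UNIV. complex_of_real (h $ i) * partial_deriv i f x)) (at x)"
    and real_analytic_partial_local: "\<exists>\<delta>>0. \<exists>q. growth \<delta> q \<and>
      (\<forall>h. norm h < \<delta> \<longrightarrow> partial_deriv i f (x + h) = hsum q h)"
proof -
  obtain \<delta> q where q: "\<delta> > 0" "growth \<delta> q"
    "\<And>h. norm h < \<delta> \<Longrightarrow> f (x + h) = hsum q h" using real_analytic_imp_growth[OF f S(2)] by blast
  have *: "(f has_derivative (\<lambda>v. \<Sum>i\<in>UNIV. complex_of_real (v $ i) * hsum (\<lambda>m. partial_deriv i (q (Suc m))) h)) (at (x + h))"
    if "norm h < \<delta>" for h
  proof -
    have "((\<lambda>y. hsum q (y - x)) has_derivative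
        (\<lambda>v. \<Sum>i\<in>UNIV. complex_of_real (v $ i) * hsum (\<lambda>m. partial_deriv i (q (Suc m))) h)) (at (x + h))"
      by (rule has_derivative_compose[of "\<lambda>y. y - x" "\<lambda>v. v" "x + h" UNIV "hsum q"])
         (use hsum_has_derivative[OF q(2) that] in \<open>auto intro!: derivative_eq_intros\<close>)
    then show ?thesis
    proof (rule has_derivative_transform_within_open[where s = "ball x \<delta>"])
      show "hsum q (y - x) = f y" if "y \<in> ball x \<delta>" for y
        using q(3)[of "y - x"] that by (simp add: dist_norm norm_minus_commute)
    qed (use that in \<open>auto simp: dist_norm\<close>)
  qed
  have p: "partial_deriv i f (x + h) = hsum (\<lambda>m. partial_deriv i (q (Suc m))) h" if "norm h < \<delta>" for h i
    using has_derivative_partial(2)[OF *[OF that], of i] by (simp add: sum_axis)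
  show "(f has_derivative (\<lambda>h. \<Sum>i\<in>UNIV. complex_of_real (h $ i) * partial_deriv i f x)) (at x)"
    using *[of 0] p[of 0] q(1) by simp
  show "\<exists>\<delta>>0. \<exists>q. growth \<delta> q \<and> (\<forall>h. norm h < \<delta> \<longrightarrow> partial_deriv i f (x + h) = hsum q h)"
    using q(1) growth_partial[OF q(2)] p by blast
qed

lemma real_analytic_partial: "real_analytic_on f S \<Longrightarrow> open S \<Longrightarrow> real_analytic_on (partial_deriv i f) S"
  by (rule real_analyticI) (rule real_analytic_partial_local)

lemma real_analytic_laplacian: "real_analytic_on f S \<Longrightarrow> open S \<Longrightarrow> real_analytic_on (laplacian f) S"
  unfolding laplacian_def[abs_def] by (intro real_analytic_sum real_analytic_partial)

lemma real_analytic_continuous: "real_analytic_on f S \<Longrightarrow> open S \<Longrightarrow> continuous_on S f"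
  using has_derivative_continuous[OF real_analytic_has_derivative] continuous_at_imp_continuous_on by blast

section \<open>Green's formula on the ball\<close>

lemma has_vector_derivative_iff_quotient:
  fixes f :: "real \<Rightarrow> 'a :: real_normed_vector"
  shows "(f has_vector_derivative d) (at x) \<longleftrightarrow> ((\<lambda>s. (f (x + s) - f x) /\<^sub>R s) \<longlongrightarrow> d) (at 0)"
proof -
  have "((\<lambda>h. norm (f (x + h) - f x - h *\<^sub>R d) / norm h) \<longlongrightarrow> 0) (at 0)
      \<longleftrightarrow> ((\<lambda>h. norm ((f (x + h) - f x) /\<^sub>R h - d)) \<longlongrightarrow> 0) (at 0)"
  proof (rule tendsto_cong)
    have "norm (f (x + h) - f x - h *\<^sub>R d) / norm h = norm ((f (x + h) - f x) /\<^sub>R h - d)" if "h \<noteq> 0" for h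
    proof -
      have "(f (x + h) - f x) /\<^sub>R h - d = (f (x + h) - f x - h *\<^sub>R d) /\<^sub>R h"
        using that by (simp add: scaleR_diff_right)
      then show ?thesis by (simp add: divide_inverse_commute)
    qed
    then show "\<forall>\<^sub>F h in at 0. norm (f (x + h) - f x - h *\<^sub>R d) / norm h = norm ((f (x + h) - f x) /\<^sub>R h - d)"
      by (simp add: eventually_at_filter)
  qed
  then show ?thesis
    unfolding has_vector_derivative_def has_derivative_at tendsto_norm_zero_iff LIM_zero_iff
    by (simp add: bounded_linear_scaleR_left)
qed

text \<open>Dominated convergence for the difference quotients; the derivative is required only almost
  everywhere, as the integrands used below have a kink on the sphere.\<close>

lemma has_vector_derivative_integral:
  fixes h :: "real \<Rightarrow> 'a \<Rightarrow> complex"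
  assumes \<delta>: "\<delta> > 0"
    and int: "\<And>s. \<bar>s\<bar> < \<delta> \<Longrightarrow> integrable M (h (x + s))"
    and meas: "h' \<in> borel_measurable M"
    and deriv: "AE y in M. ((\<lambda>s. h s y) has_vector_derivative h' y) (at x)"
    and lip: "\<And>s y. \<bar>s\<bar> < \<delta> \<Longrightarrow> y \<in> space M \<Longrightarrow> norm (h (x + s) y - h x y) \<le> \<bar>s\<bar> * B y"
    and B: "integrable M B"
  shows "((\<lambda>s. integral\<^sup>L M (h s)) has_vector_derivative integral\<^sup>L M h') (at x)"
  unfolding has_vector_derivative_iff_quotient tendsto_at_iff_sequentially
proof (intro allI impI)
  fix X :: "nat \<Rightarrow> real" assume X: "\<forall>i. X i \<in> UNIV - {0}" "X \<longlonglongrightarrow> 0"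
  from X(2) \<delta> have "\<forall>\<^sub>F i in sequentially. \<bar>X i\<bar> < \<delta>"
    by (auto dest: tendstoD)
  then obtain N where N: "\<And>i. i \<ge> N \<Longrightarrow> \<bar>X i\<bar> < \<delta>" by (auto simp: eventually_sequentially)
  define Y where "Y i = X (i + N)" for i
  have Y: "Y i \<noteq> 0" "\<bar>Y i\<bar> < \<delta>" for i using X N by (auto simp: Y_def)
  have Y0: "Y \<longlonglongrightarrow> 0" unfolding Y_def by (rule LIMSEQ_ignore_initial_segment[OF X(2)])
  have int0: "integrable M (h x)" using int[of 0] \<delta> by simp
  have "(\<lambda>i. integral\<^sup>L M (\<lambda>y. (h (x + Y i) y - h x y) /\<^sub>R Y i)) \<longlonglongrightarrow> integral\<^sup>L M h'"
  proof (rule integral_dominated_convergence[where w = B])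
    show "(\<lambda>y. (h (x + Y i) y - h x y) /\<^sub>R Y i) \<in> borel_measurable M" for i
      using int[OF Y(2)[of i]] int0 by (intro borel_measurable_scaleR borel_measurable_diff) auto
    show "AE y in M. (\<lambda>i. (h (x + Y i) y - h x y) /\<^sub>R Y i) \<longlonglongrightarrow> h' y"
      using deriv
    proof eventually_elim
      case (elim y)
      then have "((\<lambda>s. (h (x + s) y - h x y) /\<^sub>R s) \<longlongrightarrow> h' y) (at 0)"
        by (simp add: has_vector_derivative_iff_quotient)
      then show ?case
        using Y0 Y(1) unfolding tendsto_at_iff_sequentially o_def by blast
    qed
    show "AE y in M. norm ((h (x + Y i) y - h x y) /\<^sub>R Y i) \<le> B y" for i
    proof (rule AE_I2)
      fix y assume "y \<in> space M"
      from lip[OF Y(2) this, of i] Y(1)[of i]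
      show "norm ((h (x + Y i) y - h x y) /\<^sub>R Y i) \<le> B y"
        by (simp add: divide_simps mult.commute)
    qed
  qed (use meas B in auto)
  also have "(\<lambda>i. integral\<^sup>L M (\<lambda>y. (h (x + Y i) y - h x y) /\<^sub>R Y i))
      = (\<lambda>i. (integral\<^sup>L M (h (x + Y i)) - integral\<^sup>L M (h x)) /\<^sub>R Y i)"
    using int[OF Y(2)] int0 by (simp add: fun_eq_iff)
  finally show "((\<lambda>s. (integral\<^sup>L M (h (x + s)) - integral\<^sup>L M (h x)) /\<^sub>R s) \<circ> X) \<longlonglongrightarrow> integral\<^sup>L M h'"
    unfolding o_def Y_def by (rule LIMSEQ_offset)
qed

lemma set_integrable_ball_continuous:
  fixes f :: "real ^ 'n \<Rightarrow> 'b :: {banach, second_countable_topology}"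
  assumes "continuous_on (cball 0 1) f"
  shows "set_integrable lborel (ball 0 1) f"
proof -
  have "set_integrable lborel (cball 0 1) f"
    unfolding set_integrable_def by (intro borel_integrable_compact assms) auto
  then show ?thesis by (rule set_integrable_subset) auto
qed

lemma AE_not_sphere: "AE y in lborel. norm (y :: real ^ 'n) \<noteq> 1"
proof -
  have "negligible (sphere (0 :: real ^ 'n) 1)" by (rule negligible_sphere)
  then have "sphere (0 :: real ^ 'n) 1 \<in> null_sets lborel"
    by (simp add: negligible_iff_null_sets null_sets_completion_iff)
  then show ?thesis by (rule AE_I') auto
qed

text \<open>The field \<open>(1 - |y|\<^sup>2) G\<close>, extended by \<open>0\<close>, is Lipschitz with compact support, so by
  translation invariance the integral of each partial derivative vanishes; no surface measure
  and no boundary term is needed, since the cut-off vanishes on the sphere.\<close>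

lemma integral_ball_cutoff_partial:
  fixes G :: "real ^ 'n \<Rightarrow> complex"
  assumes R: "R > 1"
    and G: "\<And>y. norm y < R \<Longrightarrow> (G has_derivative (\<lambda>h. \<Sum>i\<in>UNIV. complex_of_real (h $ i) * D i y)) (at y)"
    and D: "\<And>i. continuous_on (ball 0 R) (D i)"
  shows "(LINT y:ball 0 1|lborel. of_real (1 - (norm y)\<^sup>2) * D i y) =
         (LINT y:ball 0 1|lborel. 2 * of_real (y $ i) * G y)"
proof -
  have sub: "cball 0 1 \<subseteq> ball (0 :: real ^ 'n) R" using R by auto
  have Gc: "continuous_on (cball 0 1) G"
    using G R by (intro continuous_at_imp_continuous_on ballI has_derivative_continuous[OF G]) auto
  have Dc: "continuous_on (cball 0 1) (D j)" for j using D sub by (rule continuous_on_subset)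
  have "\<exists>K. \<forall>y\<in>cball 0 1. norm (f y) \<le> K" if "continuous_on (cball 0 1) f" for f :: "real ^ 'n \<Rightarrow> complex"
    using compact_imp_bounded[OF compact_continuous_image[OF that compact_cball]]
    by (auto simp: bounded_iff)
  note bdd = this
  obtain M where "\<forall>y\<in>cball 0 1. norm (G y) \<le> M" using bdd[OF Gc] by blast
  then have M: "norm (G y) \<le> M" if "norm y \<le> 1" for y using that by simp
  have "\<forall>j. \<exists>K. \<forall>y\<in>cball 0 1. norm (D j y) \<le> K" using bdd[OF Dc] by blast
  from choice[OF this] obtain K where "\<forall>j. \<forall>y\<in>cball 0 1. norm (D j y) \<le> K j" by blast
  then have K: "norm (D j y) \<le> K j" if "norm y \<le> 1" for j y using that by simp
  have M0: "0 \<le> M" using order_trans[OF norm_ge_zero M[of 0]] by simp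
  define L where "L = (\<Sum>j\<in>UNIV. K j)"
  have GL: "norm (G x - G y) \<le> L * norm (x - y)" if "norm x \<le> 1" "norm y \<le> 1" for x y
  proof (rule differentiable_bound[where S = "cball 0 1"])
    fix y :: "real ^ 'n" assume y: "y \<in> cball 0 1"
    show "(G has_derivative (\<lambda>h. \<Sum>i\<in>UNIV. complex_of_real (h $ i) * D i y)) (at y within cball 0 1)"
      by (intro has_derivative_at_withinI[OF G]) (use y R in auto)
    show "onorm (\<lambda>h. \<Sum>i\<in>UNIV. complex_of_real (h $ i) * D i y) \<le> L"
    proof (rule onorm_le)
      fix h :: "real ^ 'n"
      have "norm (\<Sum>i\<in>UNIV. complex_of_real (h $ i) * D i y) \<le> (\<Sum>i\<in>UNIV. norm h * K i)"
        by (rule sum_norm_le, unfold norm_mult norm_of_real)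
           (use y in \<open>auto intro!: mult_mono K component_le_norm_cart\<close>)
      then show "norm (\<Sum>i\<in>UNIV. complex_of_real (h $ i) * D i y) \<le> L * norm h"
        by (simp add: L_def sum_distrib_left mult.commute)
    qed
  qed (use that in auto)
  have L0: "0 \<le> L" unfolding L_def
  proof (intro sum_nonneg)
    show "0 \<le> K j" for j using order_trans[OF norm_ge_zero K[of 0 j]] by simp
  qed
  define F where "F y = indicat_real (ball 0 1) y *\<^sub>R (complex_of_real (1 - (norm y)\<^sup>2) * G y)" for y
  define C where "C = L + 2 * M"
  have C0: "0 \<le> C" using L0 M0 by (simp add: C_def)
  have in_out: "norm (F x) \<le> C * norm (x - y)" if "norm x < 1" "norm y \<ge> 1" for x y
  proof -
    have "1 - (norm x)\<^sup>2 = (1 + norm x) * (1 - norm x)" by (simp add: power2_eq_square algebra_simps)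
    also have "\<dots> \<le> 2 * (1 - norm x)" using that by (intro mult_right_mono) auto
    also have "\<dots> \<le> 2 * norm (x - y)" using that norm_triangle_ineq2[of y x] by (simp add: norm_minus_commute)
    finally have a: "1 - (norm x)\<^sup>2 \<le> 2 * norm (x - y)" .
    have b: "0 \<le> 1 - (norm x)\<^sup>2" using that by (simp add: power_le_one)
    have "norm (F x) = (1 - (norm x)\<^sup>2) * norm (G x)" using that b by (simp add: F_def norm_mult del: of_real_diff of_real_power)
    also have "\<dots> \<le> (2 * norm (x - y)) * M" using a b M[of x] that by (intro mult_mono) auto
    also have "\<dots> = 2 * M * norm (x - y)" by simp
    also have "\<dots> \<le> C * norm (x - y)" using L0 by (intro mult_right_mono) (auto simp: C_def)
    finally show ?thesis .
  qed
  have in_in: "norm (F x - F y) \<le> C * norm (x - y)" if "norm x < 1" "norm y < 1" for x y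
  proof -
    have "F x - F y = of_real (1 - (norm x)\<^sup>2) * (G x - G y) + of_real ((norm y)\<^sup>2 - (norm x)\<^sup>2) * G y"
      using that by (simp add: F_def algebra_simps)
    also have "norm \<dots> \<le> \<bar>1 - (norm x)\<^sup>2\<bar> * norm (G x - G y) + \<bar>(norm y)\<^sup>2 - (norm x)\<^sup>2\<bar> * norm (G y)"
      by (rule order_trans[OF norm_triangle_ineq]) (simp only: norm_mult norm_of_real order_refl)
    also have "\<dots> \<le> 1 * (L * norm (x - y)) + (2 * norm (x - y)) * M"
    proof (intro add_mono mult_mono)
      have "0 \<le> 1 - (norm x)\<^sup>2" using that by (simp add: power_le_one)
      then show "\<bar>1 - (norm x)\<^sup>2\<bar> \<le> 1" by simp
      have "\<bar>(norm y)\<^sup>2 - (norm x)\<^sup>2\<bar> = (norm y + norm x) * \<bar>norm y - norm x\<bar>"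
        by (simp add: power2_eq_square square_diff_square_factored abs_mult)
      also have "\<dots> \<le> 2 * norm (x - y)"
        using that norm_triangle_ineq3[of y x] by (intro mult_mono) (auto simp: norm_minus_commute)
      finally show "\<bar>(norm y)\<^sup>2 - (norm x)\<^sup>2\<bar> \<le> 2 * norm (x - y)" .
    qed (use that GL M M0 L0 in auto)
    also have "\<dots> = C * norm (x - y)" by (simp add: C_def algebra_simps)
    finally show ?thesis .
  qed
  have F_lip: "norm (F x - F y) \<le> C * norm (x - y)" for x y
  proof -
    consider "norm x < 1" "norm y < 1" | "norm x < 1" "norm y \<ge> 1" | "norm x \<ge> 1" "norm y < 1"
      | "norm x \<ge> 1" "norm y \<ge> 1" by linarith
    then show ?thesis
    proof cases
      case 2
      then have "F y = 0" by (simp add: F_def)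
      with in_out[OF 2] show ?thesis by simp
    next
      case 3
      then have "F x = 0" by (simp add: F_def)
      with in_out[OF 3(2,1)] show ?thesis by (simp add: norm_minus_commute)
    next
      case 4
      then have "F x = 0" "F y = 0" by (auto simp: F_def)
      then show ?thesis using C0 by simp
    qed (rule in_in)
  qed
  have contF: "continuous_on (cball 0 1) (\<lambda>y. complex_of_real (1 - (norm y)\<^sup>2) * G y)"
    by (intro continuous_intros Gc)
  have intF: "integrable lborel F"
    using set_integrable_ball_continuous[OF contF] by (simp add: set_integrable_def F_def[abs_def])
  define e :: "real ^ 'n" where "e = axis i 1"
  have e: "norm e = 1" by (simp add: e_def)
  have shift: "integrable lborel (\<lambda>y. F (y + s *\<^sub>R e))" "(LINT y|lborel. F (y + s *\<^sub>R e)) = (LINT y|lborel. F y)" for s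
  proof -
    have eq: "distr lborel borel ((+) (s *\<^sub>R e)) = (lborel :: (real ^ 'n) measure)" by (rule lborel_distr_plus)
    have F_meas: "F \<in> borel_measurable borel" using intF by auto
    have "integrable (distr lborel borel ((+) (s *\<^sub>R e))) F" using intF by (simp add: eq)
    then show "integrable lborel (\<lambda>y. F (y + s *\<^sub>R e))"
      by (subst (asm) integrable_distr_eq) (auto simp: F_meas add.commute)
    have "(LINT y|distr lborel borel ((+) (s *\<^sub>R e)). F y) = (LINT y|lborel. F (s *\<^sub>R e + y))"
      by (rule integral_distr) (auto simp: F_meas)
    then show "(LINT y|lborel. F (y + s *\<^sub>R e)) = (LINT y|lborel. F y)" by (simp add: eq add.commute)
  qed
  define F' where "F' y = indicat_real (ball 0 1) y *\<^sub>R
      (complex_of_real (1 - (norm y)\<^sup>2) * D i y - 2 * of_real (y $ i) * G y)" for y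
  have int1: "set_integrable lborel (ball 0 1) (\<lambda>y. complex_of_real (1 - (norm y)\<^sup>2) * D i y)"
    by (intro set_integrable_ball_continuous continuous_intros Dc)
  have int2: "set_integrable lborel (ball 0 1) (\<lambda>y. 2 * complex_of_real (y $ i) * G y)"
    by (intro set_integrable_ball_continuous continuous_intros Gc)
  have intF': "integrable lborel F'"
    using set_integral_diff(1)[OF int1 int2] by (simp add: set_integrable_def F'_def[abs_def])
  have "((\<lambda>s. LINT y|lborel. F (y + s *\<^sub>R e)) has_vector_derivative (LINT y|lborel. F' y)) (at 0)"
  proof (rule has_vector_derivative_integral[where \<delta> = 1 and B = "\<lambda>y. C * indicat_real (ball 0 2) y"])
    show "AE y in lborel. ((\<lambda>s. F (y + s *\<^sub>R e)) has_vector_derivative F' y) (at 0)"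
      using AE_not_sphere
    proof eventually_elim
      case (elim y)
      show ?case
      proof (cases "norm y < 1")
        case True
        have "((\<lambda>y. complex_of_real (1 - (norm y)\<^sup>2) * G y) has_derivative
           (\<lambda>h. complex_of_real (1 - (norm y)\<^sup>2) * (\<Sum>i\<in>UNIV. complex_of_real (h $ i) * D i y) - complex_of_real (2 * (y \<bullet> h)) * G y)) (at y)"
          unfolding power2_norm_eq_inner using True R
          by (auto intro!: derivative_eq_intros G simp: inner_commute algebra_simps)
        from has_derivative_partial(1)[OF this, of i]
        have "((\<lambda>s. complex_of_real (1 - (norm (y + s *\<^sub>R e))\<^sup>2) * G (y + s *\<^sub>R e)) has_vector_derivative F' y) (at 0)"
          using True by (simp add: F'_def sum_axis e_def inner_axis)
        moreover have "open {s. norm (y + s *\<^sub>R e) < 1}"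
          by (intro open_Collect_less continuous_intros)
        ultimately show ?thesis
          by (rule has_vector_derivative_transform_within_open) (use True in \<open>auto simp: F_def\<close>)
      next
        case False
        with elim have y: "norm y > 1" by simp
        then have F'0: "F' y = 0" by (simp add: F'_def)
        have "((\<lambda>s. 0) has_vector_derivative F' y) (at 0)" unfolding F'0 by simp
        moreover have "open {s. 1 < norm (y + s *\<^sub>R e)}"
          by (intro open_Collect_less continuous_intros)
        ultimately show ?thesis
          by (rule has_vector_derivative_transform_within_open) (use y in \<open>auto simp: F_def\<close>)
      qed
    qed
    fix s :: real and y :: "real ^ 'n" assume s: "\<bar>s\<bar> < 1"
    show "norm (F (y + (0 + s) *\<^sub>R e) - F (y + 0 *\<^sub>R e)) \<le> \<bar>s\<bar> * (C * indicat_real (ball 0 2) y)"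
    proof (cases "norm y < 2")
      case True
      then show ?thesis using F_lip[of "y + s *\<^sub>R e" y] e by (simp add: mult.commute)
    next
      case False
      then have "norm (y + s *\<^sub>R e) \<ge> 1"
        using norm_triangle_ineq2[of y "- (s *\<^sub>R e)"] e s by simp
      with False show ?thesis by (simp add: F_def)
    qed
  qed (use shift intF' in \<open>auto intro!: integrable_mult_right integrable_real_indicator emeasure_lborel_ball_finite\<close>)
  moreover have "((\<lambda>s. LINT y|lborel. F (y + s *\<^sub>R e)) has_vector_derivative 0) (at 0)"
    by (simp add: shift)
  ultimately have "(LINT y|lborel. F' y) = 0" by (rule vector_derivative_unique_at)
  then have "(LINT y:ball 0 1|lborel. complex_of_real (1 - (norm y)\<^sup>2) * D i y - 2 * of_real (y $ i) * G y) = 0"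
    by (simp add: set_lebesgue_integral_def F'_def)
  then show ?thesis unfolding set_integral_diff(2)[OF int1 int2] by (rule eq_iff_diff_eq_0[THEN iffD2])
qed

definition harmonic_poly :: "nat \<Rightarrow> (real ^ 'n \<Rightarrow> complex) \<Rightarrow> bool" where
  "harmonic_poly m f \<longleftrightarrow> homog m f \<and> (\<forall>x. laplacian f x = 0)"

text \<open>Green's formula for the weight \<open>(1 - |y|\<^sup>2)^N\<close>.  The gradient of a radial function points
  in the direction \<open>y\<close>, so only the Euler derivatives of \<open>f\<close> and \<open>Y\<close> survive, and for \<open>Y\<close> this is
  multiplication by the degree.\<close>

lemma green_ball:
  fixes f :: "real ^ 'n \<Rightarrow> complex"
  assumes R: "R > 1" and f: "real_analytic_on f (ball 0 R)" and Y: "harmonic_poly j Y"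
  shows "(LINT y:ball 0 1|lborel. of_real ((1 - (norm y)\<^sup>2) ^ Suc N) * (laplacian f y * Y y)) =
     2 * of_nat (Suc N) * (LINT y:ball 0 1|lborel. of_real ((1 - (norm y)\<^sup>2) ^ N) *
        (((\<Sum>i\<in>UNIV. of_real (y $ i) * partial_deriv i f y) - of_nat j * f y) * Y y))"
proof -
  have sub: "cball 0 1 \<subseteq> ball (0 :: real ^ 'n) R" using R by auto
  have Yh: "homog j Y" using Y by (simp add: harmonic_poly_def)
  let ?w = "\<lambda>y :: real ^ 'n. complex_of_real (1 - (norm y)\<^sup>2)"
  let ?f = "\<lambda>i. partial_deriv i f" let ?Y = "\<lambda>i. partial_deriv i Y"
  define V where "V i y = Y y * ?f i y - f y * ?Y i y" for i y
  define V' where "V' i k y = ?Y k y * ?f i y + Y y * partial_deriv k (?f i) y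
      - (?f k y * ?Y i y + f y * partial_deriv k (?Y i) y)" for i k y
  define D where "D i k y = ?w y ^ N * V' i k y - of_nat N * (2 * of_real (y $ k)) * ?w y ^ (N - 1) * V i y" for i k y
  note RA = f real_analytic_partial[OF f open_ball] real_analytic_partial[OF real_analytic_partial[OF f open_ball] open_ball]
  note cont = RA[THEN real_analytic_continuous[OF _ open_ball]]
  have hY: "homog (j - 1) (?Y i)" "homog (j - 1 - 1) (partial_deriv k (?Y i))" for i k
    using homog_partial[OF Yh] homog_partial[OF homog_partial[OF Yh]] by auto
  note contY = homog_continuous[OF Yh] homog_continuous[OF hY(1)] homog_continuous[OF hY(2)]
  have "(LINT y:ball 0 1|lborel. ?w y * D i i y) = (LINT y:ball 0 1|lborel. 2 * of_real (y $ i) * (?w y ^ N * V i y))" for i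
  proof (rule integral_ball_cutoff_partial[where D = "D i" and i = i and G = "\<lambda>y. ?w y ^ N * V i y", OF R])
    fix y :: "real ^ 'n" assume y: "norm y < R"
    then have yb: "y \<in> ball 0 R" by simp
    have dV: "(V i has_derivative (\<lambda>h. \<Sum>k\<in>UNIV. complex_of_real (h $ k) * V' i k y)) (at y)"
      unfolding V_def[abs_def]
      by (rule has_derivative_eq_rhs,
          rule has_derivative_diff[OF has_derivative_mult[OF homog_has_derivative[OF Yh] real_analytic_has_derivative[OF RA(2) open_ball yb]]
             has_derivative_mult[OF real_analytic_has_derivative[OF RA(1) open_ball yb] homog_has_derivative[OF hY(1)]]])
         (simp add: fun_eq_iff V'_def algebra_simps sum_distrib_left sum.distrib sum_subtractf)
    have dw: "((\<lambda>y. ?w y ^ N) has_derivative (\<lambda>h. - of_nat N * ?w y ^ (N - 1) * (\<Sum>k\<in>UNIV. complex_of_real (h $ k) * (2 * of_real (y $ k))))) (at y)"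
    proof -
      have "(\<Sum>k\<in>UNIV. complex_of_real (h $ k) * (2 * complex_of_real (y $ k))) = of_real (2 * (y \<bullet> h))" for h
        by (simp add: inner_vec_def sum_distrib_left mult_ac)
      then show ?thesis
        unfolding power2_norm_eq_inner
        by (auto intro!: derivative_eq_intros simp: inner_commute algebra_simps)
    qed
    show "((\<lambda>y. ?w y ^ N * V i y) has_derivative (\<lambda>h. \<Sum>k\<in>UNIV. complex_of_real (h $ k) * D i k y)) (at y)"
      by (rule has_derivative_eq_rhs, rule has_derivative_mult[OF dw dV])
         (simp add: fun_eq_iff D_def algebra_simps sum_distrib_left sum.distrib sum_subtractf sum_negf)
  next
    show "continuous_on (ball 0 R) (D i k)" for k
      unfolding D_def[abs_def] V_def V'_def by (intro continuous_intros cont contY)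
  qed
  then have eq: "(\<Sum>i\<in>UNIV. LINT y:ball 0 1|lborel. ?w y * D i i y) =
      (\<Sum>i\<in>UNIV. LINT y:ball 0 1|lborel. 2 * of_real (y $ i) * (?w y ^ N * V i y))" by simp
  note cont' = cont[THEN continuous_on_subset[OF _ sub]]
  define P where "P y = ?w y ^ Suc N * (laplacian f y * Y y)" for y
  define Q where "Q y = ?w y ^ N * (((\<Sum>i\<in>UNIV. of_real (y $ i) * partial_deriv i f y) - of_nat j * f y) * Y y)" for y
  have intP: "set_integrable lborel (ball 0 1) P"
    unfolding P_def laplacian_def by (intro set_integrable_ball_continuous continuous_intros cont' contY)
  have intQ: "set_integrable lborel (ball 0 1) Q"
    unfolding Q_def by (intro set_integrable_ball_continuous continuous_intros cont' contY)
  have euler: "(\<Sum>i\<in>UNIV. of_real (y $ i) * V i y) =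
      ((\<Sum>i\<in>UNIV. of_real (y $ i) * partial_deriv i f y) - of_nat j * f y) * Y y" for y
  proof -
    have "(\<Sum>i\<in>UNIV. of_real (y $ i) * V i y) =
      Y y * (\<Sum>i\<in>UNIV. of_real (y $ i) * ?f i y) - f y * (\<Sum>i\<in>UNIV. of_real (y $ i) * ?Y i y)"
      by (simp add: V_def algebra_simps sum_distrib_left sum_subtractf)
    then show ?thesis unfolding homog_euler[OF Yh] by (simp add: algebra_simps)
  qed
  have divV: "(\<Sum>i\<in>UNIV. V' i i y) = laplacian f y * Y y" for y
  proof -
    have "(\<Sum>i\<in>UNIV. V' i i y) = Y y * laplacian f y - f y * laplacian Y y"
      by (simp add: V'_def laplacian_def algebra_simps sum_distrib_left sum_subtractf sum.distrib)
    with Y show ?thesis by (simp add: harmonic_poly_def)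
  qed
  have wN: "of_nat N * (?w y * ?w y ^ (N - 1)) = of_nat N * ?w y ^ N" for y by (cases N) auto
  have pt: "(\<Sum>i\<in>UNIV. ?w y * D i i y) = P y - 2 * of_nat N * Q y" for y
  proof -
    have "(\<Sum>i\<in>UNIV. ?w y * D i i y) = ?w y ^ Suc N * (\<Sum>i\<in>UNIV. V' i i y)
       - 2 * (of_nat N * (?w y * ?w y ^ (N - 1))) * (\<Sum>i\<in>UNIV. of_real (y $ i) * V i y)"
      unfolding D_def right_diff_distrib sum_subtractf sum_distrib_left by (simp only: power_Suc mult_ac)
    then show ?thesis unfolding divV euler wN by (simp add: P_def Q_def mult_ac)
  qed
  have "(\<Sum>i\<in>UNIV. LINT y:ball 0 1|lborel. ?w y * D i i y) = (LINT y:ball 0 1|lborel. \<Sum>i\<in>UNIV. ?w y * D i i y)"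
    unfolding set_lebesgue_integral_def scaleR_sum_right
    by (subst Bochner_Integration.integral_sum)
       (auto simp: set_integrable_def[symmetric] D_def V_def V'_def
         intro!: set_integrable_ball_continuous continuous_intros cont' contY)
  also have "\<dots> = (LINT y:ball 0 1|lborel. P y) - 2 * of_nat N * (LINT y:ball 0 1|lborel. Q y)"
    unfolding pt using intP intQ by (subst set_integral_diff) auto
  finally have l: "(\<Sum>i\<in>UNIV. LINT y:ball 0 1|lborel. ?w y * D i i y) = (LINT y:ball 0 1|lborel. P y) - 2 * of_nat N * (LINT y:ball 0 1|lborel. Q y)" .
  have "(\<Sum>i\<in>UNIV. LINT y:ball 0 1|lborel. 2 * of_real (y $ i) * (?w y ^ N * V i y)) =
      (LINT y:ball 0 1|lborel. \<Sum>i\<in>UNIV. 2 * of_real (y $ i) * (?w y ^ N * V i y))"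
    unfolding set_lebesgue_integral_def scaleR_sum_right
    by (subst Bochner_Integration.integral_sum)
       (auto simp: set_integrable_def[symmetric] V_def
         intro!: set_integrable_ball_continuous continuous_intros cont' contY)
  also have "(\<lambda>y. \<Sum>i\<in>UNIV. 2 * of_real (y $ i) * (?w y ^ N * V i y)) = (\<lambda>y. 2 * Q y)"
    unfolding Q_def euler[symmetric] fun_eq_iff sum_distrib_left by (simp only: mult_ac) simp
  finally have r: "(\<Sum>i\<in>UNIV. LINT y:ball 0 1|lborel. 2 * of_real (y $ i) * (?w y ^ N * V i y)) = 2 * (LINT y:ball 0 1|lborel. Q y)"
    by simp
  from eq have "(LINT y:ball 0 1|lborel. P y) = 2 * of_nat (Suc N) * (LINT y:ball 0 1|lborel. Q y)"
    unfolding l r by (simp add: algebra_simps)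
  then show ?thesis by (simp add: P_def Q_def del: power_Suc)
qed

section \<open>Radial weights and orthogonality\<close>

text \<open>Integration in polar coordinates without a surface measure: the push-forward of
  \<open>q(y) dy\<close> under the norm is determined by its values on the half-lines \<open>(x, \<infinity>)\<close>, which scaling
  computes.\<close>

lemma nn_integral_radial:
  fixes q :: "real ^ 'n \<Rightarrow> real" and \<omega> :: "real \<Rightarrow> ennreal"
  assumes q [measurable]: "q \<in> borel_measurable borel" and q0: "\<And>y. 0 \<le> q y"
    and hom: "\<And>s y. 0 < s \<Longrightarrow> q (s *\<^sub>R y) = s ^ d * q y"
    and w [measurable]: "\<omega> \<in> borel_measurable borel"
    and I: "(\<integral>\<^sup>+y. ennreal (q y) * indicator (cball 0 1) y \<partial>lborel) = ennreal I" "0 \<le> I"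
  shows "(\<integral>\<^sup>+y. ennreal (q y) * indicator (cball 0 1) y * \<omega> (norm y) \<partial>lborel) =
    ennreal I * (\<integral>\<^sup>+s. ennreal (real (d + CARD('n)) * s ^ (d + CARD('n) - 1)) * indicator {0..1} s * \<omega> s \<partial>lborel)"
proof -
  have [measurable]: "cball (0 :: real ^ 'n) r \<in> sets borel" for r by simp
  define k where "k = d + CARD('n)"
  have k: "k > 0" by (simp add: k_def)
  have J: "(\<integral>\<^sup>+y. ennreal (q y) * indicator (cball 0 r) y \<partial>lborel) = ennreal (r ^ k * I)" if r: "0 \<le> r" for r
  proof (cases "r = 0")
    case True
    have "AE y in lborel. y \<noteq> (0 :: real ^ 'n)" by (rule AE_lborel_singleton)
    then have "AE y in lborel. ennreal (q y) * indicator (cball 0 r) y = 0"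
      by eventually_elim (use True in auto)
    then have "(\<integral>\<^sup>+y. ennreal (q y) * indicator (cball 0 r) y \<partial>lborel) = (\<integral>\<^sup>+y. 0 \<partial>(lborel :: (real ^ 'n) measure))"
      by (rule nn_integral_cong_AE)
    with True k show ?thesis by (simp add: zero_power)
  next
    case False
    with r have r: "r > 0" by simp
    have "(\<integral>\<^sup>+y. ennreal (q y) * indicator (cball 0 r) y \<partial>lborel) =
       (\<integral>\<^sup>+y. ennreal (q y) * indicator (cball 0 r) y \<partial>density (distr lborel borel (\<lambda>x. 0 + r *\<^sub>R x)) (\<lambda>_. \<bar>r\<bar> ^ DIM(real ^ 'n)))"
      using lborel_affine[of r "0 :: real ^ 'n"] r by simp
    also have "\<dots> = (\<integral>\<^sup>+y. ennreal (\<bar>r\<bar> ^ DIM(real ^ 'n)) * (ennreal (q (r *\<^sub>R y)) * indicator (cball 0 r) (r *\<^sub>R y)) \<partial>lborel)"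
    proof -
      have "(\<integral>\<^sup>+y. ennreal (q y) * indicator (cball 0 r) y \<partial>density (distr lborel borel (\<lambda>x. 0 + r *\<^sub>R x)) (\<lambda>_. \<bar>r\<bar> ^ DIM(real ^ 'n)))
          = (\<integral>\<^sup>+y. ennreal (\<bar>r\<bar> ^ DIM(real ^ 'n)) * (ennreal (q y) * indicator (cball 0 r) y) \<partial>distr lborel borel (\<lambda>x. 0 + r *\<^sub>R x))"
        by (rule nn_integral_density; measurable)
      also have "\<dots> = (\<integral>\<^sup>+y. ennreal (\<bar>r\<bar> ^ DIM(real ^ 'n)) * (ennreal (q (0 + r *\<^sub>R y)) * indicator (cball 0 r) (0 + r *\<^sub>R y)) \<partial>lborel)"
        by (rule nn_integral_distr; measurable)
      finally show ?thesis by simp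
    qed
    also have "\<dots> = (\<integral>\<^sup>+y. ennreal (r ^ k) * (ennreal (q y) * indicator (cball 0 1) y) \<partial>lborel)"
    proof (rule nn_integral_cong)
      fix y :: "real ^ 'n"
      have "indicator (cball 0 r) (r *\<^sub>R y) = (indicator (cball 0 1) y :: ennreal)"
        using r by (simp add: indicator_def)
      then show "ennreal (\<bar>r\<bar> ^ DIM(real ^ 'n)) * (ennreal (q (r *\<^sub>R y)) * indicator (cball 0 r) (r *\<^sub>R y)) =
          ennreal (r ^ k) * (ennreal (q y) * indicator (cball 0 1) y)"
        using r q0[of y] by (simp add: hom k_def power_add ennreal_mult mult_ac)
    qed
    also have "\<dots> = ennreal (r ^ k) * ennreal I" by (subst nn_integral_cmult) (auto simp: I)
    finally show ?thesis using r I by (simp add: ennreal_mult)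
  qed
  define M where "M = distr (density lborel (\<lambda>y. ennreal (q y) * indicator (cball 0 1) y)) borel norm"
  define N where "N = density lborel (\<lambda>s. ennreal I * (ennreal (real k * s ^ (k - 1)) * indicator {0..1} s))"
  have M_eq: "emeasure M {x<..} = (\<integral>\<^sup>+y. ennreal (q y) * indicator (cball 0 1) y * indicator {x<..} (norm y) \<partial>lborel)" for x
  proof -
    have eq: "emeasure M {x<..} = emeasure (density lborel (\<lambda>y. ennreal (q y) * indicator (cball 0 1) y)) (norm -` {x<..})"
      unfolding M_def by (subst emeasure_distr) auto
    have [measurable]: "norm -` {x<..} \<in> sets (borel :: (real ^ 'n) measure)"
      by (auto simp: vimage_def intro!: borel_open open_Collect_less continuous_intros)
    from eq have "emeasure M {x<..} = (\<integral>\<^sup>+y. ennreal (q y) * indicator (cball 0 1) y * indicator (norm -` {x<..}) y \<partial>lborel)"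
      by (simp only:) (rule emeasure_density; measurable)
    then show ?thesis by (simp add: indicator_def)
  qed
  have N_eq: "emeasure N {x<..} = ennreal I * (\<integral>\<^sup>+s. ennreal (real k * s ^ (k - 1)) * indicator {0..1} s * indicator {x<..} s \<partial>lborel)" for x
  proof -
    have "emeasure N {x<..} = (\<integral>\<^sup>+s. ennreal I * (ennreal (real k * s ^ (k - 1)) * indicator {0..1} s) * indicator {x<..} s \<partial>lborel)"
      unfolding N_def by (rule emeasure_density; measurable)
    also have "\<dots> = (\<integral>\<^sup>+s. ennreal I * (ennreal (real k * s ^ (k - 1)) * indicator {0..1} s * indicator {x<..} s) \<partial>lborel)"
      by (simp only: mult.assoc)
    also have "\<dots> = ennreal I * (\<integral>\<^sup>+s. ennreal (real k * s ^ (k - 1)) * indicator {0..1} s * indicator {x<..} s \<partial>lborel)"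
      by (rule nn_integral_cmult; measurable)
    finally show ?thesis .
  qed
  have FTC: "(\<integral>\<^sup>+s. ennreal (real k * s ^ (k - 1)) * indicator {x..1} s \<partial>lborel) = ennreal (1 - x ^ k)"
    if "0 \<le> x" "x \<le> 1" for x
    by (subst nn_integral_FTC_Icc[where F = "\<lambda>s. s ^ k"]) (use that in \<open>auto intro!: derivative_eq_intros\<close>)
  have MN: "emeasure M {x<..} = emeasure N {x<..}" for x
  proof -
    consider "x < 0" | "0 \<le> x" "x \<le> 1" | "x > 1" by linarith
    then show ?thesis
    proof cases
      case 1
      have "emeasure M {x<..} = ennreal I" unfolding M_eq I(1)[symmetric]
        using 1 by (intro nn_integral_cong) (auto simp: indicator_def intro: less_le_trans[OF _ norm_ge_zero])
      moreover have "(\<integral>\<^sup>+s. ennreal (real k * s ^ (k - 1)) * indicator {0..1} s * indicator {x<..} s \<partial>lborel) = 1"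
        using FTC[of 0] k 1 by (subst nn_integral_cong[of _ _ "\<lambda>s. ennreal (real k * s ^ (k - 1)) * indicator {0..1} s"])
           (auto simp: indicator_def power_0_left)
      ultimately show ?thesis unfolding N_eq by simp
    next
      case 2
      have "(\<integral>\<^sup>+y. ennreal (q y) * indicator (cball 0 1) y * indicator {x<..} (norm y) \<partial>lborel) +
          (\<integral>\<^sup>+y. ennreal (q y) * indicator (cball 0 x) y \<partial>lborel) =
          (\<integral>\<^sup>+y. ennreal (q y) * indicator (cball 0 1) y \<partial>lborel)"
        by (subst nn_integral_add[symmetric]) (use 2 in \<open>auto simp: indicator_def intro!: nn_integral_cong\<close>)
      then have "emeasure M {x<..} + ennreal (x ^ k * I) = ennreal I"
        unfolding M_eq using J[OF 2(1)] I by simp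
      then have "emeasure M {x<..} = ennreal I - ennreal (x ^ k * I)"
        by (metis ennreal_add_diff_cancel_right ennreal_neq_top)
      also have "\<dots> = ennreal I * ennreal (1 - x ^ k)"
        using 2 I by (simp add: ennreal_minus ennreal_mult[symmetric] power_le_one algebra_simps)
      also have "ennreal (1 - x ^ k) = (\<integral>\<^sup>+s. ennreal (real k * s ^ (k - 1)) * indicator {0..1} s * indicator {x<..} s \<partial>lborel)"
      proof -
        have "AE s in lborel. s \<noteq> x" by (rule AE_lborel_singleton)
        then have "AE s in lborel. ennreal (real k * s ^ (k - 1)) * indicator {x..1} s =
            ennreal (real k * s ^ (k - 1)) * indicator {0..1} s * indicator {x<..} s"
          by eventually_elim (use 2 in \<open>auto simp: indicator_def\<close>)
        then show ?thesis unfolding FTC[OF 2, symmetric] by (rule nn_integral_cong_AE)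
      qed
      finally show ?thesis unfolding N_eq .
    next
      case 3
      have "emeasure M {x<..} = 0" unfolding M_eq
        using 3 by (subst nn_integral_0_iff_AE) (auto simp: indicator_def)
      moreover have "emeasure N {x<..} = 0" unfolding N_eq
        using 3 by (subst nn_integral_cong[of _ _ "\<lambda>_. 0"]) (auto simp: indicator_def)
      ultimately show ?thesis by simp
    qed
  qed
  have "M = N"
  proof (rule measure_eqI_lessThan)
    fix x
    have "emeasure M {x<..} \<le> ennreal I"
      unfolding M_eq I(1)[symmetric] by (intro nn_integral_mono) (auto simp: indicator_def)
    also have "\<dots> < \<infinity>" by simp
    finally show "emeasure M {x<..} < \<infinity>" .
  qed (auto simp: M_def N_def MN[unfolded M_def N_def])
  then have "(\<integral>\<^sup>+s. \<omega> s \<partial>M) = (\<integral>\<^sup>+s. \<omega> s \<partial>N)" by simp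
  also have "(\<integral>\<^sup>+s. \<omega> s \<partial>M) = (\<integral>\<^sup>+y. ennreal (q y) * indicator (cball 0 1) y * \<omega> (norm y) \<partial>lborel)"
  proof -
    have "(\<integral>\<^sup>+s. \<omega> s \<partial>M) = (\<integral>\<^sup>+y. \<omega> (norm y) \<partial>density lborel (\<lambda>y. ennreal (q y) * indicator (cball 0 1) y))"
      unfolding M_def by (rule nn_integral_distr; measurable)
    also have "\<dots> = (\<integral>\<^sup>+y. ennreal (q y) * indicator (cball 0 1) y * \<omega> (norm y) \<partial>lborel)"
      by (rule nn_integral_density; measurable)
    finally show ?thesis .
  qed
  also have "(\<integral>\<^sup>+s. \<omega> s \<partial>N) = ennreal I * (\<integral>\<^sup>+s. ennreal (real k * s ^ (k - 1)) * indicator {0..1} s * \<omega> s \<partial>lborel)"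
  proof -
    have "(\<integral>\<^sup>+s. \<omega> s \<partial>N) = (\<integral>\<^sup>+s. ennreal I * (ennreal (real k * s ^ (k - 1)) * indicator {0..1} s) * \<omega> s \<partial>lborel)"
      unfolding N_def by (rule nn_integral_density; measurable)
    also have "\<dots> = (\<integral>\<^sup>+s. ennreal I * (ennreal (real k * s ^ (k - 1)) * indicator {0..1} s * \<omega> s) \<partial>lborel)"
      by (simp only: mult.assoc)
    also have "\<dots> = ennreal I * (\<integral>\<^sup>+s. ennreal (real k * s ^ (k - 1)) * indicator {0..1} s * \<omega> s \<partial>lborel)"
      by (rule nn_integral_cmult; measurable)
    finally show ?thesis .
  qed
  finally show ?thesis by (simp add: k_def)
qed

text \<open>Weights bounded below on shells arbitrarily close to the unit sphere: this is what makes
  the weighted norm control homogeneous polynomials of high degree.\<close>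

definition radial_weight :: "(real ^ 'n \<Rightarrow> real) \<Rightarrow> bool" where
  "radial_weight \<omega> \<longleftrightarrow> set_integrable lborel (ball 0 1) \<omega> \<and> (\<exists>w. \<omega> = (\<lambda>y. w (norm y)) \<and> w \<in> borel_measurable borel \<and>
     (\<forall>s. 0 \<le> w s) \<and> (\<forall>r<1. \<exists>a b c. r < a \<and> a < b \<and> b < 1 \<and> 0 < c \<and> (\<forall>s. a < s \<and> s < b \<longrightarrow> c \<le> w s)))"

lemma radial_weight_nonneg: "radial_weight \<omega> \<Longrightarrow> 0 \<le> \<omega> y"
  unfolding radial_weight_def by auto

lemma radial_weight_integrable: "radial_weight \<omega> \<Longrightarrow> set_integrable lborel (ball 0 1) \<omega>"
  unfolding radial_weight_def by auto

lemma radial_weight_measurable: "radial_weight \<omega> \<Longrightarrow> \<omega> \<in> borel_measurable borel"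
  unfolding radial_weight_def by auto

lemma set_integrable_bounded_mult:
  fixes g :: "real ^ 'n \<Rightarrow> complex"
  assumes \<omega>: "set_integrable lborel (ball 0 1) \<omega>" and K: "\<And>y. norm y < 1 \<Longrightarrow> norm (g y) \<le> K"
    and g: "set_borel_measurable lborel (ball 0 1) g"
  shows "set_integrable lborel (ball 0 1) (\<lambda>y. g y * complex_of_real (\<omega> y))"
  unfolding set_integrable_def
proof (rule Bochner_Integration.integrable_bound)
  show "integrable lborel (\<lambda>y. K * (indicat_real (ball 0 1) y *\<^sub>R \<omega> y))"
    using \<omega> by (intro integrable_mult_right) (simp add: set_integrable_def)
  have "(\<lambda>y. (indicat_real (ball 0 1) y *\<^sub>R g y) * complex_of_real (indicat_real (ball 0 1) y *\<^sub>R \<omega> y)) \<in> borel_measurable lborel"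
    using g \<omega> unfolding set_borel_measurable_def set_integrable_def by measurable
  also have "(\<lambda>y. (indicat_real (ball 0 1) y *\<^sub>R g y) * complex_of_real (indicat_real (ball 0 1) y *\<^sub>R \<omega> y)) =
      (\<lambda>y. indicat_real (ball 0 1) y *\<^sub>R (g y * complex_of_real (\<omega> y)))"
    by (auto simp: fun_eq_iff indicator_def)
  finally show "(\<lambda>y. indicat_real (ball 0 1) y *\<^sub>R (g y * complex_of_real (\<omega> y))) \<in> borel_measurable lborel" .
  show "AE y in lborel. norm (indicat_real (ball 0 1) y *\<^sub>R (g y * complex_of_real (\<omega> y))) \<le>
      norm (K * (indicat_real (ball 0 1) y *\<^sub>R \<omega> y))"
  proof (rule AE_I2)
    fix y :: "real ^ 'n"
    show "norm (indicat_real (ball 0 1) y *\<^sub>R (g y * complex_of_real (\<omega> y))) \<le> norm (K * (indicat_real (ball 0 1) y *\<^sub>R \<omega> y))"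
    proof (cases "norm y < 1")
      case True
      then have "norm (g y) \<le> \<bar>K\<bar>" using K[OF True] by linarith
      with True show ?thesis by (simp add: norm_mult abs_mult mult_right_mono)
    qed simp
  qed
qed

lemma set_borel_measurable_ball_continuous:
  fixes g :: "real ^ 'n \<Rightarrow> complex"
  shows "continuous_on (ball 0 1) g \<Longrightarrow> set_borel_measurable lborel (ball 0 1) g"
  unfolding set_borel_measurable_def by (simp add: borel_measurable_continuous_on_indicator)

lemma homog_bounded:
  assumes "homog m f"
  shows "\<exists>M\<ge>0. (\<forall>x :: real ^ 'n. norm (f x) \<le> M * norm x ^ m) \<and> (\<exists>u. norm u = 1 \<and> norm (f u) = M)"
proof -
  have "\<exists>u\<in>sphere (0 :: real ^ 'n) 1. \<forall>y\<in>sphere 0 1. norm (f y) \<le> norm (f u)"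
    by (intro continuous_attains_sup continuous_intros homog_continuous[OF assms]) auto
  then obtain u where u: "norm u = 1" "\<And>y. norm y = 1 \<Longrightarrow> norm (f y) \<le> norm (f u)" by auto
  have "norm (f x) \<le> norm (f u) * norm x ^ m" for x
  proof -
    obtain v where v: "norm v = 1" "x = norm x *\<^sub>R v" by (rule unit_vector_multiple)
    have "f x = of_real (norm x ^ m) * f v" by (subst v(2)) (rule homog_scaleR[OF assms])
    then have "norm (f x) = norm (f v) * norm x ^ m" by (simp add: norm_mult norm_power)
    also have "\<dots> \<le> norm (f u) * norm x ^ m" using u(2)[OF v(1)] by (intro mult_right_mono) auto
    finally show ?thesis .
  qed
  with u show ?thesis by (intro exI[of _ "norm (f u)"]) auto
qed

lemma set_integrable_homog_weight:
  fixes f :: "real ^ 'n \<Rightarrow> complex"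
  assumes \<omega>: "set_integrable lborel (ball 0 1) \<omega>" and f: "homog m f"
  shows "set_integrable lborel (ball 0 1) (\<lambda>y. f y * complex_of_real (\<omega> y))"
proof -
  obtain M where M: "M \<ge> 0" "\<And>x. norm (f x) \<le> M * norm x ^ m" using homog_bounded[OF f] by blast
  show ?thesis
  proof (rule set_integrable_bounded_mult[OF \<omega>])
    show "norm (f y) \<le> M" if "norm y < 1" for y
    proof -
      have "M * norm y ^ m \<le> M * 1" using that M(1) by (intro mult_left_mono power_le_one) auto
      with M(2)[of y] show ?thesis by simp
    qed
    show "set_borel_measurable lborel (ball 0 1) f"
      by (intro set_borel_measurable_ball_continuous homog_continuous[OF f])
  qed
qed

text \<open>In polar coordinates the positive and the negative part of \<open>p\<close> are multiplied by the same
  radial factor.\<close>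

lemma integral_radial_eq_0_real:
  fixes p :: "real ^ 'n \<Rightarrow> real"
  assumes p: "continuous_on UNIV p" and hom: "\<And>s y. 0 < s \<Longrightarrow> p (s *\<^sub>R y) = s ^ d * p y"
    and zero: "(LINT y:ball 0 1|lborel. p y) = 0"
    and w [measurable]: "w \<in> borel_measurable borel" and w0: "\<And>s. 0 \<le> w s"
    and int: "set_integrable lborel (ball 0 1) (\<lambda>y. p y * w (norm y))"
  shows "(LINT y:ball 0 1|lborel. p y * w (norm y)) = 0"
proof -
  have [measurable]: "ball (0 :: real ^ 'n) r \<in> sets borel" "cball (0 :: real ^ 'n) r \<in> sets borel" for r by simp_all
  have p_meas [measurable]: "p \<in> borel_measurable borel" by (rule borel_measurable_continuous_onI[OF p])
  have key: "set_integrable lborel (ball 0 1) (\<lambda>y. max 0 (\<sigma> * p y)) \<and>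
       set_integrable lborel (ball 0 1) (\<lambda>y. max 0 (\<sigma> * p y) * w (norm y)) \<and>
      (LINT y:ball 0 1|lborel. max 0 (\<sigma> * p y) * w (norm y)) =
       enn2real (ennreal (LINT y:ball 0 1|lborel. max 0 (\<sigma> * p y)) *
        (\<integral>\<^sup>+s. ennreal (real (d + CARD('n)) * s ^ (d + CARD('n) - 1)) * indicator {0..1} s * ennreal (w s) \<partial>lborel))"
    if \<sigma>: "\<bar>\<sigma>\<bar> = 1" for \<sigma> :: real
  proof (intro conjI)
    define q where "q y = max 0 (\<sigma> * p y)" for y
    have q [measurable]: "q \<in> borel_measurable borel" unfolding q_def by measurable
    have q0: "0 \<le> q y" for y by (simp add: q_def)
    have max_mult: "max 0 (a * b) = a * max 0 b" if "0 \<le> a" for a b :: real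
      using that by (auto simp: max_def mult_le_0_iff zero_le_mult_iff)
    have hq: "q (s *\<^sub>R y) = s ^ d * q y" if "0 < s" for s y
      using that max_mult[of "s ^ d" "\<sigma> * p y"] by (simp add: q_def hom mult.left_commute)
    have i1: "set_integrable lborel (ball 0 1) q"
      unfolding q_def by (intro set_integrable_ball_continuous continuous_intros continuous_on_subset[OF p]) auto
    have i2: "set_integrable lborel (ball 0 1) (\<lambda>y. q y * w (norm y))"
      unfolding set_integrable_def
    proof (rule Bochner_Integration.integrable_bound)
      show "integrable lborel (\<lambda>y. indicat_real (ball 0 1) y *\<^sub>R (p y * w (norm y)))"
        using int by (simp add: set_integrable_def)
      have "norm (q y * w (norm y)) \<le> norm (p y * w (norm y))" for y
      proof -
        have "\<bar>q y\<bar> \<le> \<bar>\<sigma> * p y\<bar>" by (auto simp: q_def)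
        also have "\<dots> = \<bar>p y\<bar>" using \<sigma> by (simp add: abs_mult)
        finally show ?thesis by (simp add: abs_mult mult_right_mono)
      qed
      then show "AE y in lborel. norm (indicat_real (ball 0 1) y *\<^sub>R (q y * w (norm y))) \<le> norm (indicat_real (ball 0 1) y *\<^sub>R (p y * w (norm y)))"
        by (intro AE_I2) (simp add: indicator_def)
      show "(\<lambda>y. indicat_real (ball 0 1) y *\<^sub>R (q y * w (norm y))) \<in> borel_measurable lborel"
        by measurable
    qed
    have cb: "(\<integral>\<^sup>+y. ennreal (q y) * indicator (cball 0 1) y * \<phi> y \<partial>lborel) = (\<integral>\<^sup>+y. ennreal (q y) * indicator (ball 0 1) y * \<phi> y \<partial>lborel)" for \<phi>
    proof (rule nn_integral_cong_AE)
      show "AE y in lborel. ennreal (q y) * indicator (cball 0 1) y * \<phi> y = ennreal (q y) * indicator (ball 0 1) y * \<phi> y"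
        using AE_not_sphere by eventually_elim (auto simp: indicator_def)
    qed
    define I where "I = (LINT y:ball 0 1|lborel. q y)"
    have I0: "0 \<le> I" unfolding I_def set_lebesgue_integral_def using q0 by (intro Bochner_Integration.integral_nonneg) auto
    have I: "(\<integral>\<^sup>+y. ennreal (q y) * indicator (cball 0 1) y \<partial>lborel) = ennreal I"
    proof -
      have "(\<integral>\<^sup>+y. ennreal (indicat_real (ball 0 1) y *\<^sub>R q y) \<partial>lborel) = ennreal I"
        unfolding I_def set_lebesgue_integral_def
        using i1 q0 by (intro nn_integral_eq_integral) (auto simp: set_integrable_def)
      moreover have "(\<integral>\<^sup>+y. ennreal (q y) * indicator (ball 0 1) y \<partial>lborel) = (\<integral>\<^sup>+y. ennreal (indicat_real (ball 0 1) y *\<^sub>R q y) \<partial>lborel)"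
        by (intro nn_integral_cong) (auto simp: indicator_def)
      ultimately show ?thesis using cb[of "\<lambda>_. 1"] by simp
    qed
    have "(LINT y:ball 0 1|lborel. q y * w (norm y)) = enn2real (\<integral>\<^sup>+y. ennreal (indicat_real (ball 0 1) y *\<^sub>R (q y * w (norm y))) \<partial>lborel)"
      unfolding set_lebesgue_integral_def using q0 w0
      by (intro integral_eq_nn_integral) (auto simp: indicator_def)
    also have "(\<integral>\<^sup>+y. ennreal (indicat_real (ball 0 1) y *\<^sub>R (q y * w (norm y))) \<partial>lborel) =
        (\<integral>\<^sup>+y. ennreal (q y) * indicator (cball 0 1) y * ennreal (w (norm y)) \<partial>lborel)"
      unfolding cb using q0 w0 by (intro nn_integral_cong) (auto simp: indicator_def ennreal_mult)
    also have "\<dots> = ennreal I * (\<integral>\<^sup>+s. ennreal (real (d + CARD('n)) * s ^ (d + CARD('n) - 1)) * indicator {0..1} s * ennreal (w s) \<partial>lborel)"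
      by (rule nn_integral_radial[OF q q0 hq _ I I0]) auto
    finally show "(LINT y:ball 0 1|lborel. max 0 (\<sigma> * p y) * w (norm y)) =
       enn2real (ennreal (LINT y:ball 0 1|lborel. max 0 (\<sigma> * p y)) *
        (\<integral>\<^sup>+s. ennreal (real (d + CARD('n)) * s ^ (d + CARD('n) - 1)) * indicator {0..1} s * ennreal (w s) \<partial>lborel))"
      by (simp add: q_def I_def)
    show "set_integrable lborel (ball 0 1) (\<lambda>y. max 0 (\<sigma> * p y))" using i1 by (simp add: q_def[abs_def])
    show "set_integrable lborel (ball 0 1) (\<lambda>y. max 0 (\<sigma> * p y) * w (norm y))" using i2 by (simp add: q_def)
  qed
  have split: "max 0 (1 * a) - max 0 (-1 * a) = (a :: real)" for a by (auto simp: max_def)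
  have "(LINT y:ball 0 1|lborel. max 0 (1 * p y)) - (LINT y:ball 0 1|lborel. max 0 (-1 * p y)) =
      (LINT y:ball 0 1|lborel. max 0 (1 * p y) - max 0 (-1 * p y))"
    using key[of 1] key[of "-1"] by (subst set_integral_diff) auto
  then have eq: "(LINT y:ball 0 1|lborel. max 0 (1 * p y)) = (LINT y:ball 0 1|lborel. max 0 (-1 * p y))"
    unfolding split zero by simp
  have "(LINT y:ball 0 1|lborel. p y * w (norm y)) =
     (LINT y:ball 0 1|lborel. max 0 (1 * p y) * w (norm y) - max 0 (-1 * p y) * w (norm y))"
    unfolding left_diff_distrib[symmetric] split ..
  also have "\<dots> = (LINT y:ball 0 1|lborel. max 0 (1 * p y) * w (norm y)) - (LINT y:ball 0 1|lborel. max 0 (-1 * p y) * w (norm y))"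
    using key[of 1] key[of "-1"] by (subst set_integral_diff) auto
  also have "\<dots> = 0" using key[of 1] key[of "-1"] eq by simp
  finally show ?thesis .
qed

lemma integral_homog_radial_eq_0:
  fixes f :: "real ^ 'n \<Rightarrow> complex"
  assumes f: "homog d f" and zero: "(LINT y:ball 0 1|lborel. f y) = 0"
    and w: "w \<in> borel_measurable borel" "\<And>s. 0 \<le> w s"
    and int: "set_integrable lborel (ball 0 1) (\<lambda>y :: real ^ 'n. w (norm y))"
  shows "(LINT y:ball 0 1|lborel. f y * of_real (w (norm y))) = 0"
proof -
  have i1: "set_integrable lborel (ball 0 1) f"
    by (intro set_integrable_ball_continuous homog_continuous[OF f])
  have i2: "set_integrable lborel (ball 0 1) (\<lambda>y. f y * of_real (w (norm y)))"
    by (rule set_integrable_homog_weight[OF int f])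
  have sc: "f (s *\<^sub>R y) = of_real (s ^ d) * f y" for s y by (rule homog_scaleR[OF f])
  have "(LINT y:ball 0 1|lborel. Re (f y) * w (norm y)) = 0"
  proof (rule integral_radial_eq_0_real[OF _ _ _ w])
    show "(LINT y:ball 0 1|lborel. Re (f y)) = 0"
      using i1 zero integral_Re[of lborel "\<lambda>y. indicat_real (ball 0 1) y *\<^sub>R f y"]
      by (simp add: set_lebesgue_integral_def set_integrable_def)
    show "set_integrable lborel (ball 0 1) (\<lambda>y. Re (f y) * w (norm y))"
      using i2 integrable_Re[of lborel "\<lambda>y. indicat_real (ball 0 1) y *\<^sub>R (f y * of_real (w (norm y)))"]
      by (simp add: set_integrable_def)
  qed (auto intro!: continuous_intros homog_continuous[OF f] simp: sc simp flip: of_real_power)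
  moreover have "(LINT y:ball 0 1|lborel. Im (f y) * w (norm y)) = 0"
  proof (rule integral_radial_eq_0_real[OF _ _ _ w])
    show "(LINT y:ball 0 1|lborel. Im (f y)) = 0"
      using i1 zero integral_Im[of lborel "\<lambda>y. indicat_real (ball 0 1) y *\<^sub>R f y"]
      by (simp add: set_lebesgue_integral_def set_integrable_def)
    show "set_integrable lborel (ball 0 1) (\<lambda>y. Im (f y) * w (norm y))"
      using i2 integrable_Im[of lborel "\<lambda>y. indicat_real (ball 0 1) y *\<^sub>R (f y * of_real (w (norm y)))"]
      by (simp add: set_integrable_def)
  qed (auto intro!: continuous_intros homog_continuous[OF f] simp: sc simp flip: of_real_power)
  ultimately show ?thesis
    using i2 integral_Re[of lborel "\<lambda>y. indicat_real (ball 0 1) y *\<^sub>R (f y * of_real (w (norm y)))"]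
      integral_Im[of lborel "\<lambda>y. indicat_real (ball 0 1) y *\<^sub>R (f y * of_real (w (norm y)))"]
    by (auto simp: set_lebesgue_integral_def set_integrable_def complex_eq_iff)
qed

lemma homog_growth:
  assumes "homog m f"
  shows "growth R (\<lambda>k. if k = m then f else (\<lambda>_. 0))"
proof (rule growthI)
  show "homog k (if k = m then f else (\<lambda>_. 0))" for k using assms by (auto intro: homog_zero)
  fix r :: real assume r: "0 < r"
  obtain M where M: "M \<ge> 0" "\<And>x. norm (f x) \<le> M * norm x ^ m" using homog_bounded[OF assms] by blast
  have "norm ((if k = m then f else (\<lambda>_. 0)) x) \<le> (M * r ^ m) * (norm x / r) ^ k" for k x
    using M r by (auto simp: power_divide)
  then show "\<exists>C. \<forall>k x. norm ((if k = m then f else (\<lambda>_. 0)) x) \<le> C * (norm x / r) ^ k" by blast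
qed

lemma homog_real_analytic:
  assumes "homog m f"
  shows "real_analytic_on f (ball 0 R)"
proof -
  have "hsum (\<lambda>k. if k = m then f else (\<lambda>_. 0)) x = f x" for x
  proof -
    have "(\<lambda>k. (if k = m then f else (\<lambda>_. 0)) x) sums f x"
      using sums_If_finite_set[of "{m}" "\<lambda>_. f x"] by (simp add: if_distrib[of "\<lambda>g. g x"] cong: if_cong)
    then show ?thesis by (simp add: hsum_def sums_iff)
  qed
  then have "hsum (\<lambda>k. if k = m then f else (\<lambda>_. 0)) = f" by (rule ext)
  then show ?thesis using growth_imp_real_analytic[OF homog_growth[OF assms, of R]] by simp
qed

text \<open>Without weight this is Green's formula, whose right-hand side is \<open>(j - l)\<close> times the integral;
  as the product is homogeneous, a radial weight cannot destroy the vanishing.\<close>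

theorem harmonic_poly_orthogonal:
  fixes f g :: "real ^ 'n \<Rightarrow> complex"
  assumes f: "harmonic_poly j f" and g: "harmonic_poly l g" and jl: "j \<noteq> l"
    and w: "w \<in> borel_measurable borel" "\<And>s. 0 \<le> w s"
    and int: "set_integrable lborel (ball 0 1) (\<lambda>y :: real ^ 'n. w (norm y))"
  shows "(LINT y:ball 0 1|lborel. f y * g y * of_real (w (norm y))) = 0"
proof -
  have hf: "homog j f" and hg: "homog l g" and lf: "\<And>x. laplacian f x = 0"
    using f g by (auto simp: harmonic_poly_def)
  have "0 = 2 * of_nat (Suc 0) * (LINT y:ball 0 1|lborel. of_real ((1 - (norm y)\<^sup>2) ^ 0) *
        (((\<Sum>i\<in>UNIV. of_real (y $ i) * partial_deriv i f y) - of_nat l * f y) * g y))"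
    using green_ball[OF _ homog_real_analytic[OF hf, of 2] g, of 0] by (simp add: lf)
  then have "(LINT y:ball 0 1|lborel. (of_nat j - of_nat l) * (f y * g y)) = 0"
    unfolding homog_euler[OF hf] by (simp add: left_diff_distrib mult.assoc)
  then have "(LINT y:ball 0 1|lborel. f y * g y) = 0"
    using jl by simp
  from integral_homog_radial_eq_0[OF homog_mult[OF hf hg] this w int] show ?thesis .
qed

section \<open>Fischer decomposition\<close>

lemma partial_mult:
  fixes f g :: "real ^ 'n \<Rightarrow> complex"
  assumes "(f has_derivative f') (at x)" "(g has_derivative g') (at x)"
  shows "partial_deriv i (\<lambda>x. f x * g x) x = partial_deriv i f x * g x + f x * partial_deriv i g x"
  using has_derivative_partial(2)[OF has_derivative_mult[OF assms], of i]
    has_derivative_partial(2)[OF assms(1), of i] has_derivative_partial(2)[OF assms(2), of i] by simp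

lemma partial_add:
  fixes f g :: "real ^ 'n \<Rightarrow> complex"
  assumes "(f has_derivative f') (at x)" "(g has_derivative g') (at x)"
  shows "partial_deriv i (\<lambda>x. f x + g x) x = partial_deriv i f x + partial_deriv i g x"
  using has_derivative_partial(2)[OF has_derivative_add[OF assms], of i]
    has_derivative_partial(2)[OF assms(1), of i] has_derivative_partial(2)[OF assms(2), of i] by simp

lemma partial_const_mult:
  fixes f :: "real ^ 'n \<Rightarrow> complex"
  assumes "(f has_derivative f') (at x)"
  shows "partial_deriv i (\<lambda>x. c * f x) x = c * partial_deriv i f x"
  using has_derivative_partial(2)[OF has_derivative_mult_right[OF assms], of i c]
    has_derivative_partial(2)[OF assms, of i] by simp

lemma homog_laplacian: "homog m f \<Longrightarrow> homog (m - 2) (laplacian f)"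
  unfolding laplacian_def[abs_def]
  using homog_partial[OF homog_partial] by (intro homog_sum) (simp add: numeral_2_eq_2)

lemma laplacian_add:
  assumes f: "homog m f" and g: "homog l g"
  shows "laplacian (\<lambda>x. f x + g x) x = laplacian f x + laplacian g x"
proof -
  have "partial_deriv i (\<lambda>x. f x + g x) = (\<lambda>x. partial_deriv i f x + partial_deriv i g x)" for i
    using partial_add[OF homog_has_derivative[OF f] homog_has_derivative[OF g]] by (simp add: fun_eq_iff)
  then show ?thesis unfolding laplacian_def sum.distrib[symmetric]
    using partial_add[OF homog_has_derivative[OF homog_partial[OF f]] homog_has_derivative[OF homog_partial[OF g]]]
    by simp
qed

lemma laplacian_const_mult:
  assumes f: "homog m f"
  shows "laplacian (\<lambda>x. c * f x) x = c * laplacian f x"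
proof -
  have "partial_deriv i (\<lambda>x. c * f x) = (\<lambda>x. c * partial_deriv i f x)" for i
    using partial_const_mult[OF homog_has_derivative[OF f]] by (simp add: fun_eq_iff)
  then show ?thesis unfolding laplacian_def sum_distrib_left
    using partial_const_mult[OF homog_has_derivative[OF homog_partial[OF f]]] by simp
qed

lemma laplacian_zero: "laplacian (\<lambda>_. 0) x = 0"
  using laplacian_const_mult[OF homog.const, of 0 0 x] by simp

lemma laplacian_sum:
  assumes "finite A" "\<And>a. a \<in> A \<Longrightarrow> homog m (f a)"
  shows "laplacian (\<lambda>x. \<Sum>a\<in>A. f a x) x = (\<Sum>a\<in>A. laplacian (f a) x)"
  using assms
proof (induction A rule: finite_induct)
  case empty
  then show ?case by (simp add: laplacian_zero)
next
  case (insert a A)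
  then show ?case using laplacian_add[of m "f a" m "\<lambda>x. \<Sum>a\<in>A. f a x"] by (simp add: homog_sum)
qed

lemma laplacian_cnj:
  assumes f: "homog m f"
  shows "laplacian (\<lambda>x. cnj (f x)) x = cnj (laplacian f x)"
proof -
  have *: "partial_deriv i (\<lambda>x. cnj (g x)) = (\<lambda>x. cnj (partial_deriv i g x))" if g: "homog k g" for i g k
  proof
    fix x
    have "((\<lambda>x. cnj (g x)) has_derivative (\<lambda>h. cnj (\<Sum>i\<in>UNIV. complex_of_real (h $ i) * partial_deriv i g x))) (at x)"
      using homog_has_derivative[OF g] by (rule has_derivative_cnj)
    from has_derivative_partial(2)[OF this, of i] show "partial_deriv i (\<lambda>x. cnj (g x)) x = cnj (partial_deriv i g x)"
      by (simp only: sum_axis)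
  qed
  show ?thesis unfolding laplacian_def *[OF f] *[OF homog_partial[OF f]] by simp
qed

lemma harmonic_poly_cnj: "harmonic_poly j f \<Longrightarrow> harmonic_poly j (\<lambda>x. cnj (f x))"
  using laplacian_cnj[of j f] by (auto simp: harmonic_poly_def homog_cnj)

lemma harmonic_poly_add: "harmonic_poly j f \<Longrightarrow> harmonic_poly j g \<Longrightarrow> harmonic_poly j (\<lambda>x. f x + g x)"
  using laplacian_add[of j f j g] by (auto simp: harmonic_poly_def intro: homog.add)

lemma harmonic_poly_scale: "harmonic_poly j f \<Longrightarrow> harmonic_poly j (\<lambda>x. c * f x)"
  using laplacian_const_mult[of j f c] by (auto simp: harmonic_poly_def intro: homog_scale)

lemma harmonic_poly_zero: "harmonic_poly j (\<lambda>_. 0)"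
  by (auto simp: harmonic_poly_def homog_zero laplacian_zero)

lemma laplacian_norm_sq_mult:
  assumes g: "homog m (g :: real ^ 'n \<Rightarrow> complex)"
  shows "laplacian (\<lambda>x. complex_of_real ((norm x)\<^sup>2) * g x) x =
     of_nat (2 * CARD('n) + 4 * m) * g x + complex_of_real ((norm x)\<^sup>2) * laplacian g x"
proof -
  let ?n = "\<lambda>x :: real ^ 'n. complex_of_real ((norm x)\<^sup>2)"
  have pn: "partial_deriv i ?n x = 2 * of_real (x $ i)" for i x
  proof -
    have "(?n has_derivative (\<lambda>h. complex_of_real (2 * (x \<bullet> h)))) (at x)"
      unfolding power2_norm_eq_inner by (auto intro!: derivative_eq_intros simp: inner_commute)
    from has_derivative_partial(2)[OF this, of i] show ?thesis by (simp add: inner_axis)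
  qed
  have px: "partial_deriv i (\<lambda>x :: real ^ 'n. complex_of_real (x $ i)) x = 1" for i x
  proof -
    have "((\<lambda>x :: real ^ 'n. complex_of_real (x $ i)) has_derivative (\<lambda>h. complex_of_real (h $ i))) (at x)"
      by (rule has_derivative_of_real[OF bounded_linear_imp_has_derivative[OF bounded_linear_vec_nth]])
    from has_derivative_partial(2)[OF this, of i] show ?thesis by simp
  qed
  note hn = homog_has_derivative[OF homog_norm_sq] and hg = homog_has_derivative[OF g]
    and hx = homog_has_derivative[OF homog_x] and hpg = homog_has_derivative[OF homog_partial[OF g]]
  have p1: "partial_deriv i (\<lambda>x. ?n x * g x) = (\<lambda>x. 2 * (of_real (x $ i) * g x) + ?n x * partial_deriv i g x)" for i
    using partial_mult[OF hn hg] by (simp add: fun_eq_iff pn mult.assoc del: of_real_power)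
  have p2: "partial_deriv i (\<lambda>x. 2 * (of_real (x $ i) * g x) + ?n x * partial_deriv i g x) x =
      2 * g x + 4 * (of_real (x $ i) * partial_deriv i g x) + ?n x * partial_deriv i (partial_deriv i g) x" for i
  proof -
    have "partial_deriv i (\<lambda>x. 2 * (of_real (x $ i) * g x) + ?n x * partial_deriv i g x) x =
       partial_deriv i (\<lambda>x. 2 * (of_real (x $ i) * g x)) x + partial_deriv i (\<lambda>x. ?n x * partial_deriv i g x) x"
      by (rule partial_add[OF has_derivative_mult_right[OF has_derivative_mult[OF hx hg]] has_derivative_mult[OF hn hpg]])
    also have "partial_deriv i (\<lambda>x. 2 * (of_real (x $ i) * g x)) x = 2 * (g x + of_real (x $ i) * partial_deriv i g x)"
      using partial_const_mult[OF has_derivative_mult[OF hx hg], of i 2] partial_mult[OF hx hg, of i] by (simp add: px)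
    also have "partial_deriv i (\<lambda>x. ?n x * partial_deriv i g x) x =
        2 * of_real (x $ i) * partial_deriv i g x + ?n x * partial_deriv i (partial_deriv i g) x"
      using partial_mult[OF hn hpg] by (simp add: pn del: of_real_power)
    finally show ?thesis by (simp add: algebra_simps)
  qed
  have "laplacian (\<lambda>x. ?n x * g x) x = of_nat (2 * CARD('n)) * g x
      + 4 * (\<Sum>i\<in>UNIV. of_real (x $ i) * partial_deriv i g x) + ?n x * laplacian g x"
    unfolding laplacian_def p1 p2 by (simp add: sum.distrib sum_distrib_left algebra_simps)
  then show ?thesis unfolding homog_euler[OF g] by (simp add: algebra_simps)
qed

lemma laplacian_norm_power_harmonic:
  assumes h: "harmonic_poly l (h :: real ^ 'n \<Rightarrow> complex)"
  shows "laplacian (\<lambda>x. complex_of_real (norm x ^ (2 * Suc k)) * h x) x =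
     of_nat (2 * Suc k * (CARD('n) + 2 * l + 2 * k)) * (complex_of_real (norm x ^ (2 * k)) * h x)"
proof (induction k arbitrary: x)
  case 0
  have "homog l h" using h by (simp add: harmonic_poly_def)
  moreover have "(\<lambda>x. complex_of_real (norm x ^ (2 * Suc 0)) * h x) = (\<lambda>x. complex_of_real ((norm x)\<^sup>2) * h x)"
    by (simp add: fun_eq_iff)
  ultimately show ?case using laplacian_norm_sq_mult[of l h x] h
    by (simp add: harmonic_poly_def algebra_simps del: of_real_power)
next
  case (Suc k)
  define g where "g x = complex_of_real (norm x ^ (2 * Suc k)) * h x" for x
  have g: "homog (2 * Suc k + l) g"
    unfolding g_def using h by (intro homog_mult homog_norm_power) (auto simp: harmonic_poly_def)
  have "(\<lambda>x. complex_of_real (norm x ^ (2 * Suc (Suc k))) * h x) = (\<lambda>x. complex_of_real ((norm x)\<^sup>2) * g x)"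
    by (simp add: g_def fun_eq_iff power2_eq_square algebra_simps)
  then have "laplacian (\<lambda>x. complex_of_real (norm x ^ (2 * Suc (Suc k))) * h x) x =
      of_nat (2 * CARD('n) + 4 * (2 * Suc k + l)) * g x + complex_of_real ((norm x)\<^sup>2) * laplacian g x"
    using laplacian_norm_sq_mult[OF g, of x] by simp
  also have "laplacian g x = of_nat (2 * Suc k * (CARD('n) + 2 * l + 2 * k)) * (complex_of_real (norm x ^ (2 * k)) * h x)"
    unfolding g_def[abs_def] by (rule Suc.IH)
  also have "complex_of_real ((norm x)\<^sup>2) * (of_nat (2 * Suc k * (CARD('n) + 2 * l + 2 * k)) * (complex_of_real (norm x ^ (2 * k)) * h x))
     = of_nat (2 * Suc k * (CARD('n) + 2 * l + 2 * k)) * g x"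
    by (simp add: g_def power2_eq_square algebra_simps)
  finally have "laplacian (\<lambda>x. complex_of_real (norm x ^ (2 * Suc (Suc k))) * h x) x =
      of_nat (2 * CARD('n) + 4 * (2 * Suc k + l) + 2 * Suc k * (CARD('n) + 2 * l + 2 * k)) * g x"
    by (simp only: of_nat_add distrib_right)
  also have "2 * CARD('n) + 4 * (2 * Suc k + l) + 2 * Suc k * (CARD('n) + 2 * l + 2 * k) =
      2 * Suc (Suc k) * (CARD('n) + 2 * l + 2 * Suc k)" by (simp add: algebra_simps)
  finally show ?case unfolding g_def .
qed

text \<open>Each summand of a decomposition of \<open>\<Delta> f\<close> is, up to a positive factor, the Laplacian of
  \<open>|x|\<^sup>2\<close> times itself; subtracting these multiples from \<open>f\<close> leaves a harmonic polynomial.\<close>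

lemma fischer_decomposition:
  fixes f :: "real ^ 'n \<Rightarrow> complex"
  shows "homog m f \<Longrightarrow> \<exists>h. (\<forall>k\<le>m div 2. harmonic_poly (m - 2 * k) (h k)) \<and>
     (\<forall>x. f x = (\<Sum>k\<le>m div 2. complex_of_real (norm x ^ (2 * k)) * h k x))"
proof (induction m arbitrary: f rule: less_induct)
  case (less m)
  show ?case
  proof (cases "m < 2")
    case True
    then have "m - 1 = 0" by simp
    then have "homog 0 (partial_deriv i f)" for i using homog_partial[OF less.prems, of i] by simp
    then have "partial_deriv i (partial_deriv i f) x = 0" for i x by (rule homog_0_partial) simp
    then have "harmonic_poly m f"
      using less.prems by (auto simp: harmonic_poly_def laplacian_def)
    then show ?thesis using True by (intro exI[of _ "\<lambda>_. f"]) auto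
  next
    case False
    then have lt: "m - 2 < m" and d: "m div 2 = Suc ((m - 2) div 2)" by auto
    from less.IH[OF lt homog_laplacian[OF less.prems]] obtain h where
      h: "\<forall>k\<le>(m - 2) div 2. harmonic_poly (m - 2 - 2 * k) (h k)"
         "\<forall>x. laplacian f x = (\<Sum>k\<le>(m - 2) div 2. complex_of_real (norm x ^ (2 * k)) * h k x)" by blast
    define c where "c k = complex_of_nat (2 * Suc k * (CARD('n) + 2 * (m - 2 - 2 * k) + 2 * k))" for k
    have c0: "c k \<noteq> 0" for k by (simp add: c_def del: of_nat_add of_nat_mult)
    define h' where "h' k x = (1 / c k) * h k x" for k x
    have h': "harmonic_poly (m - 2 - 2 * k) (h' k)" if "k \<le> (m - 2) div 2" for k
      unfolding h'_def using h(1) that by (intro harmonic_poly_scale) auto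
    define G where "G k x = complex_of_real (norm x ^ (2 * Suc k)) * h' k x" for k x
    have G: "homog m (G k)" if "k \<le> (m - 2) div 2" for k
    proof -
      have eq: "2 * Suc k + (m - 2 - 2 * k) = m" using that False by simp
      have "homog (2 * Suc k + (m - 2 - 2 * k)) (G k)"
        unfolding G_def using h'[OF that] by (intro homog_mult homog_norm_power) (auto simp: harmonic_poly_def)
      then show ?thesis unfolding eq .
    qed
    have LG: "laplacian (G k) x = complex_of_real (norm x ^ (2 * k)) * h k x" if "k \<le> (m - 2) div 2" for k x
    proof -
      have "laplacian (G k) x = c k * (complex_of_real (norm x ^ (2 * k)) * h' k x)"
        unfolding G_def[abs_def] c_def by (rule laplacian_norm_power_harmonic[OF h'[OF that]])
      then show ?thesis using c0[of k] by (simp add: h'_def)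
    qed
    define g where "g x = (\<Sum>k\<le>(m - 2) div 2. G k x)" for x
    have g: "homog m g" unfolding g_def using G by (intro homog_sum) auto
    have "laplacian g x = laplacian f x" for x
      unfolding g_def[abs_def] using G LG h(2) by (subst laplacian_sum[of _ m]) auto
    moreover have "laplacian (\<lambda>x. f x + (-1) * g x) x = laplacian f x + (-1) * laplacian g x" for x
      using laplacian_add[OF less.prems homog_scale[OF g, of "-1"], of x] laplacian_const_mult[OF g, of "-1" x] by simp
    ultimately have lap0: "laplacian (\<lambda>x. f x + (-1) * g x) x = 0" for x by simp
    have hd: "harmonic_poly m (\<lambda>x. f x + (-1) * g x)"
      unfolding harmonic_poly_def using homog.add[OF less.prems homog_scale[OF g, of "-1"]] lap0 by blast
    show ?thesis
    proof (intro exI[of _ "case_nat (\<lambda>x. f x + (-1) * g x) h'"] conjI allI impI)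
      fix k assume "k \<le> m div 2"
      then show "harmonic_poly (m - 2 * k) (case k of 0 \<Rightarrow> \<lambda>x. f x + (-1) * g x | Suc k \<Rightarrow> h' k)"
        using hd h' d by (cases k) (auto simp: diff_diff_left)
    next
      fix x
      show "f x = (\<Sum>k\<le>m div 2. complex_of_real (norm x ^ (2 * k)) * (case k of 0 \<Rightarrow> \<lambda>x. f x + (-1) * g x | Suc k \<Rightarrow> h' k) x)"
        unfolding d by (subst sum.atMost_Suc_shift) (simp add: g_def G_def)
    qed
  qed
qed

section \<open>From square integrability to pointwise bounds\<close>

lemma set_integrable_norm_sq_weight:
  fixes f :: "real ^ 'n \<Rightarrow> complex"
  assumes \<omega>: "set_integrable lborel (ball 0 1) \<omega>" and f: "homog m f"
  shows "set_integrable lborel (ball 0 1) (\<lambda>y. (norm (f y))\<^sup>2 * \<omega> y)"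
    and "(LINT y:ball 0 1|lborel. f y * cnj (f y) * complex_of_real (\<omega> y)) =
      of_real (LINT y:ball 0 1|lborel. (norm (f y))\<^sup>2 * \<omega> y)"
proof -
  have eq: "f y * cnj (f y) * complex_of_real (\<omega> y) = of_real ((norm (f y))\<^sup>2 * \<omega> y)" for y
    by (simp only: of_real_mult complex_norm_square)
  have "set_integrable lborel (ball 0 1) (\<lambda>y. f y * cnj (f y) * complex_of_real (\<omega> y))"
    by (rule set_integrable_homog_weight[OF \<omega> homog_mult[OF f homog_cnj[OF f]]])
  then have "set_integrable lborel (ball 0 1) (\<lambda>y. complex_of_real ((norm (f y))\<^sup>2 * \<omega> y))"
    unfolding eq .
  then show "set_integrable lborel (ball 0 1) (\<lambda>y. (norm (f y))\<^sup>2 * \<omega> y)"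
    using complex_of_real_integrable_eq[of lborel "\<lambda>y. indicat_real (ball 0 1) y *\<^sub>R ((norm (f y))\<^sup>2 * \<omega> y)"]
    by (simp add: set_integrable_def scaleR_conv_of_real)
  show "(LINT y:ball 0 1|lborel. f y * cnj (f y) * complex_of_real (\<omega> y)) =
      of_real (LINT y:ball 0 1|lborel. (norm (f y))\<^sup>2 * \<omega> y)"
    unfolding eq by (rule set_integral_complex_of_real)
qed

lemma poly_times_geometric_bounded:
  assumes t: "0 \<le> t" "t < (1 :: real)" and n: "n > 0"
  shows "\<exists>K. \<forall>m. real (Suc m) ^ n * t ^ m \<le> K"
proof -
  define s where "s = root n t"
  have s: "0 \<le> s" "s < 1" "s ^ n = t"
    using t n by (auto simp: s_def real_root_pow_pos2)
  have "real (Suc m) ^ n * t ^ m \<le> (1 / (1 - s)) ^ n" for m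
  proof -
    have "real (Suc m) ^ n * t ^ m = (real (Suc m) * s ^ m) ^ n"
      by (simp add: power_mult_distrib s(3)[symmetric] power_mult[symmetric] mult.commute)
    also have "\<dots> \<le> (1 / (1 - s)) ^ n"
      using s by (intro power_mono Suc_power_le mult_nonneg_nonneg) auto
    finally show ?thesis .
  qed
  then show ?thesis by blast
qed

text \<open>By Bernstein's inequality a polynomial of degree \<open>m\<close> stays of the order of its maximum on
  a ball of radius comparable to \<open>1/m\<close>; its square integral is therefore at least a multiple of
  \<open>m^(-n)\<close> times the squared maximum on a sphere, chosen inside a shell where the weight is bounded
  below.  The powers of \<open>m\<close> and the radius of that sphere, arbitrarily close to \<open>1\<close>, are paid for by
  \<open>r^m\<close>.\<close>

lemma sup_le_weighted_norm:
  fixes \<omega> :: "real ^ 'n \<Rightarrow> real"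
  assumes \<omega>: "radial_weight \<omega>" and r: "0 < r" "r < 1"
  shows "\<exists>C>0. \<forall>m f. homog m f \<longrightarrow> (\<forall>x. (norm (f x))\<^sup>2 * r ^ m \<le>
     C * norm x ^ (2 * m) * (LINT y:ball 0 1|lborel. (norm (f y))\<^sup>2 * \<omega> y))"
proof -
  define n where "n = CARD('n)"
  have n: "n > 0" by (simp add: n_def)
  have \<omega>0: "0 \<le> \<omega> y" for y by (rule radial_weight_nonneg[OF \<omega>])
  have sr: "sqrt r < 1" using r by simp
  from \<omega> obtain w where w: "\<omega> = (\<lambda>y. w (norm y))"
    "\<forall>r<1. \<exists>a b c. r < a \<and> a < b \<and> b < 1 \<and> 0 < c \<and> (\<forall>s. a < s \<and> s < b \<longrightarrow> c \<le> w s)"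
    unfolding radial_weight_def by blast
  from w(2) sr obtain a b c where abc: "sqrt r < a" "a < b" "b < 1" "0 < c" "\<And>s. a < s \<Longrightarrow> s < b \<Longrightarrow> c \<le> w s"
    by blast
  define \<rho> where "\<rho> = (a + b) / 2"
  have a0: "0 < a" using abc(1) real_sqrt_ge_zero[of r] r by linarith
  have \<rho>: "a < \<rho>" "\<rho> < b" "0 < \<rho>" "\<rho> < 1" using abc a0 by (auto simp: \<rho>_def)
  \<comment> \<open>on the ball of radius \<open>\<rho> \<epsilon> / (m + 1)\<close> the gradient bound \<open>33 n m M \<rho>^(m-1)\<close> lets \<open>f\<close> drop by at most a half\<close>
  define \<epsilon> where "\<epsilon> = min ((b - a) / 2) (1 / (66 * real n))"
  have \<epsilon>: "0 < \<epsilon>" "\<epsilon> \<le> (b - a) / 2" "\<epsilon> \<le> 1 / (66 * real n)" "\<epsilon> \<le> 1"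
    using abc n a0 by (auto simp: \<epsilon>_def min_def)
  define V where "V = unit_ball_vol (real n)"
  have V: "V > 0" by (simp add: V_def)
  define t where "t = r / \<rho>\<^sup>2"
  have t: "0 \<le> t" "t < 1"
  proof -
    show "0 \<le> t" using r by (simp add: t_def)
    have "sqrt r < \<rho>" using abc(1) \<rho>(1) by linarith
    then have "r < \<rho>\<^sup>2" using r \<rho>(3) by (metis less_eq_real_def real_less_rsqrt real_sqrt_less_iff real_sqrt_pow2 real_sqrt_unique)
    then show "t < 1" using \<rho>(3) by (simp add: t_def)
  qed
  obtain K where K: "\<And>m. real (Suc m) ^ n * t ^ m \<le> K" using poly_times_geometric_bounded[OF t n] by blast
  have K0: "0 < K" using K[of 0] by simp
  define C where "C = 4 / (c * V * (\<rho> * \<epsilon>) ^ n) * K"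
  have C0: "C > 0" unfolding C_def using abc V \<rho> \<epsilon> K0 by simp
  have "(norm (f x))\<^sup>2 * r ^ m \<le> C * norm x ^ (2 * m) * (LINT y:ball 0 1|lborel. (norm (f y))\<^sup>2 * \<omega> y)"
    if f: "homog m f" for m f x
  proof -
    define I where "I = (LINT y:ball 0 1|lborel. (norm (f y))\<^sup>2 * \<omega> y)"
    obtain M u where M: "M \<ge> 0" "\<And>x. norm (f x) \<le> M * norm x ^ m" and u: "norm u = 1" "norm (f u) = M"
      using homog_bounded[OF f] by blast
    define \<delta> where "\<delta> = \<rho> * \<epsilon> / real (Suc m)"
    have \<delta>: "0 < \<delta>" "\<delta> \<le> (b - a) / 2" "\<delta> \<le> \<rho> / real (Suc m)"
    proof -
      show "0 < \<delta>" using \<rho> \<epsilon> by (simp add: \<delta>_def)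
      have "\<delta> \<le> \<rho> * \<epsilon>" using \<rho> \<epsilon> mult_left_mono[of 1 "real (Suc m)" "\<rho> * \<epsilon>"] by (simp add: \<delta>_def divide_le_eq)
      also have "\<dots> \<le> 1 * \<epsilon>" using \<rho> \<epsilon> by (intro mult_right_mono) auto
      finally show "\<delta> \<le> (b - a) / 2" using \<epsilon> by simp
      show "\<delta> \<le> \<rho> / real (Suc m)" unfolding \<delta>_def using \<rho> \<epsilon> by (intro divide_right_mono) auto
    qed
    define z where "z = \<rho> *\<^sub>R u"
    have nz: "norm z = \<rho>" using u \<rho> by (simp add: z_def)
    have fz: "norm (f z) = M * \<rho> ^ m"
      unfolding z_def homog_scaleR[OF f] using u \<rho> by (simp add: norm_mult norm_power mult.commute)
    have shell: "a < norm y" "norm y < b" "norm y \<le> \<rho> * (1 + 1 / real (Suc m))" if "y \<in> ball z \<delta>" for y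
    proof -
      have d: "norm (y - z) < \<delta>" using that by (simp add: dist_norm norm_minus_commute)
      have "\<bar>norm y - norm z\<bar> \<le> norm (y - z)" by (rule norm_triangle_ineq3)
      then have 1: "\<bar>norm y - \<rho>\<bar> < \<delta>" using d nz by simp
      then show "a < norm y" "norm y < b" using \<delta>(2) by (auto simp: \<rho>_def abs_less_iff field_simps)
      show "norm y \<le> \<rho> * (1 + 1 / real (Suc m))" using 1 \<delta>(3) by (simp add: abs_less_iff algebra_simps)
    qed
    have low: "M * \<rho> ^ m / 2 \<le> norm (f y)" if y: "y \<in> ball z \<delta>" for y
    proof -
      define L where "L = 33 * real n * real m * M * \<rho> ^ (m - 1)"
      have "norm (f y - f z) \<le> L * norm (y - z)"
      proof (rule differentiable_bound[where S = "ball z \<delta>"])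
        fix v assume v: "v \<in> ball z \<delta>"
        show "(f has_derivative (\<lambda>h. \<Sum>i\<in>UNIV. complex_of_real (h $ i) * partial_deriv i f v)) (at v within ball z \<delta>)"
          by (rule has_derivative_at_withinI[OF homog_has_derivative[OF f]])
        have "norm v ^ (m - 1) \<le> (\<rho> * (1 + 1 / real (Suc m))) ^ (m - 1)"
          using shell(3)[OF v] by (intro power_mono) auto
        also have "\<dots> = \<rho> ^ (m - 1) * (1 + 1 / real (Suc m)) ^ (m - 1)" by (rule power_mult_distrib)
        also have "\<dots> \<le> \<rho> ^ (m - 1) * 3"
        proof (intro mult_left_mono)
          have "(1 + 1 / real (Suc m)) ^ (m - 1) \<le> (1 + 1 / real (Suc m)) ^ Suc m"
            by (intro power_increasing) auto
          also have "\<dots> \<le> exp (1 / real (Suc m)) ^ Suc m" by (intro power_mono exp_ge_add_one_self) auto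
          also have "\<dots> = exp 1" by (simp only: exp_of_nat_mult[symmetric]) simp
          also have "\<dots> \<le> 3" by (rule exp_le)
          finally show "(1 + 1 / real (Suc m)) ^ (m - 1) \<le> 3" .
        qed (use \<rho> in auto)
        finally have pw: "norm v ^ (m - 1) \<le> \<rho> ^ (m - 1) * 3" .
        have pd: "norm (partial_deriv i f v) \<le> 33 * real m * M * \<rho> ^ (m - 1)" for i
        proof -
          have "norm (partial_deriv i f v) \<le> 11 * real m * M * norm v ^ (m - 1)" by (rule bernstein[OF f M(2)])
          also have "\<dots> \<le> 11 * real m * M * (\<rho> ^ (m - 1) * 3)" using pw M(1) by (intro mult_left_mono) auto
          finally show ?thesis by simp
        qed
        show "onorm (\<lambda>h. \<Sum>i\<in>UNIV. complex_of_real (h $ i) * partial_deriv i f v) \<le> L"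
        proof (rule onorm_le)
          fix h :: "real ^ 'n"
          have "norm (\<Sum>i\<in>UNIV. complex_of_real (h $ i) * partial_deriv i f v) \<le>
              (\<Sum>i\<in>(UNIV :: 'n set). norm h * (33 * real m * M * \<rho> ^ (m - 1)))"
            by (rule sum_norm_le, unfold norm_mult norm_of_real)
               (intro mult_mono pd component_le_norm_cart norm_ge_zero)
          also have "\<dots> = L * norm h" by (simp add: L_def n_def)
          finally show "norm (\<Sum>i\<in>UNIV. complex_of_real (h $ i) * partial_deriv i f v) \<le> L * norm h" .
        qed
      qed (use y \<delta> in auto)
      also have "\<dots> \<le> L * \<delta>"
        using y M(1) \<rho> by (intro mult_left_mono) (auto simp: L_def dist_norm norm_minus_commute)
      also have "\<dots> \<le> M * \<rho> ^ m / 2"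
      proof (cases m)
        case 0
        then show ?thesis using M \<rho> by (simp add: L_def)
      next
        case (Suc k)
        have "33 * real n * \<epsilon> \<le> 1 / 2" using \<epsilon>(3) n by (simp add: field_simps)
        moreover have "real m / real (Suc m) \<le> 1" by simp
        ultimately have "(33 * real n * \<epsilon>) * (real m / real (Suc m)) \<le> 1 / 2 * 1"
          using \<epsilon>(1) by (intro mult_mono) auto
        then have "(33 * real n * \<epsilon>) * (real m / real (Suc m)) * (M * \<rho> ^ m) \<le> 1 / 2 * (M * \<rho> ^ m)"
          using M \<rho> by (intro mult_right_mono) auto
        moreover have "L * \<delta> = (33 * real n * \<epsilon>) * (real m / real (Suc m)) * (M * \<rho> ^ m)"
          by (simp add: L_def \<delta>_def Suc)
        ultimately show ?thesis by simp
      qed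
      finally have "norm (f y - f z) \<le> M * \<rho> ^ m / 2" .
      moreover have "norm (f z) \<le> norm (f y) + norm (f y - f z)"
        using norm_triangle_ineq4[of "f y" "f y - f z"] by simp
      ultimately show ?thesis using fz by simp
    qed
    have "c * (M * \<rho> ^ m / 2)\<^sup>2 * (V * \<delta> ^ n) = (LINT y|lborel. c * (M * \<rho> ^ m / 2)\<^sup>2 * indicat_real (ball z \<delta>) y)"
      using \<delta> content_ball[of \<delta> z] by (simp add: V_def n_def)
    also have "\<dots> \<le> (LINT y|lborel. indicat_real (ball 0 1) y *\<^sub>R ((norm (f y))\<^sup>2 * \<omega> y))"
    proof (rule integral_mono)
      show "integrable lborel (\<lambda>y. c * (M * \<rho> ^ m / 2)\<^sup>2 * indicat_real (ball z \<delta>) y)"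
        by (intro integrable_mult_right integrable_real_indicator emeasure_lborel_ball_finite) auto
      show "integrable lborel (\<lambda>y. indicat_real (ball 0 1) y *\<^sub>R ((norm (f y))\<^sup>2 * \<omega> y))"
        using set_integrable_norm_sq_weight(1)[OF radial_weight_integrable[OF \<omega>] f] by (simp add: set_integrable_def)
      show "c * (M * \<rho> ^ m / 2)\<^sup>2 * indicat_real (ball z \<delta>) y \<le> indicat_real (ball 0 1) y *\<^sub>R ((norm (f y))\<^sup>2 * \<omega> y)" for y
      proof (cases "y \<in> ball z \<delta>")
        case True
        have "(M * \<rho> ^ m / 2)\<^sup>2 * c \<le> (norm (f y))\<^sup>2 * \<omega> y"
          using low[OF True] M \<rho> abc(4) abc(5)[OF shell(1,2)[OF True]] by (intro mult_mono power_mono) (auto simp: w(1))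
        moreover have "norm y < 1" using shell(2)[OF True] abc(3) by simp
        ultimately show ?thesis using True by (simp add: mult.commute)
      qed (use \<omega>0 in \<open>simp add: indicator_def\<close>)
    qed
    also have "\<dots> = I" by (simp add: I_def set_lebesgue_integral_def)
    finally have main: "c * (M * \<rho> ^ m / 2)\<^sup>2 * (V * \<delta> ^ n) \<le> I" .
    have I0: "0 \<le> I" unfolding I_def set_lebesgue_integral_def
      using \<omega>0 by (intro Bochner_Integration.integral_nonneg) auto
    have "M\<^sup>2 * (\<rho>\<^sup>2) ^ m \<le> 4 / (c * V * (\<rho> * \<epsilon>) ^ n) * real (Suc m) ^ n * I"
    proof -
      have "c * (M * \<rho> ^ m / 2)\<^sup>2 * (V * \<delta> ^ n) = (M\<^sup>2 * (\<rho>\<^sup>2) ^ m) * (c * V * (\<rho> * \<epsilon>) ^ n / (4 * real (Suc m) ^ n))"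
        by (simp add: \<delta>_def power_divide power_mult_distrib power_mult[symmetric] mult.commute)
      moreover have "0 < c * V * (\<rho> * \<epsilon>) ^ n / (4 * real (Suc m) ^ n)"
        using abc V \<rho> \<epsilon> by simp
      ultimately have "M\<^sup>2 * (\<rho>\<^sup>2) ^ m \<le> I / (c * V * (\<rho> * \<epsilon>) ^ n / (4 * real (Suc m) ^ n))"
        using main by (simp only: pos_le_divide_eq)
      then show ?thesis by (simp add: mult_ac)
    qed
    then have "M\<^sup>2 * (\<rho>\<^sup>2) ^ m * t ^ m \<le> 4 / (c * V * (\<rho> * \<epsilon>) ^ n) * real (Suc m) ^ n * I * t ^ m"
      using t by (intro mult_right_mono) auto
    also have "\<dots> = 4 / (c * V * (\<rho> * \<epsilon>) ^ n) * (real (Suc m) ^ n * t ^ m) * I" by (simp only: mult_ac)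
    also have "\<dots> \<le> 4 / (c * V * (\<rho> * \<epsilon>) ^ n) * K * I"
      using K[of m] I0 abc V \<rho> \<epsilon> by (intro mult_right_mono mult_left_mono) auto
    finally have "M\<^sup>2 * ((\<rho>\<^sup>2) ^ m * t ^ m) \<le> C * I" by (simp add: C_def mult.assoc)
    moreover have "(\<rho>\<^sup>2) ^ m * t ^ m = r ^ m"
      using \<rho> by (simp add: t_def power_mult_distrib[symmetric])
    ultimately have MI: "M\<^sup>2 * r ^ m \<le> C * I" by simp
    have "(norm (f x))\<^sup>2 * r ^ m \<le> (M * norm x ^ m)\<^sup>2 * r ^ m"
      using M r by (intro mult_right_mono power_mono) auto
    also have "\<dots> = norm x ^ (2 * m) * (M\<^sup>2 * r ^ m)"
      by (simp add: power_mult_distrib power_mult[symmetric] mult_ac)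
    also have "\<dots> \<le> norm x ^ (2 * m) * (C * I)" using MI by (intro mult_left_mono) auto
    finally show ?thesis by (simp add: I_def mult_ac)
  qed
  with C0 show ?thesis by blast
qed

section \<open>Moments against harmonic polynomials\<close>

lemma partial_deriv_cong:
  assumes "open S" "x \<in> S" "\<And>y. y \<in> S \<Longrightarrow> f y = g y"
  shows "partial_deriv i f x = partial_deriv i g x"
proof -
  have "((\<lambda>t. f (x + t *\<^sub>R axis i 1)) has_vector_derivative d) (at 0) \<longleftrightarrow> ((\<lambda>t. g (x + t *\<^sub>R axis i 1)) has_vector_derivative d) (at 0)" for d
  proof -
    have o: "open {t. x + t *\<^sub>R axis i 1 \<in> S}"
    proof -
      have "open ((\<lambda>t. x + t *\<^sub>R axis i 1) -` S)" by (intro open_vimage assms continuous_intros)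
      then show ?thesis by (simp add: vimage_def)
    qed
    show ?thesis
      using has_vector_derivative_transform_within_open[OF _ o, of _ d 0] assms by (smt (verit) mem_Collect_eq scaleR_zero_left add_0_right)
  qed
  then show ?thesis unfolding partial_deriv_def vector_derivative_def by simp
qed

lemma laplacian_cong:
  assumes "open S" "x \<in> S" "\<And>y. y \<in> S \<Longrightarrow> f y = g y"
  shows "laplacian f x = laplacian g x"
  unfolding laplacian_def
  by (intro sum.cong refl partial_deriv_cong[OF assms(1,2)] partial_deriv_cong[OF assms(1) _ assms(3)])

lemma real_analytic_scaleR:
  fixes u :: "real ^ 'n \<Rightarrow> complex"
  assumes u: "real_analytic_on u (ball 0 1)" and t: "0 < t"
  shows "real_analytic_on (\<lambda>y. u (t *\<^sub>R y)) (ball 0 (1 / t))"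
proof (rule real_analyticI)
  fix x :: "real ^ 'n" assume "x \<in> ball 0 (1 / t)"
  then have "norm x < 1 / t" by simp
  then have "t * norm x < 1" using t by (simp add: field_simps)
  then have "t *\<^sub>R x \<in> ball 0 1" using t by simp
  then obtain \<delta> q where q: "\<delta> > 0" "growth \<delta> q" "\<And>h. norm h < \<delta> \<Longrightarrow> u (t *\<^sub>R x + h) = hsum q h"
    using real_analytic_imp_growth[OF u] by blast
  define q' where "q' m h = of_real (t ^ m) * q m h" for m h
  have q': "q' m h = q m (t *\<^sub>R h)" for m h
    unfolding q'_def using homog_scaleR[OF growth_homog[OF q(2)]] by simp
  have "growth (\<delta> / t) q'"
  proof (rule growthI)
    show "homog m (q' m)" for m unfolding q'_def by (intro homog_scale growth_homog[OF q(2)])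
    fix r :: real assume r: "0 < r" "r < \<delta> / t"
    then have "0 < t * r" "t * r < \<delta>" using t by (auto simp: field_simps)
    then obtain C where C: "\<And>m x. norm (q m x) \<le> C * (norm x / (t * r)) ^ m"
      using growthD[OF q(2)] by blast
    have "norm (q' m h) \<le> C * (norm h / r) ^ m" for m h
      using C[of m "t *\<^sub>R h"] t by (simp add: q')
    then show "\<exists>C. \<forall>m h. norm (q' m h) \<le> C * (norm h / r) ^ m" by blast
  qed
  moreover have "u (t *\<^sub>R (x + h)) = hsum q' h" if "norm h < \<delta> / t" for h
  proof -
    have "norm (t *\<^sub>R h) < \<delta>" using that t by (simp add: field_simps)
    from q(3)[OF this] show ?thesis by (simp add: scaleR_add_right hsum_def q')
  qed
  ultimately show "\<exists>\<delta>>0. \<exists>q. growth \<delta> q \<and> (\<forall>h. norm h < \<delta> \<longrightarrow> u (t *\<^sub>R (x + h)) = hsum q h)"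
    using q(1) t by (intro exI[of _ "\<delta> / t"] conjI exI[of _ q']) auto
qed

lemma real_analytic_bounded:
  fixes u :: "real ^ 'n \<Rightarrow> complex"
  assumes u: "real_analytic_on u (ball 0 1)" and s: "s < 1"
  shows "\<exists>K\<ge>0. \<forall>x. norm x \<le> s \<longrightarrow> norm (u x) \<le> K"
proof -
  have "continuous_on (cball 0 s) u"
    by (rule continuous_on_subset[OF real_analytic_continuous[OF u open_ball]]) (use s in auto)
  from compact_imp_bounded[OF compact_continuous_image[OF this compact_cball]]
  obtain K where "\<forall>x\<in>cball 0 s. norm (u x) \<le> K" by (auto simp: bounded_iff)
  then show ?thesis by (intro exI[of _ "\<bar>K\<bar>"]) (auto intro!: order_trans[OF _ abs_ge_self])
qed

lemma real_analytic_lipschitz: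
  fixes u :: "real ^ 'n \<Rightarrow> complex"
  assumes u: "real_analytic_on u (ball 0 1)" and s: "s < 1"
  shows "\<exists>L\<ge>0. \<forall>x y. norm x \<le> s \<longrightarrow> norm y \<le> s \<longrightarrow> norm (u x - u y) \<le> L * norm (x - y)"
proof -
  have "\<forall>i. \<exists>K\<ge>0. \<forall>x. norm x \<le> s \<longrightarrow> norm (partial_deriv i u x) \<le> K"
    using real_analytic_bounded[OF real_analytic_partial[OF u open_ball] s] by blast
  from choice[OF this] obtain K where "\<forall>i. K i \<ge> 0 \<and> (\<forall>x. norm x \<le> s \<longrightarrow> norm (partial_deriv i u x) \<le> K i)" by blast
  then have K: "K i \<ge> 0" "norm x \<le> s \<Longrightarrow> norm (partial_deriv i u x) \<le> K i" for i x by auto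
  have "norm (u x - u y) \<le> (\<Sum>i\<in>UNIV. K i) * norm (x - y)" if "norm x \<le> s" "norm y \<le> s" for x y
  proof (rule differentiable_bound[where S = "cball 0 s"])
    fix v :: "real ^ 'n" assume v: "v \<in> cball 0 s"
    then have "v \<in> ball 0 1" using s by simp
    from real_analytic_has_derivative[OF u open_ball this]
    show "(u has_derivative (\<lambda>h. \<Sum>i\<in>UNIV. complex_of_real (h $ i) * partial_deriv i u v)) (at v within cball 0 s)"
      by (rule has_derivative_at_withinI)
    show "onorm (\<lambda>h. \<Sum>i\<in>UNIV. complex_of_real (h $ i) * partial_deriv i u v) \<le> (\<Sum>i\<in>UNIV. K i)"
    proof (rule onorm_le)
      fix h :: "real ^ 'n"
      have "norm (\<Sum>i\<in>UNIV. complex_of_real (h $ i) * partial_deriv i u v) \<le> (\<Sum>i\<in>UNIV. norm h * K i)"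
        by (rule sum_norm_le, unfold norm_mult norm_of_real)
           (use v in \<open>auto intro!: mult_mono K component_le_norm_cart\<close>)
      then show "norm (\<Sum>i\<in>UNIV. complex_of_real (h $ i) * partial_deriv i u v) \<le> (\<Sum>i\<in>UNIV. K i) * norm h"
        by (simp add: sum_distrib_left mult.commute)
    qed
  qed (use that in auto)
  then show ?thesis using K(1) by (intro exI[of _ "\<Sum>i\<in>UNIV. K i"]) (auto intro: sum_nonneg)
qed

text \<open>Each application of Green's formula exchanges a Laplacian for a power of \<open>1 - |y|\<^sup>2\<close>; these
  powers have to be part of the definition for the recursion to close.\<close>

definition moment :: "nat \<Rightarrow> (real ^ 'n \<Rightarrow> complex) \<Rightarrow> (real ^ 'n \<Rightarrow> complex) \<Rightarrow> real \<Rightarrow> complex" where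
  "moment N u Y t = (LINT y:ball 0 1|lborel. of_real ((1 - (norm y)\<^sup>2) ^ N) * (u (t *\<^sub>R y) * Y y))"

text \<open>Differentiating in \<open>t\<close> produces the Euler derivative of \<open>u\<close>, which Green's formula for
  \<open>y \<mapsto> u(ty)\<close> expresses by \<open>u\<close> and \<open>\<Delta> u\<close>.\<close>

lemma moment_has_derivative:
  fixes u :: "real ^ 'n \<Rightarrow> complex"
  assumes u: "real_analytic_on u (ball 0 1)" and Y: "harmonic_poly j Y" and t: "0 < t" "t < 1"
  shows "(moment N u Y has_vector_derivative
     (of_nat j * moment N u Y t + of_real (t\<^sup>2 / (2 * real (Suc N))) * moment (Suc N) (laplacian u) Y t) / of_real t) (at t)"
proof -
  have Yh: "homog j Y" using Y by (simp add: harmonic_poly_def)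
  define f where "f y = u (t *\<^sub>R y)" for y
  have f: "real_analytic_on f (ball 0 (1 / t))" unfolding f_def by (rule real_analytic_scaleR[OF u t(1)])
  have R: "1 < 1 / t" using t by simp
  have inb: "t *\<^sub>R y \<in> ball 0 1" if "y \<in> ball 0 (1 / t)" for y :: "real ^ 'n"
  proof -
    have "norm y < 1 / t" using that by simp
    then have "t * norm y < 1" using t by (simp add: field_simps)
    then show ?thesis using t by simp
  qed
  have pf: "partial_deriv i (\<lambda>y. v (t *\<^sub>R y)) y = of_real t * partial_deriv i v (t *\<^sub>R y)"
    if v: "real_analytic_on v (ball 0 1)" and y: "y \<in> ball 0 (1 / t)" for v :: "real ^ 'n \<Rightarrow> complex" and i y
  proof -
    have "((\<lambda>y. v (t *\<^sub>R y)) has_derivative (\<lambda>h. \<Sum>i\<in>UNIV. complex_of_real ((t *\<^sub>R h) $ i) * partial_deriv i v (t *\<^sub>R y))) (at y)"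
      by (rule has_derivative_compose[of "\<lambda>y. t *\<^sub>R y" "\<lambda>h. t *\<^sub>R h" y UNIV v])
         (auto intro!: derivative_eq_intros real_analytic_has_derivative[OF v open_ball inb[OF y]])
    from has_derivative_partial(2)[OF this, of i]
    have "partial_deriv i (\<lambda>y. v (t *\<^sub>R y)) y = (\<Sum>k\<in>UNIV. complex_of_real (axis i 1 $ k) * (of_real t * partial_deriv k v (t *\<^sub>R y)))"
      by (simp add: mult_ac)
    then show ?thesis by (simp only: sum_axis)
  qed
  have lf: "laplacian f y = of_real (t\<^sup>2) * laplacian u (t *\<^sub>R y)" if y: "y \<in> ball 0 (1 / t)" for y
  proof -
    have "partial_deriv i (partial_deriv i f) y = of_real (t\<^sup>2) * partial_deriv i (partial_deriv i u) (t *\<^sub>R y)" for i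
    proof -
      have "partial_deriv i (partial_deriv i f) y = partial_deriv i (\<lambda>y. of_real t * partial_deriv i u (t *\<^sub>R y)) y"
        by (rule partial_deriv_cong[OF open_ball y]) (simp add: f_def[abs_def] pf[OF u])
      also have "\<dots> = of_real t * partial_deriv i (\<lambda>y. partial_deriv i u (t *\<^sub>R y)) y"
        by (rule partial_const_mult, rule real_analytic_has_derivative[OF real_analytic_scaleR[OF real_analytic_partial[OF u open_ball] t(1)] open_ball y])
      also have "\<dots> = of_real t * (of_real t * partial_deriv i (partial_deriv i u) (t *\<^sub>R y))"
        by (simp only: pf[OF real_analytic_partial[OF u open_ball] y])
      finally show ?thesis by (simp add: power2_eq_square)
    qed
    then show ?thesis unfolding laplacian_def by (simp add: sum_distrib_left)
  qed
  define E where "E y = (\<Sum>i\<in>UNIV. of_real (y $ i) * partial_deriv i u (t *\<^sub>R y))" for y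
  define D where "D y = complex_of_real ((1 - (norm y)\<^sup>2) ^ N)" for y :: "real ^ 'n"
  have sub: "cball 0 1 \<subseteq> ball (0 :: real ^ 'n) (1 / t)" using R by auto
  have cu: "continuous_on (cball 0 1) (\<lambda>y. v (t *\<^sub>R y))" if "real_analytic_on v (ball 0 1)" for v :: "real ^ 'n \<Rightarrow> complex"
    by (rule continuous_on_subset[OF real_analytic_continuous[OF real_analytic_scaleR[OF that t(1)] open_ball] sub])
  note cont = cu[OF u] cu[OF real_analytic_partial[OF u open_ball]] homog_continuous[OF Yh]
  have cE: "continuous_on (cball 0 1) E" unfolding E_def by (intro continuous_intros cont)
  have i1: "set_integrable lborel (ball 0 1) (\<lambda>y. D y * (E y * Y y))"
    unfolding D_def by (intro set_integrable_ball_continuous continuous_intros cont cE)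
  have i2: "set_integrable lborel (ball 0 1) (\<lambda>y. D y * (u (t *\<^sub>R y) * Y y))"
    unfolding D_def by (intro set_integrable_ball_continuous continuous_intros cont)
  have "(moment N u Y has_vector_derivative (LINT y:ball 0 1|lborel. D y * (E y * Y y))) (at t)"
    unfolding moment_def[abs_def] set_lebesgue_integral_def D_def[symmetric]
  proof -
    define \<delta> where "\<delta> = min t (1 - t) / 2"
    define s where "s = t + \<delta>"
    have \<delta>: "0 < \<delta>" "s < 1" using t by (auto simp: \<delta>_def s_def min_def field_simps)
    obtain L where L: "L \<ge> 0" "\<And>x y. norm x \<le> s \<Longrightarrow> norm y \<le> s \<Longrightarrow> norm (u x - u y) \<le> L * norm (x - y)"
      using real_analytic_lipschitz[OF u \<delta>(2)] by blast
    obtain M where M: "M \<ge> 0" "\<And>x. norm (Y x) \<le> M * norm x ^ j" using homog_bounded[OF Yh] by blast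
    show "((\<lambda>t. LINT y|lborel. indicat_real (ball 0 1) y *\<^sub>R (D y * (u (t *\<^sub>R y) * Y y))) has_vector_derivative
        (LINT y|lborel. indicat_real (ball 0 1) y *\<^sub>R (D y * (E y * Y y)))) (at t)"
    proof (rule has_vector_derivative_integral[where \<delta> = \<delta> and B = "\<lambda>y. (L * M) * indicat_real (ball 0 1) y"])
      fix x assume x: "\<bar>x\<bar> < \<delta>"
      then have tx: "0 < t + x" "t + x < 1" "t + x \<le> s" using t \<delta> by (auto simp: \<delta>_def s_def abs_less_iff min_def field_simps split: if_splits)
      have "1 < 1 / (t + x)" using tx by simp
      then have "continuous_on (cball 0 1) (\<lambda>y. u ((t + x) *\<^sub>R y))"
        by (intro continuous_on_subset[OF real_analytic_continuous[OF real_analytic_scaleR[OF u tx(1)] open_ball]]) auto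
      then have "set_integrable lborel (ball 0 1) (\<lambda>y. D y * (u ((t + x) *\<^sub>R y) * Y y))"
        unfolding D_def by (intro set_integrable_ball_continuous continuous_intros cont)
      then show "integrable lborel (\<lambda>y. indicat_real (ball 0 1) y *\<^sub>R (D y * (u ((t + x) *\<^sub>R y) * Y y)))"
        by (simp add: set_integrable_def)
      fix y :: "real ^ 'n"
      show "norm (indicat_real (ball 0 1) y *\<^sub>R (D y * (u ((t + x) *\<^sub>R y) * Y y)) - indicat_real (ball 0 1) y *\<^sub>R (D y * (u (t *\<^sub>R y) * Y y)))
         \<le> \<bar>x\<bar> * (L * M * indicat_real (ball 0 1) y)"
      proof (cases "norm y < 1")
        case True
        have "norm ((t + x) *\<^sub>R y) \<le> s * 1"
          unfolding norm_scaleR using tx True \<delta> by (intro mult_mono) auto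
        moreover have "norm (t *\<^sub>R y) \<le> s * 1"
          unfolding norm_scaleR using t True \<delta> by (intro mult_mono) (auto simp: s_def)
        ultimately have "norm (u ((t + x) *\<^sub>R y) - u (t *\<^sub>R y)) \<le> L * norm ((t + x) *\<^sub>R y - t *\<^sub>R y)" using L(2) by simp
        also have "(t + x) *\<^sub>R y - t *\<^sub>R y = x *\<^sub>R y" by (simp add: algebra_simps)
        also have "L * norm (x *\<^sub>R y) \<le> L * (\<bar>x\<bar> * 1)" using L True by (intro mult_left_mono) (auto simp: mult_left_le)
        finally have 1: "norm (u ((t + x) *\<^sub>R y) - u (t *\<^sub>R y)) \<le> L * \<bar>x\<bar>" by simp
        have "M * norm y ^ j \<le> M * 1" using M True by (intro mult_left_mono power_le_one) auto
        with M(2)[of y] have 2: "norm (Y y) \<le> M" by simp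
        have 3: "norm (D y) \<le> 1"
        proof -
          have "0 \<le> 1 - (norm y)\<^sup>2" using True by (simp add: power_le_one)
          then show ?thesis unfolding D_def norm_of_real power_abs by (intro power_le_one) auto
        qed
        have "norm (D y) * (norm (u ((t + x) *\<^sub>R y) - u (t *\<^sub>R y)) * norm (Y y)) \<le> 1 * ((L * \<bar>x\<bar>) * M)"
          using 1 2 3 L M by (intro mult_mono) auto
        then show ?thesis using True
          by (simp add: norm_mult[symmetric] right_diff_distrib left_diff_distrib mult_ac)
      qed simp
    next
      show "AE y in lborel. ((\<lambda>s. indicat_real (ball 0 1) y *\<^sub>R (D y * (u (s *\<^sub>R y) * Y y))) has_vector_derivative
          indicat_real (ball 0 1) y *\<^sub>R (D y * (E y * Y y))) (at t)"
      proof (rule AE_I2)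
        fix y :: "real ^ 'n"
        show "((\<lambda>s. indicat_real (ball 0 1) y *\<^sub>R (D y * (u (s *\<^sub>R y) * Y y))) has_vector_derivative
          indicat_real (ball 0 1) y *\<^sub>R (D y * (E y * Y y))) (at t)"
        proof (cases "norm y < 1")
          case True
          then have yb: "y \<in> ball 0 (1 / t)" using R unfolding mem_ball_0 by linarith
          have "((\<lambda>s. u (s *\<^sub>R y)) has_derivative (\<lambda>h. \<Sum>i\<in>UNIV. complex_of_real ((h *\<^sub>R y) $ i) * partial_deriv i u (t *\<^sub>R y))) (at t)"
            by (rule has_derivative_compose[of "\<lambda>s. s *\<^sub>R y" "\<lambda>h. h *\<^sub>R y" t UNIV u])
               (auto intro!: derivative_eq_intros real_analytic_has_derivative[OF u open_ball inb[OF yb]])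
          then have "((\<lambda>s. u (s *\<^sub>R y)) has_vector_derivative E y) (at t)"
            unfolding has_vector_derivative_def E_def
            by (simp add: scaleR_conv_of_real[where 'a = complex] sum_distrib_left mult_ac)
          from has_vector_derivative_mult_right[OF has_vector_derivative_mult_left[OF this, of "Y y"], of "D y"] True
          show ?thesis by simp
        qed simp
      qed
    qed (use \<delta> i1 in \<open>auto simp: set_integrable_def intro!: integrable_mult_right integrable_real_indicator emeasure_lborel_ball_finite\<close>)
  qed
  also have "(LINT y:ball 0 1|lborel. D y * (E y * Y y)) =
      (of_nat j * moment N u Y t + of_real (t\<^sup>2 / (2 * real (Suc N))) * moment (Suc N) (laplacian u) Y t) / of_real t"
  proof -
    have "(LINT y:ball 0 1|lborel. of_real ((1 - (norm y)\<^sup>2) ^ Suc N) * (laplacian f y * Y y)) =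
        (LINT y:ball 0 1|lborel. of_real (t\<^sup>2) * (of_real ((1 - (norm y)\<^sup>2) ^ Suc N) * (laplacian u (t *\<^sub>R y) * Y y)))"
      using lf sub by (intro set_lebesgue_integral_cong) (auto simp: subset_iff mult_ac)
    then have l: "(LINT y:ball 0 1|lborel. of_real ((1 - (norm y)\<^sup>2) ^ Suc N) * (laplacian f y * Y y)) =
        of_real (t\<^sup>2) * moment (Suc N) (laplacian u) Y t"
      by (simp only: moment_def set_integral_mult_right)
    have "(LINT y:ball 0 1|lborel. D y * (((\<Sum>i\<in>UNIV. of_real (y $ i) * partial_deriv i f y) - of_nat j * f y) * Y y)) =
        (LINT y:ball 0 1|lborel. of_real t * (D y * (E y * Y y)) - of_nat j * (D y * (u (t *\<^sub>R y) * Y y)))"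
    proof (intro set_lebesgue_integral_cong ballI allI impI)
      fix y :: "real ^ 'n" assume "y \<in> ball 0 1"
      then have yb: "y \<in> ball 0 (1 / t)" using R unfolding mem_ball_0 by linarith
      have "(\<Sum>i\<in>UNIV. of_real (y $ i) * partial_deriv i f y) = of_real t * E y"
        by (simp add: f_def[abs_def] pf[OF u yb] E_def sum_distrib_left mult_ac)
      then show "D y * (((\<Sum>i\<in>UNIV. of_real (y $ i) * partial_deriv i f y) - of_nat j * f y) * Y y) =
          of_real t * (D y * (E y * Y y)) - of_nat j * (D y * (u (t *\<^sub>R y) * Y y))"
        by (simp add: f_def algebra_simps)
    qed simp
    also have "\<dots> = of_real t * (LINT y:ball 0 1|lborel. D y * (E y * Y y)) - of_nat j * moment N u Y t"
      using i1 i2 by (subst set_integral_diff) (auto simp: moment_def D_def)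
    finally have r: "(LINT y:ball 0 1|lborel. D y * (((\<Sum>i\<in>UNIV. of_real (y $ i) * partial_deriv i f y) - of_nat j * f y) * Y y)) =
       of_real t * (LINT y:ball 0 1|lborel. D y * (E y * Y y)) - of_nat j * moment N u Y t" .
    have "of_real (t\<^sup>2) * moment (Suc N) (laplacian u) Y t = 2 * of_nat (Suc N) *
       (of_real t * (LINT y:ball 0 1|lborel. D y * (E y * Y y)) - of_nat j * moment N u Y t)"
      using green_ball[OF R f Y, of N] unfolding l D_def[symmetric] r .
    then show ?thesis using t by (simp add: field_simps del: of_nat_Suc)
  qed
  finally show ?thesis .
qed

section \<open>Moments of polyharmonic functions\<close>

lemma power_series_const_eq_0:
  fixes e :: "nat \<Rightarrow> complex"
  assumes r: "0 < r" and e: "\<And>t. 0 < t \<Longrightarrow> t < r \<Longrightarrow> (\<lambda>k. e k * of_real t ^ k) sums 0"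
  shows "e 0 = 0"
proof -
  define f where "f z = (\<Sum>k. e k * z ^ k)" for z
  have sm: "(\<lambda>k. e k * z ^ k) sums f z" if "norm z < r / 2" for z
  proof -
    have "summable (\<lambda>k. e k * (complex_of_real (r / 2)) ^ k)" using e[of "r / 2"] r by (simp add: sums_iff)
    from powser_inside[OF this, of z] that r show ?thesis unfolding f_def
      by (intro summable_sums) (simp add: norm_divide)
  qed
  have lim: "(f \<longlongrightarrow> e 0) (at 0)" by (rule powser_limit_0[where s = "r / 2", OF _ sm]) (use r in auto)
  define X where "X n = complex_of_real (r / 4 * inverse (real (Suc n)))" for n
  have X1: "0 < r / 4 * inverse (real (Suc n))" "r / 4 * inverse (real (Suc n)) < r / 2" for n
  proof -
    show "0 < r / 4 * inverse (real (Suc n))" using r by simp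
    have "r / 4 * inverse (real (Suc n)) \<le> r / 4 * 1" using r by (intro mult_left_mono) (auto simp: inverse_le_1_iff)
    then show "r / 4 * inverse (real (Suc n)) < r / 2" using r by linarith
  qed
  have "(\<lambda>n. r / 4 * inverse (real (Suc n))) \<longlonglongrightarrow> r / 4 * 0"
    by (intro tendsto_intros LIMSEQ_inverse_real_of_nat)
  then have "X \<longlonglongrightarrow> of_real 0" unfolding X_def by (intro tendsto_of_real) simp
  moreover have "\<forall>i. X i \<in> UNIV - {0}" using X1(1) by (auto simp: X_def simp del: of_real_mult)
  ultimately have "(f \<circ> X) \<longlonglongrightarrow> e 0" using lim unfolding tendsto_at_iff_sequentially by auto
  moreover have "(f \<circ> X) n = 0" for n
  proof -
    have "(\<lambda>k. e k * X n ^ k) sums 0" unfolding X_def using X1[of n] r by (intro e) auto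
    then show ?thesis by (simp add: f_def sums_iff)
  qed
  then have "(f \<circ> X) \<longlonglongrightarrow> 0" by (simp add: fun_eq_iff[symmetric] o_def)
  ultimately show ?thesis by (rule LIMSEQ_unique)
qed

lemma power_series_unique:
  fixes d e :: "nat \<Rightarrow> complex"
  assumes r: "0 < r" and d: "\<And>t. 0 < t \<Longrightarrow> t < r \<Longrightarrow> (\<lambda>k. d k * of_real t ^ k) sums f t"
    and e: "\<And>t. 0 < t \<Longrightarrow> t < r \<Longrightarrow> (\<lambda>k. e k * of_real t ^ k) sums f t"
  shows "d m = e m"
proof -
  define c where "c k = d k - e k" for k
  have c: "(\<lambda>k. c k * of_real t ^ k) sums 0" if "0 < t" "t < r" for t
    using sums_diff[OF d[OF that] e[OF that]] by (simp add: c_def left_diff_distrib)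
  have "c m = 0"
  proof (induction m rule: less_induct)
    case (less m)
    have "(\<lambda>k. c (k + m) * of_real t ^ k) sums 0" if t: "0 < t" "t < r" for t
    proof -
      have "(\<lambda>k. c (k + m) * of_real t ^ (k + m)) sums (0 - (\<Sum>i<m. c i * of_real t ^ i))"
        using c[OF t] by (rule sums_split_initial_segment)
      then have "(\<lambda>k. c (k + m) * of_real t ^ (k + m)) sums 0" using less by simp
      from sums_mult2[OF this, of "inverse (of_real t ^ m)"] t show ?thesis
        by (simp add: power_add field_simps)
    qed
    from power_series_const_eq_0[OF r this] show ?case by simp
  qed
  then show ?thesis by (simp add: c_def)
qed

lemma moment_eq_0:
  fixes u :: "real ^ 'n \<Rightarrow> complex"
  assumes "\<And>x. x \<in> ball 0 1 \<Longrightarrow> u x = 0" "0 < t" "t < 1"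
  shows "moment N u Y t = 0"
proof -
  have z: "u (t *\<^sub>R y) = 0" if "norm y < 1" for y
  proof -
    have "t * norm y \<le> 1 * norm y" using assms by (intro mult_right_mono) auto
    then have "norm (t *\<^sub>R y) < 1" using that assms by simp
    then show ?thesis using assms(1) by simp
  qed
  have "moment N u Y t = (LINT y:ball (0 :: real ^ 'n) 1|lborel. 0)"
    unfolding moment_def set_lebesgue_integral_def
    by (intro Bochner_Integration.integral_cong) (auto simp: indicator_def z)
  then show ?thesis by simp
qed

lemma moment_bound:
  fixes u :: "real ^ 'n \<Rightarrow> complex"
  assumes u: "real_analytic_on u (ball 0 1)" and Y: "harmonic_poly j Y" and t: "0 < t" "t < 1"
    and S: "0 \<le> S" "\<And>x. norm x \<le> t \<Longrightarrow> norm (u x) \<le> S"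
  shows "norm (moment N u Y t) \<le> S * (LINT y:ball 0 1|lborel. norm (Y y))"
proof -
  have Yh: "homog j Y" using Y by (simp add: harmonic_poly_def)
  have R: "1 < 1 / t" using t by simp
  have cu: "continuous_on (cball 0 1) (\<lambda>y. u (t *\<^sub>R y))"
    using R by (intro continuous_on_subset[OF real_analytic_continuous[OF real_analytic_scaleR[OF u t(1)] open_ball]]) auto
  define f where "f y = complex_of_real ((1 - (norm y)\<^sup>2) ^ N) * (u (t *\<^sub>R y) * Y y)" for y
  have i1: "set_integrable lborel (ball 0 1) f"
    unfolding f_def by (intro set_integrable_ball_continuous continuous_intros cu homog_continuous[OF Yh])
  have i2: "set_integrable lborel (ball 0 1) (\<lambda>y. S * norm (Y y))"
    by (intro set_integrable_ball_continuous continuous_intros homog_continuous[OF Yh])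
  have "norm (moment N u Y t) \<le> (LINT y|lborel. norm (indicat_real (ball 0 1) y *\<^sub>R f y))"
    unfolding moment_def f_def[symmetric] set_lebesgue_integral_def by (rule integral_norm_bound)
  also have "\<dots> \<le> (LINT y|lborel. indicat_real (ball 0 1) y *\<^sub>R (S * norm (Y y)))"
  proof (rule integral_mono)
    show "integrable lborel (\<lambda>y. norm (indicat_real (ball 0 1) y *\<^sub>R f y))"
      using i1 unfolding set_integrable_def by (rule integrable_norm)
    show "integrable lborel (\<lambda>y. indicat_real (ball 0 1) y *\<^sub>R (S * norm (Y y)))"
      using i2 unfolding set_integrable_def .
    fix y :: "real ^ 'n"
    show "norm (indicat_real (ball 0 1) y *\<^sub>R f y) \<le> indicat_real (ball 0 1) y *\<^sub>R (S * norm (Y y))"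
    proof (cases "norm y < 1")
      case True
      then have "0 \<le> 1 - (norm y)\<^sup>2" by (simp add: power_le_one)
      then have 1: "\<bar>(1 - (norm y)\<^sup>2) ^ N\<bar> \<le> 1" unfolding power_abs by (intro power_le_one) auto
      have "t * norm y \<le> t * 1" using t True by (intro mult_left_mono) auto
      then have 2: "norm (u (t *\<^sub>R y)) \<le> S" using S(2)[of "t *\<^sub>R y"] t by simp
      have "norm (f y) = \<bar>(1 - (norm y)\<^sup>2) ^ N\<bar> * (norm (u (t *\<^sub>R y)) * norm (Y y))"
        unfolding f_def norm_mult norm_of_real ..
      also have "\<dots> \<le> 1 * (S * norm (Y y))"
        using 1 2 S(1) by (intro mult_mono mult_right_mono) auto
      finally show ?thesis using True by simp
    qed simp
  qed
  also have "\<dots> = S * (LINT y:ball 0 1|lborel. norm (Y y))"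
    by (simp add: set_lebesgue_integral_def mult.left_commute)
  finally show ?thesis .
qed

lemma euler_ode_solution:
  fixes g :: "real \<Rightarrow> complex"
  assumes g: "\<And>t. 0 < t \<Longrightarrow> t < 1 \<Longrightarrow> (g has_vector_derivative (of_nat j * g t / of_real t)) (at t)"
  shows "\<exists>c. \<forall>t. 0 < t \<and> t < 1 \<longrightarrow> g t = c * of_real (t ^ j)"
proof -
  define k where "k t = g t * complex_of_real (inverse (t ^ j))" for t
  have "(k has_derivative (\<lambda>h. 0)) (at t within {0<..<1})" if t: "t \<in> {0<..<1}" for t
  proof -
    have t0: "0 < t" "t < 1" using t by auto
    have "((\<lambda>t. inverse (t ^ j)) has_real_derivative (- (real j * t ^ (j - 1)) * inverse ((t ^ j)\<^sup>2))) (at t)"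
      using t0 by (auto intro!: derivative_eq_intros simp: power2_eq_square)
    from has_vector_derivative_of_real[OF this]
    have d: "((\<lambda>t. complex_of_real (inverse (t ^ j))) has_vector_derivative
        of_real (- (real j * t ^ (j - 1)) * inverse ((t ^ j)\<^sup>2))) (at t)" .
    have "(k has_vector_derivative (g t * of_real (- (real j * t ^ (j - 1)) * inverse ((t ^ j)\<^sup>2)) +
        of_nat j * g t / of_real t * of_real (inverse (t ^ j)))) (at t)"
      unfolding k_def by (rule has_vector_derivative_mult[OF g[OF t0] d])
    also have "g t * of_real (- (real j * t ^ (j - 1)) * inverse ((t ^ j)\<^sup>2)) +
        of_nat j * g t / of_real t * of_real (inverse (t ^ j)) = 0"
      using t0 by (cases j) (auto simp: field_simps power2_eq_square)
    finally show ?thesis by (auto simp: has_vector_derivative_def intro: has_derivative_at_withinI)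
  qed
  then obtain c where c: "\<And>t. t \<in> {0<..<1} \<Longrightarrow> k t = c"
    using has_derivative_zero_constant[of "{0<..<1 :: real}" k] by auto
  have "g t = c * of_real (t ^ j)" if "0 < t" "t < 1" for t
    using c[of t] that by (simp add: k_def field_simps)
  then show ?thesis by blast
qed

text \<open>Green's formula turns \<open>\<Delta>\<close> into the first-order operator \<open>t d/dt - j\<close> on moments, whose
  kernel on \<open>(0, 1)\<close> is spanned by \<open>t^j\<close>; iterating, the moments of a function with \<open>\<Delta>^p u = 0\<close>
  are combinations of \<open>t^(j + 2k)\<close>, \<open>k < p\<close>, on the whole interval.  The coefficients with \<open>k > 0\<close>
  are, up to factors of modulus at most \<open>1\<close>, those of \<open>\<Delta> u\<close>, and the remaining one is estimated by
  the value at \<open>t\<^sub>0\<close>.  The constant \<open>C\<close> depends neither on \<open>j\<close> nor on \<open>Y\<close>.\<close>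

lemma moment_expansion:
  fixes u :: "real ^ 'n \<Rightarrow> complex"
  assumes "real_analytic_on u (ball 0 1)" "\<And>x. x \<in> ball 0 1 \<Longrightarrow> (laplacian ^^ p) u x = 0"
    and t0: "0 < t0" "t0 < 1"
  shows "\<exists>C\<ge>0. \<forall>j Y. harmonic_poly j Y \<longrightarrow> (\<exists>c.
     (\<forall>t. 0 < t \<and> t < 1 \<longrightarrow> moment N u Y t = (\<Sum>k<p. c k * of_real (t ^ (j + 2 * k)))) \<and>
     (\<forall>k<p. norm (c k) * t0 ^ j \<le> C * (LINT y:ball 0 1|lborel. norm (Y y))))"
  using assms(1,2)
proof (induction p arbitrary: u N)
  case 0
  then have "moment N u Y t = 0" if "0 < t" "t < 1" for Y t
    using that by (intro moment_eq_0) auto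
  then show ?case by (intro exI[of _ 0]) auto
next
  case (Suc p)
  have ra: "real_analytic_on (laplacian u) (ball 0 1)"
    by (rule real_analytic_laplacian[OF Suc.prems(1) open_ball])
  have "(laplacian ^^ p) (laplacian u) x = 0" if "x \<in> ball 0 1" for x
    using Suc.prems(2)[OF that] by (simp add: funpow_swap1)
  from Suc.IH[OF ra this, of "Suc N"] obtain C where C: "C \<ge> 0"
    "\<And>j Y. harmonic_poly j Y \<Longrightarrow> \<exists>c.
     (\<forall>t. 0 < t \<and> t < 1 \<longrightarrow> moment (Suc N) (laplacian u) Y t = (\<Sum>k<p. c k * of_real (t ^ (j + 2 * k)))) \<and>
     (\<forall>k<p. norm (c k) * t0 ^ j \<le> C * (LINT y:ball 0 1|lborel. norm (Y y)))" by blast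
  obtain S where S: "S \<ge> 0" "\<And>x. norm x \<le> t0 \<Longrightarrow> norm (u x) \<le> S"
    using real_analytic_bounded[OF Suc.prems(1) t0(2)] by blast
  define C' where "C' = S + real (Suc p) * C"
  have C': "C' \<ge> 0" "C \<le> C'" "S + real p * C \<le> C'" using S C by (auto simp: C'_def algebra_simps)
  show ?case
  proof (intro exI[of _ C'] conjI C'(1) allI impI)
    fix j :: nat and Y :: "real ^ 'n \<Rightarrow> complex" assume Y: "harmonic_poly j Y"
    define I where "I = (LINT y:ball 0 1|lborel. norm (Y y))"
    have I: "I \<ge> 0" unfolding I_def set_lebesgue_integral_def by (intro Bochner_Integration.integral_nonneg) auto
    from C(2)[OF Y] obtain c where
      c: "\<And>t. 0 < t \<Longrightarrow> t < 1 \<Longrightarrow> moment (Suc N) (laplacian u) Y t = (\<Sum>k<p. c k * of_real (t ^ (j + 2 * k)))"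
      "\<And>k. k < p \<Longrightarrow> norm (c k) * t0 ^ j \<le> C * I" unfolding I_def by blast
    define a where "a k = c k / of_real (2 * real (Suc N) * (2 * real k + 2))" for k
    define P where "P t = (\<Sum>k<p. a k * complex_of_real (t ^ (j + 2 * Suc k)))" for t
    define g where "g t = moment N u Y t - P t" for t
    have "(g has_vector_derivative (of_nat j * g t / of_real t)) (at t)" if t: "0 < t" "t < 1" for t
    proof -
      have mono: "((\<lambda>t. complex_of_real (t ^ (j + 2 * Suc k))) has_vector_derivative
          of_real (real (j + 2 * Suc k) * t ^ (j + 2 * Suc k - 1))) (at t)" for k
        by (rule has_vector_derivative_of_real) (use DERIV_pow[of "j + 2 * Suc k" t] in \<open>simp only: One_nat_def\<close>)
      have dP: "(P has_vector_derivative (\<Sum>k<p. a k * of_real (real (j + 2 * Suc k) * t ^ (j + 2 * Suc k - 1)))) (at t)"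
        unfolding P_def by (intro has_vector_derivative_sum has_vector_derivative_mult_right mono)
      have "of_real (t\<^sup>2 / (2 * real (Suc N))) * moment (Suc N) (laplacian u) Y t =
          (\<Sum>k<p. a k * of_real ((2 * real k + 2) * t ^ (j + 2 * Suc k)))"
        unfolding c(1)[OF t] sum_distrib_left
      proof (rule sum.cong[OF refl])
        fix k
        have "2 * real k + 2 \<noteq> (0 :: real)" by linarith
        then have "complex_of_real (2 * real k + 2) \<noteq> 0" by (simp only: of_real_eq_0_iff not_False_eq_True)
        then show "complex_of_real (t\<^sup>2 / (2 * real (Suc N))) * (c k * of_real (t ^ (j + 2 * k))) =
            a k * of_real ((2 * real k + 2) * t ^ (j + 2 * Suc k))"
          unfolding a_def of_real_mult by (simp add: power_add power2_eq_square del: of_real_add of_nat_Suc)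
      qed
      moreover have "(\<Sum>k<p. a k * of_real (real (j + 2 * Suc k) * t ^ (j + 2 * Suc k - 1))) =
          (of_nat j * P t + (\<Sum>k<p. a k * of_real ((2 * real k + 2) * t ^ (j + 2 * Suc k)))) / of_real t"
      proof -
        have "(\<Sum>k<p. a k * of_real (real (j + 2 * Suc k) * t ^ (j + 2 * Suc k - 1))) * of_real t =
            (\<Sum>k<p. a k * of_real (real (j + 2 * Suc k) * t ^ (j + 2 * Suc k)))"
          unfolding sum_distrib_right by (intro sum.cong) (auto simp: mult_ac)
        also have "\<dots> = of_nat j * P t + (\<Sum>k<p. a k * of_real ((2 * real k + 2) * t ^ (j + 2 * Suc k)))"
          unfolding P_def sum_distrib_left sum.distrib[symmetric] by (intro sum.cong) (auto simp: algebra_simps)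
        finally show ?thesis using t by (simp add: field_simps)
      qed
      ultimately show ?thesis
        unfolding g_def
        using has_vector_derivative_diff[OF moment_has_derivative[OF Suc.prems(1) Y t, of N] dP]
        by (simp add: diff_divide_distrib add_divide_distrib right_diff_distrib)
    qed
    from euler_ode_solution[OF this] obtain b where b: "\<And>t. 0 < t \<Longrightarrow> t < 1 \<Longrightarrow> g t = b * of_real (t ^ j)" by blast
    define c' where "c' = case_nat b a"
    show "\<exists>c. (\<forall>t. 0 < t \<and> t < 1 \<longrightarrow> moment N u Y t = (\<Sum>k<Suc p. c k * of_real (t ^ (j + 2 * k)))) \<and>
        (\<forall>k<Suc p. norm (c k) * t0 ^ j \<le> C' * (LINT y:ball 0 1|lborel. norm (Y y)))"
    proof (intro exI[of _ c'] conjI allI impI)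
      fix t :: real assume t: "0 < t \<and> t < 1"
      then have "moment N u Y t = b * of_real (t ^ j) + P t" using b[of t] by (simp add: g_def diff_eq_eq)
      then show "moment N u Y t = (\<Sum>k<Suc p. c' k * of_real (t ^ (j + 2 * k)))"
        by (subst sum.lessThan_Suc_shift) (simp add: c'_def P_def)
    next
      have ab: "norm (a k) * t0 ^ j \<le> C * I" if "k < p" for k
      proof -
        have "1 * 1 \<le> 2 * real (Suc N) * (2 * real k + 2)" by (intro mult_mono) auto
        then have "norm (a k) \<le> norm (c k)"
          unfolding a_def norm_divide norm_of_real by (simp add: divide_le_eq mult_le_cancel_left1)
        then have "norm (a k) * t0 ^ j \<le> norm (c k) * t0 ^ j" using t0 by (intro mult_right_mono) auto
        with c(2)[OF that] show ?thesis by linarith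
      qed
      have b_bd: "norm b * t0 ^ j \<le> (S + real p * C) * I"
      proof -
        have "norm b * t0 ^ j = norm (g t0)" using b[OF t0] t0 by (simp add: norm_mult norm_power)
        also have "\<dots> \<le> norm (moment N u Y t0) + norm (P t0)" unfolding g_def by (rule norm_triangle_ineq4)
        also have "norm (moment N u Y t0) \<le> S * I"
          unfolding I_def by (rule moment_bound[OF Suc.prems(1) Y t0 S])
        also have "norm (P t0) \<le> (\<Sum>k<p. C * I)"
          unfolding P_def
        proof (rule sum_norm_le)
          fix k assume "k \<in> {..<p}"
          then have k: "k < p" by simp
          have "norm (a k * complex_of_real (t0 ^ (j + 2 * Suc k))) = (norm (a k) * t0 ^ j) * t0 ^ (2 * Suc k)"
            using t0 by (simp add: norm_mult norm_power power_add)
          also have "\<dots> \<le> (C * I) * 1"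
            by (rule mult_mono[OF ab[OF k] power_le_one]) (use t0 C(1) I in auto)
          finally show "norm (a k * complex_of_real (t0 ^ (j + 2 * Suc k))) \<le> C * I" by simp
        qed
        finally show ?thesis by (simp add: algebra_simps)
      qed
      fix k assume "k < Suc p"
      then show "norm (c' k) * t0 ^ j \<le> C' * (LINT y:ball 0 1|lborel. norm (Y y))"
        unfolding I_def[symmetric]
      proof (cases k)
        case 0
        have "(S + real p * C) * I \<le> C' * I" using C' I by (intro mult_right_mono) auto
        with b_bd 0 show "norm (c' k) * t0 ^ j \<le> C' * I" by (simp add: c'_def)
      next
        case (Suc i)
        with \<open>k < Suc p\<close> have "i < p" by simp
        have "C * I \<le> C' * I" using C' I by (intro mult_right_mono) auto
        with ab[OF \<open>i < p\<close>] Suc show "norm (c' k) * t0 ^ j \<le> C' * I" by (simp add: c'_def)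
      qed
    qed
  qed
qed

text \<open>On the ray through \<open>x\<close>, the two functions agree up to some \<open>T\<close>; if \<open>T < 1\<close>, the series at
  \<open>T x\<close> agree to the left of \<open>T\<close>, hence also to the right.\<close>

lemma real_analytic_identity:
  fixes u v :: "real ^ 'n \<Rightarrow> complex"
  assumes u: "real_analytic_on u (ball 0 1)" and v: "real_analytic_on v (ball 0 1)"
    and \<delta>: "\<delta> > 0" and eq: "\<And>x. norm x < \<delta> \<Longrightarrow> u x = v x" and x: "norm x < 1"
  shows "u x = v x"
proof (rule ccontr)
  assume ne: "u x \<noteq> v x"
  then have x0: "norm x > 0" using eq[of 0] \<delta> by (cases "x = 0") auto
  define S where "S = {t. 0 \<le> t \<and> t \<le> 1 \<and> (\<forall>s. 0 \<le> s \<and> s \<le> t \<longrightarrow> u (s *\<^sub>R x) = v (s *\<^sub>R x))}"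
  define T where "T = Sup S"
  have S0: "0 \<in> S" using eq[of 0] \<delta> by (auto simp: S_def)
  have bdd: "bdd_above S" by (rule bdd_aboveI[of _ 1]) (simp add: S_def)
  have T1: "0 \<le> T" "T \<le> 1"
  proof -
    show "0 \<le> T" unfolding T_def by (rule cSup_upper[OF S0 bdd])
    have "S \<noteq> {}" using S0 by blast
    then show "T \<le> 1" unfolding T_def by (rule cSup_least) (simp add: S_def)
  qed
  have below: "u (s *\<^sub>R x) = v (s *\<^sub>R x)" if s: "0 \<le> s" "s < T" for s
  proof -
    obtain t where "t \<in> S" "s < t" using less_cSup_iff[OF _ bdd] S0 s(2) unfolding T_def by blast
    then show ?thesis using s(1) by (auto simp: S_def)
  qed
  have extend: "\<exists>t\<in>S. T < t" if lt: "0 < \<epsilon>" "\<And>s. T \<le> s \<Longrightarrow> s < T + \<epsilon> \<Longrightarrow> u (s *\<^sub>R x) = v (s *\<^sub>R x)" "T < 1" for \<epsilon>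
  proof (rule bexI)
    show "T < min 1 (T + \<epsilon> / 2)" using lt by auto
    show "min 1 (T + \<epsilon> / 2) \<in> S"
      using T1 lt(1) below lt(2) by (force simp: S_def not_less[symmetric])
  qed
  have no_ext: "\<not> (\<exists>t\<in>S. T < t)" using cSup_upper[OF _ bdd] unfolding T_def by (auto simp: not_less)
  have Tp: "T > 0"
  proof (rule ccontr)
    assume "\<not> T > 0"
    then have T0: "T = 0" using T1 by simp
    have "\<exists>t\<in>S. T < t"
    proof (rule extend[of "\<delta> / norm x"])
      show "0 < \<delta> / norm x" using \<delta> x0 by simp
      fix s assume "T \<le> s" "s < T + \<delta> / norm x"
      then show "u (s *\<^sub>R x) = v (s *\<^sub>R x)" using x0 T0 by (intro eq) (simp add: field_simps)
    qed (use T0 in simp)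
    with no_ext show False by blast
  qed
  have "T * norm x < 1" using T1 x mult_left_le_one_le[of "norm x" T] by (simp add: le_less_trans)
  then have Tx: "T *\<^sub>R x \<in> ball 0 1" using T1 by simp
  obtain \<delta>1 q1 where q1: "\<delta>1 > 0" "growth \<delta>1 q1" "\<And>h. norm h < \<delta>1 \<Longrightarrow> u (T *\<^sub>R x + h) = hsum q1 h"
    using real_analytic_imp_growth[OF u Tx] by blast
  obtain \<delta>2 q2 where q2: "\<delta>2 > 0" "growth \<delta>2 q2" "\<And>h. norm h < \<delta>2 \<Longrightarrow> v (T *\<^sub>R x + h) = hsum q2 h"
    using real_analytic_imp_growth[OF v Tx] by blast
  define \<eta> where "\<eta> = min (min \<delta>1 \<delta>2 / norm x) T"
  have \<eta>: "\<eta> > 0" using q1 q2 x0 Tp by (simp add: \<eta>_def)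
  have sm: "\<bar>s\<bar> * norm x < \<delta>1" "\<bar>s\<bar> * norm x < \<delta>2" "\<bar>s\<bar> < T" if "\<bar>s\<bar> < \<eta>" for s
    using that x0 by (auto simp: \<eta>_def field_simps)
  have ser: "(\<lambda>m. q1 m x * of_real s ^ m) sums u ((T + s) *\<^sub>R x)" "(\<lambda>m. q2 m x * of_real s ^ m) sums v ((T + s) *\<^sub>R x)"
    if s: "\<bar>s\<bar> < \<eta>" for s
    using growth_summable(3)[OF q1(2), of "s *\<^sub>R x"] growth_summable(3)[OF q2(2), of "s *\<^sub>R x"]
      q1(3)[of "s *\<^sub>R x"] q2(3)[of "s *\<^sub>R x"] sm[OF s]
    by (simp_all add: homog_scaleR[OF growth_homog[OF q1(2)]] homog_scaleR[OF growth_homog[OF q2(2)]] scaleR_add_left mult.commute)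
  have "(-1) ^ m * q1 m x = (-1) ^ m * q2 m x" for m
  proof (rule power_series_unique[OF \<eta>])
    fix t :: real assume t: "0 < t" "t < \<eta>"
    then have "\<bar>- t\<bar> < \<eta>" by simp
    from ser(1)[OF this] show "(\<lambda>k. (-1) ^ k * q1 k x * of_real t ^ k) sums u ((T + - t) *\<^sub>R x)"
      by (simp add: power_minus[of "of_real t"] mult_ac)
    from ser(2)[OF \<open>\<bar>- t\<bar> < \<eta>\<close>] have "(\<lambda>k. (-1) ^ k * q2 k x * of_real t ^ k) sums v ((T + - t) *\<^sub>R x)"
      by (simp add: power_minus[of "of_real t"] mult_ac)
    moreover have "u ((T + - t) *\<^sub>R x) = v ((T + - t) *\<^sub>R x)"
      using sm(3)[OF \<open>\<bar>- t\<bar> < \<eta>\<close>] t by (intro below) auto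
    ultimately show "(\<lambda>k. (-1) ^ k * q2 k x * of_real t ^ k) sums u ((T + - t) *\<^sub>R x)" by simp
  qed
  then have coeff: "q1 m x = q2 m x" for m by simp
  have near: "u (s *\<^sub>R x) = v (s *\<^sub>R x)" if s: "T \<le> s" "s < T + \<eta>" for s
  proof -
    have "\<bar>s - T\<bar> < \<eta>" using s by simp
    from ser[OF this] show ?thesis unfolding coeff by (simp add: sums_unique2)
  qed
  have "T = 1"
  proof (rule ccontr)
    assume "T \<noteq> 1"
    then have "T < 1" using T1 by simp
    from extend[OF \<eta> near this] no_ext show False by blast
  qed
  then have "u (1 *\<^sub>R x) = v (1 *\<^sub>R x)" using near[of 1] \<eta> by auto
  with ne show False by simp
qed

section \<open>Almansi expansions\<close>

lemma
  fixes f :: "nat \<Rightarrow> real ^ 'n \<Rightarrow> complex"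
  assumes g: "set_integrable lborel (ball 0 1) g" and f: "\<And>m. set_integrable lborel (ball 0 1) (f m)"
    and bd: "\<And>m y. norm y < 1 \<Longrightarrow> norm (f m y) \<le> B m * g y" and B: "summable B"
  shows sums_integral_ball: "(\<lambda>m. LINT y:ball 0 1|lborel. f m y) sums (LINT y:ball 0 1|lborel. \<Sum>m. f m y)"
    and suminf_integrable_ball: "set_integrable lborel (ball 0 1) (\<lambda>y. \<Sum>m. f m y)"
proof -
  let ?f = "\<lambda>m y. indicat_real (ball 0 1) y *\<^sub>R f m y"
  let ?g = "\<lambda>y. indicat_real (ball 0 1) y *\<^sub>R g y"
  have fg: "norm (?f m y) \<le> B m * ?g y" for m y
    using bd[of y m] by (simp add: indicator_def)
  have i: "integrable lborel (?f m)" for m using f by (simp add: set_integrable_def)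
  have ig: "integrable lborel ?g" using g by (simp add: set_integrable_def)
  have s: "summable (\<lambda>m. norm (?f m y))" for y
    by (rule summable_comparison_test'[OF summable_mult2[OF B, of "?g y"], of 0]) (use fg in simp)
  have int_le: "(LINT y|lborel. norm (?f m y)) \<le> B m * (LINT y|lborel. ?g y)" for m
  proof -
    have "(LINT y|lborel. norm (?f m y)) \<le> (LINT y|lborel. B m * ?g y)"
      using fg by (intro integral_mono integrable_norm i integrable_mult_right ig)
    also have "\<dots> = B m * (LINT y|lborel. ?g y)" by (rule integral_mult_right_zero)
    finally show ?thesis .
  qed
  have si: "summable (\<lambda>m. LINT y|lborel. norm (?f m y))"
    by (rule summable_comparison_test'[OF summable_mult2[OF B, of "LINT y|lborel. ?g y"], of 0])
       (use int_le in simp)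
  have eq: "(\<Sum>m. ?f m y) = indicat_real (ball 0 1) y *\<^sub>R (\<Sum>m. f m y)" for y by (simp add: indicator_def)
  show "(\<lambda>m. LINT y:ball 0 1|lborel. f m y) sums (LINT y:ball 0 1|lborel. \<Sum>m. f m y)"
    using sums_integral[of lborel ?f, OF i AE_I2[OF s] si] unfolding eq set_lebesgue_integral_def .
  show "set_integrable lborel (ball 0 1) (\<lambda>y. \<Sum>m. f m y)"
    using integrable_suminf[of lborel ?f, OF i AE_I2[OF s] si] unfolding eq set_integrable_def .
qed

lemma growth_zero: "growth R (\<lambda>_ _. 0)"
  by (rule growthI) (auto intro: homog_zero exI[of _ 0])

lemma growth_sum: "(\<And>a. a \<in> A \<Longrightarrow> growth R (q a)) \<Longrightarrow> growth R (\<lambda>m x. \<Sum>a\<in>A. q a m x)"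
proof (induction A rule: infinite_finite_induct)
  case (insert a A)
  have "growth R (\<lambda>m x. q a m x + (\<Sum>a\<in>A. q a m x))" using insert by (intro growth_add) auto
  then show ?case using insert.hyps by simp
qed (auto intro: growth_zero)

lemma growth_laplacian:
  assumes "growth R q"
  shows "growth R (\<lambda>m. laplacian (q (Suc (Suc m))))"
proof -
  have "growth R (\<lambda>m x. \<Sum>i\<in>UNIV. partial_deriv i (partial_deriv i (q (Suc (Suc m)))) x)"
    by (rule growth_sum) (rule growth_partial[OF growth_partial[OF assms]])
  then show ?thesis by (simp add: laplacian_def[abs_def])
qed

lemma hsum_laplacian:
  assumes q: "growth R q" and x: "norm x < R"
  shows "laplacian (hsum q) x = hsum (\<lambda>m. laplacian (q (Suc (Suc m)))) x"
proof -
  have "partial_deriv i (partial_deriv i (hsum q)) x = hsum (\<lambda>m. partial_deriv i (partial_deriv i (q (Suc (Suc m))))) x" for i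
  proof -
    have "partial_deriv i (partial_deriv i (hsum q)) x = partial_deriv i (hsum (\<lambda>m. partial_deriv i (q (Suc m)))) x"
      by (rule partial_deriv_cong[OF open_ball[of 0 R]]) (use x hsum_partial[OF q] in auto)
    also have "\<dots> = hsum (\<lambda>m. partial_deriv i (partial_deriv i (q (Suc (Suc m))))) x"
      by (rule hsum_partial[OF growth_partial[OF q] x])
    finally show ?thesis .
  qed
  then show ?thesis unfolding laplacian_def hsum_def
    using growth_summable(2)[OF growth_partial[OF growth_partial[OF q]] x]
    by (subst suminf_sum) auto
qed

lemma laplacian_funpow_hsum:
  assumes "growth R q"
  shows "growth R (\<lambda>m. (laplacian ^^ p) (q (m + 2 * p))) \<and>
    (\<forall>x. norm x < R \<longrightarrow> (laplacian ^^ p) (hsum q) x = hsum (\<lambda>m. (laplacian ^^ p) (q (m + 2 * p))) x)"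
proof (induction p)
  case 0
  then show ?case using assms by simp
next
  case (Suc p)
  define q' where "q' m = (laplacian ^^ p) (q (m + 2 * p))" for m
  have q': "growth R q'" "\<And>x. norm x < R \<Longrightarrow> (laplacian ^^ p) (hsum q) x = hsum q' x"
    using Suc by (auto simp: q'_def[abs_def])
  have eq: "(laplacian ^^ Suc p) (q (m + 2 * Suc p)) = laplacian (q' (Suc (Suc m)))" for m
    by (simp add: q'_def)
  have "(laplacian ^^ Suc p) (hsum q) x = hsum (\<lambda>m. laplacian (q' (Suc (Suc m)))) x" if x: "norm x < R" for x
  proof -
    have "(laplacian ^^ Suc p) (hsum q) x = laplacian (hsum q') x"
      using laplacian_cong[OF open_ball[of 0 R], of x "(laplacian ^^ p) (hsum q)" "hsum q'"] q'(2) x by simp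
    then show ?thesis using hsum_laplacian[OF q'(1) x] by simp
  qed
  then show ?case unfolding eq using growth_laplacian[OF q'(1)] by blast
qed

lemma laplacian_funpow_zero: "(laplacian ^^ p) (\<lambda>_ :: real ^ 'n. 0) = (\<lambda>_. 0)"
proof -
  have lz: "laplacian (\<lambda>_ :: real ^ 'n. 0) = (\<lambda>_. 0)" by (rule ext) (rule laplacian_zero)
  show ?thesis by (induction p) (simp_all add: lz)
qed

lemma laplacian_funpow_sum:
  assumes "finite A" "\<And>a. a \<in> A \<Longrightarrow> homog m (f a)"
  shows "(laplacian ^^ p) (\<lambda>x. \<Sum>a\<in>A. f a x) = (\<lambda>x. \<Sum>a\<in>A. (laplacian ^^ p) (f a) x)"
  using assms(2)
proof (induction p arbitrary: m f)
  case 0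
  then show ?case by simp
next
  case (Suc p)
  have "laplacian (\<lambda>x. \<Sum>a\<in>A. f a x) = (\<lambda>x. \<Sum>a\<in>A. laplacian (f a) x)"
    using laplacian_sum[OF assms(1) Suc.prems] by (simp add: fun_eq_iff)
  then show ?case unfolding funpow_Suc_right o_def
    using Suc.IH[of "m - 2" "\<lambda>a. laplacian (f a)"] homog_laplacian[OF Suc.prems] by simp
qed

lemma laplacian_funpow_norm_power_harmonic:
  fixes h :: "real ^ 'n \<Rightarrow> complex"
  assumes "harmonic_poly l h" "k < p"
  shows "(laplacian ^^ p) (\<lambda>x. complex_of_real (norm x ^ (2 * k)) * h x) = (\<lambda>_. 0)"
  using assms
proof (induction k arbitrary: h p)
  case 0
  then have "laplacian (\<lambda>x. complex_of_real (norm x ^ (2 * 0)) * h x) = (\<lambda>_. 0)"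
    by (simp add: harmonic_poly_def fun_eq_iff)
  moreover obtain p' where p': "p = Suc p'" using 0(2) by (cases p) auto
  ultimately show ?case unfolding p' funpow_Suc_right o_def by (simp only: laplacian_funpow_zero)
next
  case (Suc k)
  obtain p' where p': "p = Suc p'" "k < p'" using Suc.prems(2) by (cases p) auto
  define c where "c = complex_of_nat (2 * Suc k * (CARD('n) + 2 * l + 2 * k))"
  have "laplacian (\<lambda>x. complex_of_real (norm x ^ (2 * Suc k)) * h x) = (\<lambda>x. complex_of_real (norm x ^ (2 * k)) * (c * h x))"
    using laplacian_norm_power_harmonic[OF Suc.prems(1), of k] unfolding c_def[symmetric]
    by (simp only: fun_eq_iff mult.left_commute simp_thms)
  then show ?case unfolding p'(1) funpow_Suc_right o_def
    using Suc.IH[OF harmonic_poly_scale[OF Suc.prems(1), of c] p'(2)] by (simp only:)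
qed

text \<open>The homogeneous component of degree \<open>m\<close> of \<open>\<Sum>k<p. |x|^(2k) \<Sum>j. h k j x\<close>.\<close>

definition almansi :: "nat \<Rightarrow> (nat \<Rightarrow> nat \<Rightarrow> real ^ 'n \<Rightarrow> complex) \<Rightarrow> nat \<Rightarrow> real ^ 'n \<Rightarrow> complex" where
  "almansi p h m x = (\<Sum>k<p. if 2 * k \<le> m then complex_of_real (norm x ^ (2 * k)) * h k (m - 2 * k) x else 0)"

lemma growth_norm_power_shift:
  fixes q :: "nat \<Rightarrow> real ^ 'n \<Rightarrow> complex"
  assumes q: "growth R q"
  shows "growth R (\<lambda>m x. if 2 * k \<le> m then complex_of_real (norm x ^ (2 * k)) * q (m - 2 * k) x else 0)"
proof (rule growthI)
  show "homog m (\<lambda>x. if 2 * k \<le> m then complex_of_real (norm x ^ (2 * k)) * q (m - 2 * k) x else 0)" for m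
  proof (cases "2 * k \<le> m")
    case True
    then have "homog (2 * k + (m - 2 * k)) (\<lambda>x. complex_of_real (norm x ^ (2 * k)) * q (m - 2 * k) x)"
      by (intro homog_mult homog_norm_power growth_homog[OF q])
    with True show ?thesis by simp
  qed (simp add: homog_zero)
  fix r :: real assume r: "0 < r" "r < R"
  obtain C where C: "C \<ge> 0" "\<And>m x. norm (q m x) \<le> C * (norm x / r) ^ m" using growthD[OF q r] by blast
  have "norm (if 2 * k \<le> m then complex_of_real (norm x ^ (2 * k)) * q (m - 2 * k) x else 0) \<le>
      (C * r ^ (2 * k)) * (norm x / r) ^ m" for m and x :: "real ^ 'n"
  proof (cases "2 * k \<le> m")
    case True
    then obtain l where l: "m = 2 * k + l" using le_Suc_ex by blast
    have "norm x ^ (2 * k) * norm (q l x) \<le> norm x ^ (2 * k) * (C * (norm x / r) ^ l)"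
      by (intro mult_left_mono C) auto
    also have "\<dots> = (C * r ^ (2 * k)) * (norm x / r) ^ m"
      using r by (simp add: l power_add power_divide)
    finally show ?thesis using True by (simp add: l norm_mult norm_power)
  qed (use C r in simp)
  then show "\<exists>C. \<forall>m x. norm (if 2 * k \<le> m then complex_of_real (norm x ^ (2 * k)) * q (m - 2 * k) x else 0)
      \<le> C * (norm x / r) ^ m" by blast
qed

lemma growth_almansi: "(\<And>k. k < p \<Longrightarrow> growth R (h k)) \<Longrightarrow> growth R (almansi p h)"
  unfolding almansi_def[abs_def] by (intro growth_sum growth_norm_power_shift) auto

text \<open>The factors \<open>a j\<close> are there to carry the phases \<open>e^(ij\<psi>)\<close>.\<close>

lemma sums_norm_power_shift:
  fixes x :: "real ^ 'n"
  assumes "(\<lambda>j. a j * q j x) sums s"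
  shows "(\<lambda>m. if 2 * k \<le> m then a (m - 2 * k) * (complex_of_real (norm x ^ (2 * k)) * q (m - 2 * k) x) else 0)
     sums (complex_of_real (norm x ^ (2 * k)) * s)"
proof -
  define F where "F m = (if 2 * k \<le> m then a (m - 2 * k) * (complex_of_real (norm x ^ (2 * k)) * q (m - 2 * k) x) else 0)" for m
  have "(\<lambda>j. F (j + 2 * k)) sums (complex_of_real (norm x ^ (2 * k)) * s)"
    using sums_mult[OF assms, of "complex_of_real (norm x ^ (2 * k))"] by (simp add: F_def mult_ac)
  moreover have "(\<Sum>i<2 * k. F i) = 0" by (simp add: F_def)
  ultimately have "F sums (complex_of_real (norm x ^ (2 * k)) * s + 0)"
    using sums_iff_shift[of F "2 * k" "complex_of_real (norm x ^ (2 * k)) * s"] by simp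
  then show ?thesis by (simp add: F_def[abs_def])
qed

lemma harmonic_almansi:
  assumes "\<And>k j. k < p \<Longrightarrow> harmonic_poly j (h k j)"
  shows "homog m (almansi p h m)" "(laplacian ^^ p) (almansi p h m) = (\<lambda>_. 0)"
proof -
  define F where "F k x = (if 2 * k \<le> m then complex_of_real (norm x ^ (2 * k)) * h k (m - 2 * k) x else 0)" for k x
  have F: "homog m (F k)" "(laplacian ^^ p) (F k) = (\<lambda>_. 0)" if k: "k < p" for k
  proof -
    show "homog m (F k)"
    proof (cases "2 * k \<le> m")
      case True
      then have eq: "2 * k + (m - 2 * k) = m" and Fk: "F k = (\<lambda>x. complex_of_real (norm x ^ (2 * k)) * h k (m - 2 * k) x)"
        by (simp_all add: F_def fun_eq_iff)
      have "homog (m - 2 * k) (h k (m - 2 * k))" using assms[OF k] by (simp add: harmonic_poly_def)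
      from homog_mult[OF homog_norm_power this, of k] show ?thesis unfolding Fk eq .
    next
      case False
      then have "F k = (\<lambda>_. 0)" by (simp add: F_def fun_eq_iff)
      then show ?thesis by (simp only: homog_zero)
    qed
    show "(laplacian ^^ p) (F k) = (\<lambda>_. 0)"
    proof (cases "2 * k \<le> m")
      case True
      then have "F k = (\<lambda>x. complex_of_real (norm x ^ (2 * k)) * h k (m - 2 * k) x)" by (simp add: F_def fun_eq_iff)
      then show ?thesis by (simp only: laplacian_funpow_norm_power_harmonic[OF assms[OF k] k])
    next
      case False
      then have "F k = (\<lambda>_. 0)" by (simp add: F_def fun_eq_iff)
      then show ?thesis by (simp only: laplacian_funpow_zero)
    qed
  qed
  have eq: "almansi p h m = (\<lambda>x. \<Sum>k<p. F k x)" by (simp add: almansi_def F_def fun_eq_iff)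
  show "homog m (almansi p h m)" unfolding eq by (intro homog_sum F) auto
  show "(laplacian ^^ p) (almansi p h m) = (\<lambda>_. 0)"
    unfolding eq using F by (subst laplacian_funpow_sum[of _ m]) auto
qed

theorem almansi_polyharmonic:
  assumes g: "\<And>k. k < p \<Longrightarrow> growth 1 (h k)" and h: "\<And>k j. k < p \<Longrightarrow> harmonic_poly j (h k j)"
  shows "hsum (almansi p h) \<in> polyharmonic p"
proof -
  have ga: "growth 1 (almansi p h)" by (rule growth_almansi[OF g])
  have "(laplacian ^^ p) (hsum (almansi p h)) x = 0" if "norm x < 1" for x
    using laplacian_funpow_hsum[OF ga, of p] that by (simp add: harmonic_almansi(2)[OF h] hsum_def)
  then show ?thesis
    using growth_imp_real_analytic[OF ga] by (simp add: polyharmonic_def)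
qed

lemma radial_weight_power: "radial_weight (\<lambda>y :: real ^ 'n. norm y ^ (2 * k))"
  unfolding radial_weight_def
proof (intro conjI exI[of _ "\<lambda>s. s ^ (2 * k)"] allI impI refl)
  show "set_integrable lborel (ball 0 1) (\<lambda>y :: real ^ 'n. norm y ^ (2 * k))"
    by (intro set_integrable_ball_continuous continuous_intros)
  fix r :: real assume "r < 1"
  define r' where "r' = max r 0"
  have r': "0 \<le> r'" "r \<le> r'" "r' < 1" using \<open>r < 1\<close> by (auto simp: r'_def)
  have "0 < ((2 * r' + 1) / 3) ^ (2 * k)" using r' by simp
  moreover have "((2 * r' + 1) / 3) ^ (2 * k) \<le> s ^ (2 * k)" if "(2 * r' + 1) / 3 < s" for s
    using that r' by (intro power_mono) auto
  ultimately show "\<exists>a b c. r < a \<and> a < b \<and> b < 1 \<and> 0 < c \<and> (\<forall>s. a < s \<and> s < b \<longrightarrow> c \<le> s ^ (2 * k))"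
    using r' by (intro exI[of _ "(2 * r' + 1) / 3"] exI[of _ "(r' + 2) / 3"] exI[of _ "((2 * r' + 1) / 3) ^ (2 * k)"]) auto
qed auto

lemma integral_norm_homog_le:
  fixes f :: "real ^ 'n \<Rightarrow> complex"
  assumes f: "homog m f" and M: "\<And>x. norm (f x) \<le> M * norm x ^ m" "M \<ge> 0"
  shows "(LINT y:ball 0 1|lborel. norm (f y)) \<le> M * measure lborel (ball (0 :: real ^ 'n) 1)"
proof -
  have "(LINT y:ball 0 1|lborel. norm (f y)) \<le> (LINT y|lborel. M * indicat_real (ball (0 :: real ^ 'n) 1) y)"
    unfolding set_lebesgue_integral_def
  proof (rule integral_mono)
    have "set_integrable lborel (ball 0 1) (\<lambda>y. norm (f y))"
      by (intro set_integrable_ball_continuous continuous_intros homog_continuous[OF f])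
    then show "integrable lborel (\<lambda>y. indicat_real (ball 0 1) y *\<^sub>R norm (f y))" by (simp add: set_integrable_def)
    show "integrable lborel (\<lambda>y. M * indicat_real (ball (0 :: real ^ 'n) 1) y)"
      by (intro integrable_mult_right integrable_real_indicator emeasure_lborel_ball_finite) auto
    fix y :: "real ^ 'n"
    show "indicat_real (ball 0 1) y *\<^sub>R norm (f y) \<le> M * indicat_real (ball 0 1) y"
    proof (cases "norm y < 1")
      case True
      have "M * norm y ^ m \<le> M * 1" using True M(2) by (intro mult_left_mono power_le_one) auto
      with M(1)[of y] True show ?thesis by simp
    qed simp
  qed
  then show ?thesis by simp
qed

text \<open>Near the origin the Taylor polynomials of \<open>u\<close>, decomposed by Fischer, give candidates for
  the harmonic components.  Pairing with the conjugate of one component, the moments of \<open>u\<close> are a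
  power series with the square norms of the components as coefficients; comparison with the finite
  expansion valid on all of \<open>(0, 1)\<close> shows that the components with \<open>k \<ge> p\<close> vanish and that
  the others have the growth needed for convergence on the whole ball.\<close>

theorem polyharmonic_expansion:
  fixes u :: "real ^ 'n \<Rightarrow> complex"
  assumes "u \<in> polyharmonic p"
  shows "\<exists>h. (\<forall>k<p. \<forall>j. harmonic_poly j (h k j)) \<and> (\<forall>k<p. growth 1 (h k)) \<and>
     (\<forall>x\<in>ball 0 1. u x = hsum (almansi p h) x)"
proof -
  have u: "real_analytic_on u (ball 0 1)" and lap: "\<And>x. x \<in> ball 0 1 \<Longrightarrow> (laplacian ^^ p) u x = 0"
    using assms by (auto simp: polyharmonic_def)
  have z: "0 \<in> ball (0 :: real ^ 'n) 1" by simp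
  obtain \<delta> q where q: "\<delta> > 0" "growth \<delta> q" "\<And>x. norm x < \<delta> \<Longrightarrow> u x = hsum q x"
    using real_analytic_imp_growth[OF u z] by auto
  have "\<forall>m. \<exists>H. (\<forall>k\<le>m div 2. harmonic_poly (m - 2 * k) (H k)) \<and>
     (\<forall>x. q m x = (\<Sum>k\<le>m div 2. complex_of_real (norm x ^ (2 * k)) * H k x))"
    using fischer_decomposition[OF growth_homog[OF q(2)]] by blast
  from choice[OF this] obtain H where "\<forall>m. (\<forall>k\<le>m div 2. harmonic_poly (m - 2 * k) (H m k)) \<and>
     (\<forall>x. q m x = (\<Sum>k\<le>m div 2. complex_of_real (norm x ^ (2 * k)) * H m k x))" by blast
  then have H: "\<And>m k. k \<le> m div 2 \<Longrightarrow> harmonic_poly (m - 2 * k) (H m k)"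
    "\<And>m x. q m x = (\<Sum>k\<le>m div 2. complex_of_real (norm x ^ (2 * k)) * H m k x)" by blast+
  define h where "h k j = H (j + 2 * k) k" for k j
  have h: "harmonic_poly j (h k j)" for k j using H(1)[of k "j + 2 * k"] by (simp add: h_def)
  have hh: "homog j (h k j)" for k j using h[of j k] by (simp add: harmonic_poly_def)
  define E where "E k j = (LINT y:ball 0 1|lborel. (norm (h k j y))\<^sup>2 * norm y ^ (2 * k))" for k j
  \<comment> \<open>the pairing of a Taylor polynomial with a harmonic polynomial picks one Fischer component\<close>
  have pair: "(LINT y:ball 0 1|lborel. q (j + 2 * k) y * cnj (h k j y)) = of_real (E k j)" for k j
  proof -
    define Y where "Y y = cnj (h k j y)" for y
    have Y: "harmonic_poly j Y" unfolding Y_def by (rule harmonic_poly_cnj[OF h])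
    define m where "m = j + 2 * k"
    define F where "F i y = complex_of_real (norm y ^ (2 * i)) * H m i y * Y y" for i y
    have Fi: "set_integrable lborel (ball 0 1) (F i)" if "i \<le> m div 2" for i
      unfolding F_def using H(1)[OF that] Y
      by (intro set_integrable_ball_continuous continuous_intros homog_continuous[of "m - 2 * i"] homog_continuous[of j])
         (auto simp: harmonic_poly_def)
    have F0: "(LINT y:ball 0 1|lborel. F i y) = 0" if i: "i \<le> m div 2" "i \<noteq> k" for i
    proof -
      have "m - 2 * i \<noteq> j" using i by (auto simp: m_def)
      from harmonic_poly_orthogonal[OF H(1)[OF i(1)] Y this, of "\<lambda>s. s ^ (2 * i)"]
      have "(LINT y:ball 0 1|lborel. H m i y * Y y * complex_of_real (norm y ^ (2 * i))) = 0"
        by (auto intro!: set_integrable_ball_continuous continuous_intros)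
      then show ?thesis by (simp add: F_def mult_ac)
    qed
    have "(LINT y:ball 0 1|lborel. q m y * Y y) = (LINT y:ball 0 1|lborel. \<Sum>i\<le>m div 2. F i y)"
      by (simp add: H(2) F_def sum_distrib_right)
    also have "\<dots> = (\<Sum>i\<le>m div 2. LINT y:ball 0 1|lborel. F i y)"
      unfolding set_lebesgue_integral_def scaleR_sum_right
      using Fi by (intro Bochner_Integration.integral_sum) (auto simp: set_integrable_def)
    also have "\<dots> = (\<Sum>i\<in>{k}. LINT y:ball 0 1|lborel. F i y)"
      using F0 by (intro sum.mono_neutral_right) (auto simp: m_def)
    also have "\<dots> = (LINT y:ball 0 1|lborel. h k j y * cnj (h k j y) * complex_of_real (norm y ^ (2 * k)))"
      by (simp add: F_def h_def Y_def m_def mult_ac)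
    also have "\<dots> = of_real (E k j)"
      unfolding E_def by (rule set_integrable_norm_sq_weight(2)[OF radial_weight_integrable[OF radial_weight_power] hh])
    finally show ?thesis by (simp add: m_def Y_def)
  qed
  define r0 where "r0 = min \<delta> 1"
  have r0: "0 < r0" "r0 \<le> \<delta>" "r0 \<le> 1" using q(1) by (auto simp: r0_def)
  have series: "(\<lambda>m. (LINT y:ball 0 1|lborel. q m y * Y y) * of_real t ^ m) sums moment 0 u Y t"
    if Y: "harmonic_poly j Y" and t: "0 < t" "t < r0" for j Y t
  proof -
    have Yh: "homog j Y" using Y by (simp add: harmonic_poly_def)
    obtain B where B: "summable B" "\<And>m x. norm x \<le> t \<Longrightarrow> norm (q m x) \<le> B m"
      using growth_uniform[OF q(2), of t] t r0 q(1) by auto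
    have ty: "norm (t *\<^sub>R y) \<le> t" if "norm y < 1" for y :: "real ^ 'n"
      using t that by simp
    have "(\<lambda>m. LINT y:ball 0 1|lborel. q m (t *\<^sub>R y) * Y y) sums (LINT y:ball 0 1|lborel. \<Sum>m. q m (t *\<^sub>R y) * Y y)"
    proof (rule sums_integral_ball[OF _ _ _ B(1)])
      show "set_integrable lborel (ball 0 1) (\<lambda>y. norm (Y y))"
        by (intro set_integrable_ball_continuous continuous_intros homog_continuous[OF Yh])
      show "set_integrable lborel (ball 0 1) (\<lambda>y. q m (t *\<^sub>R y) * Y y)" for m
        unfolding homog_scaleR[OF growth_homog[OF q(2)]]
        by (intro set_integrable_ball_continuous continuous_intros homog_continuous[OF Yh] homog_continuous[OF growth_homog[OF q(2)]])
      show "norm (q m (t *\<^sub>R y) * Y y) \<le> B m * norm (Y y)" if "norm y < 1" for m y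
        unfolding norm_mult by (intro mult_right_mono B(2) ty that) auto
    qed
    also have "(\<lambda>m. LINT y:ball 0 1|lborel. q m (t *\<^sub>R y) * Y y) = (\<lambda>m. (LINT y:ball 0 1|lborel. q m y * Y y) * of_real t ^ m)"
      unfolding homog_scaleR[OF growth_homog[OF q(2)]]
      by (rule ext, simp only: mult.assoc set_integral_mult_right of_real_power, rule mult.commute)
    also have "(LINT y:ball 0 1|lborel. \<Sum>m. q m (t *\<^sub>R y) * Y y) = moment 0 u Y t"
      unfolding moment_def set_lebesgue_integral_def
    proof (intro Bochner_Integration.integral_cong refl)
      fix y :: "real ^ 'n"
      show "indicat_real (ball 0 1) y *\<^sub>R (\<Sum>m. q m (t *\<^sub>R y) * Y y) =
          indicat_real (ball 0 1) y *\<^sub>R (complex_of_real ((1 - (norm y)\<^sup>2) ^ 0) * (u (t *\<^sub>R y) * Y y))"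
      proof (cases "norm y < 1")
        case True
        have n: "norm (t *\<^sub>R y) < \<delta>" using ty[OF True] t r0 by linarith
        have "(\<Sum>m. q m (t *\<^sub>R y) * Y y) = hsum q (t *\<^sub>R y) * Y y"
          unfolding hsum_def by (rule suminf_mult2[symmetric, OF growth_summable(2)[OF q(2) n]])
        then show ?thesis using q(3)[OF n] by simp
      qed simp
    qed
    finally show ?thesis .
  qed
  have coeff: "\<exists>C\<ge>0. \<forall>k j. (k < p \<longrightarrow> E k j * t0 ^ j \<le> C * (LINT y:ball 0 1|lborel. norm (h k j y))) \<and> (k \<ge> p \<longrightarrow> E k j = 0)"
    if t0: "0 < t0" "t0 < 1" for t0
  proof -
    obtain C where C: "C \<ge> 0" "\<And>j Y. harmonic_poly j Y \<Longrightarrow> (\<exists>c.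
       (\<forall>t. 0 < t \<and> t < 1 \<longrightarrow> moment 0 u Y t = (\<Sum>k<p. c k * of_real (t ^ (j + 2 * k)))) \<and>
       (\<forall>k<p. norm (c k) * t0 ^ j \<le> C * (LINT y:ball 0 1|lborel. norm (Y y))))"
      using moment_expansion[OF u lap t0, of 0] by blast
    have "(k < p \<longrightarrow> E k j * t0 ^ j \<le> C * (LINT y:ball 0 1|lborel. norm (h k j y))) \<and> (k \<ge> p \<longrightarrow> E k j = 0)" for k j
    proof -
      define Y where "Y y = cnj (h k j y)" for y
      have Y: "harmonic_poly j Y" unfolding Y_def by (rule harmonic_poly_cnj[OF h])
      from C(2)[OF Y] obtain c where
        c: "\<And>t. 0 < t \<Longrightarrow> t < 1 \<Longrightarrow> moment 0 u Y t = (\<Sum>k<p. c k * of_real (t ^ (j + 2 * k)))"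
           "\<And>k. k < p \<Longrightarrow> norm (c k) * t0 ^ j \<le> C * (LINT y:ball 0 1|lborel. norm (Y y))" by blast
      define N where "N = (\<lambda>k. j + 2 * k) ` {..<p}"
      have inj: "inj_on (\<lambda>k. j + 2 * k) {..<p}" by (auto simp: inj_on_def)
      define e where "e m = (if m \<in> N then c ((m - j) div 2) else 0)" for m
      have "(LINT y:ball 0 1|lborel. q m y * Y y) = e m" for m
      proof (rule power_series_unique[OF r0(1)])
        fix t assume t: "0 < t" "t < r0"
        show "(\<lambda>m. (LINT y:ball 0 1|lborel. q m y * Y y) * of_real t ^ m) sums moment 0 u Y t"
          by (rule series[OF Y t])
        have "(\<lambda>m. e m * of_real t ^ m) sums (\<Sum>m\<in>N. e m * of_real t ^ m)"
          by (rule sums_finite) (auto simp: N_def e_def)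
        also have "(\<Sum>m\<in>N. e m * of_real t ^ m) = (\<Sum>k<p. e (j + 2 * k) * of_real t ^ (j + 2 * k))"
          unfolding N_def by (subst sum.reindex[OF inj]) simp
        also have "\<dots> = (\<Sum>k<p. c k * of_real (t ^ (j + 2 * k)))"
          by (intro sum.cong) (auto simp: e_def N_def)
        also have "\<dots> = moment 0 u Y t" using c(1)[of t] t r0 by simp
        finally show "(\<lambda>m. e m * of_real t ^ m) sums moment 0 u Y t" .
      qed
      from this[of "j + 2 * k"] have "of_real (E k j) = e (j + 2 * k)" by (simp add: Y_def pair)
      also have "e (j + 2 * k) = (if k < p then c k else 0)" by (auto simp: e_def N_def)
      finally have Ec: "complex_of_real (E k j) = (if k < p then c k else 0)" .
      have "E k j * t0 ^ j \<le> C * (LINT y:ball 0 1|lborel. norm (h k j y))" if "k < p"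
      proof -
        have "E k j \<le> norm (complex_of_real (E k j))" by simp
        also have "\<dots> = norm (c k)" using Ec that by simp
        finally have "E k j * t0 ^ j \<le> norm (c k) * t0 ^ j" using t0 by (intro mult_right_mono) auto
        also have "\<dots> \<le> C * (LINT y:ball 0 1|lborel. norm (Y y))" by (rule c(2)[OF that])
        finally show ?thesis by (simp add: Y_def)
      qed
      with Ec show ?thesis by auto
    qed
    with C(1) show ?thesis by blast
  qed
  have h0: "h k j x = 0" if k: "k \<ge> p" for k j x
  proof -
    obtain C where C: "\<And>m f x. homog m f \<Longrightarrow> (norm (f x))\<^sup>2 * (1 / 2) ^ m \<le>
       C * norm x ^ (2 * m) * (LINT y:ball 0 1|lborel. (norm (f y))\<^sup>2 * norm (y :: real ^ 'n) ^ (2 * k))"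
      using sup_le_weighted_norm[OF radial_weight_power, of "1 / 2" k] by auto
    have "E k j = 0" using coeff[of "1 / 2"] k by auto
    then have "(norm (h k j x))\<^sup>2 * (1 / 2) ^ j \<le> 0" using C[OF hh[of j k], of x] by (simp add: E_def)
    moreover have "(0 :: real) < (1 / 2) ^ j" by simp
    ultimately show ?thesis by (simp only: mult_le_0_iff) auto
  qed
  have gh: "growth 1 (h k)" if k: "k < p" for k
  proof (rule growthI[OF hh])
    fix r :: real assume r: "0 < r" "r < 1"
    define s where "s = sqrt r"
    have s: "0 < s" "s < 1" "s * s = r" using r by (auto simp: s_def)
    obtain C1 where C1: "C1 > 0" "\<And>m f x. homog m f \<Longrightarrow> (norm (f x))\<^sup>2 * s ^ m \<le>
       C1 * norm x ^ (2 * m) * (LINT y:ball 0 1|lborel. (norm (f y))\<^sup>2 * norm (y :: real ^ 'n) ^ (2 * k))"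
      using sup_le_weighted_norm[OF radial_weight_power s(1,2), of k] by blast
    obtain C where C: "C \<ge> 0" "\<And>j. E k j * s ^ j \<le> C * (LINT y:ball 0 1|lborel. norm (h k j y))"
      using coeff[OF s(1,2)] k by blast
    define V where "V = measure lborel (ball (0 :: real ^ 'n) 1)"
    have V: "V \<ge> 0" by (simp add: V_def)
    have "norm (h k j x) \<le> (C1 * C * V) * (norm x / r) ^ j" for j x
    proof -
      obtain M v where M: "M \<ge> 0" "\<And>x. norm (h k j x) \<le> M * norm x ^ j" and v: "norm v = 1" "norm (h k j v) = M"
        using homog_bounded[OF hh[of j k]] by blast
      have Mr: "M * r ^ j \<le> C1 * C * V"
      proof (cases "M = 0")
        case True
        then show ?thesis using C1 C V by simp
      next
        case False
        with M have M0: "M > 0" by simp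
        have "M\<^sup>2 * s ^ j \<le> C1 * E k j" using C1(2)[OF hh[of j k], of v] v by (simp add: E_def)
        then have "M\<^sup>2 * s ^ j * s ^ j \<le> C1 * E k j * s ^ j" using s by (intro mult_right_mono) auto
        also have "\<dots> \<le> C1 * (C * (LINT y:ball 0 1|lborel. norm (h k j y)))"
          using C(2)[of j] C1(1) by (simp add: mult.assoc)
        also have "\<dots> \<le> C1 * (C * (M * V))"
          using integral_norm_homog_le[OF hh M(2,1)] C(1) C1(1) unfolding V_def by (intro mult_left_mono) auto
        finally have "M * (M * r ^ j) \<le> M * (C1 * C * V)"
          by (simp add: s(3)[symmetric] power_mult_distrib power2_eq_square mult_ac)
        then show ?thesis using M0 by simp
      qed
      have "norm (h k j x) \<le> (M * r ^ j) * (norm x / r) ^ j" using M(2)[of x] r by (simp add: power_divide)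
      also have "\<dots> \<le> (C1 * C * V) * (norm x / r) ^ j" using Mr r by (intro mult_right_mono) auto
      finally show ?thesis .
    qed
    then show "\<exists>C. \<forall>j x. norm (h k j x) \<le> C * (norm x / r) ^ j" by blast
  qed
  have qa: "q m x = almansi p h m x" for m x
  proof -
    have "q m x = (\<Sum>k\<in>{..m div 2}. complex_of_real (norm x ^ (2 * k)) * h k (m - 2 * k) x)"
      unfolding H(2) by (intro sum.cong) (auto simp: h_def)
    also have "\<dots> = (\<Sum>k\<in>{..m div 2} \<inter> {..<p}. complex_of_real (norm x ^ (2 * k)) * h k (m - 2 * k) x)"
      using h0 by (intro sum.mono_neutral_right) auto
    also have "\<dots> = (\<Sum>k\<in>{..m div 2} \<inter> {..<p}. if 2 * k \<le> m then complex_of_real (norm x ^ (2 * k)) * h k (m - 2 * k) x else 0)"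
      by (intro sum.cong) auto
    also have "\<dots> = almansi p h m x" unfolding almansi_def
      by (intro sum.mono_neutral_left) auto
    finally show ?thesis .
  qed
  have ra: "real_analytic_on (hsum (almansi p h)) (ball 0 1)"
    by (rule growth_imp_real_analytic[OF growth_almansi[OF gh]])
  have near: "u x = hsum (almansi p h) x" if "norm x < \<delta>" for x
    using q(3)[OF that] by (simp add: hsum_def qa)
  have "u x = hsum (almansi p h) x" if "norm x < 1" for x
    by (rule real_analytic_identity[OF u ra q(1) near that])
  with h gh show ?thesis by (intro exI[of _ h]) auto
qed

section \<open>Evaluation of the extensions to rotated balls\<close>

text \<open>Both sides are the value of the complexified polynomial at the same point; this makes the
  extensions to rotated balls independent of the representation of their arguments.\<close>

lemma homog_rot_eq:
  assumes q: "homog m q" and eq: "rot \<psi> x = rot \<phi> y"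
  shows "cis (real m * \<psi>) * q x = cis (real m * \<phi>) * q y"
proof -
  obtain \<Phi> where \<Phi>: "\<And>x. \<Phi> (cplx_vec x) = q x" "\<And>c z. \<Phi> (c *s z) = c ^ m * \<Phi> z"
    using homog_complexification[OF q] by blast
  have *: "\<Phi> (rot \<psi> x) = cis (real m * \<psi>) * q x" for \<psi> x
    unfolding rot_def \<Phi> Complex.DeMoivre ..
  show ?thesis using *[of \<psi> x] *[of \<phi> y] eq by simp
qed

lemma homog_expansion_unique:
  assumes "homog_expansion u q" "homog_expansion u q'" "x \<in> ball 0 1"
  shows "q m x = q' m x"
proof (rule power_series_unique[of 1])
  fix t :: real assume t: "0 < t" "t < 1"
  have "t * norm x \<le> 1 * norm x" using t by (intro mult_right_mono) auto
  then have tx: "t *\<^sub>R x \<in> ball 0 1" using assms(3) t by simp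
  have "(\<lambda>k. p k x * of_real t ^ k) sums u (t *\<^sub>R x)" if "homog_expansion u p" for p
  proof -
    have "homog k (p k)" for k using that by (simp add: homog_expansion_def homog_poly_iff)
    from homog_scaleR[OF this] have eq: "p k (t *\<^sub>R x) = p k x * of_real t ^ k" for k by (simp add: mult.commute)
    have "(\<lambda>k. p k (t *\<^sub>R x)) sums u (t *\<^sub>R x)" using that tx unfolding homog_expansion_def by blast
    then show ?thesis unfolding eq .
  qed
  then show "(\<lambda>k. q k x * of_real t ^ k) sums u (t *\<^sub>R x)" "(\<lambda>k. q' k x * of_real t ^ k) sums u (t *\<^sub>R x)"
    using assms by blast+
qed simp

lemma hol_ext_rot:
  assumes u: "homog_expansion u q" and x: "x \<in> ball 0 1"
    and s: "(\<lambda>m. cis (real m * \<psi>) * q m x) sums s"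
  shows "hol_ext u (rot \<psi> x) = s"
  unfolding hol_ext_def
proof (rule the_equality)
  show "\<exists>q' \<psi>' x'. homog_expansion u q' \<and> x' \<in> ball 0 1 \<and> rot \<psi> x = rot \<psi>' x' \<and>
      (\<lambda>m. cis (real m * \<psi>') * q' m x') sums s"
    using assms by blast
  fix s' assume "\<exists>q' \<psi>' x'. homog_expansion u q' \<and> x' \<in> ball 0 1 \<and> rot \<psi> x = rot \<psi>' x' \<and>
      (\<lambda>m. cis (real m * \<psi>') * q' m x') sums s'"
  then obtain q' \<psi>' x' where q': "homog_expansion u q'" "x' \<in> ball 0 1" "rot \<psi> x = rot \<psi>' x'"
      "(\<lambda>m. cis (real m * \<psi>') * q' m x') sums s'" by blast
  have "cis (real m * \<psi>') * q' m x' = cis (real m * \<psi>) * q m x" for m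
  proof -
    have "homog m (q m)" using u by (simp add: homog_expansion_def homog_poly_iff)
    from homog_rot_eq[OF this q'(3)] show ?thesis
      using homog_expansion_unique[OF u q'(1,2), of m] by simp
  qed
  with q'(4) s show "s' = s" by (simp add: sums_unique2)
qed

lemma bihomog_poly_homog:
  assumes "bihomog_poly m r"
  shows "homog m (\<lambda>x. r x y)" "homog m (r x)"
proof -
  from assms obtain c where c: "r = (\<lambda>x y. \<Sum>a\<in>multi_indices m. \<Sum>b\<in>multi_indices m. c a b * complex_of_real (mpow x a * mpow y b))"
    unfolding bihomog_poly_def fun_eq_iff by blast
  have "r x y = (\<Sum>a\<in>multi_indices m. (\<Sum>b\<in>multi_indices m. c a b * of_real (mpow y b)) * of_real (mpow x a))" for x
    unfolding c sum_distrib_right by (simp only: of_real_mult mult_ac)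
  then have "homog_poly m (\<lambda>x. r x y)"
    unfolding homog_poly_def by (intro exI[of _ "\<lambda>a. \<Sum>b\<in>multi_indices m. c a b * of_real (mpow y b)"]) simp
  then show "homog m (\<lambda>x. r x y)" by (rule homog_poly_imp_homog)
  have "r x y = (\<Sum>b\<in>multi_indices m. (\<Sum>a\<in>multi_indices m. c a b * of_real (mpow x a)) * of_real (mpow y b))" for y
    unfolding c sum_distrib_right by (subst sum.swap) (simp only: of_real_mult mult_ac)
  then have "homog_poly m (r x)"
    unfolding homog_poly_def by (intro exI[of _ "\<lambda>b. \<Sum>a\<in>multi_indices m. c a b * of_real (mpow x a)"]) simp
  then show "homog m (r x)" by (rule homog_poly_imp_homog)
qed

lemma bihomog_expansion_unique:
  assumes "bihomog_expansion K r" "bihomog_expansion K r'" "x \<in> ball 0 1" "y \<in> ball 0 1"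
  shows "r m x y = r' m x y"
proof (rule power_series_unique[of 1])
  fix t :: real assume t: "0 < t" "t < 1"
  have "t * norm x \<le> 1 * norm x" using t by (intro mult_right_mono) auto
  then have tx: "t *\<^sub>R x \<in> ball 0 1" using assms(3) t by simp
  have "(\<lambda>k. p k x y * of_real t ^ k) sums K (cplx_vec (t *\<^sub>R x), cplx_vec y)" if "bihomog_expansion K p" for p
  proof -
    have "homog k (\<lambda>x. p k x y)" for k using that bihomog_poly_homog(1) by (auto simp: bihomog_expansion_def)
    from homog_scaleR[OF this] have eq: "p k (t *\<^sub>R x) y = p k x y * of_real t ^ k" for k by (simp add: mult.commute)
    have "(\<lambda>k. p k (t *\<^sub>R x) y) sums K (cplx_vec (t *\<^sub>R x), cplx_vec y)"
      using that tx assms(4) unfolding bihomog_expansion_def by blast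
    then show ?thesis unfolding eq .
  qed
  then show "(\<lambda>k. r k x y * of_real t ^ k) sums K (cplx_vec (t *\<^sub>R x), cplx_vec y)"
     "(\<lambda>k. r' k x y * of_real t ^ k) sums K (cplx_vec (t *\<^sub>R x), cplx_vec y)"
    using assms by blast+
qed simp

lemma kernel_ext_rot:
  assumes K: "bihomog_expansion K r" and x: "x \<in> ball 0 1" and y: "y \<in> ball 0 1"
    and s: "(\<lambda>m. cis (real m * (\<psi> - \<phi>)) * r m x y) sums s"
  shows "kernel_ext K (rot \<psi> x, rot \<phi> y) = s"
  unfolding kernel_ext_def case_prod_conv
proof (rule the_equality)
  show "\<exists>r' \<psi>' x' \<phi>' y'. bihomog_expansion K r' \<and> x' \<in> ball 0 1 \<and> rot \<psi> x = rot \<psi>' x' \<and>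
      y' \<in> ball 0 1 \<and> rot \<phi> y = rot \<phi>' y' \<and> (\<lambda>m. cis (real m * (\<psi>' - \<phi>')) * r' m x' y') sums s"
    using assms by blast
  fix s' assume "\<exists>r' \<psi>' x' \<phi>' y'. bihomog_expansion K r' \<and> x' \<in> ball 0 1 \<and> rot \<psi> x = rot \<psi>' x' \<and>
      y' \<in> ball 0 1 \<and> rot \<phi> y = rot \<phi>' y' \<and> (\<lambda>m. cis (real m * (\<psi>' - \<phi>')) * r' m x' y') sums s'"
  then obtain r' \<psi>' x' \<phi>' y' where r': "bihomog_expansion K r'" "x' \<in> ball 0 1" "rot \<psi> x = rot \<psi>' x'"
      "y' \<in> ball 0 1" "rot \<phi> y = rot \<phi>' y'" "(\<lambda>m. cis (real m * (\<psi>' - \<phi>')) * r' m x' y') sums s'" by blast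
  have "cis (real m * (\<psi>' - \<phi>')) * r' m x' y' = cis (real m * (\<psi> - \<phi>)) * r m x y" for m
  proof -
    have rm: "bihomog_poly m (r m)" using K by (simp add: bihomog_expansion_def)
    have split: "cis (real m * (a - b)) = cis (real m * a) * cnj (cis (real m * b))" for a b
      by (simp add: cis_cnj cis_mult algebra_simps)
    have 1: "cis (real m * \<psi>') * r m x' y' = cis (real m * \<psi>) * r m x y'"
      using homog_rot_eq[OF bihomog_poly_homog(1)[OF rm] r'(3)] by simp
    have "cis (real m * \<phi>) * cnj (r m x y) = cis (real m * \<phi>') * cnj (r m x y')"
      using homog_rot_eq[OF homog_cnj[OF bihomog_poly_homog(2)[OF rm]] r'(5)] .
    then have "cnj (cis (real m * \<phi>) * cnj (r m x y)) = cnj (cis (real m * \<phi>') * cnj (r m x y'))" by simp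
    then have 2: "cnj (cis (real m * \<phi>')) * r m x y' = cnj (cis (real m * \<phi>)) * r m x y" by simp
    have "cis (real m * (\<psi>' - \<phi>')) * r' m x' y' = cnj (cis (real m * \<phi>')) * (cis (real m * \<psi>') * r m x' y')"
      unfolding split bihomog_expansion_unique[OF K r'(1,2,4), symmetric] by (simp only: mult_ac)
    also have "\<dots> = cis (real m * \<psi>) * (cnj (cis (real m * \<phi>')) * r m x y')" unfolding 1 by (simp only: mult_ac)
    also have "\<dots> = cis (real m * (\<psi> - \<phi>)) * r m x y" unfolding 2 split by (simp only: mult_ac)
    finally show ?thesis .
  qed
  with r'(6) s show "s' = s" by (simp add: sums_unique2)
qed

section \<open>Reproducing kernels of the spaces of harmonic polynomials\<close>

definition weighted_inner :: "(real ^ 'n \<Rightarrow> real) \<Rightarrow> (real ^ 'n \<Rightarrow> complex) \<Rightarrow> (real ^ 'n \<Rightarrow> complex) \<Rightarrow> complex" where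
  "weighted_inner \<omega> f g = (LINT y:ball 0 1|lborel. f y * cnj (g y) * complex_of_real (\<omega> y))"

lemma weighted_inner_integrable:
  assumes "radial_weight \<omega>" "homog m f" "homog l g"
  shows "set_integrable lborel (ball 0 1) (\<lambda>y. f y * cnj (g y) * complex_of_real (\<omega> y))"
  by (rule set_integrable_homog_weight[OF radial_weight_integrable[OF assms(1)] homog_mult[OF assms(2) homog_cnj[OF assms(3)]]])

lemma weighted_inner_cnj: "weighted_inner \<omega> g f = cnj (weighted_inner \<omega> f g)"
proof -
  have "cnj (weighted_inner \<omega> f g) = (LINT y|lborel. cnj (indicat_real (ball 0 1) y *\<^sub>R (f y * cnj (g y) * complex_of_real (\<omega> y))))"
    unfolding weighted_inner_def set_lebesgue_integral_def by (rule Bochner_Integration.integral_cnj[symmetric])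
  also have "\<dots> = weighted_inner \<omega> g f"
    unfolding weighted_inner_def set_lebesgue_integral_def by (simp add: mult_ac)
  finally show ?thesis ..
qed

lemma weighted_inner_scale: "weighted_inner \<omega> (\<lambda>x. c * f x) g = c * weighted_inner \<omega> f g"
  by (simp add: weighted_inner_def mult.assoc)

lemma weighted_inner_sum:
  assumes "radial_weight \<omega>" "\<And>a. a \<in> A \<Longrightarrow> homog m (f a)" "homog l g"
  shows "weighted_inner \<omega> (\<lambda>x. \<Sum>a\<in>A. c a * f a x) g = (\<Sum>a\<in>A. c a * weighted_inner \<omega> (f a) g)"
proof -
  have "weighted_inner \<omega> (\<lambda>x. \<Sum>a\<in>A. c a * f a x) g =
      (LINT y:ball 0 1|lborel. \<Sum>a\<in>A. c a * (f a y * cnj (g y) * complex_of_real (\<omega> y)))"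
    unfolding weighted_inner_def sum_distrib_right by (simp only: mult.assoc)
  also have "\<dots> = (\<Sum>a\<in>A. LINT y:ball 0 1|lborel. c a * (f a y * cnj (g y) * complex_of_real (\<omega> y)))"
    unfolding set_lebesgue_integral_def scaleR_sum_right
  proof (rule Bochner_Integration.integral_sum)
    fix a assume "a \<in> A"
    then show "integrable lborel (\<lambda>y. indicat_real (ball 0 1) y *\<^sub>R (c a * (f a y * cnj (g y) * complex_of_real (\<omega> y))))"
      using weighted_inner_integrable[OF assms(1) homog_scale[OF assms(2), of a "c a"] assms(3)]
      by (simp add: set_integrable_def mult.assoc)
  qed
  finally show ?thesis by (simp add: weighted_inner_def)
qed

lemma weighted_inner_diff:
  assumes "radial_weight \<omega>" "homog m f" "homog m' f'" "homog l g"
  shows "weighted_inner \<omega> (\<lambda>x. f x - f' x) g = weighted_inner \<omega> f g - weighted_inner \<omega> f' g"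
  unfolding weighted_inner_def
  using set_integral_diff(2)[OF weighted_inner_integrable[OF assms(1,2,4)] weighted_inner_integrable[OF assms(1,3,4)]]
  by (simp add: left_diff_distrib)

lemma weighted_inner_self: "radial_weight \<omega> \<Longrightarrow> homog m f \<Longrightarrow>
    weighted_inner \<omega> f f = of_real (LINT y:ball 0 1|lborel. (norm (f y))\<^sup>2 * \<omega> y)"
  unfolding weighted_inner_def by (rule set_integrable_norm_sq_weight(2)[OF radial_weight_integrable])

lemma weighted_inner_self_eq_0:
  assumes "radial_weight \<omega>" "homog m f" "weighted_inner \<omega> f f = 0"
  shows "f x = 0"
proof -
  have z: "(LINT y:ball 0 1|lborel. (norm (f y))\<^sup>2 * \<omega> y) = 0"
    using weighted_inner_self[OF assms(1,2)] assms(3) by simp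
  obtain C where "\<And>m f x. homog m f \<Longrightarrow> (norm (f x))\<^sup>2 * (1 / 2) ^ m \<le>
     C * norm x ^ (2 * m) * (LINT y:ball 0 1|lborel. (norm (f y))\<^sup>2 * \<omega> y)"
    using sup_le_weighted_norm[OF assms(1), of "1 / 2"] by auto
  from this[OF assms(2), of x] have "(norm (f x))\<^sup>2 * (1 / 2) ^ m \<le> 0" by (simp add: z)
  moreover have "(0 :: real) < (1 / 2) ^ m" by simp
  ultimately show ?thesis by (simp only: mult_le_0_iff) auto
qed

lemma weighted_inner_self_nonneg:
  assumes "radial_weight \<omega>"
  shows "0 \<le> (LINT y:ball 0 1|lborel. (norm (f y))\<^sup>2 * \<omega> y)"
  unfolding set_lebesgue_integral_def
  using radial_weight_nonneg[OF assms] by (intro Bochner_Integration.integral_nonneg) auto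

text \<open>The spanning statement is kept in the form of an expansion with the inner products as
  coefficients, so no notion of dimension is needed; a vector that already lies in the span is
  skipped.\<close>

lemma gram_schmidt:
  assumes \<omega>: "radial_weight \<omega>" and A: "finite A" "\<And>a. a \<in> A \<Longrightarrow> harmonic_poly j a"
  shows "\<exists>E. finite E \<and> (\<forall>e\<in>E. harmonic_poly j e) \<and>
     (\<forall>e\<in>E. \<forall>e'\<in>E. weighted_inner \<omega> e e' = (if e = e' then 1 else 0)) \<and>
     (\<forall>a\<in>A. \<forall>x. a x = (\<Sum>e\<in>E. weighted_inner \<omega> a e * e x))"
  using A
proof (induction A rule: finite_induct)
  case empty
  then show ?case by (intro exI[of _ "{}"]) auto
next
  case (insert a A)
  have "\<exists>E. finite E \<and> (\<forall>e\<in>E. harmonic_poly j e) \<and>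
     (\<forall>e\<in>E. \<forall>e'\<in>E. weighted_inner \<omega> e e' = (if e = e' then 1 else 0)) \<and>
     (\<forall>a\<in>A. \<forall>x. a x = (\<Sum>e\<in>E. weighted_inner \<omega> a e * e x))"
    by (rule insert.IH) (use insert.prems in simp)
  then obtain E where "finite E \<and> (\<forall>e\<in>E. harmonic_poly j e) \<and>
     (\<forall>e\<in>E. \<forall>e'\<in>E. weighted_inner \<omega> e e' = (if e = e' then 1 else 0)) \<and>
     (\<forall>a\<in>A. \<forall>x. a x = (\<Sum>e\<in>E. weighted_inner \<omega> a e * e x))" ..
  then have E: "finite E" "\<And>e. e \<in> E \<Longrightarrow> harmonic_poly j e"
     "\<And>e e'. e \<in> E \<Longrightarrow> e' \<in> E \<Longrightarrow> weighted_inner \<omega> e e' = (if e = e' then 1 else 0)"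
     "\<And>b x. b \<in> A \<Longrightarrow> b x = (\<Sum>e\<in>E. weighted_inner \<omega> b e * e x)" by simp_all
  have a: "harmonic_poly j a" using insert.prems by simp
  have hE: "homog j e" if "e \<in> E" for e using E(2)[OF that] by (simp add: harmonic_poly_def)
  have ha: "homog j a" using a by (simp add: harmonic_poly_def)
  define P where "P x = (\<Sum>e\<in>E. weighted_inner \<omega> a e * e x)" for x
  have hP: "homog j P" unfolding P_def using hE by (intro homog_sum homog_scale) auto
  define g where "g x = a x - P x" for x
  have hsumE: "harmonic_poly j (\<lambda>x. \<Sum>e\<in>B. c e * e x)" if "B \<subseteq> E" for B c
    using finite_subset[OF that E(1)] that
  proof (induction B rule: finite_induct)
    case empty
    then show ?case by (simp add: harmonic_poly_zero)
  next
    case (insert e B)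
    then have "harmonic_poly j (\<lambda>x. c e * e x + (\<Sum>e\<in>B. c e * e x))"
      using E(2) by (intro harmonic_poly_add harmonic_poly_scale) auto
    then show ?case using insert.hyps by simp
  qed
  have gP: "harmonic_poly j P" unfolding P_def by (rule hsumE) simp
  have g: "harmonic_poly j g"
    using harmonic_poly_add[OF a harmonic_poly_scale[OF gP, of "-1"]] by (simp add: g_def[abs_def])
  have hg: "homog j g" using g by (simp add: harmonic_poly_def)
  have g_orth: "weighted_inner \<omega> g e = 0" if e: "e \<in> E" for e
  proof -
    have "weighted_inner \<omega> P e = (\<Sum>e'\<in>E. weighted_inner \<omega> a e' * weighted_inner \<omega> e' e)"
      unfolding P_def using hE e by (intro weighted_inner_sum[OF \<omega>, of _ j _ j]) auto
    also have "\<dots> = (\<Sum>e'\<in>E. if e' = e then weighted_inner \<omega> a e' else 0)"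
      using E(3) e by (intro sum.cong) auto
    also have "\<dots> = weighted_inner \<omega> a e" using E(1) e by simp
    finally have "weighted_inner \<omega> P e = weighted_inner \<omega> a e" .
    moreover have "weighted_inner \<omega> g e = weighted_inner \<omega> a e - weighted_inner \<omega> P e"
      unfolding g_def by (rule weighted_inner_diff[OF \<omega> ha hP hE[OF e]])
    ultimately show ?thesis by simp
  qed
  show ?case
  proof (cases "weighted_inner \<omega> g g = 0")
    case True
    have "g x = 0" for x by (rule weighted_inner_self_eq_0[OF \<omega> hg True])
    then have "a x = (\<Sum>e\<in>E. weighted_inner \<omega> a e * e x)" for x by (simp add: g_def P_def)
    then show ?thesis using E by (intro exI[of _ E]) auto
  next
    case False
    define n2 where "n2 = (LINT y:ball 0 1|lborel. (norm (g y))\<^sup>2 * \<omega> y)"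
    have gg: "weighted_inner \<omega> g g = of_real n2" unfolding n2_def by (rule weighted_inner_self[OF \<omega> hg])
    have n2: "n2 > 0" using weighted_inner_self_nonneg[OF \<omega>, of g] False gg by (auto simp: n2_def less_le)
    define c where "c = complex_of_real (1 / sqrt n2)"
    have c: "c \<noteq> 0" "cnj c = c" "c * c * of_real n2 = 1"
    proof -
      show "c \<noteq> 0" "cnj c = c" using n2 by (auto simp: c_def)
      have "1 / sqrt n2 * (1 / sqrt n2) * n2 = 1" using n2 by (simp add: real_divide_square_eq)
      then show "c * c * of_real n2 = 1" unfolding c_def by (metis of_real_1 of_real_mult)
    qed
    define e0 where "e0 x = c * g x" for x
    have e0: "harmonic_poly j e0" unfolding e0_def by (rule harmonic_poly_scale[OF g])
    have he0: "homog j e0" using e0 by (simp add: harmonic_poly_def)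
    have w0: "weighted_inner \<omega> e0 f = c * weighted_inner \<omega> g f" for f unfolding e0_def by (rule weighted_inner_scale)
    have w1: "weighted_inner \<omega> f e0 = c * weighted_inner \<omega> f g" for f
      using weighted_inner_cnj[of \<omega> f e0] w0[of f] weighted_inner_cnj[of \<omega> f g] c(2) by simp
    have e00: "weighted_inner \<omega> e0 e0 = 1" unfolding w0 w1 gg using c(3) by (simp add: mult_ac)
    have e0e: "weighted_inner \<omega> e0 e = 0" "weighted_inner \<omega> e e0 = 0" if "e \<in> E" for e
      using g_orth[OF that] weighted_inner_cnj[of \<omega> e g] by (simp_all add: w0 w1)
    have nin: "e0 \<notin> E" using e0e(1)[of e0] e00 by auto
    show ?thesis
    proof (intro exI[of _ "insert e0 E"] conjI ballI allI)
      fix e e' assume "e \<in> insert e0 E" "e' \<in> insert e0 E"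
      then show "weighted_inner \<omega> e e' = (if e = e' then 1 else 0)"
        using E(3) e00 e0e nin by auto
    next
      fix b x assume b: "b \<in> insert a A"
      show "b x = (\<Sum>e\<in>insert e0 E. weighted_inner \<omega> b e * e x)"
      proof (cases "b \<in> A")
        case True
        have "b = (\<lambda>x. \<Sum>e\<in>E. weighted_inner \<omega> b e * e x)" using E(4)[OF True] by (rule ext)
        from arg_cong[OF this, of "\<lambda>f. weighted_inner \<omega> f e0"]
        have "weighted_inner \<omega> b e0 = weighted_inner \<omega> (\<lambda>x. \<Sum>e\<in>E. weighted_inner \<omega> b e * e x) e0" .
        also have "\<dots> = (\<Sum>e\<in>E. weighted_inner \<omega> b e * weighted_inner \<omega> e e0)"
          using hE by (intro weighted_inner_sum[OF \<omega> _ he0]) auto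
        also have "\<dots> = 0" using e0e(2) by simp
        finally show ?thesis using E(1) nin E(4)[OF True, of x] by simp
      next
        case False
        with b have "b = a" by simp
        have "weighted_inner \<omega> g e0 = weighted_inner \<omega> a e0 - weighted_inner \<omega> P e0"
          unfolding g_def by (rule weighted_inner_diff[OF \<omega> ha hP he0])
        moreover have "weighted_inner \<omega> P e0 = (\<Sum>e\<in>E. weighted_inner \<omega> a e * weighted_inner \<omega> e e0)"
          unfolding P_def using hE by (intro weighted_inner_sum[OF \<omega> _ he0]) auto
        moreover have "(\<Sum>e\<in>E. weighted_inner \<omega> a e * weighted_inner \<omega> e e0) = 0"
          by (intro sum.neutral ballI) (simp only: e0e(2) mult_zero_right)
        ultimately have "weighted_inner \<omega> a e0 = weighted_inner \<omega> g e0" by simp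
        then have "weighted_inner \<omega> a e0 * e0 x = (c * c * of_real n2) * g x"
          unfolding w1[of g] gg e0_def by (simp only: mult_ac)
        then have "weighted_inner \<omega> a e0 * e0 x = g x" unfolding c(3) by simp
        then show ?thesis using E(1) nin \<open>b = a\<close> by (simp add: g_def P_def)
      qed
    qed (use E e0 in auto)
  qed
qed

text \<open>The harmonic parts of the monomials span: if \<open>f\<close> is harmonic, the non-harmonic Fischer
  components of its monomials add up to a harmonic polynomial that is orthogonal to itself.\<close>

lemma harmonic_poly_finite_span:
  assumes \<omega>: "radial_weight (\<omega> :: real ^ 'n \<Rightarrow> real)"
  shows "\<exists>A. finite A \<and> (\<forall>a\<in>A. harmonic_poly j a) \<and>
     (\<forall>f :: real ^ 'n \<Rightarrow> complex. harmonic_poly j f \<longrightarrow> (\<exists>c. \<forall>x. f x = (\<Sum>a\<in>A. c a * a x)))"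
proof -
  have "\<forall>a. \<exists>H. a \<in> multi_indices j \<longrightarrow> (\<forall>k\<le>j div 2. harmonic_poly (j - 2 * k) (H k)) \<and>
     (\<forall>x :: real ^ 'n. complex_of_real (mpow x a) = (\<Sum>k\<le>j div 2. complex_of_real (norm x ^ (2 * k)) * H k x))"
  proof
    fix a :: "'n \<Rightarrow> nat"
    show "\<exists>H. a \<in> multi_indices j \<longrightarrow> (\<forall>k\<le>j div 2. harmonic_poly (j - 2 * k) (H k)) \<and>
     (\<forall>x :: real ^ 'n. complex_of_real (mpow x a) = (\<Sum>k\<le>j div 2. complex_of_real (norm x ^ (2 * k)) * H k x))"
      using fischer_decomposition[OF homog_mpow[of a]] by (cases "a \<in> multi_indices j") (auto simp: multi_indices_def)
  qed
  from choice[OF this] obtain H where "\<forall>a. a \<in> multi_indices j \<longrightarrow> (\<forall>k\<le>j div 2. harmonic_poly (j - 2 * k) (H a k)) \<and>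
     (\<forall>x :: real ^ 'n. complex_of_real (mpow x a) = (\<Sum>k\<le>j div 2. complex_of_real (norm x ^ (2 * k)) * H a k x))" by blast
  then have H: "\<And>a k. a \<in> multi_indices j \<Longrightarrow> k \<le> j div 2 \<Longrightarrow> harmonic_poly (j - 2 * k) (H a k)"
     "\<And>a x. a \<in> multi_indices j \<Longrightarrow> complex_of_real (mpow x a) = (\<Sum>k\<le>j div 2. complex_of_real (norm x ^ (2 * k)) * H a k x)"
    by blast+
  have fin: "finite (multi_indices j :: ('n \<Rightarrow> nat) set)" by (rule finite_multi_indices)
  have span: "\<exists>c. \<forall>x. f x = (\<Sum>a\<in>multi_indices j. c a * H a 0 x)" if f: "harmonic_poly j f" for f
  proof -
    have hf: "homog j f" using f by (simp add: harmonic_poly_def)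
    obtain c where c: "\<And>x. f x = (\<Sum>a\<in>multi_indices j. c a * complex_of_real (mpow x a))"
      using homog_imp_homog_poly[OF hf] unfolding homog_poly_def by blast
    define G where "G k x = (\<Sum>a\<in>multi_indices j. c a * H a k x)" for k x
    have G: "harmonic_poly (j - 2 * k) (G k)" if k: "k \<le> j div 2" for k
    proof -
      have hH: "homog (j - 2 * k) (\<lambda>x. c a * H a k x)" if "a \<in> multi_indices j" for a
        using H(1)[OF that k] by (auto simp: harmonic_poly_def intro: homog_scale)
      have "laplacian (\<lambda>x. c a * H a k x) x = 0" if "a \<in> multi_indices j" for a x
        using harmonic_poly_scale[OF H(1)[OF that k], of "c a"] by (simp add: harmonic_poly_def)
      then have "laplacian (G k) x = 0" for x
        unfolding G_def[abs_def] using laplacian_sum[OF fin hH] by simp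
      moreover have "homog (j - 2 * k) (G k)" unfolding G_def using hH by (intro homog_sum) auto
      ultimately show ?thesis by (simp add: harmonic_poly_def)
    qed
    have fG: "f x = (\<Sum>k\<le>j div 2. complex_of_real (norm x ^ (2 * k)) * G k x)" for x
    proof -
      have "f x = (\<Sum>a\<in>multi_indices j. \<Sum>k\<le>j div 2. complex_of_real (norm x ^ (2 * k)) * (c a * H a k x))"
        unfolding c by (intro sum.cong refl) (simp add: H(2) sum_distrib_left mult_ac)
      also have "\<dots> = (\<Sum>k\<le>j div 2. \<Sum>a\<in>multi_indices j. complex_of_real (norm x ^ (2 * k)) * (c a * H a k x))"
        by (rule sum.swap)
      finally show ?thesis by (simp add: G_def sum_distrib_left)
    qed
    define r where "r x = f x - G 0 x" for x
    have G0: "harmonic_poly j (G 0)" using G[of 0] by simp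
    have r: "harmonic_poly j r"
      using harmonic_poly_add[OF f harmonic_poly_scale[OF G0, of "-1"]] by (simp add: r_def[abs_def])
    have hr: "homog j r" using r by (simp add: harmonic_poly_def)
    have r_eq: "r x = (\<Sum>k\<in>{1..j div 2}. complex_of_real (norm x ^ (2 * k)) * G k x)" for x
    proof -
      have "(\<Sum>k\<le>j div 2. complex_of_real (norm x ^ (2 * k)) * G k x) = G 0 x + (\<Sum>k\<in>{1..j div 2}. complex_of_real (norm x ^ (2 * k)) * G k x)"
        by (subst sum.atMost_shift) (simp add: sum.atLeast1_atMost_eq)
      then show ?thesis by (simp add: r_def fG)
    qed
    have hnG: "homog j (\<lambda>x. complex_of_real (norm x ^ (2 * k)) * G k x)" if "k \<in> {1..j div 2}" for k
    proof -
      have "homog (2 * k + (j - 2 * k)) (\<lambda>x. complex_of_real (norm x ^ (2 * k)) * G k x)"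
        using G[of k] that by (intro homog_mult homog_norm_power) (auto simp: harmonic_poly_def)
      moreover have "2 * k + (j - 2 * k) = j" using that by auto
      ultimately show ?thesis by simp
    qed
    obtain w where w: "\<omega> = (\<lambda>y. w (norm y))" "w \<in> borel_measurable borel" "\<And>s. 0 \<le> w s"
      using \<omega> unfolding radial_weight_def by blast
    have orth: "weighted_inner \<omega> (\<lambda>x. complex_of_real (norm x ^ (2 * k)) * G k x) r = 0" if k: "k \<in> {1..j div 2}" for k
    proof -
      have deg: "j - 2 * k \<noteq> j" using k by auto
      have "(LINT y:ball 0 1|lborel. G k y * cnj (r y) * of_real (norm y ^ (2 * k) * w (norm y))) = 0"
      proof (rule harmonic_poly_orthogonal[OF G harmonic_poly_cnj[OF r] deg, where w = "\<lambda>s. s ^ (2 * k) * w s"])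
        show "set_integrable lborel (ball 0 1) (\<lambda>y :: real ^ 'n. norm y ^ (2 * k) * w (norm y))"
          using set_integrable_norm_sq_weight(1)[OF radial_weight_integrable[OF \<omega>] homog_norm_power[of "k"]]
            set_integrable_homog_weight[OF radial_weight_integrable[OF \<omega>] homog_norm_power[of "k"]]
          using complex_of_real_integrable_eq[of lborel "\<lambda>y :: real ^ 'n. indicat_real (ball 0 1) y *\<^sub>R (norm y ^ (2 * k) * w (norm y))"]
          by (simp add: set_integrable_def w(1) scaleR_conv_of_real)
      qed (use k w in \<open>auto intro!: borel_measurable_times\<close>)
      then show ?thesis by (simp add: weighted_inner_def w(1) mult_ac)
    qed
    have "r = (\<lambda>x. \<Sum>k\<in>{1..j div 2}. 1 * (complex_of_real (norm x ^ (2 * k)) * G k x))"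
      using r_eq by (simp only: mult_1 fun_eq_iff simp_thms)
    from arg_cong[OF this, of "\<lambda>f. weighted_inner \<omega> f r"]
    have "weighted_inner \<omega> r r = weighted_inner \<omega> (\<lambda>x. \<Sum>k\<in>{1..j div 2}. 1 * (complex_of_real (norm x ^ (2 * k)) * G k x)) r" .
    also have "\<dots> = (\<Sum>k\<in>{1..j div 2}. 1 * weighted_inner \<omega> (\<lambda>x. complex_of_real (norm x ^ (2 * k)) * G k x) r)"
      by (rule weighted_inner_sum[OF \<omega> hnG hr])
    also have "\<dots> = 0" using orth by simp
    finally have "r x = 0" for x by (rule weighted_inner_self_eq_0[OF \<omega> hr])
    then show ?thesis by (intro exI[of _ c]) (simp add: r_def G_def)
  qed
  let ?A = "(\<lambda>a. H a 0) ` multi_indices j"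
  have "\<exists>c. \<forall>x. f x = (\<Sum>a\<in>?A. c a * a x)" if f: "harmonic_poly j f" for f
  proof -
    obtain c where c: "\<And>x. f x = (\<Sum>a\<in>multi_indices j. c a * H a 0 x)" using span[OF f] by blast
    have "(\<Sum>a\<in>multi_indices j. c a * H a 0 x) = (\<Sum>b\<in>?A. (\<Sum>a\<in>{a \<in> multi_indices j. H a 0 = b}. c a) * b x)" for x
      unfolding sum_distrib_right
      by (subst sum.image_gen[OF fin, of _ "\<lambda>a. H a 0"]) (intro sum.cong refl, auto)
    with c show ?thesis by auto
  qed
  moreover have "\<forall>a\<in>?A. harmonic_poly j a" using H(1)[of _ 0] by auto
  ultimately show ?thesis using fin by (intro exI[of _ ?A]) auto
qed

lemma orthonormal_basis:
  assumes \<omega>: "radial_weight (\<omega> :: real ^ 'n \<Rightarrow> real)"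
  shows "\<exists>E. finite E \<and> (\<forall>e\<in>E. harmonic_poly j e) \<and>
     (\<forall>f. harmonic_poly j f \<longrightarrow> (\<forall>x. f x = (\<Sum>e\<in>E. weighted_inner \<omega> f e * e x)))"
proof -
  from harmonic_poly_finite_span[OF \<omega>, of j]
  obtain A where "finite A \<and> (\<forall>a\<in>A. harmonic_poly j a) \<and>
     (\<forall>f :: real ^ 'n \<Rightarrow> complex. harmonic_poly j f \<longrightarrow> (\<exists>c. \<forall>x. f x = (\<Sum>a\<in>A. c a * a x)))" ..
  then have A: "finite A" "\<And>a. a \<in> A \<Longrightarrow> harmonic_poly j a"
     "\<And>f :: real ^ 'n \<Rightarrow> complex. harmonic_poly j f \<Longrightarrow> \<exists>c. \<forall>x. f x = (\<Sum>a\<in>A. c a * a x)" by simp_all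
  from gram_schmidt[OF \<omega> A(1,2)] obtain E where "finite E \<and> (\<forall>e\<in>E. harmonic_poly j e) \<and>
     (\<forall>e\<in>E. \<forall>e'\<in>E. weighted_inner \<omega> e e' = (if e = e' then 1 else 0)) \<and>
     (\<forall>a\<in>A. \<forall>x. a x = (\<Sum>e\<in>E. weighted_inner \<omega> a e * e x))" ..
  then have E: "finite E" "\<And>e. e \<in> E \<Longrightarrow> harmonic_poly j e"
     "\<And>a x. a \<in> A \<Longrightarrow> a x = (\<Sum>e\<in>E. weighted_inner \<omega> a e * e x)" by simp_all
  have "f x = (\<Sum>e\<in>E. weighted_inner \<omega> f e * e x)" if f: "harmonic_poly j f" for f x
  proof -
    obtain c where c: "\<And>x. f x = (\<Sum>a\<in>A. c a * a x)" using A(3)[OF f] by blast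
    have wf: "weighted_inner \<omega> f e = (\<Sum>a\<in>A. c a * weighted_inner \<omega> a e)" if "e \<in> E" for e
    proof -
      have "f = (\<lambda>x. \<Sum>a\<in>A. c a * a x)" using c by (rule ext)
      from arg_cong[OF this, of "\<lambda>f. weighted_inner \<omega> f e"]
      have "weighted_inner \<omega> f e = weighted_inner \<omega> (\<lambda>x. \<Sum>a\<in>A. c a * a x) e" .
      also have "\<dots> = (\<Sum>a\<in>A. c a * weighted_inner \<omega> a e)"
        using A(2) E(2)[OF that] by (intro weighted_inner_sum[OF \<omega>, of _ j _ j]) (auto simp: harmonic_poly_def)
      finally show ?thesis .
    qed
    have "f x = (\<Sum>a\<in>A. c a * (\<Sum>e\<in>E. weighted_inner \<omega> a e * e x))" using c[of x] E(3)[of _ x] by simp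
    also have "\<dots> = (\<Sum>e\<in>E. \<Sum>a\<in>A. c a * weighted_inner \<omega> a e * e x)"
      by (subst sum.swap) (simp add: sum_distrib_left mult.assoc)
    also have "\<dots> = (\<Sum>e\<in>E. weighted_inner \<omega> f e * e x)"
      by (intro sum.cong refl) (simp add: wf sum_distrib_right)
    finally show ?thesis .
  qed
  with E(1,2) show ?thesis by (intro exI[of _ E]) auto
qed

definition harmonic_onb :: "(real ^ 'n \<Rightarrow> real) \<Rightarrow> nat \<Rightarrow> (real ^ 'n \<Rightarrow> complex) set" where
  "harmonic_onb \<omega> j = (SOME E. finite E \<and> (\<forall>e\<in>E. harmonic_poly j e) \<and>
     (\<forall>f. harmonic_poly j f \<longrightarrow> (\<forall>x. f x = (\<Sum>e\<in>E. weighted_inner \<omega> f e * e x))))"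

definition zonal :: "(real ^ 'n \<Rightarrow> real) \<Rightarrow> nat \<Rightarrow> real ^ 'n \<Rightarrow> real ^ 'n \<Rightarrow> complex" where
  "zonal \<omega> j x y = (\<Sum>e\<in>harmonic_onb \<omega> j. e x * cnj (e y))"

context
  fixes \<omega> :: "real ^ 'n \<Rightarrow> real"
  assumes \<omega>: "radial_weight \<omega>"
begin

lemma harmonic_onb:
  "finite (harmonic_onb \<omega> j)" "e \<in> harmonic_onb \<omega> j \<Longrightarrow> harmonic_poly j e"
  "harmonic_poly j f \<Longrightarrow> f x = (\<Sum>e\<in>harmonic_onb \<omega> j. weighted_inner \<omega> f e * e x)"
  using someI_ex[OF orthonormal_basis[OF \<omega>, of j], folded harmonic_onb_def] by simp_all

lemma zonal_bihomog: "bihomog_poly j (zonal \<omega> j)"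
proof -
  have "\<exists>c. e \<in> harmonic_onb \<omega> j \<longrightarrow> (\<forall>x. e x = (\<Sum>a\<in>multi_indices j. c a * complex_of_real (mpow x a)))" for e
    using harmonic_onb(2)[of e j] homog_imp_homog_poly[of j e] by (auto simp: harmonic_poly_def homog_poly_def)
  then have "\<forall>e. \<exists>c. e \<in> harmonic_onb \<omega> j \<longrightarrow> (\<forall>x. e x = (\<Sum>a\<in>multi_indices j. c a * complex_of_real (mpow x a)))" by blast
  from choice[OF this] obtain c where
    c: "\<And>e x. e \<in> harmonic_onb \<omega> j \<Longrightarrow> e x = (\<Sum>a\<in>multi_indices j. c e a * complex_of_real (mpow x a))" by blast
  have "zonal \<omega> j x y = (\<Sum>a\<in>multi_indices j. \<Sum>b\<in>multi_indices j.
      (\<Sum>e\<in>harmonic_onb \<omega> j. c e a * cnj (c e b)) * complex_of_real (mpow x a * mpow y b))" for x y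
  proof -
    have "zonal \<omega> j x y = (\<Sum>e\<in>harmonic_onb \<omega> j. \<Sum>a\<in>multi_indices j. \<Sum>b\<in>multi_indices j.
        c e a * cnj (c e b) * complex_of_real (mpow x a * mpow y b))"
      unfolding zonal_def
    proof (intro sum.cong refl)
      fix e assume e: "e \<in> harmonic_onb \<omega> j"
      have ey: "cnj (e y) = (\<Sum>b\<in>multi_indices j. cnj (c e b) * complex_of_real (mpow y b))"
        by (simp add: c[OF e, of y])
      have "e x * cnj (e y) = (\<Sum>a\<in>multi_indices j. \<Sum>b\<in>multi_indices j.
          c e a * complex_of_real (mpow x a) * (cnj (c e b) * complex_of_real (mpow y b)))"
        unfolding ey c[OF e, of x] by (rule sum_product)
      also have "\<dots> = (\<Sum>a\<in>multi_indices j. \<Sum>b\<in>multi_indices j. c e a * cnj (c e b) * complex_of_real (mpow x a * mpow y b))"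
        by (intro sum.cong refl) (simp only: of_real_mult mult_ac)
      finally show "e x * cnj (e y) = (\<Sum>a\<in>multi_indices j. \<Sum>b\<in>multi_indices j. c e a * cnj (c e b) * complex_of_real (mpow x a * mpow y b))" .
    qed
    also have "\<dots> = (\<Sum>a\<in>multi_indices j. \<Sum>e\<in>harmonic_onb \<omega> j. \<Sum>b\<in>multi_indices j.
        c e a * cnj (c e b) * complex_of_real (mpow x a * mpow y b))"
      by (rule sum.swap)
    also have "\<dots> = (\<Sum>a\<in>multi_indices j. \<Sum>b\<in>multi_indices j. \<Sum>e\<in>harmonic_onb \<omega> j.
        c e a * cnj (c e b) * complex_of_real (mpow x a * mpow y b))"
      by (intro sum.cong refl sum.swap)
    finally show ?thesis by (simp add: sum_distrib_right)
  qed
  then show ?thesis unfolding bihomog_poly_def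
    by (intro exI[of _ "\<lambda>a b. \<Sum>e\<in>harmonic_onb \<omega> j. c e a * cnj (c e b)"]) simp
qed

lemma zonal_harmonic: "harmonic_poly j (\<lambda>x. zonal \<omega> j x y)"
proof -
  have "laplacian (\<lambda>x. \<Sum>e\<in>harmonic_onb \<omega> j. cnj (e y) * e x) x = (\<Sum>e\<in>harmonic_onb \<omega> j. laplacian (\<lambda>x. cnj (e y) * e x) x)" for x
    using harmonic_onb(2) by (intro laplacian_sum[of _ j] harmonic_onb(1) homog_scale) (auto simp: harmonic_poly_def)
  also have "\<dots> x = 0" for x
    using harmonic_poly_scale[OF harmonic_onb(2)] by (intro sum.neutral) (auto simp: harmonic_poly_def)
  finally have "laplacian (\<lambda>x. zonal \<omega> j x y) x = 0" for x by (simp add: zonal_def mult.commute)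
  moreover have "homog j (\<lambda>x. zonal \<omega> j x y)" by (rule bihomog_poly_homog(1)[OF zonal_bihomog])
  ultimately show ?thesis by (simp add: harmonic_poly_def)
qed

lemma zonal_reproducing:
  assumes f: "harmonic_poly j f"
  shows "weighted_inner \<omega> f (\<lambda>x. zonal \<omega> j x y) = f y"
proof -
  have hf: "homog j f" using f by (simp add: harmonic_poly_def)
  have "weighted_inner \<omega> (\<lambda>x. \<Sum>e\<in>harmonic_onb \<omega> j. cnj (e y) * e x) f =
      (\<Sum>e\<in>harmonic_onb \<omega> j. cnj (e y) * weighted_inner \<omega> e f)"
    by (rule weighted_inner_sum[OF \<omega> _ hf]) (use harmonic_onb(2) in \<open>auto simp: harmonic_poly_def\<close>)
  then have "weighted_inner \<omega> (\<lambda>x. zonal \<omega> j x y) f = (\<Sum>e\<in>harmonic_onb \<omega> j. cnj (e y) * weighted_inner \<omega> e f)"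
    by (simp add: zonal_def mult.commute)
  then have "weighted_inner \<omega> f (\<lambda>x. zonal \<omega> j x y) = cnj (\<Sum>e\<in>harmonic_onb \<omega> j. cnj (e y) * weighted_inner \<omega> e f)"
    using weighted_inner_cnj[of \<omega> f "\<lambda>x. zonal \<omega> j x y"] by simp
  also have "\<dots> = (\<Sum>e\<in>harmonic_onb \<omega> j. weighted_inner \<omega> f e * e y)"
    by (simp add: weighted_inner_cnj[of \<omega> f, symmetric] mult.commute)
  finally show ?thesis using harmonic_onb(3)[OF f, of y] by simp
qed

text \<open>For fixed \<open>y\<close> the reproducing property gives \<open>N = zonal \<omega> j y y\<close> for the square norm \<open>N\<close> of the
  section; the pointwise bound at \<open>y\<close> then bounds \<open>N\<close> itself, and the pointwise bound at \<open>x\<close> the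
  kernel.\<close>

lemma zonal_bound:
  assumes r: "0 < r" "r < 1"
  shows "\<exists>C\<ge>0. \<forall>j x y. norm (zonal \<omega> j x y) \<le> C * (norm x * norm y / r) ^ j"
proof -
  obtain C where C: "C > 0" "\<And>m f x. homog m f \<Longrightarrow> (norm (f x))\<^sup>2 * r ^ m \<le>
     C * norm x ^ (2 * m) * (LINT y:ball 0 1|lborel. (norm (f y))\<^sup>2 * \<omega> y)"
    using sup_le_weighted_norm[OF \<omega> r] by blast
  have "norm (zonal \<omega> j x y) \<le> C * (norm x * norm y / r) ^ j" for j x y
  proof -
    define f where "f x = zonal \<omega> j x y" for x
    have f: "harmonic_poly j f" unfolding f_def by (rule zonal_harmonic)
    have hf: "homog j f" using f by (simp add: harmonic_poly_def)
    define N where "N = (LINT y:ball 0 1|lborel. (norm (f y))\<^sup>2 * \<omega> y)"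
    have N0: "N \<ge> 0" unfolding N_def by (rule weighted_inner_self_nonneg[OF \<omega>])
    have "f y = of_real N"
      using zonal_reproducing[OF f, of y] weighted_inner_self[OF \<omega> hf] unfolding f_def[symmetric] N_def by simp
    then have "N\<^sup>2 * r ^ j \<le> C * norm y ^ (2 * j) * N" using C(2)[OF hf, of y] N0 by (simp add: N_def)
    then have "N * (N * r ^ j) \<le> N * (C * norm y ^ (2 * j))" by (simp add: power2_eq_square mult_ac)
    then have Nr: "N * r ^ j \<le> C * norm y ^ (2 * j)"
      using N0 C(1) by (cases "N = 0") auto
    have "(norm (f x))\<^sup>2 * r ^ j * r ^ j \<le> C * norm x ^ (2 * j) * N * r ^ j"
      using C(2)[OF hf, of x] r unfolding N_def by (intro mult_right_mono) auto
    also have "\<dots> = C * norm x ^ (2 * j) * (N * r ^ j)" by (simp only: mult.assoc)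
    also have "\<dots> \<le> C * norm x ^ (2 * j) * (C * norm y ^ (2 * j))" using Nr C(1) by (intro mult_left_mono) auto
    finally have "(norm (f x) * r ^ j)\<^sup>2 \<le> (C * (norm x * norm y) ^ j)\<^sup>2"
      by (simp add: power_mult_distrib power_mult power2_eq_square mult_ac)
    then have "norm (f x) * r ^ j \<le> C * (norm x * norm y) ^ j"
      by (rule power2_le_imp_le) (use C(1) in auto)
    then show ?thesis using r by (simp add: f_def power_divide field_simps)
  qed
  with C(1) show ?thesis by (intro exI[of _ C]) auto
qed

end

section \<open>The weights\<close>

lemma radial_weight_mult_power:
  assumes "radial_weight (\<omega> :: real ^ 'n \<Rightarrow> real)"
  shows "radial_weight (\<lambda>y. norm y ^ (4 * k) * \<omega> y)"
proof -
  obtain w where w: "\<omega> = (\<lambda>y. w (norm y))" "w \<in> borel_measurable borel" "\<And>s. 0 \<le> w s"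
    "\<forall>r<1. \<exists>a b c. r < a \<and> a < b \<and> b < 1 \<and> 0 < c \<and> (\<forall>s. a < s \<and> s < b \<longrightarrow> c \<le> w s)"
    using assms unfolding radial_weight_def by blast
  show ?thesis unfolding radial_weight_def
  proof (intro conjI exI[of _ "\<lambda>s. s ^ (4 * k) * w s"] allI impI)
    have "homog (2 * (2 * k)) (\<lambda>y :: real ^ 'n. complex_of_real (norm y ^ (2 * (2 * k))))"
      by (rule homog_norm_power)
    from set_integrable_homog_weight[OF radial_weight_integrable[OF assms] this]
    have "integrable lborel (\<lambda>y. complex_of_real (indicat_real (ball 0 1) y *\<^sub>R (norm y ^ (4 * k) * \<omega> y)))"
      by (simp add: set_integrable_def scaleR_conv_of_real)
    then show "set_integrable lborel (ball 0 1) (\<lambda>y. norm y ^ (4 * k) * \<omega> y)"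
      unfolding complex_of_real_integrable_eq set_integrable_def .
    fix r :: real assume "r < 1"
    then have "max r (1 / 2) < 1" by simp
    with w(4) obtain a b c where abc: "max r (1 / 2) < a" "a < b" "b < 1" "0 < c" "\<forall>s. a < s \<and> s < b \<longrightarrow> c \<le> w s"
      by blast
    have "a ^ (4 * k) * c \<le> s ^ (4 * k) * w s" if "a < s" "s < b" for s
      using abc that by (intro mult_mono power_mono) auto
    moreover have "0 < a ^ (4 * k) * c" using abc by simp
    ultimately show "\<exists>a b c. r < a \<and> a < b \<and> b < 1 \<and> 0 < c \<and> (\<forall>s. a < s \<and> s < b \<longrightarrow> c \<le> s ^ (4 * k) * w s)"
      using abc by (intro exI[of _ a] exI[of _ b] exI[of _ "a ^ (4 * k) * c"]) auto
  next
    show "0 \<le> s ^ (4 * k) * w s" for s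
      using w(3)[of s] zero_le_even_power[of "4 * k" s] by simp
    show "(\<lambda>s. s ^ (4 * k) * w s) \<in> borel_measurable borel" using w(2) by measurable
  qed (simp add: w(1))
qed

lemma bergman_weight_mult_power:
  "bergman_weight (\<alpha> + 4 * real k) \<beta> y = norm y ^ (4 * k) * bergman_weight \<alpha> \<beta> y"
proof (cases "y = 0")
  case False
  then have "norm y powr (4 * real k) = norm y ^ (4 * k)"
    using powr_realpow[of "norm y" "4 * k"] by simp
  then show ?thesis by (simp add: bergman_weight_def powr_add)
qed (simp add: bergman_weight_def)

text \<open>In polar coordinates the integral is dominated by the Beta integral with parameters
  \<open>n + \<alpha>\<close> and \<open>\<beta> + 1\<close>; this is where the conditions on \<open>\<alpha>\<close> and \<open>\<beta>\<close> enter.\<close>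

lemma bergman_weight_integrable:
  assumes \<alpha>: "real CARD('n) + \<alpha> > 0" and \<beta>: "\<beta> > -1"
  shows "set_integrable lborel (ball 0 1) (bergman_weight \<alpha> \<beta> :: real ^ 'n \<Rightarrow> real)"
proof -
  define n where "n = CARD('n)"
  have n: "n > 0" by (simp add: n_def)
  define w where "w s = s powr \<alpha> * (1 - s\<^sup>2) powr \<beta>" for s :: real
  have [measurable]: "w \<in> borel_measurable borel" unfolding w_def by measurable
  have [measurable]: "ball (0 :: real ^ 'n) 1 \<in> sets borel" by simp
  define I where "I = measure lborel (cball (0 :: real ^ 'n) 1)"
  have I: "emeasure lborel (cball (0 :: real ^ 'n) 1) = ennreal I" "0 \<le> I"
  proof -
    have "emeasure lborel (cball (0 :: real ^ 'n) 1) \<noteq> top"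
      using emeasure_lborel_cball_finite[of "0 :: real ^ 'n" 1] by (metis less_irrefl infinity_ennreal_def)
    then show "emeasure lborel (cball (0 :: real ^ 'n) 1) = ennreal I"
      unfolding I_def by (rule emeasure_eq_ennreal_measure)
  qed (simp add: I_def)
  define G where "G s = s powr (real n + \<alpha> - 1) * (1 - s) powr (\<beta> + 1 - 1)" for s :: real
  have G: "(G has_integral Beta (real n + \<alpha>) (\<beta> + 1)) {0..1}"
    unfolding G_def using assms by (intro has_integral_Beta_real) (auto simp: n_def)
  have bound: "real n * s ^ (n - 1) * w s \<le> real n * 2 powr \<bar>\<beta>\<bar> * G s" if s: "0 \<le> s" "s \<le> 1" for s
  proof (cases "s = 0")
    case True
    then show ?thesis by (simp add: w_def G_def)
  next
    case False
    with s have s0: "0 < s" by simp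
    have "s ^ (n - 1) = s powr (real n - 1)" using powr_realpow[OF s0, of "n - 1"] n by (simp add: of_nat_diff)
    then have 1: "s ^ (n - 1) * s powr \<alpha> = s powr (real n + \<alpha> - 1)"
      by (simp add: powr_add[symmetric] algebra_simps)
    have "1 - s\<^sup>2 = (1 - s) * (1 + s)" by (simp add: power2_eq_square algebra_simps)
    then have 2: "(1 - s\<^sup>2) powr \<beta> = (1 - s) powr \<beta> * (1 + s) powr \<beta>"
      using s by (simp add: powr_mult)
    have "(1 + s) powr \<beta> \<le> (1 + s) powr \<bar>\<beta>\<bar>" using s by (intro powr_mono) auto
    also have "\<dots> \<le> 2 powr \<bar>\<beta>\<bar>" using s by (intro powr_mono2) auto
    finally have 3: "(1 + s) powr \<beta> \<le> 2 powr \<bar>\<beta>\<bar>" .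
    have "real n * s ^ (n - 1) * w s = real n * (s powr (real n + \<alpha> - 1) * (1 - s) powr \<beta>) * (1 + s) powr \<beta>"
      unfolding w_def 2 1[symmetric] by (simp only: mult_ac)
    also have "\<dots> \<le> real n * (s powr (real n + \<alpha> - 1) * (1 - s) powr \<beta>) * 2 powr \<bar>\<beta>\<bar>"
      using 3 by (intro mult_left_mono) auto
    finally show ?thesis by (simp add: G_def mult_ac)
  qed
  have "(\<integral>\<^sup>+y. ennreal (norm (indicat_real (ball 0 1) y *\<^sub>R (bergman_weight \<alpha> \<beta> y :: real))) \<partial>(lborel :: (real ^ 'n) measure))
      \<le> (\<integral>\<^sup>+y. ennreal 1 * indicator (cball (0 :: real ^ 'n) 1) y * ennreal (w (norm y)) \<partial>lborel)"
    by (intro nn_integral_mono) (auto simp: indicator_def bergman_weight_def w_def)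
  also have "\<dots> = ennreal I * (\<integral>\<^sup>+s. ennreal (real (0 + CARD('n)) * s ^ (0 + CARD('n) - 1)) * indicator {0..1} s * ennreal (w s) \<partial>lborel)"
    by (rule nn_integral_radial[where d = 0 and \<omega> = "\<lambda>s. ennreal (w s)" and q = "\<lambda>_. 1"]) (simp_all add: I)
  also have "\<dots> \<le> ennreal I * (\<integral>\<^sup>+s. ennreal (real n * 2 powr \<bar>\<beta>\<bar>) * (ennreal (G s) * indicator {0..1} s) \<partial>lborel)"
  proof (intro mult_left_mono nn_integral_mono)
    fix s :: real
    show "ennreal (real (0 + CARD('n)) * s ^ (0 + CARD('n) - 1)) * indicator {0..1} s * ennreal (w s)
        \<le> ennreal (real n * 2 powr \<bar>\<beta>\<bar>) * (ennreal (G s) * indicator {0..1} s)"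
    proof (cases "0 \<le> s \<and> s \<le> 1")
      case True
      have "ennreal (real n * s ^ (n - 1)) * ennreal (w s) = ennreal (real n * s ^ (n - 1) * w s)"
        using True by (intro ennreal_mult[symmetric]) (auto simp: w_def)
      also have "\<dots> \<le> ennreal (real n * 2 powr \<bar>\<beta>\<bar> * G s)"
        using bound True by (intro ennreal_leI) auto
      also have "\<dots> = ennreal (real n * 2 powr \<bar>\<beta>\<bar>) * ennreal (G s)"
        by (intro ennreal_mult) (auto simp: G_def)
      finally show ?thesis using True by (simp add: n_def)
    qed (auto simp: indicator_def)
  qed auto
  also have "\<dots> = ennreal I * (ennreal (real n * 2 powr \<bar>\<beta>\<bar>) * ennreal (Beta (real n + \<alpha>) (\<beta> + 1)))"
  proof -
    have [measurable]: "G \<in> borel_measurable borel" unfolding G_def by measurable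
    have "(\<integral>\<^sup>+s. ennreal (G s) * indicator {0..1} s \<partial>lborel) = ennreal (Beta (real n + \<alpha>) (\<beta> + 1))"
      by (rule nn_integral_has_integral_lebesgue'[OF _ G]) (auto simp: G_def)
    then show ?thesis by (subst nn_integral_cmult) auto
  qed
  also have "\<dots> < \<infinity>" by (simp add: ennreal_mult_less_top)
  finally show ?thesis
    unfolding set_integrable_def
    by (intro integrableI_bounded) (auto simp: bergman_weight_def)
qed

lemma radial_weight_bergman_weight:
  assumes "real CARD('n) + \<alpha> > 0" "\<beta> > -1"
  shows "radial_weight (bergman_weight \<alpha> \<beta> :: real ^ 'n \<Rightarrow> real)"
  unfolding radial_weight_def
proof (intro conjI bergman_weight_integrable assms exI[of _ "\<lambda>s. s powr \<alpha> * (1 - s\<^sup>2) powr \<beta>"] allI impI)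
  fix r :: real assume "r < 1"
  define r' where "r' = max r 0"
  have r': "0 \<le> r'" "r \<le> r'" "r' < 1" using \<open>r < 1\<close> by (auto simp: r'_def)
  define a where "a = (2 * r' + 1) / 3"
  define b where "b = (r' + 2) / 3"
  have ab: "0 < a" "r < a" "a < b" "b < 1" using r' by (auto simp: a_def b_def)
  have pos: "0 < 1 - s\<^sup>2" if "s \<in> {a..b}" for s
  proof -
    have "s * s < 1 * 1" using that ab by (intro mult_strict_mono) auto
    then show ?thesis by (simp add: power2_eq_square)
  qed
  have "\<exists>s\<in>{a..b}. \<forall>t\<in>{a..b}. s powr \<alpha> * (1 - s\<^sup>2) powr \<beta> \<le> t powr \<alpha> * (1 - t\<^sup>2) powr \<beta>"
    using ab pos by (intro continuous_attains_inf continuous_intros) force+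
  then obtain s where s: "s \<in> {a..b}" "\<And>t. t \<in> {a..b} \<Longrightarrow> s powr \<alpha> * (1 - s\<^sup>2) powr \<beta> \<le> t powr \<alpha> * (1 - t\<^sup>2) powr \<beta>"
    by auto
  have "0 < s powr \<alpha> * (1 - s\<^sup>2) powr \<beta>" using pos[OF s(1)] s(1) ab by auto
  with ab s(2) show "\<exists>a b c. r < a \<and> a < b \<and> b < 1 \<and> 0 < c \<and> (\<forall>s. a < s \<and> s < b \<longrightarrow> c \<le> s powr \<alpha> * (1 - s\<^sup>2) powr \<beta>)"
    by (intro exI[of _ a] exI[of _ b] exI[of _ "s powr \<alpha> * (1 - s\<^sup>2) powr \<beta>"]) auto
qed (auto simp: bergman_weight_def fun_eq_iff)

section \<open>Polyharmonic functions on rotated balls\<close>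

definition twist :: "real \<Rightarrow> (nat \<Rightarrow> real ^ 'n \<Rightarrow> complex) \<Rightarrow> nat \<Rightarrow> real ^ 'n \<Rightarrow> complex" where
  "twist \<psi> q j x = cis (real j * \<psi>) * q j x"

text \<open>The value at \<open>e^(i\<psi>) x\<close> of the function with harmonic components \<open>h\<close>.\<close>

definition almansi_rot :: "nat \<Rightarrow> (nat \<Rightarrow> nat \<Rightarrow> real ^ 'n \<Rightarrow> complex) \<Rightarrow> real \<Rightarrow> real ^ 'n \<Rightarrow> complex" where
  "almansi_rot p h \<psi> x = (\<Sum>k<p. cis (2 * real k * \<psi>) * (complex_of_real (norm x ^ (2 * k)) * hsum (twist \<psi> (h k)) x))"

lemma growth_twist: "growth R q \<Longrightarrow> growth R (twist \<psi> q)"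
  unfolding growth_def twist_def[abs_def] by (auto intro: homog_scale simp: norm_mult)

lemma hsum_continuous: "growth R q \<Longrightarrow> continuous_on (ball 0 R) (hsum q)"
  by (rule real_analytic_continuous[OF growth_imp_real_analytic open_ball])

lemma almansi_rot_continuous:
  "(\<And>k. k < p \<Longrightarrow> growth R (h k)) \<Longrightarrow> continuous_on (ball 0 R) (almansi_rot p h \<psi>)"
  unfolding almansi_rot_def[abs_def]
  by (intro continuous_intros hsum_continuous growth_twist) auto

lemma hol_ext_almansi:
  assumes h: "\<And>k. k < p \<Longrightarrow> growth 1 (h k)"
    and u: "\<And>x. x \<in> ball 0 1 \<Longrightarrow> u x = hsum (almansi p h) x" and x: "x \<in> ball 0 1"
  shows "hol_ext u (rot \<psi> x) = almansi_rot p h \<psi> x"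
proof (rule hol_ext_rot[OF _ x])
  have ga: "growth 1 (almansi p h)" by (rule growth_almansi[OF h])
  show "homog_expansion u (almansi p h)"
    unfolding homog_expansion_def homog_poly_iff using growth_homog[OF ga] growth_summable(3)[OF ga] u by auto
  have "(\<lambda>m. \<Sum>k<p. cis (2 * real k * \<psi>) * (if 2 * k \<le> m then cis (real (m - 2 * k) * \<psi>) *
      (complex_of_real (norm x ^ (2 * k)) * h k (m - 2 * k) x) else 0)) sums almansi_rot p h \<psi> x"
    unfolding almansi_rot_def
  proof (intro sums_sum sums_mult sums_norm_power_shift[where a = "\<lambda>j. cis (real j * \<psi>)"])
    fix k assume "k \<in> {..<p}"
    then have "growth 1 (h k)" using h by simp
    from growth_summable(3)[OF growth_twist[OF this], of x \<psi>] x
    show "(\<lambda>j. cis (real j * \<psi>) * h k j x) sums hsum (twist \<psi> (h k)) x" by (simp add: twist_def)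
  qed
  also have "(\<lambda>m. \<Sum>k<p. cis (2 * real k * \<psi>) * (if 2 * k \<le> m then cis (real (m - 2 * k) * \<psi>) *
      (complex_of_real (norm x ^ (2 * k)) * h k (m - 2 * k) x) else 0)) = (\<lambda>m. cis (real m * \<psi>) * almansi p h m x)"
  proof
    fix m
    have "cis (2 * real k * \<psi>) * cis (real (m - 2 * k) * \<psi>) = cis (real m * \<psi>)" if "2 * k \<le> m" for k
      using that by (simp add: cis_mult of_nat_diff algebra_simps)
    then show "(\<Sum>k<p. cis (2 * real k * \<psi>) * (if 2 * k \<le> m then cis (real (m - 2 * k) * \<psi>) *
      (complex_of_real (norm x ^ (2 * k)) * h k (m - 2 * k) x) else 0)) = cis (real m * \<psi>) * almansi p h m x"
      unfolding almansi_def sum_distrib_left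
      by (intro sum.cong refl) (simp add: mult.assoc[symmetric] del: of_real_power)
  qed
  finally show "(\<lambda>m. cis (real m * \<psi>) * almansi p h m x) sums almansi_rot p h \<psi> x" .
qed

lemma hat_ballI: "k < p \<Longrightarrow> y \<in> ball 0 1 \<Longrightarrow> rot (real k * pi / real p) y \<in> hat_ball p"
  unfolding hat_ball_def by blast

lemma hat_ballE: "z \<in> hat_ball p \<Longrightarrow> \<exists>\<psi> x. z = rot \<psi> x \<and> x \<in> ball 0 1"
  unfolding hat_ball_def by blast

lemma bergman_space_expansion:
  assumes "U \<in> bergman_space p \<omega>"
  shows "\<exists>g. (\<forall>k<p. \<forall>j. harmonic_poly j (g k j)) \<and> (\<forall>k<p. growth 1 (g k)) \<and>
     (\<forall>\<psi> x. x \<in> ball 0 1 \<and> rot \<psi> x \<in> hat_ball p \<longrightarrow> U (rot \<psi> x) = almansi_rot p g \<psi> x)"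
proof -
  obtain u where u: "u \<in> polyharmonic p" "\<And>z. z \<in> hat_ball p \<Longrightarrow> U z = hol_ext u z"
    using assms unfolding bergman_space_def by blast
  obtain g where g: "\<forall>k<p. \<forall>j. harmonic_poly j (g k j)" "\<forall>k<p. growth 1 (g k)"
     "\<forall>x\<in>ball 0 1. u x = hsum (almansi p g) x"
    using polyharmonic_expansion[OF u(1)] by blast
  have "hol_ext u (rot \<psi> x) = almansi_rot p g \<psi> x" if "x \<in> ball 0 1" for \<psi> x
    by (rule hol_ext_almansi) (use g that in auto)
  with u(2) g show ?thesis by (intro exI[of _ g]) auto
qed

section \<open>Orthogonality on rotated balls\<close>

lemma sum_cis_roots:
  assumes "k < p" "l < p"
  shows "(\<Sum>s<p. cis (2 * (real l - real k) * (real s * pi / real p))) = (if l = k then of_nat p else 0)"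
proof (cases "l = k")
  case False
  have p: "p > 0" using assms by simp
  define a where "a l = exp (2 * complex_of_real pi * \<i> * of_nat l / of_nat p)" for l
  have ap: "a l ^ p = 1" "a l \<noteq> 0" for l
    using complex_root_unity[of p l] p by (auto simp: a_def)
  have "a l \<noteq> a k" using complex_root_unity_eq[of p l k] assms False p by (simp add: a_def)
  then have z1: "a l / a k \<noteq> 1" using ap(2)[of k] by simp
  have "cis (2 * (real l - real k) * (real s * pi / real p)) = (a l / a k) ^ s" for s
  proof -
    have "a l / a k = exp (\<i> * of_real (2 * (real l - real k) * (pi / real p)))"
      unfolding a_def exp_diff[symmetric]
      by (rule arg_cong[where f = exp]) (simp add: diff_divide_distrib algebra_simps)
    also have "\<dots> = cis (2 * (real l - real k) * (pi / real p))" by (simp only: cis_conv_exp)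
    finally show ?thesis by (simp add: Complex.DeMoivre mult_ac)
  qed
  then have "(\<Sum>s<p. cis (2 * (real l - real k) * (real s * pi / real p))) = (\<Sum>s<p. (a l / a k) ^ s)" by simp
  also have "\<dots> = 0" by (subst geometric_sum[OF z1]) (simp add: power_divide ap(1))
  finally show ?thesis using False by simp
qed simp

lemma weighted_inner_scale_right: "weighted_inner \<omega> f (\<lambda>x. c * g x) = cnj c * weighted_inner \<omega> f g"
  using weighted_inner_cnj[of \<omega> f "\<lambda>x. c * g x"] weighted_inner_scale[of \<omega> c g f] weighted_inner_cnj[of \<omega> f g] by simp

text \<open>The weight vanishes near the sphere, so the series converges uniformly where it matters and only
  the term of degree \<open>j\<close> survives.\<close>

lemma integral_twist_harmonic:
  fixes q :: "nat \<Rightarrow> real ^ 'n \<Rightarrow> complex"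
  assumes q: "growth 1 q" "\<And>i. harmonic_poly i (q i)" and Y: "harmonic_poly j Y"
    and v: "v \<in> borel_measurable borel" "\<And>s. 0 \<le> v s" and \<rho>: "\<rho> < 1" "\<And>s. \<rho> \<le> s \<Longrightarrow> v s = 0"
    and int: "set_integrable lborel (ball 0 1) (\<lambda>y :: real ^ 'n. v (norm y))"
  shows "(LINT y:ball 0 1|lborel. hsum (twist \<theta> q) y * cnj (Y y) * of_real (v (norm y))) =
     cis (real j * \<theta>) * (LINT y:ball 0 1|lborel. q j y * cnj (Y y) * of_real (v (norm y)))"
    and "set_integrable lborel (ball 0 1) (\<lambda>y. hsum (twist \<theta> q) y * cnj (Y y) * of_real (v (norm y)))"
proof -
  have Yh: "homog j Y" using Y by (simp add: harmonic_poly_def)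
  obtain M where M: "M \<ge> 0" "\<And>x. norm (Y x) \<le> M * norm x ^ j" using homog_bounded[OF Yh] by blast
  obtain B where B: "summable B" "\<And>m x. norm x \<le> \<rho> \<Longrightarrow> norm (q m x) \<le> B m" "\<And>m. 0 \<le> B m"
    using growth_uniform[OF q(1) \<rho>(1)] by auto
  define f where "f i y = twist \<theta> q i y * cnj (Y y) * of_real (v (norm y))" for i y
  have f_eq: "f i y = cis (real i * \<theta>) * (q i y * cnj (Y y) * of_real (v (norm y)))" for i y
    by (simp add: f_def twist_def mult.assoc)
  have hqY: "homog (i + j) (\<lambda>y. q i y * cnj (Y y))" for i
    by (intro homog_mult homog_cnj Yh growth_homog[OF q(1)])
  have fi: "set_integrable lborel (ball 0 1) (f i)" for i
    unfolding f_eq[abs_def] by (intro set_integrable_mult_right set_integrable_homog_weight[OF int hqY])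
  have g: "set_integrable lborel (ball 0 1) (\<lambda>y :: real ^ 'n. M * v (norm y))"
    using int by (intro set_integrable_mult_right) auto
  have bd: "norm (f i y) \<le> B i * (M * v (norm y))" if "norm y < 1" for i y
  proof (cases "norm y \<le> \<rho>")
    case True
    have "M * norm y ^ j \<le> M * 1" using that M(1) by (intro mult_left_mono power_le_one) auto
    with M(2)[of y] have "norm (Y y) \<le> M" by simp
    then have "norm (q i y) * norm (Y y) * v (norm y) \<le> B i * M * v (norm y)"
      using B(2)[OF True, of i] B(3)[of i] v(2) by (intro mult_right_mono mult_mono) auto
    then show ?thesis using v(2) by (simp add: f_eq norm_mult mult.assoc)
  next
    case False
    then show ?thesis using \<rho>(2)[of "norm y"] by (simp add: f_def)
  qed
  have pt: "(\<Sum>i. f i y) = hsum (twist \<theta> q) y * cnj (Y y) * of_real (v (norm y))" if "norm y < 1" for y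
  proof -
    have "(\<lambda>i. f i y) sums (hsum (twist \<theta> q) y * (cnj (Y y) * of_real (v (norm y))))"
      unfolding f_def mult.assoc using growth_summable(3)[OF growth_twist[OF q(1)] that] by (rule sums_mult2)
    then show ?thesis by (simp add: sums_iff mult.assoc)
  qed
  have eq: "indicat_real (ball 0 1) y *\<^sub>R (\<Sum>i. f i y) =
      indicat_real (ball 0 1) y *\<^sub>R (hsum (twist \<theta> q) y * cnj (Y y) * of_real (v (norm y)))" for y
    by (cases "norm y < 1") (simp_all add: pt)
  show "set_integrable lborel (ball 0 1) (\<lambda>y. hsum (twist \<theta> q) y * cnj (Y y) * of_real (v (norm y)))"
    using suminf_integrable_ball[OF g fi bd B(1)] unfolding set_integrable_def eq .
  have "(\<lambda>i. LINT y:ball 0 1|lborel. f i y) sums (LINT y:ball 0 1|lborel. hsum (twist \<theta> q) y * cnj (Y y) * of_real (v (norm y)))"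
    using sums_integral_ball[OF g fi bd B(1)] unfolding set_lebesgue_integral_def eq .
  moreover have "(\<lambda>i. LINT y:ball 0 1|lborel. f i y) sums (\<Sum>i\<in>{j}. LINT y:ball 0 1|lborel. f i y)"
  proof (rule sums_finite)
    fix i assume "i \<notin> {j}"
    then have "i \<noteq> j" by simp
    from harmonic_poly_orthogonal[OF q(2) harmonic_poly_cnj[OF Y] this v int]
    show "(LINT y:ball 0 1|lborel. f i y) = 0" unfolding f_eq by simp
  qed simp
  ultimately have "(LINT y:ball 0 1|lborel. hsum (twist \<theta> q) y * cnj (Y y) * of_real (v (norm y))) = (LINT y:ball 0 1|lborel. f j y)"
    by (simp add: sums_unique2)
  then show "(LINT y:ball 0 1|lborel. hsum (twist \<theta> q) y * cnj (Y y) * of_real (v (norm y))) =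
     cis (real j * \<theta>) * (LINT y:ball 0 1|lborel. q j y * cnj (Y y) * of_real (v (norm y)))"
    unfolding f_eq by simp
qed

lemma integral_ball_exhaustion:
  fixes F :: "real ^ 'n \<Rightarrow> complex"
  assumes F: "set_integrable lborel (ball 0 1) F"
  shows "(\<lambda>n. LINT y:ball 0 1|lborel. F y * of_real (indicat_real {..<1 - inverse (real (Suc n))} (norm y)))
     \<longlonglongrightarrow> (LINT y:ball 0 1|lborel. F y)"
  unfolding set_lebesgue_integral_def
proof (rule integral_dominated_convergence)
  let ?I = "\<lambda>n. indicat_real {..<1 - inverse (real (Suc n))}"
  have F': "integrable lborel (\<lambda>y. indicat_real (ball 0 1) y *\<^sub>R F y)" using F by (simp add: set_integrable_def)
  then show "(\<lambda>y. indicat_real (ball 0 1) y *\<^sub>R F y) \<in> borel_measurable lborel" by simp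
  show "integrable lborel (\<lambda>y. norm (indicat_real (ball 0 1) y *\<^sub>R F y))" using F' by (rule integrable_norm)
  show "(\<lambda>y. indicat_real (ball 0 1) y *\<^sub>R (F y * of_real (?I n (norm y)))) \<in> borel_measurable lborel" for n
  proof -
    have "(\<lambda>y. (indicat_real (ball 0 1) y *\<^sub>R F y) * complex_of_real (?I n (norm y))) \<in> borel_measurable lborel"
      using F' by measurable
    then show ?thesis by simp
  qed
  show "AE y in lborel. (\<lambda>n. indicat_real (ball 0 1) y *\<^sub>R (F y * of_real (?I n (norm y)))) \<longlonglongrightarrow> indicat_real (ball 0 1) y *\<^sub>R F y"
  proof (rule AE_I2)
    fix y :: "real ^ 'n"
    show "(\<lambda>n. indicat_real (ball 0 1) y *\<^sub>R (F y * of_real (?I n (norm y)))) \<longlonglongrightarrow> indicat_real (ball 0 1) y *\<^sub>R F y"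
    proof (cases "norm y < 1")
      case True
      have "(\<lambda>n. inverse (real (Suc n))) \<longlonglongrightarrow> 0" by (rule LIMSEQ_inverse_real_of_nat)
      then have "\<forall>\<^sub>F n in sequentially. inverse (real (Suc n)) < 1 - norm y"
        using True by (intro order_tendstoD) auto
      then have "\<forall>\<^sub>F n in sequentially. indicat_real (ball 0 1) y *\<^sub>R (F y * of_real (?I n (norm y))) = indicat_real (ball 0 1) y *\<^sub>R F y"
        by eventually_elim (simp add: indicator_def)
      then show ?thesis by (rule tendsto_eventually)
    qed simp
  qed
  show "AE y in lborel. norm (indicat_real (ball 0 1) y *\<^sub>R (F y * of_real (?I n (norm y)))) \<le> norm (indicat_real (ball 0 1) y *\<^sub>R F y)" for n
    by (intro AE_I2) (simp add: indicator_def)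
qed

text \<open>The weight has finite mass, so square integrability implies integrability, by
  \<open>a \<le> 1 + a\<^sup>2\<close>.\<close>

lemma bergman_space_integrable:
  fixes U :: "complex ^ 'n \<Rightarrow> complex"
  assumes \<omega>: "radial_weight \<omega>" and U: "U \<in> bergman_space p \<omega>" and s: "s < p"
  shows "set_integrable lborel (ball 0 1) (\<lambda>y. U (rot (real s * pi / real p) y) * of_real (\<omega> y))"
proof -
  define \<theta> where "\<theta> = real s * pi / real p"
  obtain g where g: "\<forall>k<p. growth 1 (g k)" "\<forall>\<psi> x. x \<in> ball 0 1 \<and> rot \<psi> x \<in> hat_ball p \<longrightarrow> U (rot \<psi> x) = almansi_rot p g \<psi> x"
    using bergman_space_expansion[OF U] by blast
  have Ug: "U (rot \<theta> y) = almansi_rot p g \<theta> y" if "y \<in> ball 0 1" for y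
    using g(2) hat_ballI[OF s that] that unfolding \<theta>_def by blast
  have "continuous_on (ball 0 1) (almansi_rot p g \<theta>)" using g(1) by (intro almansi_rot_continuous) auto
  then have "continuous_on (ball 0 1) (\<lambda>y. U (rot \<theta> y))"
    by (rule continuous_on_eq) (rule Ug[symmetric])
  then have meas: "(\<lambda>y. indicat_real (ball 0 1) y *\<^sub>R U (rot \<theta> y)) \<in> borel_measurable lborel"
    using set_borel_measurable_ball_continuous unfolding set_borel_measurable_def by blast
  have sq: "integrable lborel (\<lambda>y. indicat_real (ball 0 1) y *\<^sub>R (bergman_integrand p \<omega> U U s y))"
    using U s unfolding bergman_space_def set_integrable_def by blast
  have [measurable]: "\<omega> \<in> borel_measurable borel" by (rule radial_weight_measurable[OF \<omega>])
  show ?thesis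
    unfolding set_integrable_def \<theta>_def[symmetric]
  proof (rule Bochner_Integration.integrable_bound)
    show "integrable lborel (\<lambda>y. indicat_real (ball 0 1) y *\<^sub>R \<omega> y + norm (indicat_real (ball 0 1) y *\<^sub>R bergman_integrand p \<omega> U U s y))"
      using sq radial_weight_integrable[OF \<omega>]
      by (intro Bochner_Integration.integrable_add integrable_norm) (auto simp: set_integrable_def)
    have "(\<lambda>y. (indicat_real (ball 0 1) y *\<^sub>R U (rot \<theta> y)) * complex_of_real (\<omega> y)) \<in> borel_measurable lborel"
      using meas by measurable
    then show "(\<lambda>y. indicat_real (ball 0 1) y *\<^sub>R (U (rot \<theta> y) * complex_of_real (\<omega> y))) \<in> borel_measurable lborel"
      by simp
    show "AE y in lborel. norm (indicat_real (ball 0 1) y *\<^sub>R (U (rot \<theta> y) * complex_of_real (\<omega> y))) \<le>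
       norm (indicat_real (ball 0 1) y *\<^sub>R \<omega> y + norm (indicat_real (ball 0 1) y *\<^sub>R bergman_integrand p \<omega> U U s y))"
    proof (rule AE_I2)
      fix y :: "real ^ 'n"
      show "norm (indicat_real (ball 0 1) y *\<^sub>R (U (rot \<theta> y) * complex_of_real (\<omega> y))) \<le>
         norm (indicat_real (ball 0 1) y *\<^sub>R \<omega> y + norm (indicat_real (ball 0 1) y *\<^sub>R bergman_integrand p \<omega> U U s y))"
      proof (cases "norm y < 1")
        case True
        define a where "a = norm (U (rot \<theta> y))"
        have w0: "0 \<le> \<omega> y" by (rule radial_weight_nonneg[OF \<omega>])
        have "a \<le> 1 + a * a"
        proof (cases "a \<le> 1")
          case True
          then show ?thesis using zero_le_square[of a] by linarith
        next
          case False
          then have "a * 1 \<le> a * a" by (intro mult_left_mono) auto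
          then show ?thesis by simp
        qed
        then have "a * \<omega> y \<le> (1 + a * a) * \<omega> y" using w0 by (rule mult_right_mono)
        then have "a * \<omega> y \<le> \<omega> y + a * a * \<omega> y" by (simp add: algebra_simps)
        then show ?thesis using True w0
          by (simp add: norm_mult bergman_integrand_def \<theta>_def[symmetric] a_def)
      qed simp
    qed
  qed
qed

lemma set_integrable_mult_continuous:
  fixes G X :: "real ^ 'n \<Rightarrow> complex"
  assumes G: "set_integrable lborel (ball 0 1) G" and c: "continuous_on (ball 0 1) X"
    and X: "\<And>y. norm y < 1 \<Longrightarrow> norm (X y) \<le> K"
  shows "set_integrable lborel (ball 0 1) (\<lambda>y. X y * G y)"
  unfolding set_integrable_def
proof (rule Bochner_Integration.integrable_bound)
  have G': "integrable lborel (\<lambda>y. indicat_real (ball 0 1) y *\<^sub>R G y)" using G by (simp add: set_integrable_def)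
  then show "integrable lborel (\<lambda>y. K * norm (indicat_real (ball 0 1) y *\<^sub>R G y))"
    by (intro integrable_mult_right integrable_norm)
  have "(\<lambda>y. indicat_real (ball 0 1) y *\<^sub>R X y) \<in> borel_measurable lborel"
    using set_borel_measurable_ball_continuous[OF c] by (simp add: set_borel_measurable_def)
  then have "(\<lambda>y. (indicat_real (ball 0 1) y *\<^sub>R X y) * (indicat_real (ball 0 1) y *\<^sub>R G y)) \<in> borel_measurable lborel"
    using G' by measurable
  also have "(\<lambda>y. (indicat_real (ball 0 1) y *\<^sub>R X y) * (indicat_real (ball 0 1) y *\<^sub>R G y)) =
      (\<lambda>y. indicat_real (ball 0 1) y *\<^sub>R (X y * G y))"
    by (auto simp: indicator_def fun_eq_iff)
  finally show "(\<lambda>y. indicat_real (ball 0 1) y *\<^sub>R (X y * G y)) \<in> borel_measurable lborel" .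
  have "norm (X y * G y) \<le> K * norm (G y)" if "norm y < 1" for y
    unfolding norm_mult by (rule mult_right_mono[OF X[OF that] norm_ge_zero])
  moreover have "K * norm (G y) \<le> norm (K * norm (G y))" for y by simp
  ultimately have "norm (X y * G y) \<le> norm (K * norm (G y))" if "norm y < 1" for y
    using that by (meson order_trans)
  then show "AE y in lborel. norm (indicat_real (ball 0 1) y *\<^sub>R (X y * G y)) \<le> norm (K * norm (indicat_real (ball 0 1) y *\<^sub>R G y))"
    by (intro AE_I2) (simp add: indicator_def)
qed

text \<open>Averaging over the rotations separates the components \<open>|x|^(2k) g\<close> with different \<open>k\<close>, as
  their phases differ by \<open>p\<close>-th roots of unity, and orthogonality of harmonic polynomials separates
  the degrees.  The series may diverge on the sphere, so both are applied on smaller balls first.\<close>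

lemma bergman_component:
  fixes U :: "complex ^ 'n \<Rightarrow> complex"
  assumes \<omega>: "radial_weight \<omega>" and U: "U \<in> bergman_space p \<omega>"
    and g: "\<And>k j. k < p \<Longrightarrow> harmonic_poly j (g k j)" "\<And>k. k < p \<Longrightarrow> growth 1 (g k)"
      "\<And>\<psi> x. x \<in> ball 0 1 \<Longrightarrow> rot \<psi> x \<in> hat_ball p \<Longrightarrow> U (rot \<psi> x) = almansi_rot p g \<psi> x"
    and k: "k < p" and Y: "harmonic_poly j Y"
  shows "(\<Sum>s<p. LINT y:ball 0 1|lborel. U (rot (real s * pi / real p) y) *
      cnj (cis (real (2 * k + j) * (real s * pi / real p)) * (of_real (norm y ^ (2 * k)) * Y y)) * of_real (\<omega> y)) =
    of_nat p * weighted_inner (\<lambda>y. norm y ^ (4 * k) * \<omega> y) (g k j) Y"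
proof -
  define \<theta> where "\<theta> s = real s * pi / real p" for s
  have Yh: "homog j Y" using Y by (simp add: harmonic_poly_def)
  obtain w where w: "\<omega> = (\<lambda>y. w (norm y))" "w \<in> borel_measurable borel" "\<And>s. 0 \<le> w s"
    using \<omega> unfolding radial_weight_def by blast
  define X where "X s y = cnj (cis (real (2 * k + j) * \<theta> s) * (of_real (norm y ^ (2 * k)) * Y y))" for s and y :: "real ^ 'n"
  define F where "F s y = U (rot (\<theta> s) y) * X s y * of_real (\<omega> y)" for s y
  have hX: "homog (2 * k + j) (X s)" for s
    unfolding X_def[abs_def] by (intro homog_cnj homog_scale homog_mult homog_norm_power Yh)
  have F_int: "set_integrable lborel (ball 0 1) (F s)" if s: "s < p" for s
  proof -
    obtain M where M: "M \<ge> 0" "\<And>x. norm (X s x) \<le> M * norm x ^ (2 * k + j)" using homog_bounded[OF hX] by blast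
    have "set_integrable lborel (ball 0 1) (\<lambda>y. X s y * (U (rot (\<theta> s) y) * of_real (\<omega> y)))"
    proof (rule set_integrable_mult_continuous)
      show "set_integrable lborel (ball 0 1) (\<lambda>y. U (rot (\<theta> s) y) * of_real (\<omega> y))"
        unfolding \<theta>_def by (rule bergman_space_integrable[OF \<omega> U s])
      show "continuous_on (ball 0 1) (X s)" by (rule homog_continuous[OF hX])
      show "norm (X s y) \<le> M" if "norm y < 1" for y
      proof -
        have "M * norm y ^ (2 * k + j) \<le> M * 1" using that M(1) by (intro mult_left_mono power_le_one) auto
        with M(2)[of y] show ?thesis by linarith
      qed
    qed
    then show ?thesis by (simp add: F_def[abs_def] mult_ac)
  qed
  define \<rho> where "\<rho> n = 1 - inverse (real (Suc n))" for n
  have \<rho>1: "\<rho> n < 1" for n by (simp add: \<rho>_def)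
  define v where "v n l s = indicat_real {..<\<rho> n} s * (s ^ (2 * l + 2 * k) * w s)" for n l s
  have v: "v n l \<in> borel_measurable borel" "0 \<le> v n l s" "\<rho> n \<le> s \<Longrightarrow> v n l s = 0" for n l s
  proof -
    show "v n l \<in> borel_measurable borel" unfolding v_def[abs_def] using w(2) by measurable
    show "0 \<le> v n l s" unfolding v_def using w(3)[of s] zero_le_even_power[of "2 * l + 2 * k" s] by simp
    show "\<rho> n \<le> s \<Longrightarrow> v n l s = 0" by (simp add: v_def)
  qed
  have v_int: "set_integrable lborel (ball 0 1) (\<lambda>y :: real ^ 'n. v n l (norm y))" for n l
    unfolding set_integrable_def
  proof (rule Bochner_Integration.integrable_bound)
    show "integrable lborel (\<lambda>y. indicat_real (ball 0 1) y *\<^sub>R \<omega> y)"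
      using radial_weight_integrable[OF \<omega>] by (simp add: set_integrable_def)
    have [measurable]: "ball (0 :: real ^ 'n) 1 \<in> sets borel" by simp
    show "(\<lambda>y :: real ^ 'n. indicat_real (ball 0 1) y *\<^sub>R v n l (norm y)) \<in> borel_measurable lborel"
      using v(1)[of n l] by measurable
    show "AE y in lborel. norm (indicat_real (ball 0 1) y *\<^sub>R v n l (norm (y :: real ^ 'n))) \<le> norm (indicat_real (ball 0 1) y *\<^sub>R \<omega> y)"
    proof (rule AE_I2)
      fix y :: "real ^ 'n"
      show "norm (indicat_real (ball 0 1) y *\<^sub>R v n l (norm y)) \<le> norm (indicat_real (ball 0 1) y *\<^sub>R \<omega> y)"
      proof (cases "norm y < 1")
        case True
        have "norm y ^ (2 * l + 2 * k) * w (norm y) \<le> 1 * w (norm y)"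
          using True w(3) by (intro mult_right_mono power_le_one) auto
        then have "v n l (norm y) \<le> w (norm y)" using w(3)[of "norm y"] by (simp add: v_def indicator_def)
        then show ?thesis using True v(2)[of n l "norm y"] by (simp add: w(1))
      qed simp
    qed
  qed
  define W where "W n l = (LINT y:ball 0 1|lborel. g l j y * cnj (Y y) * of_real (v n l (norm y)))" for n l
  have trunc: "(\<Sum>s<p. LINT y:ball 0 1|lborel. F s y * of_real (indicat_real {..<\<rho> n} (norm y))) = of_nat p * W n k" for n
  proof -
    have Fs: "(LINT y:ball 0 1|lborel. F s y * of_real (indicat_real {..<\<rho> n} (norm y))) =
        (\<Sum>l<p. cis (2 * (real l - real k) * \<theta> s) * W n l)" if s: "s < p" for s
    proof -
      define c where "c l = cis (2 * real l * \<theta> s) * cnj (cis (real (2 * k + j) * \<theta> s))" for l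
      have "(LINT y:ball 0 1|lborel. F s y * of_real (indicat_real {..<\<rho> n} (norm y))) =
          (LINT y:ball 0 1|lborel. \<Sum>l<p. c l * (hsum (twist (\<theta> s) (g l)) y * cnj (Y y) * of_real (v n l (norm y))))"
        unfolding set_lebesgue_integral_def
      proof (intro Bochner_Integration.integral_cong refl)
        fix y :: "real ^ 'n"
        show "indicat_real (ball 0 1) y *\<^sub>R (F s y * of_real (indicat_real {..<\<rho> n} (norm y))) =
          indicat_real (ball 0 1) y *\<^sub>R (\<Sum>l<p. c l * (hsum (twist (\<theta> s) (g l)) y * cnj (Y y) * of_real (v n l (norm y))))"
        proof (cases "norm y < 1")
          case True
          then have yb: "y \<in> ball 0 1" by simp
          have Uy: "U (rot (\<theta> s) y) = almansi_rot p g (\<theta> s) y"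
            using g(3)[OF yb] hat_ballI[OF s yb] unfolding \<theta>_def by blast
          have "F s y * of_real (indicat_real {..<\<rho> n} (norm y)) =
             (\<Sum>l<p. c l * (hsum (twist (\<theta> s) (g l)) y * cnj (Y y) * of_real (v n l (norm y))))"
            unfolding F_def X_def Uy almansi_rot_def sum_distrib_right v_def w(1) c_def
            by (intro sum.cong refl) (simp add: power_add mult_ac)
          then show ?thesis by simp
        qed simp
      qed
      also have "\<dots> = (\<Sum>l<p. LINT y:ball 0 1|lborel. c l * (hsum (twist (\<theta> s) (g l)) y * cnj (Y y) * of_real (v n l (norm y))))"
        unfolding set_lebesgue_integral_def scaleR_sum_right
      proof (rule Bochner_Integration.integral_sum)
        fix l assume "l \<in> {..<p}"
        then have "l < p" by simp
        from set_integrable_mult_right[OF integral_twist_harmonic(2)[OF g(2)[OF this] g(1)[OF this] Y v(1,2) \<rho>1 v(3) v_int]]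
        show "integrable lborel (\<lambda>y. indicat_real (ball 0 1) y *\<^sub>R (c l * (hsum (twist (\<theta> s) (g l)) y * cnj (Y y) * of_real (v n l (norm y)))))"
          unfolding set_integrable_def .
      qed
      also have "\<dots> = (\<Sum>l<p. cis (2 * (real l - real k) * \<theta> s) * W n l)"
      proof (rule sum.cong[OF refl])
        fix l assume "l \<in> {..<p}"
        then have "l < p" by simp
        then have tw: "(LINT y:ball 0 1|lborel. hsum (twist (\<theta> s) (g l)) y * cnj (Y y) * of_real (v n l (norm y))) =
            cis (real j * \<theta> s) * (LINT y:ball 0 1|lborel. g l j y * cnj (Y y) * of_real (v n l (norm y)))"
          by (intro integral_twist_harmonic(1)[OF g(2) g(1) Y v(1,2) \<rho>1 v(3) v_int])
        have "c l * cis (real j * \<theta> s) = cis (2 * (real l - real k) * \<theta> s)"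
          unfolding c_def cis_cnj cis_mult by (simp add: algebra_simps)
        then show "(LINT y:ball 0 1|lborel. c l * (hsum (twist (\<theta> s) (g l)) y * cnj (Y y) * of_real (v n l (norm y)))) =
            cis (2 * (real l - real k) * \<theta> s) * W n l"
          unfolding set_integral_mult_right tw W_def by (simp only: mult.assoc[symmetric])
      qed
      finally show ?thesis .
    qed
    have "(\<Sum>s<p. LINT y:ball 0 1|lborel. F s y * of_real (indicat_real {..<\<rho> n} (norm y))) =
        (\<Sum>s<p. \<Sum>l<p. cis (2 * (real l - real k) * \<theta> s) * W n l)" using Fs by simp
    also have "\<dots> = (\<Sum>l<p. (\<Sum>s<p. cis (2 * (real l - real k) * \<theta> s)) * W n l)"
      by (subst sum.swap) (simp add: sum_distrib_right)
    also have "\<dots> = (\<Sum>l<p. if l = k then of_nat p * W n l else 0)"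
      using sum_cis_roots[OF k] by (intro sum.cong refl) (simp add: \<theta>_def)
    also have "\<dots> = of_nat p * W n k" using k by simp
    finally show ?thesis .
  qed
  have "(\<lambda>n. \<Sum>s<p. LINT y:ball 0 1|lborel. F s y * of_real (indicat_real {..<\<rho> n} (norm y)))
      \<longlonglongrightarrow> (\<Sum>s<p. LINT y:ball 0 1|lborel. F s y)"
    unfolding \<rho>_def using F_int by (intro tendsto_sum integral_ball_exhaustion) auto
  moreover have "(\<lambda>n. of_nat p * W n k) \<longlonglongrightarrow> of_nat p * weighted_inner (\<lambda>y. norm y ^ (4 * k) * \<omega> y) (g k j) Y"
  proof -
    have hg: "homog j (g k j)" using g(1)[OF k] by (simp add: harmonic_poly_def)
    have "(\<lambda>n. LINT y:ball 0 1|lborel. g k j y * cnj (Y y) * complex_of_real (norm y ^ (4 * k) * \<omega> y) *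
        of_real (indicat_real {..<1 - inverse (real (Suc n))} (norm y))) \<longlonglongrightarrow> weighted_inner (\<lambda>y. norm y ^ (4 * k) * \<omega> y) (g k j) Y"
      unfolding weighted_inner_def
      by (rule integral_ball_exhaustion[OF weighted_inner_integrable[OF radial_weight_mult_power[OF \<omega>] hg Yh]])
    moreover have "W n k = (LINT y:ball 0 1|lborel. g k j y * cnj (Y y) * complex_of_real (norm y ^ (4 * k) * \<omega> y) *
        of_real (indicat_real {..<1 - inverse (real (Suc n))} (norm y)))" for n
    proof -
      have "2 * k + 2 * k = 4 * k" by simp
      then show ?thesis unfolding W_def v_def w(1) \<rho>_def by (simp only: of_real_mult mult_ac)
    qed
    ultimately show ?thesis by (intro tendsto_mult_left) simp
  qed
  ultimately have "(\<Sum>s<p. LINT y:ball 0 1|lborel. F s y) = of_nat p * weighted_inner (\<lambda>y. norm y ^ (4 * k) * \<omega> y) (g k j) Y"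
    unfolding trunc by (rule LIMSEQ_unique)
  then show ?thesis by (simp add: F_def[abs_def] X_def \<theta>_def)
qed

section \<open>The polyharmonic kernel as an Almansi expansion\<close>

lemma cnorm_rot: "cnorm (rot \<psi> x) ^ (2 * k) = cis (2 * real k * \<psi>) * complex_of_real (norm x ^ (2 * k))"
proof -
  have "(\<Sum>j\<in>UNIV. (rot \<psi> x $ j)\<^sup>2) = cis (2 * \<psi>) * complex_of_real (\<Sum>j\<in>UNIV. (x $ j)\<^sup>2)"
    by (simp add: rot_def cplx_vec_def power_mult_distrib Complex.DeMoivre sum_distrib_left)
  also have "(\<Sum>j\<in>UNIV. (x $ j)\<^sup>2) = (norm x)\<^sup>2"
    unfolding power2_norm_eq_inner by (simp add: inner_vec_def power2_eq_square)
  finally have "(cnorm (rot \<psi> x))\<^sup>2 = cis (2 * \<psi>) * complex_of_real ((norm x)\<^sup>2)"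
    by (simp add: cnorm_def)
  then have "cnorm (rot \<psi> x) ^ (2 * k) = (cis (2 * \<psi>) * complex_of_real ((norm x)\<^sup>2)) ^ k"
    by (simp only: power_mult)
  also have "\<dots> = cis (real k * (2 * \<psi>)) * complex_of_real (norm x ^ (2 * k))"
    by (simp only: power_mult_distrib Complex.DeMoivre power_mult of_real_power)
  also have "real k * (2 * \<psi>) = 2 * real k * \<psi>" by simp
  finally show ?thesis .
qed

lemma cnj_vec_rot: "cnj_vec (rot \<phi> y) = rot (- \<phi>) y"
  by (simp add: cnj_vec_def rot_def cplx_vec_def vec_eq_iff cis_cnj)

lemma rot_0: "rot 0 x = cplx_vec x"
  by (simp add: rot_def)

lemma growth_const_mult: "growth R q \<Longrightarrow> growth R (\<lambda>j x. c * q j x)"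
proof (rule growthI)
  assume q: "growth R q"
  show "homog m (\<lambda>x. c * q m x)" for m by (rule homog_scale[OF growth_homog[OF q]])
  fix r :: real assume "0 < r" "r < R"
  then obtain C where C: "C \<ge> 0" "\<forall>m x. norm (q m x) \<le> C * (norm x / r) ^ m" using growthD[OF q] by blast
  have "norm (c * q m x) \<le> norm c * C * (norm x / r) ^ m" for m x
    unfolding norm_mult mult.assoc using C(2) by (intro mult_left_mono) auto
  then show "\<exists>C. \<forall>m x. norm (c * q m x) \<le> C * (norm x / r) ^ m" by blast
qed

lemma hsum_const_mult:
  assumes "growth R q" "norm x < R"
  shows "hsum (\<lambda>j x. c * q j x) x = c * hsum q x"
  unfolding hsum_def by (rule suminf_mult[OF growth_summable(2)[OF assms]])

text \<open>Part of the decay \<open>|y|^j\<close> is traded for a larger radius of convergence in \<open>x\<close>.  As the radius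
  exceeds \<open>1\<close>, the sections of the kernel are bounded on the ball, and integrable against any
  integrable weight.\<close>

lemma zonal_growth:
  assumes \<omega>: "radial_weight \<omega>" and y: "norm y < 1"
  shows "growth (2 / (1 + norm y)) (\<lambda>j x. zonal \<omega> j x y)"
proof (rule growthI)
  show "homog j (\<lambda>x. zonal \<omega> j x y)" for j
    using zonal_harmonic[OF \<omega>, of j y] by (simp add: harmonic_poly_def)
  fix \<rho> assume \<rho>: "0 < \<rho>" "\<rho> < 2 / (1 + norm y)"
  define r where "r = max (\<rho> * norm y) (1 / 2)"
  have "\<rho> * norm y \<le> 2 / (1 + norm y) * norm y" using \<rho> by (intro mult_right_mono) auto
  also have "\<dots> = 2 * norm y / (1 + norm y)" by simp
  also have "\<dots> < 1" using y by (subst divide_less_eq_1_pos) (auto intro: add_pos_nonneg)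
  finally have r: "0 < r" "r < 1" "\<rho> * norm y \<le> r" by (auto simp: r_def)
  obtain C where C: "C \<ge> 0" "\<forall>j x y. norm (zonal \<omega> j x y) \<le> C * (norm x * norm y / r) ^ j"
    using zonal_bound[OF \<omega> r(1,2)] by blast
  have "norm (zonal \<omega> j x y) \<le> C * (norm x / \<rho>) ^ j" for j x
  proof -
    have "norm y / r \<le> 1 / \<rho>" using r \<rho> by (simp add: field_simps)
    then have "norm x * (norm y / r) \<le> norm x * (1 / \<rho>)" by (intro mult_left_mono) auto
    then have "(norm x * norm y / r) ^ j \<le> (norm x / \<rho>) ^ j" using r by (intro power_mono) auto
    then have "C * (norm x * norm y / r) ^ j \<le> C * (norm x / \<rho>) ^ j" using C(1) by (rule mult_left_mono)
    with C(2) show ?thesis by (meson order_trans)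
  qed
  then show "\<exists>C. \<forall>j x. norm (zonal \<omega> j x y) \<le> C * (norm x / \<rho>) ^ j" by blast
qed

lemma one_less_zonal_radius: "norm y < 1 \<Longrightarrow> 1 < 2 / (1 + norm y)"
  by (subst less_divide_eq_1_pos) (auto intro: add_pos_nonneg)

lemma kernel_ext_zonal:
  assumes \<omega>: "radial_weight \<omega>" and K: "bihomog_expansion K (zonal \<omega>)" and x: "x \<in> ball 0 1" and y: "y \<in> ball 0 1"
  shows "kernel_ext K (rot \<psi> x, rot \<phi> y) = hsum (twist (\<psi> - \<phi>) (\<lambda>j x. zonal \<omega> j x y)) x"
proof (rule kernel_ext_rot[OF K x y])
  have y1: "norm y < 1" using y by simp
  have "norm x < 2 / (1 + norm y)" using x one_less_zonal_radius[OF y1] by simp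
  from growth_summable(3)[OF growth_twist[OF zonal_growth[OF \<omega> y1]] this, of "\<psi> - \<phi>"]
  show "(\<lambda>m. cis (real m * (\<psi> - \<phi>)) * zonal \<omega> m x y) sums hsum (twist (\<psi> - \<phi>) (\<lambda>j x. zonal \<omega> j x y)) x"
    by (simp add: twist_def)
qed

text \<open>The extension of a kernel only looks at pairs of real vectors, from which the real parts recover
  the arguments.\<close>

definition zonal_kernel :: "(real ^ 'n \<Rightarrow> real) \<Rightarrow> (complex ^ 'n) \<times> (complex ^ 'n) \<Rightarrow> complex" where
  "zonal_kernel \<omega> = (\<lambda>(z, w). \<Sum>j. zonal \<omega> j (\<chi> i. Re (z $ i)) (\<chi> i. Re (w $ i)))"

lemma zonal_kernel_expansion:
  fixes \<omega> :: "real ^ 'n \<Rightarrow> real"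
  assumes \<omega>: "radial_weight \<omega>"
  shows "bihomog_expansion (zonal_kernel \<omega>) (zonal \<omega>)"
  unfolding bihomog_expansion_def
proof (intro conjI allI ballI zonal_bihomog[OF \<omega>])
  fix x y :: "real ^ 'n" assume x: "x \<in> ball 0 1" and y: "y \<in> ball 0 1"
  then have y1: "norm y < 1" by simp
  have "norm x < 2 / (1 + norm y)" using x one_less_zonal_radius[OF y1] by simp
  from growth_summable(2)[OF zonal_growth[OF \<omega> y1] this]
  show "(\<lambda>m. zonal \<omega> m x y) sums zonal_kernel \<omega> (cplx_vec x, cplx_vec y)"
    by (simp add: zonal_kernel_def cplx_vec_def summable_sums)
qed

text \<open>The harmonic components of the section of the kernel at the point \<open>e^(i\<phi>) y\<close>: the \<open>k\<close>-th is
  \<open>e^(-2ki\<phi>) |y|^(2k)\<close> times the harmonic kernel for the weight multiplied by \<open>|y|^(4k)\<close>, with the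
  antiholomorphic phase \<open>e^(-ij\<phi>)\<close> in degree \<open>j\<close>.\<close>

definition kernel_component :: "(real ^ 'n \<Rightarrow> real) \<Rightarrow> real \<Rightarrow> real ^ 'n \<Rightarrow> nat \<Rightarrow> nat \<Rightarrow> real ^ 'n \<Rightarrow> complex" where
  "kernel_component \<omega> \<phi> y k = twist (- \<phi>)
     (\<lambda>j x. cis (- (2 * real k * \<phi>)) * complex_of_real (norm y ^ (2 * k)) * zonal (\<lambda>y. norm y ^ (4 * k) * \<omega> y) j x y)"

definition polyharmonic_kernel :: "nat \<Rightarrow> (real ^ 'n \<Rightarrow> real) \<Rightarrow> (complex ^ 'n) \<times> (complex ^ 'n) \<Rightarrow> complex" where
  "polyharmonic_kernel p \<omega> = (\<lambda>(z, w). \<Sum>k<p. cnorm z ^ (2 * k) * cnorm (cnj_vec w) ^ (2 * k) *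
     kernel_ext (zonal_kernel (\<lambda>y. norm y ^ (4 * k) * \<omega> y)) (z, w))"

lemma kernel_component_growth:
  assumes "radial_weight \<omega>" "norm y < 1"
  shows "growth (2 / (1 + norm y)) (kernel_component \<omega> \<phi> y k)"
  unfolding kernel_component_def
  by (intro growth_twist growth_const_mult zonal_growth radial_weight_mult_power assms)

lemma kernel_component_harmonic:
  assumes "radial_weight \<omega>"
  shows "harmonic_poly j (kernel_component \<omega> \<phi> y k j)"
  unfolding kernel_component_def twist_def[abs_def]
  by (intro harmonic_poly_scale zonal_harmonic radial_weight_mult_power assms)

lemma polyharmonic_kernel_rot:
  assumes \<omega>: "radial_weight \<omega>" and x: "x \<in> ball 0 1" and y: "y \<in> ball 0 1"
  shows "polyharmonic_kernel p \<omega> (rot \<psi> x, rot \<phi> y) = almansi_rot p (kernel_component \<omega> \<phi> y) \<psi> x"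
  unfolding polyharmonic_kernel_def almansi_rot_def case_prod_conv
proof (intro sum.cong refl)
  fix k
  define \<omega>k where "\<omega>k = (\<lambda>y. norm y ^ (4 * k) * \<omega> y)"
  have \<omega>k: "radial_weight \<omega>k" unfolding \<omega>k_def by (rule radial_weight_mult_power[OF \<omega>])
  have y1: "norm y < 1" using y by simp
  have xR: "norm x < 2 / (1 + norm y)" using x one_less_zonal_radius[OF y1] by simp
  define c where "c = cis (- (2 * real k * \<phi>)) * complex_of_real (norm y ^ (2 * k))"
  have tw: "twist \<psi> (kernel_component \<omega> \<phi> y k) = (\<lambda>j x. c * twist (\<psi> - \<phi>) (\<lambda>j x. zonal \<omega>k j x y) j x)"
  proof (intro ext)
    fix j x
    have "cis (real j * \<psi>) * cis (real j * (- \<phi>)) = cis (real j * (\<psi> - \<phi>))" by (simp add: cis_mult algebra_simps)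
    then show "twist \<psi> (kernel_component \<omega> \<phi> y k) j x = c * twist (\<psi> - \<phi>) (\<lambda>j x. zonal \<omega>k j x y) j x"
      unfolding twist_def kernel_component_def c_def[symmetric] \<omega>k_def[symmetric]
      by (simp only: mult.assoc[symmetric]) (simp only: mult_ac)
  qed
  have "hsum (twist \<psi> (kernel_component \<omega> \<phi> y k)) x = c * hsum (twist (\<psi> - \<phi>) (\<lambda>j x. zonal \<omega>k j x y)) x"
    unfolding tw by (rule hsum_const_mult[OF growth_twist[OF zonal_growth[OF \<omega>k y1]] xR])
  moreover have "kernel_ext (zonal_kernel \<omega>k) (rot \<psi> x, rot \<phi> y) = hsum (twist (\<psi> - \<phi>) (\<lambda>j x. zonal \<omega>k j x y)) x"
    by (rule kernel_ext_zonal[OF \<omega>k zonal_kernel_expansion[OF \<omega>k] x y])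
  moreover have "cnorm (cnj_vec (rot \<phi> y)) ^ (2 * k) = c"
    unfolding cnj_vec_rot cnorm_rot c_def by simp
  ultimately show "cnorm (rot \<psi> x) ^ (2 * k) * cnorm (cnj_vec (rot \<phi> y)) ^ (2 * k) *
      kernel_ext (zonal_kernel (\<lambda>y. norm y ^ (4 * k) * \<omega> y)) (rot \<psi> x, rot \<phi> y) =
      cis (2 * real k * \<psi>) * (complex_of_real (norm x ^ (2 * k)) * hsum (twist \<psi> (kernel_component \<omega> \<phi> y k)) x)"
    unfolding \<omega>k_def[symmetric] cnorm_rot[of \<psi> x k] by (simp only: mult_ac)
qed

lemma polyharmonic_kernel_in_space:
  fixes \<omega> :: "real ^ 'n \<Rightarrow> real"
  assumes \<omega>: "radial_weight \<omega>" and y: "y \<in> ball 0 1"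
  shows "(\<lambda>z. polyharmonic_kernel p \<omega> (z, rot \<phi> y)) \<in> bergman_space p \<omega>"
proof -
  let ?h = "kernel_component \<omega> \<phi> y"
  have y1: "norm y < 1" using y by simp
  define R where "R = 2 / (1 + norm y)"
  have R: "1 < R" unfolding R_def by (rule one_less_zonal_radius[OF y1])
  have gR: "growth R (?h k)" for k unfolding R_def by (rule kernel_component_growth[OF \<omega> y1])
  have g1: "growth 1 (?h k)" for k using growth_mono[OF gR] R by simp
  define u where "u = hsum (almansi p ?h)"
  have u: "u \<in> polyharmonic p"
    unfolding u_def by (rule almansi_polyharmonic[OF g1 kernel_component_harmonic[OF \<omega>]])
  have "polyharmonic_kernel p \<omega> (z, rot \<phi> y) = hol_ext u z" if "z \<in> hat_ball p" for z
  proof -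
    from hat_ballE[OF that] obtain \<psi> x where z: "z = rot \<psi> x" "x \<in> ball 0 1" by blast
    have "hol_ext u (rot \<psi> x) = almansi_rot p ?h \<psi> x"
      by (rule hol_ext_almansi[OF g1 _ z(2)]) (simp add: u_def)
    then show ?thesis unfolding z(1) using polyharmonic_kernel_rot[OF \<omega> z(2) y] by simp
  qed
  moreover have "set_integrable lborel (ball 0 1) (bergman_integrand p \<omega>
      (\<lambda>z. polyharmonic_kernel p \<omega> (z, rot \<phi> y)) (\<lambda>z. polyharmonic_kernel p \<omega> (z, rot \<phi> y)) s)" for s
  proof -
    define f where "f x = almansi_rot p ?h (real s * pi / real p) x * cnj (almansi_rot p ?h (real s * pi / real p) x)" for x
    have "continuous_on (ball 0 R) f"
      unfolding f_def[abs_def] by (intro continuous_intros almansi_rot_continuous gR)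
    then have fc: "continuous_on (cball 0 1) f" by (rule continuous_on_subset) (use R in auto)
    then have "compact (f ` cball 0 1)" by (intro compact_continuous_image compact_cball)
    then have "bounded (f ` cball 0 1)" by (rule compact_imp_bounded)
    then obtain M where M: "\<forall>v\<in>f ` cball 0 1. norm v \<le> M" unfolding bounded_iff by blast
    have "set_integrable lborel (ball 0 1) (\<lambda>x. f x * complex_of_real (\<omega> x))"
    proof (rule set_integrable_bounded_mult[OF radial_weight_integrable[OF \<omega>]])
      show "norm (f x) \<le> M" if "norm x < 1" for x using M that by auto
      show "set_borel_measurable lborel (ball 0 1) f"
        by (rule set_borel_measurable_ball_continuous[OF continuous_on_subset[OF fc]]) auto
    qed
    moreover have "indicat_real (ball 0 1) x *\<^sub>R (f x * complex_of_real (\<omega> x)) = indicat_real (ball 0 1) x *\<^sub>R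
      bergman_integrand p \<omega> (\<lambda>z. polyharmonic_kernel p \<omega> (z, rot \<phi> y)) (\<lambda>z. polyharmonic_kernel p \<omega> (z, rot \<phi> y)) s x" for x
      using polyharmonic_kernel_rot[OF \<omega> _ y, of x p "real s * pi / real p" \<phi>]
      by (cases "norm x < 1") (simp_all add: bergman_integrand_def f_def)
    ultimately show ?thesis unfolding set_integrable_def by simp
  qed
  ultimately show ?thesis unfolding bergman_space_def using u by blast
qed

section \<open>The reproducing property\<close>

text \<open>The series of the section is integrated term by term, with \<open>|U \<omega>|\<close> times a summable sequence as
  majorant; each term extracts one harmonic component of \<open>U\<close>, which the zonal kernel evaluates at
  \<open>y\<close>.\<close>

theorem polyharmonic_kernel_reproducing:
  fixes U :: "complex ^ 'n \<Rightarrow> complex"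
  assumes \<omega>: "radial_weight \<omega>" and p: "p > 0" and U: "U \<in> bergman_space p \<omega>" and y: "y \<in> ball 0 1" "rot \<phi> y \<in> hat_ball p"
  shows "bergman_inner p \<omega> U (\<lambda>z. polyharmonic_kernel p \<omega> (z, rot \<phi> y)) = U (rot \<phi> y)"
proof -
  obtain g where g: "\<forall>k<p. \<forall>j. harmonic_poly j (g k j)" "\<forall>k<p. growth 1 (g k)"
     "\<forall>\<psi> x. x \<in> ball 0 1 \<and> rot \<psi> x \<in> hat_ball p \<longrightarrow> U (rot \<psi> x) = almansi_rot p g \<psi> x"
    using bergman_space_expansion[OF U] by blast
  let ?h = "kernel_component \<omega> \<phi> y"
  define \<theta> where "\<theta> s = real s * pi / real p" for s
  have y1: "norm y < 1" using y by simp
  have gR: "growth (2 / (1 + norm y)) (?h k)" for k by (rule kernel_component_growth[OF \<omega> y1])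
  have hh: "homog j (?h k j)" for k j using kernel_component_harmonic[OF \<omega>] by (simp add: harmonic_poly_def)
  have U\<omega>: "set_integrable lborel (ball 0 1) (\<lambda>x. U (rot (\<theta> s) x) * of_real (\<omega> x))" if "s < p" for s
    unfolding \<theta>_def by (rule bergman_space_integrable[OF \<omega> U that])
  define X where "X s k j x = cnj (cis (real (2 * k + j) * \<theta> s) * (of_real (norm x ^ (2 * k)) * ?h k j x))" for s k j and x :: "real ^ 'n"
  define F where "F s k j x = U (rot (\<theta> s) x) * X s k j x * of_real (\<omega> x)" for s k j x
  define G where "G s k x = U (rot (\<theta> s) x) * cnj (cis (2 * real k * \<theta> s) * (of_real (norm x ^ (2 * k)) * hsum (twist (\<theta> s) (?h k)) x)) * of_real (\<omega> x)" for s k x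
  have "\<exists>B. summable B \<and> (\<forall>m x. norm x \<le> 1 \<longrightarrow> norm (?h k m x) \<le> B m) \<and> (\<forall>m. 0 \<le> B m)" for k
    by (rule growth_uniform[OF gR one_less_zonal_radius[OF y1]]) (use one_less_zonal_radius[OF y1] in linarith)
  then obtain B where B: "\<And>k. summable (B k)" "\<And>k m x. norm x \<le> 1 \<Longrightarrow> norm (?h k m x) \<le> B k m" "\<And>k m. 0 \<le> B k m"
    by metis
  have XB: "norm (X s k j x) \<le> B k j" if "norm x < 1" for s k j x
  proof -
    have "norm x ^ (2 * k) * norm (?h k j x) \<le> 1 * B k j"
      using that B(2)[of x k j] by (intro mult_mono power_le_one) auto
    then show ?thesis by (simp add: X_def norm_mult norm_power)
  qed
  have Xc: "continuous_on (ball 0 1) (X s k j)" for s k j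
    unfolding X_def[abs_def] by (intro continuous_intros homog_continuous[OF hh])
  have F_int: "set_integrable lborel (ball 0 1) (F s k j)" if "s < p" for s k j
    using set_integrable_mult_continuous[OF U\<omega>[OF that] Xc[of s k j] XB[of _ s k j]] by (simp add: F_def[abs_def] mult_ac)
  have F_le: "norm (F s k j x) \<le> B k j * norm (U (rot (\<theta> s) x) * of_real (\<omega> x))" if "norm x < 1" for s k j x
  proof -
    have "norm (F s k j x) = norm (X s k j x) * norm (U (rot (\<theta> s) x) * of_real (\<omega> x))"
      unfolding F_def norm_mult by (simp only: mult_ac)
    also have "\<dots> \<le> B k j * norm (U (rot (\<theta> s) x) * of_real (\<omega> x))"
      by (rule mult_right_mono[OF XB[OF that] norm_ge_zero])
    finally show ?thesis .
  qed
  have U\<omega>n: "set_integrable lborel (ball 0 1) (\<lambda>x. norm (U (rot (\<theta> s) x) * of_real (\<omega> x)))" if "s < p" for s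
    using set_integrable_norm[OF U\<omega>[OF that]] .
  have FG: "(\<Sum>j. F s k j x) = G s k x" if "norm x < 1" for s k x
  proof -
    have xR: "norm x < 2 / (1 + norm y)" using that one_less_zonal_radius[OF y1] by simp
    have "(\<lambda>j. twist (\<theta> s) (?h k) j x) sums hsum (twist (\<theta> s) (?h k)) x"
      by (rule growth_summable(3)[OF growth_twist[OF gR] xR])
    then have "(\<lambda>j. U (rot (\<theta> s) x) * cnj (cis (2 * real k * \<theta> s) * (of_real (norm x ^ (2 * k)) * twist (\<theta> s) (?h k) j x)) * of_real (\<omega> x)) sums G s k x"
      unfolding G_def by (intro sums_mult sums_mult2 sums_cnj[THEN iffD2])
    moreover have "X s k j x = cnj (cis (2 * real k * \<theta> s) * (of_real (norm x ^ (2 * k)) * twist (\<theta> s) (?h k) j x))" for j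
    proof -
      have "cis (real (2 * k + j) * \<theta> s) = cis (2 * real k * \<theta> s) * cis (real j * \<theta> s)"
        by (simp add: cis_mult algebra_simps)
      then show ?thesis unfolding X_def twist_def by (simp only: mult_ac)
    qed
    ultimately show ?thesis unfolding F_def by (simp add: sums_iff)
  qed
  have FGi: "indicat_real (ball 0 1) x *\<^sub>R (\<Sum>j. F s k j x) = indicat_real (ball 0 1) x *\<^sub>R G s k x" for s k x
    by (cases "norm x < 1") (simp_all add: FG)
  have G_int: "set_integrable lborel (ball 0 1) (G s k)" if "s < p" for s k
    using suminf_integrable_ball[OF U\<omega>n[OF that] F_int[OF that] F_le B(1)] unfolding set_integrable_def FGi .
  have "(\<lambda>j. LINT x:ball 0 1|lborel. F s k j x) sums (LINT x:ball 0 1|lborel. G s k x)" if "s < p" for s k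
    using sums_integral_ball[OF U\<omega>n[OF that] F_int[OF that] F_le B(1)] unfolding set_lebesgue_integral_def FGi .
  then have "(\<lambda>j. \<Sum>s<p. \<Sum>k<p. LINT x:ball 0 1|lborel. F s k j x) sums (\<Sum>s<p. \<Sum>k<p. LINT x:ball 0 1|lborel. G s k x)"
    by (intro sums_sum) auto
  moreover have "(\<Sum>s<p. \<Sum>k<p. LINT x:ball 0 1|lborel. F s k j x) =
     (\<Sum>k<p. of_nat p * (cis (2 * real k * \<phi>) * (of_real (norm y ^ (2 * k)) * twist \<phi> (g k) j y)))" for j
  proof -
    have "(\<Sum>s<p. LINT x:ball 0 1|lborel. F s k j x) = of_nat p * (cis (2 * real k * \<phi>) * (of_real (norm y ^ (2 * k)) * twist \<phi> (g k) j y))"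
      if k: "k < p" for k
    proof -
      have "(\<Sum>s<p. LINT x:ball 0 1|lborel. F s k j x) = of_nat p * weighted_inner (\<lambda>y. norm y ^ (4 * k) * \<omega> y) (g k j) (?h k j)"
        unfolding F_def[abs_def] X_def \<theta>_def
        by (rule bergman_component[OF \<omega> U _ _ _ k kernel_component_harmonic[OF \<omega>]]) (use g in auto)
      also have "?h k j = (\<lambda>x. cis (real j * (- \<phi>)) * (cis (- (2 * real k * \<phi>)) * of_real (norm y ^ (2 * k))) *
          zonal (\<lambda>y. norm y ^ (4 * k) * \<omega> y) j x y)"
        unfolding kernel_component_def twist_def by (simp only: mult.assoc)
      also have "weighted_inner (\<lambda>y. norm y ^ (4 * k) * \<omega> y) (g k j) \<dots> =
          cnj (cis (real j * (- \<phi>)) * (cis (- (2 * real k * \<phi>)) * of_real (norm y ^ (2 * k)))) * g k j y"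
        unfolding weighted_inner_scale_right
        using zonal_reproducing[OF radial_weight_mult_power[OF \<omega>], of j "g k j" k y] g(1) k by simp
      also have "\<dots> = cis (2 * real k * \<phi>) * (of_real (norm y ^ (2 * k)) * twist \<phi> (g k) j y)"
        by (simp add: twist_def cis_cnj del: of_real_power)
      finally show ?thesis .
    qed
    then show ?thesis by (subst sum.swap) simp
  qed
  moreover have "(\<lambda>j. \<Sum>k<p. of_nat p * (cis (2 * real k * \<phi>) * (of_real (norm y ^ (2 * k)) * twist \<phi> (g k) j y))) sums
     (\<Sum>k<p. of_nat p * (cis (2 * real k * \<phi>) * (of_real (norm y ^ (2 * k)) * hsum (twist \<phi> (g k)) y)))"
    using g(2) y1 by (intro sums_sum sums_mult growth_summable(3)[OF growth_twist]) auto
  ultimately have "(\<Sum>s<p. \<Sum>k<p. LINT x:ball 0 1|lborel. G s k x) =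
      (\<Sum>k<p. of_nat p * (cis (2 * real k * \<phi>) * (of_real (norm y ^ (2 * k)) * hsum (twist \<phi> (g k)) y)))"
    by (simp only: sums_unique2)
  also have "\<dots> = of_nat p * almansi_rot p g \<phi> y" by (simp only: almansi_rot_def sum_distrib_left)
  also have "\<dots> = of_nat p * U (rot \<phi> y)" using g(3) y by simp
  finally have sumG: "(\<Sum>s<p. \<Sum>k<p. LINT x:ball 0 1|lborel. G s k x) = of_nat p * U (rot \<phi> y)" .
  have "set_lebesgue_integral lborel (ball 0 1) (bergman_integrand p \<omega> U (\<lambda>z. polyharmonic_kernel p \<omega> (z, rot \<phi> y)) s) =
      (\<Sum>k<p. LINT x:ball 0 1|lborel. G s k x)" if s: "s < p" for s
  proof -
    have "indicat_real (ball 0 1) x *\<^sub>R bergman_integrand p \<omega> U (\<lambda>z. polyharmonic_kernel p \<omega> (z, rot \<phi> y)) s x =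
        (\<Sum>k<p. indicat_real (ball 0 1) x *\<^sub>R G s k x)" for x
    proof (cases "norm x < 1")
      case True
      then have xb: "x \<in> ball 0 1" by simp
      have "bergman_integrand p \<omega> U (\<lambda>z. polyharmonic_kernel p \<omega> (z, rot \<phi> y)) s x = (\<Sum>k<p. G s k x)"
        unfolding bergman_integrand_def polyharmonic_kernel_rot[OF \<omega> xb y(1)] \<theta>_def[symmetric] almansi_rot_def G_def
        by (simp only: cnj_sum sum_distrib_left sum_distrib_right)
      then show ?thesis using True by simp
    qed simp
    then show ?thesis
      unfolding set_lebesgue_integral_def
      by (simp only: Bochner_Integration.integral_sum[OF G_int[OF s, unfolded set_integrable_def]])
  qed
  then show ?thesis unfolding bergman_inner_def using sumG p by simp
qed

section \<open>Uniqueness of the kernel\<close>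

lemma bergman_inner_cnj: "bergman_inner p \<omega> V U = cnj (bergman_inner p \<omega> U V)"
proof -
  have "cnj (set_lebesgue_integral lborel (ball 0 1) (bergman_integrand p \<omega> U V k)) =
      set_lebesgue_integral lborel (ball 0 1) (bergman_integrand p \<omega> V U k)" for k
    unfolding set_lebesgue_integral_def Bochner_Integration.integral_cnj[symmetric]
    by (intro Bochner_Integration.integral_cong refl) (simp add: bergman_integrand_def mult_ac)
  then show ?thesis unfolding bergman_inner_def by simp
qed

lemma bergman_integrand_cong:
  assumes "\<And>z. z \<in> hat_ball p \<Longrightarrow> U z = U' z" "\<And>z. z \<in> hat_ball p \<Longrightarrow> V z = V' z" "k < p"
  shows "indicat_real (ball 0 1) y *\<^sub>R bergman_integrand p \<omega> U V k y =
    indicat_real (ball 0 1) y *\<^sub>R bergman_integrand p \<omega> U' V' k y"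
  using assms(1,2)[OF hat_ballI[OF assms(3), of y]]
  by (cases "norm y < 1") (simp_all add: bergman_integrand_def)

lemma bergman_inner_cong:
  assumes "\<And>z. z \<in> hat_ball p \<Longrightarrow> U z = U' z" "\<And>z. z \<in> hat_ball p \<Longrightarrow> V z = V' z"
  shows "bergman_inner p \<omega> U V = bergman_inner p \<omega> U' V'"
proof -
  have "(LINT y|lborel. indicat_real (ball 0 1) y *\<^sub>R bergman_integrand p \<omega> U V k y) =
      (LINT y|lborel. indicat_real (ball 0 1) y *\<^sub>R bergman_integrand p \<omega> U' V' k y)" if "k < p" for k
    by (intro Bochner_Integration.integral_cong refl bergman_integrand_cong[of p U U' V V', OF assms that])
  then show ?thesis unfolding bergman_inner_def set_lebesgue_integral_def by simp
qed

lemma bergman_space_cong: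
  assumes "\<And>z. z \<in> hat_ball p \<Longrightarrow> U z = U' z" "U \<in> bergman_space p \<omega>"
  shows "U' \<in> bergman_space p \<omega>"
  using assms(2) bergman_integrand_cong[of p U U' U U', OF assms(1,1)] assms(1)
  unfolding bergman_space_def set_integrable_def by auto

text \<open>Two reproducing kernels represent each other's sections, hence agree.\<close>

lemma bergman_kernel_eqI:
  fixes K :: "(complex ^ 'n) \<times> (complex ^ 'n) \<Rightarrow> complex"
  assumes K: "\<And>w. w \<in> hat_ball p \<Longrightarrow> (\<lambda>z. K (z, w)) \<in> bergman_space p \<omega>"
    "\<And>w U. w \<in> hat_ball p \<Longrightarrow> U \<in> bergman_space p \<omega> \<Longrightarrow> bergman_inner p \<omega> U (\<lambda>z. K (z, w)) = U w"
    and zw: "z \<in> hat_ball p" "w \<in> hat_ball p"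
  shows "bergman_kernel p \<omega> (z, w) = K (z, w)"
proof -
  let ?H = "hat_ball p :: (complex ^ 'n) set"
  have "bergman_kernel p \<omega> = restrict K (?H \<times> ?H)"
    unfolding bergman_kernel_def
  proof (rule the_equality, intro conjI ballI)
    show "restrict K (?H \<times> ?H) \<in> extensional (?H \<times> ?H)" by simp
    fix w assume w: "w \<in> ?H"
    show "(\<lambda>z. restrict K (?H \<times> ?H) (z, w)) \<in> bergman_space p \<omega>"
      by (rule bergman_space_cong[OF _ K(1)[OF w]]) (use w in simp)
    fix U assume U: "U \<in> bergman_space p \<omega>"
    have "bergman_inner p \<omega> U (\<lambda>z. restrict K (?H \<times> ?H) (z, w)) = bergman_inner p \<omega> U (\<lambda>z. K (z, w))"
      by (rule bergman_inner_cong) (use w in simp_all)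
    then show "U w = bergman_inner p \<omega> U (\<lambda>z. restrict K (?H \<times> ?H) (z, w))"
      using K(2)[OF w U] by simp
  next
    fix R assume R: "R \<in> extensional (?H \<times> ?H) \<and>
     (\<forall>x\<in>?H. (\<lambda>z. R (z, x)) \<in> bergman_space p \<omega> \<and>
        (\<forall>U\<in>bergman_space p \<omega>. U x = bergman_inner p \<omega> U (\<lambda>z. R (z, x))))"
    have Rs: "(\<lambda>z. R (z, x)) \<in> bergman_space p \<omega>" if "x \<in> ?H" for x
      using R that by simp
    have Rr: "U x = bergman_inner p \<omega> U (\<lambda>z. R (z, x))" if "U \<in> bergman_space p \<omega>" "x \<in> ?H" for U x
      using R that by simp
    have "R (z, w) = K (z, w)" if z: "z \<in> ?H" and w: "w \<in> ?H" for z w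
    proof -
      have "K (z, w) = bergman_inner p \<omega> (\<lambda>z. K (z, w)) (\<lambda>x. R (x, z))"
        by (rule Rr[OF K(1)[OF w] z])
      also have "\<dots> = cnj (bergman_inner p \<omega> (\<lambda>x. R (x, z)) (\<lambda>z. K (z, w)))" by (rule bergman_inner_cnj)
      also have "\<dots> = cnj (R (w, z))" using K(2)[OF w Rs[OF z]] by simp
      also have "\<dots> = cnj (bergman_inner p \<omega> (\<lambda>x. R (x, z)) (\<lambda>x. R (x, w)))"
        using Rr[OF Rs[OF z] w] by simp
      also have "\<dots> = bergman_inner p \<omega> (\<lambda>x. R (x, w)) (\<lambda>x. R (x, z))" by (rule bergman_inner_cnj[symmetric])
      also have "\<dots> = R (z, w)" using Rr[OF Rs[OF w] z] by simp
      finally show ?thesis by simp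
    qed
    moreover have "R q = restrict K (?H \<times> ?H) q" if "q \<notin> ?H \<times> ?H" for q
      using extensional_arb[OF conjunct1[OF R] that] that by (auto simp: restrict_def)
    ultimately show "R = restrict K (?H \<times> ?H)" by (intro ext) (metis SigmaE restrict_apply')
  qed
  then show ?thesis using zw by simp
qed

theorem bergman_kernel_eq:
  fixes \<omega> :: "real ^ 'n \<Rightarrow> real"
  assumes \<omega>: "radial_weight \<omega>" and p: "p > 0" and z: "z \<in> hat_ball p" and w: "w \<in> hat_ball p"
  shows "bergman_kernel p \<omega> (z, w) = polyharmonic_kernel p \<omega> (z, w)"
proof (rule bergman_kernel_eqI[OF _ _ z w])
  fix w :: "complex ^ 'n" assume w: "w \<in> hat_ball p"
  obtain \<phi> y where y: "w = rot \<phi> y" "y \<in> ball 0 1" using hat_ballE[OF w] by blast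
  show "(\<lambda>z. polyharmonic_kernel p \<omega> (z, w)) \<in> bergman_space p \<omega>"
    unfolding y(1) by (rule polyharmonic_kernel_in_space[OF \<omega> y(2)])
  show "bergman_inner p \<omega> U (\<lambda>z. polyharmonic_kernel p \<omega> (z, w)) = U w" if "U \<in> bergman_space p \<omega>" for U
    using polyharmonic_kernel_reproducing[OF \<omega> p that y(2)] w unfolding y(1) by blast
qed

text \<open>For \<open>p = 1\<close> the candidate consists of a single block with trivial phases and factors.\<close>

lemma harmonic_kernel_expansion:
  fixes \<omega> :: "real ^ 'n \<Rightarrow> real"
  assumes \<omega>: "radial_weight \<omega>"
  shows "bihomog_expansion (bergman_kernel 1 \<omega>) (zonal \<omega>)"
  unfolding bihomog_expansion_def
proof (intro conjI allI ballI zonal_bihomog[OF \<omega>])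
  fix x y :: "real ^ 'n" assume x: "x \<in> ball 0 1" and y: "y \<in> ball 0 1"
  have h: "cplx_vec x \<in> hat_ball 1" if "x \<in> ball 0 1" for x :: "real ^ 'n"
    using hat_ballI[of 0 1 x] that by (simp add: rot_0)
  have y1: "norm y < 1" using y by simp
  have xR: "norm x < 2 / (1 + norm y)" using x one_less_zonal_radius[OF y1] by simp
  have "bergman_kernel 1 \<omega> (cplx_vec x, cplx_vec y) = polyharmonic_kernel 1 \<omega> (cplx_vec x, cplx_vec y)"
    by (rule bergman_kernel_eq[OF \<omega> _ h[OF x] h[OF y]]) simp
  also have "\<dots> = kernel_ext (zonal_kernel \<omega>) (rot 0 x, rot 0 y)"
    by (simp add: polyharmonic_kernel_def rot_0)
  also have "\<dots> = hsum (twist (0 - 0) (\<lambda>j x. zonal \<omega> j x y)) x"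
    by (rule kernel_ext_zonal[OF \<omega> zonal_kernel_expansion[OF \<omega>] x y])
  also have "twist (0 - 0) (\<lambda>j x. zonal \<omega> j x y) = (\<lambda>j x. zonal \<omega> j x y)"
    by (simp add: twist_def fun_eq_iff)
  finally show "(\<lambda>m. zonal \<omega> m x y) sums bergman_kernel 1 \<omega> (cplx_vec x, cplx_vec y)"
    using growth_summable(3)[OF zonal_growth[OF \<omega> y1] xR] by simp
qed

theorem bergman_kernel_sum:
  fixes \<omega> :: "real ^ 'n \<Rightarrow> real"
  assumes \<omega>: "radial_weight \<omega>" and p: "p > 0" and z: "z \<in> hat_ball p" and w: "w \<in> hat_ball p"
  shows "bergman_kernel p \<omega> (z, w) = (\<Sum>k<p. cnorm z ^ (2 * k) * cnorm (cnj_vec w) ^ (2 * k) *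
     kernel_ext (bergman_kernel 1 (\<lambda>y. norm y ^ (4 * k) * \<omega> y)) (z, w))"
proof -
  obtain \<psi> x where x: "z = rot \<psi> x" "x \<in> ball 0 1" using hat_ballE[OF z] by blast
  obtain \<phi> y where y: "w = rot \<phi> y" "y \<in> ball 0 1" using hat_ballE[OF w] by blast
  have "kernel_ext (zonal_kernel (\<lambda>y. norm y ^ (4 * k) * \<omega> y)) (z, w) =
      kernel_ext (bergman_kernel 1 (\<lambda>y. norm y ^ (4 * k) * \<omega> y)) (z, w)" for k
    unfolding x(1) y(1)
    using kernel_ext_zonal[OF radial_weight_mult_power[OF \<omega>] zonal_kernel_expansion[OF radial_weight_mult_power[OF \<omega>]] x(2) y(2)]
      kernel_ext_zonal[OF radial_weight_mult_power[OF \<omega>] harmonic_kernel_expansion[OF radial_weight_mult_power[OF \<omega>]] x(2) y(2)]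
    by simp
  then show ?thesis
    unfolding bergman_kernel_eq[OF \<omega> p z w] polyharmonic_kernel_def case_prod_conv by simp
qed

section \<open>Weights that differ at the origin\<close>

lemma integral_change_point:
  fixes f f' :: "real ^ 'n \<Rightarrow> complex"
  assumes "\<And>y. y \<noteq> 0 \<Longrightarrow> f y = f' y"
  shows "integrable lborel f \<longleftrightarrow> integrable lborel f'" and "(LINT y|lborel. f y) = (LINT y|lborel. f' y)"
proof -
  have d: "has_bochner_integral lborel (\<lambda>y. indicat_real {0 :: real ^ 'n} y *\<^sub>R c) 0" for c :: complex
  proof -
    have "AE y in lborel. indicat_real {0 :: real ^ 'n} y *\<^sub>R c = 0"
      using AE_lborel_singleton[of "0 :: real ^ 'n"] by eventually_elim simp
    moreover have "(\<lambda>y. indicat_real {0 :: real ^ 'n} y *\<^sub>R c) \<in> borel_measurable lborel" by simp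
    ultimately show ?thesis
      using has_bochner_integral_zero by (subst has_bochner_integral_cong_AE[where g = "\<lambda>_. 0"]) auto
  qed
  have step: "has_bochner_integral lborel g' I" if "has_bochner_integral lborel g I" "\<And>y. y \<noteq> 0 \<Longrightarrow> g y = g' y"
    for g g' :: "real ^ 'n \<Rightarrow> complex" and I
  proof -
    have "g' = (\<lambda>y. g y + indicat_real {0} y *\<^sub>R (g' 0 - g 0))"
      using that(2) by (auto simp: fun_eq_iff indicator_def)
    then show ?thesis using has_bochner_integral_add[OF that(1) d[of "g' 0 - g 0"]] by simp
  qed
  have eq: "has_bochner_integral lborel f I \<longleftrightarrow> has_bochner_integral lborel f' I" for I
    using step[of f I f'] step[of f' I f] assms by auto
  then show "integrable lborel f \<longleftrightarrow> integrable lborel f'" by (simp add: integrable.simps)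
  show "(LINT y|lborel. f y) = (LINT y|lborel. f' y)" unfolding lebesgue_integral_def eq ..
qed

text \<open>Needed because \<open>0 powr 0 = 0\<close>: the weight with \<open>\<alpha> = \<beta> = 0\<close> is not \<open>1\<close> at the origin.  A
  change at one point alters neither integrability nor the integral, measurable or not, so the inner
  products of arbitrary functions agree.\<close>

lemma bergman_kernel_change_point:
  fixes \<omega> \<omega>' :: "real ^ 'n \<Rightarrow> real"
  assumes "\<And>y. y \<noteq> 0 \<Longrightarrow> norm y < 1 \<Longrightarrow> \<omega> y = \<omega>' y"
  shows "bergman_kernel p \<omega> = bergman_kernel p \<omega>'"
proof -
  have eq: "indicat_real (ball 0 1) y *\<^sub>R bergman_integrand p \<omega> U V k y = indicat_real (ball 0 1) y *\<^sub>R bergman_integrand p \<omega>' U V k y"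
    if "y \<noteq> 0" for U V k y
    using assms[OF that] by (cases "norm y < 1") (simp_all add: bergman_integrand_def)
  have "set_integrable lborel (ball 0 1) (bergman_integrand p \<omega> U V k) \<longleftrightarrow>
      set_integrable lborel (ball 0 1) (bergman_integrand p \<omega>' U V k)" for U V k
    unfolding set_integrable_def by (rule integral_change_point(1)[OF eq])
  then have "bergman_space p \<omega> = bergman_space p \<omega>'" unfolding bergman_space_def by simp
  moreover have "set_lebesgue_integral lborel (ball 0 1) (bergman_integrand p \<omega> U V k) =
      set_lebesgue_integral lborel (ball 0 1) (bergman_integrand p \<omega>' U V k)" for U V k
    unfolding set_lebesgue_integral_def by (rule integral_change_point(2)[OF eq])
  then have "bergman_inner p \<omega> = bergman_inner p \<omega>'" unfolding bergman_inner_def[abs_def] by simp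
  ultimately show ?thesis unfolding bergman_kernel_def by simp
qed

theorem theorem6:
  fixes p :: nat and \<alpha> \<beta> :: real and x y :: "complex ^ 'n"
  assumes "p \<ge> 1"
    and "real CARD('n) + \<alpha> > 0"
    and "\<beta> > -1"
    and "x \<in> hat_ball p"
    and "y \<in> hat_ball p"
  shows "weighted_kernel p \<alpha> \<beta> (x, y) =
           (\<Sum>k<p. cnorm x ^ (2 * k) * cnorm (cnj_vec y) ^ (2 * k) *
              harmonic_kernel_ext (\<alpha> + 4 * real k) \<beta> (x, y))
       \<and> unweighted_kernel p (x, y) =
           (\<Sum>k<p. cnorm x ^ (2 * k) * cnorm (cnj_vec y) ^ (2 * k) *
              harmonic_kernel_ext (4 * real k) 0 (x, y))"
proof -
  have *: "weighted_kernel p \<alpha> \<beta> (x, y) =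
      (\<Sum>k<p. cnorm x ^ (2 * k) * cnorm (cnj_vec y) ^ (2 * k) * harmonic_kernel_ext (\<alpha> + 4 * real k) \<beta> (x, y))"
    if "real CARD('n) + \<alpha> > 0" "\<beta> > -1" for \<alpha> \<beta>
  proof -
    have "(\<lambda>y :: real ^ 'n. norm y ^ (4 * k) * bergman_weight \<alpha> \<beta> y) = bergman_weight (\<alpha> + 4 * real k) \<beta>" for k
      by (simp add: bergman_weight_mult_power fun_eq_iff)
    then show ?thesis
      using bergman_kernel_sum[OF radial_weight_bergman_weight[OF that] _ assms(4,5)] assms(1)
      by (simp add: weighted_kernel_def harmonic_kernel_ext_def)
  qed
  have "bergman_kernel p (\<lambda>_. 1) = bergman_kernel p (bergman_weight 0 0 :: real ^ 'n \<Rightarrow> real)"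
  proof (rule bergman_kernel_change_point)
    fix y :: "real ^ 'n" assume y: "y \<noteq> 0" "norm y < 1"
    have "norm y * norm y < 1 * 1" using y by (intro mult_strict_mono) auto
    then have "(norm y)\<^sup>2 \<noteq> 1" by (simp add: power2_eq_square)
    then show "1 = bergman_weight 0 0 y" using y by (simp add: bergman_weight_def)
  qed
  then have "unweighted_kernel p (x, y) = weighted_kernel p 0 0 (x, y)"
    by (simp add: unweighted_kernel_def weighted_kernel_def)
  with *[of \<alpha> \<beta>] *[of 0 0] assms(2,3) show ?thesis by simp
qed

end
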